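(* If $\Gamma$ is a finitely generated parafree group of pf-rank $r$, then $$b_1^{(2)}(\Gamma)\ \ge\ r-1\ =\ b_1(\Gamma)-1,$$ with equality (that is, $b_1^{(2)}(\Gamma)= r-1$) if $\Gamma$ is finitely presented.
   Context: The lower central series of a group $G$ is defined by $G_1=G$ and $G_{n+1}=\langle [x,y] : x\in G_n,\ y\in G\rangle$. A group $G$ is residually nilpotent if $\bigcap_n G_n=1$. Two residually nilpotent groups $G$ and $\Lambda$ have the same nilpotent genus if $G/G_c\cong\Lambda/\Lambda_c$ for all $c\ge 1$. A group is parafree of pf-rank $r$ if it is residually nilpotent and has the same nilpotent genus as a free group of rank $r$. Here $b_1(\Gamma)=\dim_{\mathbb{Q}}\big((\Gamma/[\Gamma,\Gamma])\otimes_{\mathbb{Z}}\mathbb{Q}\big)$ is the first Betti number and $b_1^{(2)}(\Gamma)$ is the first $L^2$-Betti number of $\Gamma$.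
   Formalization: The equality for finitely presented groups is stated for pf-rank r at least 1; for r = 0 the group is trivial, its first L2-Betti number is 0, and the claimed value r-1 = -1 is false. *)

theory Defs
  imports
    "HOL-Algebra.Generated_Groups"
    "HOL-Algebra.Free_Abelian_Groups"
    "HOL-Analysis.Infinite_Sum"
    "Jordan_Normal_Form.VS_Connect"
begin

section \<open>Free groups and presentations\<close>

text \<open>The free group on \<open>x\<^sub>0, \<dots>, x\<^sub>r\<^sub>-\<^sub>1\<close> as the group of reduced words. A letter \<open>(i, True)\<close>
  stands for \<open>x\<^sub>i\<close> and \<open>(i, False)\<close> for its inverse.\<close>

definition cancels :: "nat \<times> bool \<Rightarrow> nat \<times> bool \<Rightarrow> bool" where
  "cancels a b \<longleftrightarrow> fst a = fst b \<and> snd a \<noteq> snd b"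

fun reduced :: "(nat \<times> bool) list \<Rightarrow> bool" where
  "reduced [] = True"
| "reduced [a] = True"
| "reduced (a # b # w) = (\<not> cancels a b \<and> reduced (b # w))"

fun cons_reduce :: "nat \<times> bool \<Rightarrow> (nat \<times> bool) list \<Rightarrow> (nat \<times> bool) list" where
  "cons_reduce a [] = [a]"
| "cons_reduce a (b # w) = (if cancels a b then w else a # b # w)"

definition free_group :: "nat \<Rightarrow> (nat \<times> bool) list monoid" where
  "free_group r =
     \<lparr>carrier = {w. reduced w \<and> fst ` set w \<subseteq> {..<r}},
      monoid.mult = (\<lambda>u v. foldr cons_reduce u v),
      one = []\<rparr>"

lemma reduced_Cons_iff: "reduced (a # w) \<longleftrightarrow> reduced w \<and> (w = [] \<or> \<not> cancels a (hd w))"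
  by (cases w) auto

lemma reduced_cons_reduce: "reduced w \<Longrightarrow> reduced (cons_reduce a w)"
  by (cases w) (auto simp: reduced_Cons_iff)

lemma reduced_foldr: "reduced v \<Longrightarrow> reduced (foldr cons_reduce u v)"
  by (induction u) (auto simp: reduced_cons_reduce)

lemma set_cons_reduce: "set (cons_reduce a w) \<subseteq> insert a (set w)"
  by (cases w) auto

lemma set_foldr_cons_reduce: "set (foldr cons_reduce u v) \<subseteq> set u \<union> set v"
  by (induction u) (use set_cons_reduce in fastforce)+

lemma cons_reduce_cancel:
  assumes "reduced w" "cancels a b"
  shows "cons_reduce a (cons_reduce b w) = w"
proof (cases w)
  case (Cons c w')
  show ?thesis
  proof (cases "cancels b c")
    case True
    then have "c = a"
      using assms(2) by (auto simp: cancels_def prod_eq_iff)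
    then show ?thesis
      using Cons True assms(1) by (cases w') (auto simp: reduced_Cons_iff)
  qed (use Cons assms in auto)
qed (use assms in auto)

lemma foldr_cons_reduce_assoc:
  assumes "reduced w"
  shows "foldr cons_reduce (cons_reduce a v) w = cons_reduce a (foldr cons_reduce v w)"
  using assms by (cases v) (auto simp: cons_reduce_cancel reduced_foldr)

lemma foldr_cons_reduce_Nil: "reduced w \<Longrightarrow> foldr cons_reduce w [] = w"
proof (induction w)
  case (Cons a w)
  then show ?case by (cases w) auto
qed simp

lemma foldr_cons_reduce_inverse:
  "reduced v \<Longrightarrow>
     foldr cons_reduce (rev (map (apsnd Not) u)) (foldr cons_reduce u v) = v"
proof (induction u)
  case (Cons a u)
  then show ?case
    by (simp add: cons_reduce_cancel reduced_foldr cancels_def apsnd_def map_prod_def split_beta)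
qed simp

lemma group_free_group: "group (free_group r)"
proof (rule groupI)
  fix u v w
  assume "u \<in> carrier (free_group r)" "v \<in> carrier (free_group r)"
  then show "u \<otimes>\<^bsub>free_group r\<^esub> v \<in> carrier (free_group r)"
    using set_foldr_cons_reduce[of u v] by (fastforce simp: free_group_def reduced_foldr)
  assume w: "w \<in> carrier (free_group r)"
  then have "foldr cons_reduce (foldr cons_reduce u v) w
      = foldr cons_reduce u (foldr cons_reduce v w)"
    by (induction u) (auto simp: foldr_cons_reduce_assoc free_group_def)
  then show "u \<otimes>\<^bsub>free_group r\<^esub> v \<otimes>\<^bsub>free_group r\<^esub> w = u \<otimes>\<^bsub>free_group r\<^esub> (v \<otimes>\<^bsub>free_group r\<^esub> w)"
    by (simp add: free_group_def)
next
  fix u assume u: "u \<in> carrier (free_group r)"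
  let ?u' = "foldr cons_reduce (rev (map (apsnd Not) u)) []"
  have "?u' \<in> carrier (free_group r)"
    using u set_foldr_cons_reduce[of "rev (map (apsnd Not) u)" "[]"]
    by (fastforce simp: free_group_def reduced_foldr)
  moreover have "foldr cons_reduce ?u' u = []"
  proof -
    have assoc: "foldr cons_reduce (foldr cons_reduce x []) u = foldr cons_reduce x u" for x
      using u by (induction x) (auto simp: foldr_cons_reduce_assoc free_group_def)
    show ?thesis
      using foldr_cons_reduce_inverse[of "[]" u] u
      by (simp add: assoc foldr_cons_reduce_Nil free_group_def)
  qed
  ultimately show "\<exists>v\<in>carrier (free_group r). v \<otimes>\<^bsub>free_group r\<^esub> u = \<one>\<^bsub>free_group r\<^esub>"
    by (auto simp: free_group_def)
qed (auto simp: free_group_def)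

definition finitely_generated :: "('a, 'b) monoid_scheme \<Rightarrow> bool" where
  "finitely_generated G \<longleftrightarrow> (\<exists>S. finite S \<and> S \<subseteq> carrier G \<and> generate G S = carrier G)"

definition normal_closure :: "('a, 'b) monoid_scheme \<Rightarrow> 'a set \<Rightarrow> 'a set" where
  "normal_closure G R = generate G {g \<otimes>\<^bsub>G\<^esub> x \<otimes>\<^bsub>G\<^esub> inv\<^bsub>G\<^esub> g | g x. g \<in> carrier G \<and> x \<in> R}"

definition finitely_presented :: "('a, 'b) monoid_scheme \<Rightarrow> bool" where
  "finitely_presented G \<longleftrightarrow>
     (\<exists>n R. finite R \<and> R \<subseteq> carrier (free_group n) \<and>
            G \<cong> free_group n Mod normal_closure (free_group n) R)"


section \<open>Parafree groups\<close>

text \<open>The series starts at index 1; the value at 0 is a dummy.\<close>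

fun lower_central :: "('a, 'b) monoid_scheme \<Rightarrow> nat \<Rightarrow> 'a set" where
  "lower_central G 0 = carrier G"
| "lower_central G (Suc 0) = carrier G"
| "lower_central G (Suc (Suc n)) =
     generate G {x \<otimes>\<^bsub>G\<^esub> y \<otimes>\<^bsub>G\<^esub> inv\<^bsub>G\<^esub> x \<otimes>\<^bsub>G\<^esub> inv\<^bsub>G\<^esub> y | x y.
       x \<in> lower_central G (Suc n) \<and> y \<in> carrier G}"

definition residually_nilpotent :: "('a, 'b) monoid_scheme \<Rightarrow> bool" where
  "residually_nilpotent G \<longleftrightarrow> (\<Inter>n\<in>{1..}. lower_central G n) = {\<one>\<^bsub>G\<^esub>}"

definition same_nilpotent_genus ::
    "('a, 'b) monoid_scheme \<Rightarrow> ('c, 'd) monoid_scheme \<Rightarrow> bool" where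
  "same_nilpotent_genus G H \<longleftrightarrow>
     (\<forall>c\<ge>1. G Mod lower_central G c \<cong> H Mod lower_central H c)"

definition parafree :: "('a, 'b) monoid_scheme \<Rightarrow> nat \<Rightarrow> bool" where
  "parafree G r \<longleftrightarrow> residually_nilpotent G \<and> same_nilpotent_genus G (free_group r)"


section \<open>The first Betti number\<close>

text \<open>The tensor product over the integers of a commutative group \<open>A\<close> (written multiplicatively)
  with the rationals: the free abelian group on the symbols \<open>a \<otimes> q\<close>, represented as pairs
  \<open>(a, q)\<close>, modulo the bilinearity relations.\<close>

definition symbol_group :: "('a, 'b) monoid_scheme \<Rightarrow> ('a \<times> rat \<Rightarrow>\<^sub>0 int) monoid" where
  "symbol_group A = free_Abelian_group (carrier A \<times> UNIV)"

definition bilinear_relations :: "('a, 'b) monoid_scheme \<Rightarrow> ('a \<times> rat \<Rightarrow>\<^sub>0 int) set" where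
  "bilinear_relations A = generate (symbol_group A)
     ({frag_of (a \<otimes>\<^bsub>A\<^esub> b, q) - frag_of (a, q) - frag_of (b, q) | a b q.
         a \<in> carrier A \<and> b \<in> carrier A} \<union>
      {frag_of (a, p + q) - frag_of (a, p) - frag_of (a, q) | a p q. a \<in> carrier A})"

text \<open>The action of \<open>q\<close> on representatives: \<open>a \<otimes> p\<close> goes to \<open>a \<otimes> q p\<close>.\<close>

definition scale_symbols :: "rat \<Rightarrow> ('a \<times> rat \<Rightarrow>\<^sub>0 int) \<Rightarrow> ('a \<times> rat \<Rightarrow>\<^sub>0 int)" where
  "scale_symbols q = frag_extend (\<lambda>(a, p). frag_of (a, q * p))"

text \<open>HOL-Algebra modules are extensions of ring records; the multiplicative fields are not used
  in a module and are left undefined.\<close>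

definition tensor_rat ::
    "('a, 'b) monoid_scheme \<Rightarrow> (rat, ('a \<times> rat \<Rightarrow>\<^sub>0 int) set) module" where
  "tensor_rat A =
     \<lparr>carrier = rcosets\<^bsub>symbol_group A\<^esub> (bilinear_relations A),
      monoid.mult = undefined,
      one = undefined,
      zero = bilinear_relations A,
      add = set_mult (symbol_group A),
      smult = (\<lambda>q X. \<Union>x\<in>X. bilinear_relations A #>\<^bsub>symbol_group A\<^esub> scale_symbols q x)\<rparr>"

lemma scale_symbols_simps:
  "scale_symbols q (x - y) = scale_symbols q x - scale_symbols q y"
  "scale_symbols q (x + y) = scale_symbols q x + scale_symbols q y"
  "scale_symbols q (- x) = - scale_symbols q x"
  "scale_symbols q 0 = 0"
  "scale_symbols q (frag_of (a, p)) = frag_of (a, q * p)"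
  by (simp_all add: scale_symbols_def frag_extend_diff frag_extend_add frag_extend_minus)

context
  fixes A :: "('a, 'b) monoid_scheme"
  assumes A: "comm_group A"
begin

private abbreviation (input) "F \<equiv> symbol_group A"
private abbreviation (input) "N \<equiv> bilinear_relations A"

interpretation A: comm_group A by (rule A)
interpretation SG: comm_group F
  unfolding symbol_group_def by (rule abelian_free_Abelian_group)

lemma carrier_symbol_group_iff:
  "x \<in> carrier F \<longleftrightarrow> Poly_Mapping.keys x \<subseteq> carrier A \<times> UNIV"
  by (simp add: symbol_group_def)

lemma mult_symbol_group: "x \<otimes>\<^bsub>F\<^esub> y = x + y"
  by (simp add: symbol_group_def)

lemma inv_symbol_group: "x \<in> carrier F \<Longrightarrow> inv\<^bsub>F\<^esub> x = - x"
  by (simp add: symbol_group_def)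

lemma diff_symbol_group:
  "x \<in> carrier F \<Longrightarrow> y \<in> carrier F \<Longrightarrow> x - y \<in> carrier F"
  using SG.m_closed[of x "inv\<^bsub>F\<^esub> y"] SG.inv_closed[of y]
  by (simp only: mult_symbol_group inv_symbol_group diff_conv_add_uminus)

lemma frag_of_symbol_group: "a \<in> carrier A \<Longrightarrow> frag_of (a, q) \<in> carrier F"
  by (simp add: carrier_symbol_group_iff)

lemma subgroup_bilinear_relations: "subgroup N F"
  unfolding bilinear_relations_def
  by (rule SG.generate_is_subgroup) (auto intro!: diff_symbol_group frag_of_symbol_group)

lemma normal_bilinear_relations: "N \<lhd> F"
  using subgroup_bilinear_relations SG.normal_iff_subgroup by blast

lemma scale_symbols_closed: "x \<in> carrier F \<Longrightarrow> scale_symbols q x \<in> carrier F"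
  unfolding carrier_symbol_group_iff scale_symbols_def
  using keys_frag_extend[of "\<lambda>(a, p). frag_of (a, q * p)" x] by fastforce

lemma bilinear_relations_zero:
  "0 \<in> N"
  using subgroup.one_closed[OF subgroup_bilinear_relations] by (simp add: symbol_group_def)

lemma bilinear_relations_add:
  "x \<in> N \<Longrightarrow> y \<in> N \<Longrightarrow> x + y \<in> N"
  using subgroup.m_closed[OF subgroup_bilinear_relations] by (simp add: mult_symbol_group)

lemma bilinear_relations_minus:
  "x \<in> N \<Longrightarrow> - x \<in> N"
  using subgroup.m_inv_closed[OF subgroup_bilinear_relations] subgroup.mem_carrier[OF subgroup_bilinear_relations]
  by (metis inv_symbol_group)

lemma bilinear_relations_diff:
  "x \<in> N \<Longrightarrow> y \<in> N \<Longrightarrow> x - y \<in> N"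
  using bilinear_relations_add[OF _ bilinear_relations_minus, of x y] by simp

lemma bilinear_relations_left:
  "a \<in> carrier A \<Longrightarrow> b \<in> carrier A \<Longrightarrow> frag_of (a \<otimes>\<^bsub>A\<^esub> b, q) - frag_of (a, q) - frag_of (b, q) \<in> N"
  unfolding bilinear_relations_def by (rule generate.incl) blast

lemma bilinear_relations_right:
  "a \<in> carrier A \<Longrightarrow> frag_of (a, p + q) - frag_of (a, p) - frag_of (a, q) \<in> N"
  unfolding bilinear_relations_def by (rule generate.incl) blast

lemma scale_symbols_bilinear_relations: assumes "x \<in> N" shows "scale_symbols q x \<in> N"
proof -
  let ?R = "({frag_of (a \<otimes>\<^bsub>A\<^esub> b, q) - frag_of (a, q) - frag_of (b, q) | a b q.
         a \<in> carrier A \<and> b \<in> carrier A} \<union>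
      {frag_of (a, p + q) - frag_of (a, p) - frag_of (a, q) | a p q. a \<in> carrier A})"
  have R: "scale_symbols q h \<in> N" if "h \<in> ?R" for h
    using that
    by (auto simp: scale_symbols_simps distrib_left intro: bilinear_relations_left bilinear_relations_right)
  have RF: "h \<in> carrier F" if "h \<in> ?R" for h
    using that by (auto intro!: diff_symbol_group frag_of_symbol_group)
  have "x \<in> generate F ?R" using assms unfolding bilinear_relations_def .
  then show ?thesis
  proof (induction rule: generate.induct)
    case one then show ?case
      using bilinear_relations_zero by (simp add: symbol_group_def scale_symbols_simps)
  next
    case (incl h) then show ?case by (rule R)
  next
    case (inv h) then show ?case
      using R[OF inv] RF[OF inv] bilinear_relations_minus
      by (simp add: inv_symbol_group scale_symbols_simps)
  next
    case (eng x y) then show ?case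
      by (simp add: mult_symbol_group scale_symbols_simps bilinear_relations_add)
  qed
qed

lemma mem_tensor_coset_iff: "y \<in> N #>\<^bsub>F\<^esub> x \<longleftrightarrow> y - x \<in> N"
  unfolding r_coset_def mult_symbol_group by (auto intro: bexI[of _ "y - x"])

lemma tensor_coset_eq_iff: "N #>\<^bsub>F\<^esub> x = N #>\<^bsub>F\<^esub> y \<longleftrightarrow> x - y \<in> N"
proof
  assume "N #>\<^bsub>F\<^esub> x = N #>\<^bsub>F\<^esub> y"
  then show "x - y \<in> N"
    using mem_tensor_coset_iff[of x x] mem_tensor_coset_iff[of x y] bilinear_relations_zero by simp
next
  assume xy: "x - y \<in> N"
  have "z - x \<in> N \<longleftrightarrow> z - y \<in> N" for z
    using bilinear_relations_add[OF _ xy, of "z - x"] bilinear_relations_diff[OF _ xy, of "z - y"]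
    by auto
  then show "N #>\<^bsub>F\<^esub> x = N #>\<^bsub>F\<^esub> y"
    by (auto simp: mem_tensor_coset_iff)
qed

lemma smult_tensor_coset: assumes x: "x \<in> carrier F"
  shows "q \<odot>\<^bsub>tensor_rat A\<^esub> (N #>\<^bsub>F\<^esub> x) = N #>\<^bsub>F\<^esub> scale_symbols q x"
proof -
  have same: "N #>\<^bsub>F\<^esub> scale_symbols q y = N #>\<^bsub>F\<^esub> scale_symbols q x" if "y \<in> N #>\<^bsub>F\<^esub> x" for y
  proof -
    have "y - x \<in> N" using that mem_tensor_coset_iff x by blast
    moreover have "y \<in> carrier F"
      using that x SG.r_coset_subset_G[of N x] subgroup.subset[OF subgroup_bilinear_relations] by blast
    ultimately show ?thesis
      using x scale_symbols_bilinear_relations[of "y - x" q]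
      by (simp add: tensor_coset_eq_iff scale_symbols_closed scale_symbols_simps)
  qed
  have "x \<in> N #>\<^bsub>F\<^esub> x"
    using x bilinear_relations_zero by (simp add: mem_tensor_coset_iff)
  then show ?thesis
    using UN_constant_eq[of x, OF _ ballI[OF same]] by (simp add: tensor_rat_def)
qed

lemma add_tensor_coset: assumes "x \<in> carrier F" "y \<in> carrier F"
  shows "(N #>\<^bsub>F\<^esub> x) \<oplus>\<^bsub>tensor_rat A\<^esub> (N #>\<^bsub>F\<^esub> y) = N #>\<^bsub>F\<^esub> (x + y)"
  using normal.rcos_sum[OF normal_bilinear_relations assms]
  by (simp add: tensor_rat_def mult_symbol_group)

lemma carrier_tensor_rat_iff:
  "X \<in> carrier (tensor_rat A) \<longleftrightarrow> (\<exists>x\<in>carrier F. X = N #>\<^bsub>F\<^esub> x)"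
  by (auto simp: tensor_rat_def RCOSETS_def)

lemma vectorspace_tensor_rat: "vectorspace class_ring (tensor_rat A)"
proof -
  interpret Q: comm_group "F Mod N"
    by (rule SG.abelian_FactGroup[OF subgroup_bilinear_relations])
  have ab: "abelian_group (tensor_rat A)"
    using Q.m_closed Q.one_closed Q.m_assoc Q.m_comm Q.l_one Q.l_inv_ex
    by (intro abelian_groupI) (simp_all add: tensor_rat_def FactGroup_def)
  have l: "scale_symbols (p + q) x - (scale_symbols p x + scale_symbols q x) \<in> N"
    if "x \<in> carrier F" for p q x
    using that[unfolded carrier_symbol_group_iff]
  proof (induction x rule: frag_induction)
    case zero then show ?case using bilinear_relations_zero by (simp add: scale_symbols_simps)
  next
    case (one z) then show ?case using bilinear_relations_right[of "fst z" "p * snd z" "q * snd z"]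
      by (cases z) (auto simp: scale_symbols_simps distrib_right diff_diff_eq)
  next
    case (diff x y) then show ?case
      using bilinear_relations_diff[OF diff(1,2)] by (simp add: scale_symbols_simps algebra_simps)
  qed
  have "module class_ring (tensor_rat A)"
  proof (rule moduleI)
    show "cring (class_ring :: rat ring)" by unfold_locales
    show "abelian_group (tensor_rat A)" by (rule ab)
    have comp: "scale_symbols p (scale_symbols q x) = scale_symbols (p * q) x" for p q x
      using frag_extend_compose[of "\<lambda>(a, r). frag_of (a, p * r)" "\<lambda>(a, r). (a, q * r)" x]
      by (simp add: scale_symbols_def comp_def case_prod_unfold mult.assoc)
    have one: "scale_symbols 1 x = x" for x
      using frag_expansion[of x] by (simp add: scale_symbols_def case_prod_unfold)
    fix p q X Y assume X: "X \<in> carrier (tensor_rat A)"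
    then obtain x where x: "x \<in> carrier F" "X = N #>\<^bsub>F\<^esub> x"
      using carrier_tensor_rat_iff by blast
    show "p \<odot>\<^bsub>tensor_rat A\<^esub> X \<in> carrier (tensor_rat A)"
      using x by (auto simp: smult_tensor_coset carrier_tensor_rat_iff intro: scale_symbols_closed)
    show "(p \<oplus>\<^bsub>class_ring\<^esub> q) \<odot>\<^bsub>tensor_rat A\<^esub> X =
          p \<odot>\<^bsub>tensor_rat A\<^esub> X \<oplus>\<^bsub>tensor_rat A\<^esub> q \<odot>\<^bsub>tensor_rat A\<^esub> X"
      using x l[of x p q] SG.m_closed[of "scale_symbols p x" "scale_symbols q x"]
      by (simp add: smult_tensor_coset add_tensor_coset scale_symbols_closed tensor_coset_eq_iff mult_symbol_group)
    show "(p \<otimes>\<^bsub>class_ring\<^esub> q) \<odot>\<^bsub>tensor_rat A\<^esub> X = p \<odot>\<^bsub>tensor_rat A\<^esub> (q \<odot>\<^bsub>tensor_rat A\<^esub> X)"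
      using x by (simp add: smult_tensor_coset scale_symbols_closed comp)
    show "\<one>\<^bsub>class_ring\<^esub> \<odot>\<^bsub>tensor_rat A\<^esub> X = X"
      using x by (simp add: smult_tensor_coset one)
    assume "Y \<in> carrier (tensor_rat A)"
    then obtain y where y: "y \<in> carrier F" "Y = N #>\<^bsub>F\<^esub> y"
      using carrier_tensor_rat_iff by blast
    show "p \<odot>\<^bsub>tensor_rat A\<^esub> (X \<oplus>\<^bsub>tensor_rat A\<^esub> Y) =
          p \<odot>\<^bsub>tensor_rat A\<^esub> X \<oplus>\<^bsub>tensor_rat A\<^esub> p \<odot>\<^bsub>tensor_rat A\<^esub> Y"
      using x y SG.m_closed[of x y]
      by (simp add: smult_tensor_coset add_tensor_coset scale_symbols_closed mult_symbol_group scale_symbols_simps)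
  qed
  then show ?thesis by (intro vectorspace.intro class_field)
qed

end

definition first_betti :: "('a, 'b) monoid_scheme \<Rightarrow> nat" where
  "first_betti G = vectorspace.dim class_ring (tensor_rat (G Mod derived G (carrier G)))"


section \<open>The first L2-Betti number\<close>

text \<open>Elements of the Hilbert space \<open>\<ell>\<^sup>2(X)\<close> are represented by functions vanishing outside \<open>X\<close>.\<close>

definition l2 :: "'x set \<Rightarrow> ('x \<Rightarrow> complex) set" where
  "l2 X = {f. (\<forall>x. x \<notin> X \<longrightarrow> f x = 0) \<and> (\<lambda>x. (cmod (f x))\<^sup>2) summable_on X}"

definition l2_inner :: "'x set \<Rightarrow> ('x \<Rightarrow> complex) \<Rightarrow> ('x \<Rightarrow> complex) \<Rightarrow> complex" where
  "l2_inner X f g = (\<Sum>\<^sub>\<infinity>x\<in>X. f x * cnj (g x))"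

text \<open>The orthogonal projection onto a closed subspace \<open>V\<close> of \<open>\<ell>\<^sup>2(X)\<close>.\<close>

definition l2_proj :: "'x set \<Rightarrow> ('x \<Rightarrow> complex) set \<Rightarrow> ('x \<Rightarrow> complex) \<Rightarrow> 'x \<Rightarrow> complex" where
  "l2_proj X V f = (THE p. p \<in> V \<and> (\<forall>v\<in>V. l2_inner X (\<lambda>x. f x - p x) v = 0))"

text \<open>The von Neumann dimension of a closed subspace \<open>V\<close> of \<open>\<ell>\<^sup>2(G)\<^sup>I = \<ell>\<^sup>2(I \<times> G)\<close>, \<open>I\<close> finite,
  that is invariant under right translation by \<open>G\<close>: the trace of the projection onto \<open>V\<close>,
  i.e. the sum over \<open>i\<close> of \<open>\<langle>P\<^sub>V e\<^sub>i, e\<^sub>i\<rangle>\<close> where \<open>e\<^sub>i\<close> is the unit vector at \<open>(i, \<one>)\<close>.\<close>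

definition vN_dim :: "('a, 'b) monoid_scheme \<Rightarrow> 'i set \<Rightarrow> ('i \<times> 'a \<Rightarrow> complex) set \<Rightarrow> real" where
  "vN_dim G I V =
     (\<Sum>i\<in>I. let e = (\<lambda>z. if z = (i, \<one>\<^bsub>G\<^esub>) then 1 else 0)
             in Re (l2_inner (I \<times> carrier G) (l2_proj (I \<times> carrier G) V e) e))"

text \<open>One-cocycles and one-coboundaries with values in the left regular representation
  \<open>(\<lambda>(g) f)(x) = f (g\<^sup>-\<^sup>1 x)\<close>, that is, \<open>b (g h) = b g + \<lambda>(g) (b h)\<close> and
  \<open>b g = \<lambda>(g) f - f\<close> respectively.\<close>

definition l2_cocycles :: "('a, 'b) monoid_scheme \<Rightarrow> ('a \<Rightarrow> 'a \<Rightarrow> complex) set" where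
  "l2_cocycles G =
     {b. (\<forall>g\<in>carrier G. b g \<in> l2 (carrier G)) \<and>
         (\<forall>g\<in>carrier G. \<forall>h\<in>carrier G. \<forall>x\<in>carrier G.
            b (g \<otimes>\<^bsub>G\<^esub> h) x = b g x + b h (inv\<^bsub>G\<^esub> g \<otimes>\<^bsub>G\<^esub> x))}"

definition l2_coboundaries :: "('a, 'b) monoid_scheme \<Rightarrow> ('a \<Rightarrow> 'a \<Rightarrow> complex) set" where
  "l2_coboundaries G =
     {b \<in> l2_cocycles G. \<exists>f\<in>l2 (carrier G). \<forall>g\<in>carrier G. \<forall>x\<in>carrier G.
        b g x = f (inv\<^bsub>G\<^esub> g \<otimes>\<^bsub>G\<^esub> x) - f x}"

text \<open>A cocycle is determined by its values on a generating set \<open>S\<close>. For finite \<open>S\<close> this identifies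
  the space of cocycles, with pointwise convergence, with a closed subspace of \<open>\<ell>\<^sup>2(S \<times> G)\<close>.\<close>

definition on_generators :: "'a set \<Rightarrow> ('a \<Rightarrow> 'a \<Rightarrow> complex) \<Rightarrow> 'a \<times> 'a \<Rightarrow> complex" where
  "on_generators S b = (\<lambda>(s, x). if s \<in> S then b s x else 0)"

text \<open>The reduced cohomology \<open>Z\<^sup>1 / cl(B\<^sup>1)\<close> with coefficients in \<open>\<ell>\<^sup>2(G)\<close>. The quotient of a
  Hilbert space by a closed subspace is realised as the orthogonal complement.\<close>

definition reduced_H1 :: "('a, 'b) monoid_scheme \<Rightarrow> 'a set \<Rightarrow> ('a \<times> 'a \<Rightarrow> complex) set" where
  "reduced_H1 G S =
     {u \<in> on_generators S ` l2_cocycles G.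
        \<forall>v\<in>on_generators S ` l2_coboundaries G. l2_inner (S \<times> carrier G) u v = 0}"

text \<open>The first L2-Betti number of a finitely generated group is the von Neumann dimension of its
  first reduced cohomology with coefficients in \<open>\<ell>\<^sup>2(G)\<close>. It does not depend on the finite
  generating set: changing \<open>S\<close> changes the Hilbert space by a bounded equivariant isomorphism.
  The definition is only meaningful for finitely generated groups.\<close>

definition first_l2_betti :: "('a, 'b) monoid_scheme \<Rightarrow> real" where
  "first_l2_betti G =
     (let S = (SOME S. finite S \<and> S \<subseteq> carrier G \<and> generate G S = carrier G)
      in vN_dim G S (reduced_H1 G S))"

end

theory Submission
  imports
    Defs
    "HOL-Library.List_Lexorder"
    "HOL-Algebra.Sylow"
    "HOL-Algebra.Multiplicative_Group"
    "HOL-Number_Theory.Cong"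
    "HOL-Algebra.Product_Groups"
    "Jordan_Normal_Form.Schur_Decomposition"
    "Jordan_Normal_Form.Char_Poly"
    "HOL-Analysis.Inner_Product"
begin

text \<open>Let \<open>S\<close> be a finite generating set. The cocycles with values in \<open>\<ell>\<^sup>2(G)\<close> form the intersection of the
  kernels of the Fox matrices of finite sets of relators, and the von Neumann dimension of such a
  kernel is the limit of the traces of \<open>(1 - A\<^sup>* A / K)\<^sup>k\<close>. For a fixed \<open>k\<close> the trace involves finitely
  many group elements, so it can be computed in a finite \<open>p\<close>-quotient \<open>Q\<close> of \<open>G\<close>; such quotients
  exist because free nilpotent groups are residually finite \<open>p\<close>-groups, by the Magnus embedding.
  Over \<open>Q\<close> the matrix \<open>A\<^sup>* A\<close> is an integer matrix, so the product of its nonzero eigenvalues is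
  at least 1, and the trace is close to the dimension of the kernel, uniformly in \<open>Q\<close>. The latter
  dimension is read off from the number of derivations into the functions \<open>Q \<rightarrow> \<int>/p\<^sup>k\<close>. There are at
  least \<open>(p\<^sup>k)\<^bsup>r |Q|\<^esup>\<close> of them, because for every finite
  \<open>p\<close>-group there are \<open>r\<close> elements of \<open>G\<close> whose images can be prescribed.
  For suitably chosen \<open>|S|\<close> relators there are no more, because a nontrivial finite \<open>p\<close>-group on
  which \<open>Q\<close> acts has a nontrivial fixed point. Hence the cocycles have dimension \<open>r\<close>. The
  coboundaries have dimension 1 if \<open>G\<close> is infinite, that is, if \<open>r \<ge> 1\<close>.\<close>

section \<open>Commutator calculus\<close>

text \<open>The obstacle is to exchange two limits: the power \<open>k\<close>, whose limit gives
  the von Neumann dimension, and the passage to finite quotients. The quotient \<open>Q\<close> is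
  chosen after \<open>k\<close>, so no compatible chain of quotients occurs; what is needed is an
  error bound, normalised by the order of \<open>Q\<close>, that does not depend on
  \<open>Q\<close>. It comes from logarithms, as in Lueck's approximation argument: since the
  product of the nonzero eigenvalues \<open>l\<close> is at least 1, the sum of
  \<open>ln (K / l)\<close> over them is at most \<open>ln K\<close> times the size of the matrix,
  so eigenvalues close to 0 are rare. Ranks in characteristic 0 are read off from counts modulo all
  powers of \<open>p\<close>, because elimination over the integers changes each count only by a
  factor that does not depend on the power. Derivations over \<open>Q\<close> with coefficients
  modulo \<open>p ^ k\<close> are the lifts of \<open>G \<rightarrow> Q\<close> to a wreath product.
  This is again a finite p-group, hence nilpotent, and \<open>G\<close> maps to nilpotent groups as
  the free group of rank \<open>r\<close> does. So the lower bound holds for every finite set of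
  relators, while the upper bound is proved for one set whose exponent sums are controlled by the
  abelianisation.\<close>

declare lower_central.simps(3) [simp del]

context group begin

definition comm :: "'a \<Rightarrow> 'a \<Rightarrow> 'a" where
  "comm x y = x \<otimes> y \<otimes> inv x \<otimes> inv y"

abbreviation lc :: "nat \<Rightarrow> 'a set" where "lc \<equiv> lower_central G"

lemma inv_cancel_left:
  "x \<in> carrier G \<Longrightarrow> y \<in> carrier G \<Longrightarrow> x \<otimes> (inv x \<otimes> y) = y"
  "x \<in> carrier G \<Longrightarrow> y \<in> carrier G \<Longrightarrow> inv x \<otimes> (x \<otimes> y) = y"
  by (simp_all add: m_assoc[symmetric])

lemma comm_closed [simp]: "x \<in> carrier G \<Longrightarrow> y \<in> carrier G \<Longrightarrow> comm x y \<in> carrier G"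
  by (simp add: comm_def)

lemma lower_central_Suc_Suc:
  "lc (Suc (Suc n)) = generate G {comm x y | x y. x \<in> lc (Suc n) \<and> y \<in> carrier G}"
  by (simp only: lower_central.simps comm_def)

text \<open>A normal form for group words: bracketed to the right, inverses on single letters,
  neighbouring inverse letters cancelled. With these rules \<open>simp\<close> proves identities
  that hold in every group.\<close>

lemmas word_simps = comm_def m_assoc inv_mult_group inv_cancel_left

lemma inv_comm: "x \<in> carrier G \<Longrightarrow> y \<in> carrier G \<Longrightarrow> inv (comm x y) = comm y x"
  by (simp add: word_simps)

lemma comm_mult_right:
  "x \<in> carrier G \<Longrightarrow> a \<in> carrier G \<Longrightarrow> b \<in> carrier G \<Longrightarrow>
   comm x (a \<otimes> b) = comm x a \<otimes> comm a (comm x b) \<otimes> comm x b"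
  by (simp add: word_simps)

lemma comm_inv_right:
  "x \<in> carrier G \<Longrightarrow> a \<in> carrier G \<Longrightarrow>
   comm x (inv a) = comm (inv a) (inv (comm x a)) \<otimes> inv (comm x a)"
  by (simp add: word_simps)

lemma comm_mult_left:
  "x \<in> carrier G \<Longrightarrow> a \<in> carrier G \<Longrightarrow> b \<in> carrier G \<Longrightarrow>
   comm (a \<otimes> b) x = comm a (comm b x) \<otimes> comm b x \<otimes> comm a x"
  by (simp add: word_simps)

text \<open>Conjugation by \<open>x\<close> turns \<open>[a, b]\<close> into \<open>[[x, a] a, [x, b] b]\<close>; expanding the latter
  replaces the Hall--Witt identity.\<close>

lemma comm_comm_right:
  assumes "x \<in> carrier G" "a \<in> carrier G" "b \<in> carrier G"
  defines "\<alpha> \<equiv> comm x a" and "\<beta> \<equiv> comm x b" and "c \<equiv> comm a b"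
  shows "comm x c = comm \<alpha> (comm a \<beta>) \<otimes> comm a \<beta> \<otimes> (comm \<alpha> (comm \<beta> c \<otimes> c) \<otimes> comm \<beta> c)
    \<otimes> (comm c (comm \<alpha> (\<beta> \<otimes> b)) \<otimes> comm \<alpha> (\<beta> \<otimes> b))"
  using assms(1-3) unfolding assms(4-6) by (simp add: word_simps)

lemma lower_central_subset: "lc n \<subseteq> carrier G"
proof (induction n rule: induct_nat_012)
  case (ge2 n)
  have "{comm x y | x y. x \<in> lc (Suc n) \<and> y \<in> carrier G} \<subseteq> carrier G"
    using ge2(2) by auto
  then show ?case unfolding lower_central_Suc_Suc by (rule generate_incl)
qed auto

lemma lower_central_closed: "a \<in> lc n \<Longrightarrow> a \<in> carrier G"
  using lower_central_subset by blast

lemma subgroup_lower_central: "subgroup (lc n) G"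
proof -
  consider "n = 0" | "n = Suc 0" | m where "n = Suc (Suc m)" by (metis not0_implies_Suc)
  then show ?thesis
  proof cases
    case (3 m)
    have "{comm x y | x y. x \<in> lc (Suc m) \<and> y \<in> carrier G} \<subseteq> carrier G"
      using lower_central_closed[of _ "Suc m"] by auto
    then show ?thesis unfolding 3 lower_central_Suc_Suc by (rule generate_is_subgroup)
  qed (auto simp: subgroup_self)
qed

lemma lower_central_comm:
  assumes "a \<in> lc n" "y \<in> carrier G" "1 \<le> n"
  shows "comm a y \<in> lc (Suc n)"
proof -
  obtain m where "n = Suc m" using assms(3) by (cases n) auto
  with assms show ?thesis by (auto simp: lower_central_Suc_Suc intro!: generate.incl)
qed

text \<open>A conjugate of \<open>x\<close> is \<open>inv (comm x g) \<otimes> x\<close>, and the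
  commutator has the right level because \<open>x\<close> already lies in \<open>lc n\<close>. The
  inclusion of consecutive terms is a premise, as the lemma serves in the induction that proves
  it.\<close>

lemma conj_lower_central_aux:
  assumes "lc (Suc n) \<subseteq> lc n" "1 \<le> n" "x \<in> lc (Suc n)" "g \<in> carrier G"
  shows "g \<otimes> x \<otimes> inv g \<in> lc (Suc n)"
proof -
  interpret N: subgroup "lc (Suc n)" G by (rule subgroup_lower_central)
  have "comm x g \<in> lc (Suc n)"
    using assms by (intro lower_central_comm) auto
  then have "inv (comm x g) \<otimes> x \<in> lc (Suc n)" using assms by blast
  moreover have "inv (comm x g) \<otimes> x = g \<otimes> x \<otimes> inv g"
    using assms(4) lower_central_closed[OF assms(3)] by (simp add: word_simps)
  ultimately show ?thesis by metis
qed

text \<open>\<open>comm x y\<close> is \<open>x\<close> times a conjugate of \<open>inv x\<close>,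
  so inclusion and normality advance together level by level. The dummy value at 0 starts the
  induction.\<close>

lemma lower_central_Suc_subset: "lc (Suc n) \<subseteq> lc n"
proof (induction n)
  case (Suc n)
  show ?case
  proof (cases n)
    case 0
    then show ?thesis using lower_central_subset[of "Suc (Suc n)"] by simp
  next
    case (Suc m)
    interpret N: subgroup "lc (Suc n)" G by (rule subgroup_lower_central)
    have "comm x y \<in> lc (Suc n)" if "x \<in> lc (Suc n)" "y \<in> carrier G" for x y
    proof -
      have "y \<otimes> inv x \<otimes> inv y \<in> lc (Suc n)"
        using that Suc N.m_inv_closed by (intro conj_lower_central_aux Suc.IH) auto
      then have "x \<otimes> (y \<otimes> inv x \<otimes> inv y) \<in> lc (Suc n)" using that by blast
      moreover have "x \<otimes> (y \<otimes> inv x \<otimes> inv y) = comm x y"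
        using that(2) lower_central_closed[OF that(1)] by (simp add: comm_def m_assoc)
      ultimately show ?thesis by metis
    qed
    then show ?thesis
      unfolding Suc lower_central_Suc_Suc[of m] lower_central_Suc_Suc[of "Suc m"]
      by (intro generate_subgroup_incl subgroup_lower_central[of "Suc (Suc m)", unfolded lower_central_Suc_Suc])
         auto
  qed
qed simp

lemma lower_central_antimono: "m \<le> n \<Longrightarrow> lc n \<subseteq> lc m"
  using lower_central_Suc_subset by (rule lift_Suc_antimono_le)

lemma lower_central_comm_swap:
  assumes "a \<in> lc n" "y \<in> carrier G" "1 \<le> n"
  shows "comm y a \<in> lc (Suc n)"
proof -
  have "inv (comm a y) \<in> lc (Suc n)"
    using lower_central_comm[OF assms] subgroup.m_inv_closed[OF subgroup_lower_central] by blast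
  then show ?thesis using assms(2) lower_central_closed[OF assms(1)] by (simp only: inv_comm)
qed

lemma lower_central_conj:
  assumes "a \<in> lc n" "g \<in> carrier G"
  shows "g \<otimes> a \<otimes> inv g \<in> lc n"
proof (cases "n = 0")
  case False
  interpret N: subgroup "lc n" G by (rule subgroup_lower_central)
  have "comm g a \<in> lc n"
    using lower_central_comm_swap[OF assms] lower_central_Suc_subset[of n] False by auto
  then have "comm g a \<otimes> a \<in> lc n" using assms by blast
  moreover have "comm g a \<otimes> a = g \<otimes> a \<otimes> inv g"
    using assms(2) lower_central_closed[OF assms(1)] by (simp add: word_simps)
  ultimately show ?thesis by metis
qed (use assms in simp)

lemma normal_lower_central: "lc n \<lhd> G"
  using subgroup_lower_central lower_central_conj by (simp add: normal_inv_iff)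

end

context group begin

text \<open>Induction on \<open>i\<close>, for all \<open>j\<close> at once. A generator
  \<open>c = comm a y\<close> of the next term is treated by expanding \<open>comm b c\<close> with
  \<open>comm_comm_right\<close>: every factor contains a commutator covered by the hypothesis for
  \<open>(i, j)\<close> or for \<open>(i, Suc j)\<close>. Passing from generators to the whole
  subgroup only uses normality.\<close>

lemma lower_central_comm_add:
  assumes "a \<in> lc i" "b \<in> lc j" "1 \<le> i" "1 \<le> j"
  shows "comm a b \<in> lc (i + j)"
  using assms(3,1,2,4)
proof (induction i arbitrary: j a b rule: dec_induct)
  case base
  then show ?case using lower_central_comm_swap[of b j a] by simp
next
  case (step i)
  note lcc = lower_central_closed
  interpret K: normal "lc (Suc i + j)" G by (rule normal_lower_central)
  have Kc: "g \<otimes> k \<otimes> inv g \<in> lc (Suc i + j)" if "g \<in> carrier G" "k \<in> lc (Suc i + j)" for g k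
    using that lower_central_conj by blast
  have gen: "comm (comm a y) b \<in> lc (Suc i + j)"
    if a: "a \<in> lc i" and y: "y \<in> carrier G" and b: "b \<in> lc j" for a y b
  proof -
    define \<alpha> \<beta> c where "\<alpha> = comm b a" and "\<beta> = comm b y" and "c = comm a y"
    have cl: "a \<in> carrier G" "b \<in> carrier G" "y \<in> carrier G" using lcc a b y by blast+
    then have cl': "\<alpha> \<in> carrier G" "\<beta> \<in> carrier G" "c \<in> carrier G"
      by (auto simp: \<alpha>_def \<beta>_def c_def)
    have "comm a b \<in> lc (i + j)" using step a b by blast
    then have "inv (comm a b) \<in> lc (i + j)"
      using subgroup.m_inv_closed[OF subgroup_lower_central] by blast
    then have \<alpha>: "\<alpha> \<in> lc (i + j)" using cl by (simp only: \<alpha>_def inv_comm)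
    have \<beta>: "\<beta> \<in> lc (Suc j)"
      unfolding \<beta>_def using lower_central_comm step b y by blast
    have c: "c \<in> lc i"
      unfolding c_def using lower_central_comm[OF a y] lower_central_Suc_subset step by blast
    have 1: "comm \<alpha> z \<in> lc (Suc i + j)" if "z \<in> carrier G" for z
      using lower_central_comm[OF \<alpha> that] step by simp
    have 2: "comm a \<beta> \<in> lc (Suc i + j)"
      using step.IH[OF a \<beta>] by simp
    have "comm c \<beta> \<in> lc (Suc i + j)"
      using step.IH[OF c \<beta>] by simp
    from K.m_inv_closed[OF this] have 3: "comm \<beta> c \<in> lc (Suc i + j)"
      by (simp only: inv_comm cl')
    have 4: "comm c z \<in> lc (Suc i + j)" if "z \<in> lc (Suc i + j)" for z
      using lower_central_comm_swap[OF that cl'(3)] lower_central_Suc_subset by auto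
    have "comm b c \<in> lc (Suc i + j)"
      unfolding comm_comm_right[OF cl(2,1,3), folded \<alpha>_def \<beta>_def c_def]
    proof (intro K.m_closed)
      show "comm \<alpha> (comm a \<beta>) \<in> lc (Suc i + j)" "comm \<alpha> (comm \<beta> c \<otimes> c) \<in> lc (Suc i + j)"
        "comm \<alpha> (\<beta> \<otimes> y) \<in> lc (Suc i + j)"
        using cl cl' by (auto intro!: 1 simp del: add_Suc)
      then show "comm c (comm \<alpha> (\<beta> \<otimes> y)) \<in> lc (Suc i + j)" by (intro 4)
    qed (rule 2 3)+
    from K.m_inv_closed[OF this] show ?thesis
      unfolding c_def[symmetric] by (simp only: inv_comm cl cl')
  qed
  obtain m where m: "i = Suc m" using step by (cases i) auto
  have "a \<in> generate G {comm x y | x y. x \<in> lc i \<and> y \<in> carrier G}"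
    using step.prems m by (simp add: lower_central_Suc_Suc)
  then have "a \<in> carrier G \<and> (\<forall>b\<in>lc j. comm a b \<in> lc (Suc i + j))"
  proof (induction rule: generate.induct)
    case one
    then show ?case using K.one_closed lcc by (auto simp: comm_def)
  next
    case (incl h)
    then show ?case using gen lcc by (fastforce intro!: m_closed inv_closed comm_closed)
  next
    case (inv h)
    then have h: "h \<in> carrier G" "\<And>b. b \<in> lc j \<Longrightarrow> comm h b \<in> lc (Suc i + j)" using gen lcc by (fastforce intro!: m_closed inv_closed comm_closed)+
    have "comm (inv h) b \<in> lc (Suc i + j)" if "b \<in> lc j" for b
    proof -
      have "inv h \<otimes> inv (comm h b) \<otimes> inv (inv h) \<in> lc (Suc i + j)"
        using h that by (intro Kc K.m_inv_closed) auto
      moreover have "inv h \<otimes> inv (comm h b) \<otimes> inv (inv h) = comm (inv h) b"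
        using h that lower_central_closed[OF that] by (simp add: word_simps)
      ultimately show ?thesis by metis
    qed
    with h(1) show ?case by blast
  next
    case (eng g h)
    have "comm (g \<otimes> h) b \<in> lc (Suc i + j)" if "b \<in> lc j" for b
    proof -
      have "g \<otimes> comm h b \<otimes> inv g \<otimes> comm g b \<in> lc (Suc i + j)"
        using eng that by (intro K.m_closed Kc) auto
      moreover have "g \<otimes> comm h b \<otimes> inv g \<otimes> comm g b = comm (g \<otimes> h) b"
        using eng lower_central_closed[OF that] by (simp add: word_simps)
      ultimately show ?thesis by metis
    qed
    with eng show ?case by blast
  qed
  then show ?case using step.prems by blast
qed

text \<open>The Lie subring of the associated graded Lie ring of the lower central series generated by
  a set of weighted elements, described by representatives in the group.\<close>

inductive lie :: "(nat \<times> 'a) set \<Rightarrow> nat \<Rightarrow> 'a \<Rightarrow> bool" for Y where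
  base: "(d, y) \<in> Y \<Longrightarrow> y \<in> lc d \<Longrightarrow> 1 \<le> d \<Longrightarrow> lie Y d y"
| lower: "a \<in> lc (Suc d) \<Longrightarrow> 1 \<le> d \<Longrightarrow> lie Y d a"
| mult: "lie Y d a \<Longrightarrow> lie Y d b \<Longrightarrow> lie Y d (a \<otimes> b)"
| minv: "lie Y d a \<Longrightarrow> lie Y d (inv a)"
| bracket: "lie Y i a \<Longrightarrow> lie Y j b \<Longrightarrow> lie Y (i + j) (comm a b)"

lemma lie_lower_central: "lie Y d a \<Longrightarrow> a \<in> lc d \<and> 1 \<le> d"
proof (induction rule: lie.induct)
  case (lower a d)
  then show ?case using lower_central_Suc_subset by auto
next
  case (mult d a b)
  then show ?case using subgroup.m_closed[OF subgroup_lower_central] by blast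
next
  case (minv d a)
  then show ?case using subgroup.m_inv_closed[OF subgroup_lower_central] by blast
next
  case (bracket i a j b)
  then show ?case using lower_central_comm_add by auto
qed auto

lemma lie_closed: "lie Y d a \<Longrightarrow> a \<in> carrier G"
  using lie_lower_central lower_central_closed by blast

lemma lie_deeper: "a \<in> lc m \<Longrightarrow> d < m \<Longrightarrow> 1 \<le> d \<Longrightarrow> lie Y d a"
  using lower_central_antimono[of "Suc d" m] by (intro lower) auto

lemma lie_empty: "lie {} d a \<Longrightarrow> a \<in> lc (Suc d)"
proof (induction rule: lie.induct)
  case (mult d a b)
  then show ?case using subgroup.m_closed[OF subgroup_lower_central] by blast
next
  case (minv d a)
  then show ?case using subgroup.m_inv_closed[OF subgroup_lower_central] by blast
next
  case (bracket i a j b)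
  then show ?case
    using lower_central_comm_add[of a "Suc i" b "Suc j"] lower_central_Suc_subset by auto
qed auto

text \<open>Commutation with any group element raises the level, so the result is zero in the graded
  component of degree \<open>d\<close>. This permits conjugating and reordering factors freely in
  the proofs below.\<close>

lemma lie_comm_any:
  assumes "lie Y d a" "g \<in> carrier G"
  shows "lie Y d (comm g a)" "lie Y d (comm a g)"
  using lie_lower_central[OF assms(1)] assms(2)
    lower_central_comm[of a d g] lower_central_comm_swap[of a d g]
  by (auto intro!: lie.lower)

lemma lie_conj:
  assumes "lie Y d a" "g \<in> carrier G"
  shows "lie Y d (g \<otimes> a \<otimes> inv g)"
proof -
  have "lie Y d (comm g a \<otimes> a)"
    using assms by (intro mult lie_comm_any)
  moreover have "comm g a \<otimes> a = g \<otimes> a \<otimes> inv g"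
    using assms lie_closed by (simp add: word_simps)
  ultimately show ?thesis by metis
qed

lemma lie_comm_swap: "lie Y d (comm a b) \<Longrightarrow> a \<in> carrier G \<Longrightarrow> b \<in> carrier G \<Longrightarrow> lie Y d (comm b a)"
  using minv[of Y d "comm a b"] by (simp only: inv_comm)

text \<open>Bracketing with \<open>x\<close> is a derivation of the graded Lie ring, so it preserves
  the subring as soon as it preserves the generators. The cut-off at \<open>n\<close> allows finite
  sets \<open>Y\<close> to satisfy the closure condition.\<close>

lemma lie_ad:
  assumes Y: "\<And>d y. (d, y) \<in> Y \<Longrightarrow> d + e \<le> n \<Longrightarrow> (d + e, comm x y) \<in> Y"
    and x: "x \<in> lc e" "1 \<le> e"
    and a: "lie Y d a" "d + e \<le> n"
  shows "lie Y (d + e) (comm x a)"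
  using a
proof (induction rule: lie.induct)
  case (base d y)
  then show ?case
    using Y x lower_central_comm_add[of x e y d] by (intro lie.base) (auto simp: add.commute)
next
  case (lower a d)
  then show ?case
    using x lower_central_comm_add[of x e a "Suc d"] by (intro lie.lower) (auto simp: add.commute)
next
  case (mult d a b)
  note cl = lower_central_closed[OF x(1)] lie_closed[OF mult(1)] lie_closed[OF mult(2)]
  show ?case
    unfolding comm_mult_right[OF cl]
    using mult cl lie_comm_any(1)[of Y "d + e" "comm x b" a] by (auto intro!: lie.mult)
next
  case (minv d a)
  note cl = lower_central_closed[OF x(1)] lie_closed[OF minv(1)]
  have "lie Y (d + e) (inv (comm x a))" using minv by (intro lie.minv) auto
  then show ?case
    unfolding comm_inv_right[OF cl]
    using cl by (intro lie.mult lie_comm_any(1)) auto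
next
  case (bracket i a j b)
  note cl = lower_central_closed[OF x(1)] lie_closed[OF bracket(1)] lie_closed[OF bracket(2)]
  \<comment> \<open>The two terms of the Leibniz rule are \<open>comm a \<beta>\<close> and
    \<open>comm \<alpha> b\<close>, both of weight \<open>?m\<close>. All other factors produced by
    \<open>comm_comm_right\<close> are deeper, or commutators of these two with something.\<close>
  define \<alpha> \<beta> c where "\<alpha> = comm x a" and "\<beta> = comm x b" and "c = comm a b"
  have cl': "\<alpha> \<in> carrier G" "\<beta> \<in> carrier G" "c \<in> carrier G"
    using cl by (auto simp: \<alpha>_def \<beta>_def c_def)
  have \<alpha>: "lie Y (i + e) \<alpha>" and \<beta>: "lie Y (j + e) \<beta>"
    using bracket by (auto simp: \<alpha>_def \<beta>_def)
  have c: "lie Y (i + j) c"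
    using bracket by (auto simp: c_def intro: lie.bracket)
  have pos: "1 \<le> i" "1 \<le> j" using bracket lie_lower_central by blast+
  let ?m = "i + j + e"
  have deep: "lie Y ?m z" if "z \<in> lc m" "?m < m" for m z
    using that pos by (intro lie_deeper) auto
  have ab: "lie Y ?m (comm a \<beta>)"
    using lie.bracket[OF bracket(1) \<beta>] by (simp add: ac_simps)
  have \<alpha>b: "lie Y ?m (comm \<alpha> b)"
    using lie.bracket[OF \<alpha> bracket(2)] by (simp add: ac_simps)
  have \<beta>c: "comm \<beta> c \<in> lc (?m + j)"
    using lie_lower_central[OF lie.bracket[OF \<beta> c]] by (simp add: ac_simps)
  have \<alpha>\<beta>: "comm \<alpha> \<beta> \<in> lc (?m + e)"
    using lie_lower_central[OF lie.bracket[OF \<alpha> \<beta>]] by (simp add: ac_simps)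
  have 0: "lie Y ?m (comm \<alpha> (\<beta> \<otimes> b))"
    unfolding comm_mult_right[OF cl'(1,2) cl(3)]
    using lie_comm_any(1)[OF \<alpha>b cl'(2)] x \<alpha>b by (auto intro!: lie.mult deep[OF \<alpha>\<beta>])
  have 1: "lie Y ?m (comm a \<beta>)" by (rule ab)
  have 2: "lie Y ?m (comm \<alpha> (comm a \<beta>))"
    using ab cl'(1) by (rule lie_comm_any)
  have "comm \<beta> c \<otimes> c \<in> lc (i + j)"
    using subgroup.m_closed[OF subgroup_lower_central, of "comm \<beta> c" "i + j" c]
      lie_lower_central[OF c] \<beta>c lower_central_antimono[of "i + j" "?m + j"] by auto
  then have "comm \<alpha> (comm \<beta> c \<otimes> c) \<in> lc (i + e + (i + j))"
    using lie_lower_central[OF \<alpha>] lie_lower_central[OF c] by (intro lower_central_comm_add) auto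
  then have 3: "lie Y ?m (comm \<alpha> (comm \<beta> c \<otimes> c))"
    by (rule deep) (use pos in auto)
  have 4: "lie Y ?m (comm \<beta> c)"
    by (rule deep[OF \<beta>c]) (use pos in auto)
  have 5: "lie Y ?m (comm c (comm \<alpha> (\<beta> \<otimes> b)))"
    using 0 cl'(3) by (rule lie_comm_any)
  show ?case
    unfolding c_def[symmetric] comm_comm_right[OF cl, folded \<alpha>_def \<beta>_def c_def]
    by (intro lie.mult 0 1 2 3 4 5)
qed

text \<open>Elimination of one generator \<open>x\<close> of weight \<open>e\<close> in degrees up to \<open>n\<close>: apart from the
  powers of \<open>x\<close> in degree \<open>e\<close>, everything lies in the subring generated by \<open>Y\<close>.\<close>

context
  fixes Y :: "(nat \<times> 'a) set" and e n :: nat and x :: 'a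
  assumes Y: "\<And>d y. (d, y) \<in> Y \<Longrightarrow> d + e \<le> n \<Longrightarrow> (d + e, comm x y) \<in> Y"
    and x: "x \<in> lc e" "1 \<le> e"
begin

text \<open>In degree \<open>e\<close> an element of the larger ring is a power of \<open>x\<close>
  times an element of the subring. Both factors normalise the subring, and so does their product,
  because the elements that normalise it form a subgroup.\<close>

definition ad_stable :: "'a \<Rightarrow> bool" where
  "ad_stable g \<longleftrightarrow> g \<in> lc e \<and> (\<forall>d b. lie Y d b \<longrightarrow> d + e \<le> n \<longrightarrow> lie Y (d + e) (comm g b))"

lemma subgroup_ad_stable: "subgroup (Collect ad_stable) G"
proof
  show "Collect ad_stable \<subseteq> carrier G"
    using lower_central_closed by (auto simp: ad_stable_def)
  show "\<one> \<in> Collect ad_stable"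
  proof -
    have "lie Y (d + e) (comm \<one> b)" if b: "lie Y d b" "d + e \<le> n" for d b
      using lie_closed[OF b(1)] subgroup.one_closed[OF subgroup_lower_central] x
      by (auto simp: comm_def intro!: lie.lower)
    then show ?thesis using subgroup.one_closed[OF subgroup_lower_central] by (simp add: ad_stable_def)
  qed
next
  fix g h assume g: "g \<in> Collect ad_stable" and h: "h \<in> Collect ad_stable"
  then have cl: "g \<in> carrier G" "h \<in> carrier G" using lower_central_closed by (auto simp: ad_stable_def)
  have "lie Y (d + e) (comm (g \<otimes> h) b)" if b: "lie Y d b" "d + e \<le> n" for d b
    unfolding comm_mult_left[OF lie_closed[OF b(1)] cl]
    using g h b cl lie_comm_any(1)[of Y "d + e" "comm h b" g] by (auto simp: ad_stable_def intro!: lie.mult)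
  then show "g \<otimes> h \<in> Collect ad_stable"
    using g h subgroup.m_closed[OF subgroup_lower_central] by (auto simp: ad_stable_def)
next
  fix g assume g: "g \<in> Collect ad_stable"
  then have cl: "g \<in> carrier G" using lower_central_closed by (auto simp: ad_stable_def)
  have "lie Y (d + e) (comm (inv g) b)" if b: "lie Y d b" "d + e \<le> n" for d b
  proof -
    have "lie Y (d + e) (inv g \<otimes> inv (comm g b) \<otimes> inv (inv g))"
      using g b cl by (intro lie_conj lie.minv) (auto simp: ad_stable_def)
    moreover have "inv g \<otimes> inv (comm g b) \<otimes> inv (inv g) = comm (inv g) b"
      using cl lie_closed[OF b(1)] by (simp add: word_simps)
    ultimately show ?thesis by metis
  qed
  then show "inv g \<in> Collect ad_stable"
    using g subgroup.m_inv_closed[OF subgroup_lower_central] by (auto simp: ad_stable_def)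
qed

lemma ad_stable_lie: "lie Y e b \<Longrightarrow> ad_stable b"
  using lie_lower_central lie.bracket[of Y e b] by (auto simp: ad_stable_def add.commute)

lemma ad_stable_pow: "ad_stable (x [^] (m::int))"
  using subgroup_int_pow_closed[OF subgroup_ad_stable, of x m] lie_ad[OF Y x] x
  by (auto simp: ad_stable_def)

text \<open>Lazard elimination on representatives: the subring generated by \<open>Y\<close> absorbs
  brackets with \<open>x\<close>, and powers of \<open>x\<close> commute with each other, so a power
  of \<open>x\<close> can only survive in degree \<open>e\<close>, where \<open>x\<close> itself
  lives.\<close>

lemma lie_eliminate:
  assumes "lie Z d a" "d \<le> n" and Z: "\<And>d y. (d, y) \<in> Z \<Longrightarrow> d \<le> n \<Longrightarrow> (d, y) = (e, x) \<or> (d, y) \<in> Y"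
  shows "\<exists>m::int. \<exists>b. a = x [^] m \<otimes> b \<and> lie Y d b \<and> (d \<noteq> e \<longrightarrow> m = 0)"
  using assms(1,2)
proof (induction rule: lie.induct)
  case (base d y)
  then consider "d = e" "y = x" | "(d, y) \<in> Y" using Z by blast
  then show ?case
  proof cases
    case 1
    have "\<one> \<in> lc (Suc e)" using subgroup.one_closed[OF subgroup_lower_central] .
    then have "lie Y d \<one>" using x 1 by (intro lie.lower) auto
    moreover have "y = x [^] (1::int) \<otimes> \<one>" using 1 x lower_central_closed by (auto simp: int_pow_1)
    ultimately show ?thesis using 1 by blast
  next
    case 2
    then show ?thesis using base lower_central_closed by (intro exI[of _ 0] exI[of _ y]) (auto intro: lie.base)
  qed
next
  case (lower a d)
  then show ?case using lower_central_closed by (intro exI[of _ 0] exI[of _ a]) (auto intro: lie.lower)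
next
  case (mult d a a')
  then obtain m b m' b' where *: "a = x [^] (m::int) \<otimes> b" "lie Y d b" "d \<noteq> e \<longrightarrow> m = 0"
    "a' = x [^] (m'::int) \<otimes> b'" "lie Y d b'" "d \<noteq> e \<longrightarrow> m' = 0" by blast
  have cl: "x \<in> carrier G" "b \<in> carrier G" "b' \<in> carrier G"
    using x * lower_central_closed lie_closed by blast+
  have "a \<otimes> a' = x [^] (m + m') \<otimes> ((x [^] - m' \<otimes> b \<otimes> inv (x [^] - m')) \<otimes> b')"
    unfolding * using cl by (simp add: int_pow_mult int_pow_neg word_simps)
  moreover have "lie Y d ((x [^] - m' \<otimes> b \<otimes> inv (x [^] - m')) \<otimes> b')"
    using * cl by (intro lie.mult lie_conj) auto
  ultimately show ?case using * by (intro exI[of _ "m + m'"] exI conjI) auto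
next
  case (minv d a)
  then obtain m b where *: "a = x [^] (m::int) \<otimes> b" "lie Y d b" "d \<noteq> e \<longrightarrow> m = 0" by blast
  have cl: "x \<in> carrier G" "b \<in> carrier G" using x * lower_central_closed lie_closed by blast+
  have "inv a = x [^] (- m) \<otimes> (x [^] m \<otimes> inv b \<otimes> inv (x [^] m))"
    unfolding * using cl by (simp add: int_pow_neg word_simps)
  moreover have "lie Y d (x [^] m \<otimes> inv b \<otimes> inv (x [^] m))"
    using * cl by (intro lie_conj lie.minv) auto
  ultimately show ?case using * by (intro exI[of _ "- m"] exI conjI) auto
next
  case (bracket i a j a')
  then obtain m b m' b' where *: "a = x [^] (m::int) \<otimes> b" "lie Y i b" "i \<noteq> e \<longrightarrow> m = 0"
    "a' = x [^] (m'::int) \<otimes> b'" "lie Y j b'" "j \<noteq> e \<longrightarrow> m' = 0"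
    using add_leE[OF bracket.prems] by meson
  have cl: "x \<in> carrier G" "b \<in> carrier G" "b' \<in> carrier G"
    using x * lower_central_closed lie_closed by blast+
  have A: "lie Y i a" if "i \<noteq> e" using * cl that by simp
  have A': "lie Y j a'" if "j \<noteq> e" using * cl that by simp
  have S: "ad_stable a" if "i = e"
    using subgroup.m_closed[OF subgroup_ad_stable, of "x [^] m" b] ad_stable_pow[of m]
      ad_stable_lie *(2) that unfolding *(1) by simp
  have S': "ad_stable a'" if "j = e"
    using subgroup.m_closed[OF subgroup_ad_stable, of "x [^] m'" b'] ad_stable_pow[of m']
      ad_stable_lie *(5) that unfolding *(4) by simp
  have cl': "a \<in> carrier G" "a' \<in> carrier G" using * cl by auto
  have "lie Y (i + j) (comm a a')"
  proof (cases "i = e")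
    case i: True
    show ?thesis
    proof (cases "j = e")
      case False
      then show ?thesis using S[OF i] A'[OF False] i bracket.prems unfolding ad_stable_def by (metis add.commute)
    next
      \<comment> \<open>Both factors may contain powers of \<open>x\<close>. The commutator is
        expanded so that these powers meet only in \<open>comm (x [^] m') (x [^] m)\<close>, which
        is trivial; every other factor is a bracket with an element of the subring.\<close>
      case j: True
      have 1: "lie Y (i + j) (comm a b')"
        using S[OF i] *(5) i j bracket.prems unfolding ad_stable_def by metis
      have "comm (x [^] m') a = comm (x [^] m') (x [^] m) \<otimes> comm (x [^] m) (comm (x [^] m') b) \<otimes> comm (x [^] m') b"
        unfolding * using cl by (intro comm_mult_right) auto
      also have "comm (x [^] m') (x [^] m) = \<one>"
      proof -
        have "x [^] m' \<otimes> x [^] m = x [^] m \<otimes> x [^] m'"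
          using cl by (metis add.commute int_pow_mult)
        then have "comm (x [^] m') (x [^] m) = x [^] m \<otimes> x [^] m' \<otimes> inv (x [^] m') \<otimes> inv (x [^] m)"
          by (simp only: comm_def)
        also have "\<dots> = \<one>" using cl by (simp add: word_simps)
        finally show ?thesis .
      qed
      finally have 2: "comm (x [^] m') a = comm (x [^] m) (comm (x [^] m') b) \<otimes> comm (x [^] m') b"
        using cl by simp
      have "lie Y (i + j) (comm (x [^] m') b)"
        using ad_stable_pow[of m'] * i j bracket.prems by (auto simp: ad_stable_def)
      then have "lie Y (i + j) (comm (x [^] m') a)"
        unfolding 2 using lie.mult[OF lie_comm_any(1)] cl by blast
      then have 3: "lie Y (i + j) (comm a (x [^] m'))"
        by (rule lie_comm_swap) (use cl cl' in auto)
      have "comm a a' = comm a (x [^] m') \<otimes> comm (x [^] m') (comm a b') \<otimes> comm a b'"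
        unfolding *(4) using cl cl' by (intro comm_mult_right) auto
      then show ?thesis
        using lie.mult[OF lie.mult[OF 3 lie_comm_any(1)[OF 1, of "x [^] m'"]] 1] cl by simp
    qed
  next
    case i: False
    show ?thesis
    proof (cases "j = e")
      case True
      then have "lie Y (i + j) (comm a' a)"
        using S' A i bracket.prems by (auto simp: ad_stable_def)
      then show ?thesis using cl' by (intro lie_comm_swap[of _ _ a' a])
    qed (use A A' i in \<open>auto intro: lie.bracket\<close>)
  qed
  moreover have "comm a a' = x [^] (0::int) \<otimes> comm a a'" using cl' by simp
  ultimately show ?case by blast
qed

end

end

section \<open>The Magnus embedding\<close>

text \<open>Formal power series in noncommuting variables with integer coefficients, given by their
  coefficient functions on words. The product sums over all ways to cut a word in two.\<close>

typedef ncs = "UNIV :: (nat list \<Rightarrow> int) set" morphisms coef Ncs by simp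

setup_lifting type_definition_ncs

instantiation ncs :: ring_1
begin

lift_definition zero_ncs :: ncs is "\<lambda>_. 0" .
lift_definition one_ncs :: ncs is "\<lambda>w. if w = [] then 1 else 0" .
lift_definition plus_ncs :: "ncs \<Rightarrow> ncs \<Rightarrow> ncs" is "\<lambda>a b w. a w + b w" .
lift_definition minus_ncs :: "ncs \<Rightarrow> ncs \<Rightarrow> ncs" is "\<lambda>a b w. a w - b w" .
lift_definition uminus_ncs :: "ncs \<Rightarrow> ncs" is "\<lambda>a w. - a w" .
lift_definition times_ncs :: "ncs \<Rightarrow> ncs \<Rightarrow> ncs"
  is "\<lambda>a b w. \<Sum>k\<le>length w. a (take k w) * b (drop k w)" .

instance
proof
  fix a b c :: ncs
  show "a * b * c = a * (b * c)"
  proof (transfer, rule ext)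
    fix a b c :: "nat list \<Rightarrow> int" and w :: "nat list"
    let ?n = "length w"
    have "(\<Sum>k\<le>?n. (\<Sum>j\<le>length (take k w). a (take j (take k w)) * b (drop j (take k w))) * c (drop k w))
      = (\<Sum>k\<le>?n. \<Sum>j\<le>k. a (take j w) * b (drop j (take k w)) * c (drop k w))"
      by (intro sum.cong) (auto simp: sum_distrib_right min_def intro!: sum.cong)
    also have "\<dots> = (\<Sum>(k, j)\<in>(SIGMA k:{..?n}. {..k}). a (take j w) * b (drop j (take k w)) * c (drop k w))"
      by (subst sum.Sigma) auto
    also have "\<dots> = (\<Sum>(j, i)\<in>(SIGMA j:{..?n}. {..?n - j}). a (take j w) * (b (take i (drop j w)) * c (drop i (drop j w))))"
      by (rule sum.reindex_bij_witness[of _ "\<lambda>(j, i). (i + j, j)" "\<lambda>(k, j). (j, k - j)"])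
         (auto simp: drop_take add.commute)
    also have "\<dots> = (\<Sum>j\<le>?n. \<Sum>i\<le>?n - j. a (take j w) * (b (take i (drop j w)) * c (drop i (drop j w))))"
      by (subst sum.Sigma) auto
    finally show "(\<Sum>k\<le>?n. (\<Sum>j\<le>length (take k w). a (take j (take k w)) * b (drop j (take k w))) * c (drop k w))
      = (\<Sum>j\<le>?n. a (take j w) * (\<Sum>i\<le>length (drop j w). b (take i (drop j w)) * c (drop i (drop j w))))"
      by (simp add: sum_distrib_left)
  qed
  show "1 * a = a"
  proof (transfer, rule ext)
    fix a :: "nat list \<Rightarrow> int" and w :: "nat list"
    have "(\<Sum>k\<le>length w. (if take k w = [] then 1 else 0) * a (drop k w)) = (\<Sum>k\<in>{0}. a (drop k w))"
      by (rule sum.mono_neutral_cong_right) auto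
    then show "(\<Sum>k\<le>length w. (if take k w = [] then 1 else 0) * a (drop k w)) = a w" by simp
  qed
  show "a * 1 = a"
  proof (transfer, rule ext)
    fix a :: "nat list \<Rightarrow> int" and w :: "nat list"
    have "(\<Sum>k\<le>length w. a (take k w) * (if drop k w = [] then 1 else 0)) = (\<Sum>k\<in>{length w}. a (take k w))"
      by (rule sum.mono_neutral_cong_right) auto
    then show "(\<Sum>k\<le>length w. a (take k w) * (if drop k w = [] then 1 else 0)) = a w" by simp
  qed
  show "0 \<noteq> (1 :: ncs)" by transfer (metis one_neq_zero)
qed (transfer; auto simp: algebra_simps sum.distrib)+

end

lemma ncs_eqI: "(\<And>w. coef a w = coef b w) \<Longrightarrow> a = b"
  by transfer auto

lemma coef_simps [simp]:
  "coef 0 w = 0" "coef (a + b) w = coef a w + coef b w" "coef (a - b) w = coef a w - coef b w"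
  "coef (- a) w = - coef a w" "coef 1 w = (if w = [] then 1 else 0)"
  by (transfer; simp)+

lemma coef_mult: "coef (a * b) w = (\<Sum>k\<le>length w. coef a (take k w) * coef b (drop k w))"
  by transfer simp

text \<open>The two-sided ideal of series of order at least \<open>n\<close>: the
  \<open>n\<close>-th power of the ideal generated by the variables, up to completion.\<close>

definition low_order :: "nat \<Rightarrow> ncs set" where
  "low_order n = {a. \<forall>w. length w < n \<longrightarrow> coef a w = 0}"

lemma low_order_0 [simp]: "low_order 0 = UNIV"
  by (simp add: low_order_def)

lemma low_order_add: "a \<in> low_order n \<Longrightarrow> b \<in> low_order n \<Longrightarrow> a + b \<in> low_order n"
  and low_order_diff: "a \<in> low_order n \<Longrightarrow> b \<in> low_order n \<Longrightarrow> a - b \<in> low_order n"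
  and low_order_minus: "a \<in> low_order n \<Longrightarrow> - a \<in> low_order n"
  and low_order_zero: "0 \<in> low_order n"
  by (auto simp: low_order_def)

lemma low_order_antimono: "m \<le> n \<Longrightarrow> a \<in> low_order n \<Longrightarrow> a \<in> low_order m"
  by (auto simp: low_order_def)

lemma low_order_mult:
  assumes "a \<in> low_order m" "b \<in> low_order n"
  shows "a * b \<in> low_order (m + n)"
proof -
  have "coef a (take k w) * coef b (drop k w) = 0" if "length w < m + n" "k \<le> length w" for w k
    using assms that by (cases "k < m") (auto simp: low_order_def)
  then show ?thesis by (auto simp: low_order_def coef_mult intro!: sum.neutral)
qed

lemma low_order_mult_left: "b \<in> low_order n \<Longrightarrow> a * b \<in> low_order n"
  using low_order_mult[of a 0 b n] by simp

lemma low_order_mult_right: "a \<in> low_order n \<Longrightarrow> a * b \<in> low_order n"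
  using low_order_mult[of a n b 0] by simp

lemma coef_mult_leading:
  assumes "a \<in> low_order m" "b \<in> low_order n" "length w = m + n"
  shows "coef (a * b) w = coef a (take m w) * coef b (drop m w)"
proof -
  have "coef a (take k w) * coef b (drop k w) = 0" if "k \<in> {..length w} - {m}" for k
    using assms that by (cases "k < m") (auto simp: low_order_def)
  then have "coef (a * b) w = (\<Sum>k\<in>{m}. coef a (take k w) * coef b (drop k w))"
    unfolding coef_mult using assms(3) by (intro sum.mono_neutral_right) auto
  then show ?thesis by simp
qed

text \<open>The generator \<open>x_i\<close> goes to \<open>1 + X_i\<close>, its inverse to the
  geometric series in \<open>- X_i\<close>, whose support consists of the words that use the letter
  \<open>i\<close> only, including the empty word.\<close>

definition magnus_letter :: "nat \<times> bool \<Rightarrow> ncs" where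
  "magnus_letter a = Ncs (\<lambda>w. if snd a then (if w = [] \<or> w = [fst a] then 1 else 0)
     else (if set w \<subseteq> {fst a} then (- 1) ^ length w else 0))"

lemma coef_magnus_letter:
  "coef (magnus_letter (i, True)) w = (if w = [] \<or> w = [i] then 1 else 0)"
  "coef (magnus_letter (i, False)) w = (if set w \<subseteq> {i} then (- 1) ^ length w else 0)"
  by (simp_all add: magnus_letter_def Ncs_inverse)

lemma magnus_letter_cancel: "cancels a b \<Longrightarrow> magnus_letter a * magnus_letter b = 1"
proof -
  have 1: "magnus_letter (i, True) * magnus_letter (i, False) = 1" for i
  proof (rule ncs_eqI)
    fix w
    show "coef (magnus_letter (i, True) * magnus_letter (i, False)) w = coef 1 w"
    proof (cases w)
      case (Cons j v)
      have "coef (magnus_letter (i, True) * magnus_letter (i, False)) w =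
        (\<Sum>k\<in>{0, Suc 0}. coef (magnus_letter (i, True)) (take k w) * coef (magnus_letter (i, False)) (drop k w))"
        unfolding coef_mult
      proof (rule sum.mono_neutral_right)
        show "\<forall>k\<in>{..length w} - {0, Suc 0}.
          coef (magnus_letter (i, True)) (take k w) * coef (magnus_letter (i, False)) (drop k w) = 0"
        proof
          fix k assume "k \<in> {..length w} - {0, Suc 0}"
          then have "length (take k w) > 1" by auto
          then have "take k w \<noteq> []" "take k w \<noteq> [i]" by force+
          then show "coef (magnus_letter (i, True)) (take k w) * coef (magnus_letter (i, False)) (drop k w) = 0"
            by (simp add: coef_magnus_letter(1))
        qed
      qed (use Cons in auto)
      then show ?thesis using Cons by (auto simp: coef_magnus_letter)
    qed (simp add: coef_mult coef_magnus_letter)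
  qed
  have 2: "magnus_letter (i, False) * magnus_letter (i, True) = 1" for i
  proof (rule ncs_eqI)
    fix w
    show "coef (magnus_letter (i, False) * magnus_letter (i, True)) w = coef 1 w"
    proof (cases w rule: rev_cases)
      case (snoc v j)
      have "coef (magnus_letter (i, False) * magnus_letter (i, True)) w =
        (\<Sum>k\<in>{length v, Suc (length v)}. coef (magnus_letter (i, False)) (take k w) * coef (magnus_letter (i, True)) (drop k w))"
        unfolding coef_mult
      proof (rule sum.mono_neutral_right)
        show "\<forall>k\<in>{..length w} - {length v, Suc (length v)}.
          coef (magnus_letter (i, False)) (take k w) * coef (magnus_letter (i, True)) (drop k w) = 0"
        proof
          fix k assume "k \<in> {..length w} - {length v, Suc (length v)}"
          then have "length (drop k w) > 1" using snoc by auto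
          then have "drop k w \<noteq> []" "drop k w \<noteq> [i]" by force+
          then show "coef (magnus_letter (i, False)) (take k w) * coef (magnus_letter (i, True)) (drop k w) = 0"
            by (simp add: coef_magnus_letter(1))
        qed
      qed (use snoc in auto)
      then show ?thesis using snoc by (auto simp: coef_magnus_letter)
    qed (simp add: coef_mult coef_magnus_letter)
  qed
  assume "cancels a b"
  then show ?thesis using 1 2 by (cases a; cases b; cases "snd a") (auto simp: cancels_def)
qed

definition magnus :: "(nat \<times> bool) list \<Rightarrow> ncs" where
  "magnus w = prod_list (map magnus_letter w)"

lemma magnus_simps [simp]: "magnus [] = 1" "magnus (a # w) = magnus_letter a * magnus w"
  by (simp_all add: magnus_def)

lemma magnus_cons_reduce: "magnus (cons_reduce a w) = magnus_letter a * magnus w"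
  using magnus_letter_cancel[of a "hd w"] by (cases w) (auto simp: mult.assoc[symmetric])

lemma magnus_foldr: "magnus (foldr cons_reduce u v) = magnus u * magnus v"
  by (induction u) (auto simp: magnus_cons_reduce mult.assoc)

lemma magnus_order: "magnus w - 1 \<in> low_order 1"
proof -
  have "coef (magnus w) [] = 1"
  proof (induction w)
    case (Cons a w)
    then show ?case by (cases a; cases "snd a") (auto simp: coef_mult coef_magnus_letter)
  qed simp
  then show ?thesis by (auto simp: low_order_def)
qed

context
  fixes r :: nat
begin

interpretation F: group "free_group r" by (rule group_free_group)

lemma magnus_mult: "magnus (u \<otimes>\<^bsub>free_group r\<^esub> v) = magnus u * magnus v"
  by (simp add: free_group_def magnus_foldr)

lemma magnus_one: "magnus \<one>\<^bsub>free_group r\<^esub> = 1"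
  by (simp add: free_group_def)

lemma magnus_inv:
  assumes "u \<in> carrier (free_group r)"
  shows "magnus u * magnus (inv\<^bsub>free_group r\<^esub> u) = 1" "magnus (inv\<^bsub>free_group r\<^esub> u) * magnus u = 1"
  using assms by (simp_all add: magnus_mult[symmetric] magnus_one)

text \<open>With \<open>U\<close>, \<open>V\<close> the expansions,
  \<open>U V U\<inverse> V\<inverse> - 1\<close> is
  \<open>(U V - V U) U\<inverse> V\<inverse>\<close>, and \<open>U V - V U\<close> is the ring
  commutator of \<open>U - 1\<close> and \<open>V - 1\<close>. The remaining factor is 1 up to
  higher order, so the group commutator has the ring commutator as its leading part.\<close>

lemma magnus_comm:
  assumes "u \<in> carrier (free_group r)" "v \<in> carrier (free_group r)"
    and "magnus u - 1 \<in> low_order i" "magnus v - 1 \<in> low_order j"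
  defines "c \<equiv> magnus (F.comm u v) - 1"
    and "d \<equiv> (magnus u - 1) * (magnus v - 1) - (magnus v - 1) * (magnus u - 1)"
  shows "c \<in> low_order (i + j)" "c - d \<in> low_order (Suc (i + j))"
proof -
  define a b where "a = magnus u - 1" and "b = magnus v - 1"
  let ?u' = "magnus (inv\<^bsub>free_group r\<^esub> u)" and ?v' = "magnus (inv\<^bsub>free_group r\<^esub> v)"
  have d: "d = a * b - b * a" by (simp add: d_def a_def b_def)
  have dl: "d \<in> low_order (i + j)"
    using low_order_mult[OF assms(3,4)] low_order_mult[OF assms(4,3)]
    unfolding d_def by (intro low_order_diff) (auto simp: add.commute)
  have "c = (magnus u * magnus v - magnus v * magnus u) * (?u' * ?v')"
    using magnus_inv[OF assms(1)] magnus_inv[OF assms(2)] assms(1,2)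
    unfolding c_def F.comm_def magnus_mult left_diff_distrib
    by (metis mult.assoc mult_1_right)
  also have "magnus u * magnus v - magnus v * magnus u = d"
    by (simp add: d_def algebra_simps)
  finally have c: "c = d * (?u' * ?v')" .
  show "c \<in> low_order (i + j)" unfolding c using dl by (rule low_order_mult_right)
  have "?u' * ?v' - 1 = (?u' - 1) * ?v' + (?v' - 1)" by (simp add: algebra_simps)
  also have "\<dots> \<in> low_order 1"
    by (intro low_order_add low_order_mult_right magnus_order)
  finally have "d * (?u' * ?v' - 1) \<in> low_order (i + j + 1)"
    by (rule low_order_mult[OF dl])
  then show "c - d \<in> low_order (Suc (i + j))" unfolding c by (simp add: algebra_simps)
qed

lemma magnus_mult_leading:
  assumes "magnus u - 1 \<in> low_order n" "magnus v - 1 \<in> low_order n" "1 \<le> n"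
  defines "s \<equiv> (magnus u - 1) + (magnus v - 1)"
  shows "magnus (u \<otimes>\<^bsub>free_group r\<^esub> v) - 1 \<in> low_order n"
    "(magnus (u \<otimes>\<^bsub>free_group r\<^esub> v) - 1) - s \<in> low_order (Suc n)"
proof -
  have *: "magnus (u \<otimes>\<^bsub>free_group r\<^esub> v) - 1 = s + (magnus u - 1) * (magnus v - 1)"
    by (simp add: s_def magnus_mult algebra_simps)
  have "(magnus u - 1) * (magnus v - 1) \<in> low_order (n + n)"
    by (rule low_order_mult) (use assms in auto)
  then have p: "(magnus u - 1) * (magnus v - 1) \<in> low_order (Suc n)"
    using low_order_antimono[of "Suc n" "n + n"] assms(3) by auto
  then show "(magnus (u \<otimes>\<^bsub>free_group r\<^esub> v) - 1) - s \<in> low_order (Suc n)" by (simp add: *)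
  show "magnus (u \<otimes>\<^bsub>free_group r\<^esub> v) - 1 \<in> low_order n"
    unfolding * s_def using assms low_order_antimono[of n "Suc n", OF _ p]
    by (intro low_order_add) auto
qed

lemma magnus_inv_leading:
  assumes "u \<in> carrier (free_group r)" "magnus u - 1 \<in> low_order n" "1 \<le> n"
  shows "magnus (inv\<^bsub>free_group r\<^esub> u) - 1 \<in> low_order n"
    "(magnus (inv\<^bsub>free_group r\<^esub> u) - 1) + (magnus u - 1) \<in> low_order (Suc n)"
proof -
  let ?u' = "magnus (inv\<^bsub>free_group r\<^esub> u)"
  have *: "?u' - 1 = - (?u' * (magnus u - 1))"
    using magnus_inv[OF assms(1)] by (simp add: algebra_simps)
  show l: "?u' - 1 \<in> low_order n"
    unfolding * using assms by (intro low_order_minus low_order_mult_left)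
  have "(?u' - 1) * (magnus u - 1) \<in> low_order (1 + n)"
    by (rule low_order_mult[OF magnus_order assms(2)])
  moreover have "(?u' - 1) + (magnus u - 1) = - ((?u' - 1) * (magnus u - 1))"
    using magnus_inv[OF assms(1)] by (simp add: algebra_simps)
  ultimately show "(?u' - 1) + (magnus u - 1) \<in> low_order (Suc n)"
    using low_order_minus by fastforce
qed

text \<open>The easy half of Magnus' theorem: by \<open>magnus_comm\<close> each further commutator
  gains at least one degree. The converse occupies the rest of the section.\<close>

lemma magnus_lower_central:
  assumes "u \<in> F.lc n" "1 \<le> n"
  shows "magnus u - 1 \<in> low_order n"
  using assms(2,1)
proof (induction n arbitrary: u rule: dec_induct)
  case base
  then show ?case using magnus_order by simp
next
  case (step n)
  obtain m where m: "n = Suc m" using step by (cases n) auto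
  have "u \<in> generate (free_group r) {F.comm x y | x y. x \<in> F.lc n \<and> y \<in> carrier (free_group r)}"
    using step.prems m by (simp add: F.lower_central_Suc_Suc)
  then have "u \<in> carrier (free_group r) \<and> magnus u - 1 \<in> low_order (Suc n)"
  proof (induction rule: generate.induct)
    case one
    then show ?case by (simp add: magnus_one low_order_zero)
  next
    case (incl h)
    then obtain x y where h: "h = F.comm x y" "x \<in> F.lc n" "y \<in> carrier (free_group r)" by blast
    then show ?case
      using magnus_comm(1)[of x y n 1] step.IH[of x] F.lower_central_closed magnus_order by auto
  next
    case (inv h)
    then obtain x y where h: "h = F.comm x y" "x \<in> F.lc n" "y \<in> carrier (free_group r)" by blast
    then have "h \<in> carrier (free_group r) \<and> magnus h - 1 \<in> low_order (Suc n)"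
      using magnus_comm(1)[of x y n 1] step.IH[of x] F.lower_central_closed magnus_order by auto
    then show ?case using magnus_inv_leading(1)[of h "Suc n"] by auto
  next
    case (eng g h)
    then show ?case using magnus_mult_leading(1)[of g "Suc n" h] by auto
  qed
  then show ?case by blast
qed

lemma magnus_eq_of_lower_central:
  assumes "u \<in> F.lc (Suc n)" "length w = n" "1 \<le> n"
  shows "coef (magnus u) w = 0"
  using magnus_lower_central[OF assms(1)] assms by (force simp: low_order_def)

text \<open>The homogeneous part of degree \<open>length w\<close> of the Magnus expansion of \<open>u\<close> is \<open>w\<close> plus a
  combination of lexicographically smaller words.\<close>

definition leads :: "nat list \<Rightarrow> (nat \<times> bool) list \<Rightarrow> bool" where
  "leads w u \<longleftrightarrow> u \<in> F.lc (length w) \<and> w \<noteq> [] \<and> coef (magnus u) w = 1 \<and>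
     (\<forall>v. length v = length w \<longrightarrow> w < v \<longrightarrow> coef (magnus u) v = 0)"

end

text \<open>Lexicographic comparison that is decided at a letter, without the prefix case. Unlike
  \<open><\<close> on lists it survives appending different tails, which is needed because words of
  different lengths are compared.\<close>

definition word_above :: "nat list \<Rightarrow> nat list \<Rightarrow> bool" where
  "word_above u v \<longleftrightarrow> (\<exists>p a b s t. u = p @ a # s \<and> v = p @ b # t \<and> b < a)"

lemma word_above_append: "word_above u v \<Longrightarrow> word_above (u @ s) (v @ t)"
  unfolding word_above_def by fastforce

lemma word_above_prepend: "word_above u v \<Longrightarrow> word_above (p @ u) (p @ v)"
  unfolding word_above_def by (metis append.assoc)

lemma word_above_less: "word_above u v \<Longrightarrow> v < u"
  unfolding word_above_def list_less_def lexord_def by blast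

lemma word_above_of_less: "v < u \<Longrightarrow> (\<And>s. u \<noteq> v @ s) \<Longrightarrow> word_above u v"
  unfolding word_above_def list_less_def lexord_def by fastforce

lemma less_iff_word_above: "length u = length v \<Longrightarrow> v < u \<longleftrightarrow> word_above u v"
  using word_above_of_less[of v u] word_above_less by force

context
  fixes r :: nat
begin

interpretation F: group "free_group r" by (rule group_free_group)

text \<open>The leading part of the commutator is \<open>u v - v u\<close>, whose two products have
  the largest words \<open>w @ w'\<close> and \<open>w' @ w\<close>. By hypothesis the first is
  larger, so it cannot be cancelled by the second and keeps coefficient 1.\<close>

lemma leads_comm:
  assumes u: "leads r w u" and v: "leads r w' v" and above: "word_above (w @ w') (w' @ w)"
  shows "leads r (w @ w') (F.comm u v)"
proof -
  let ?i = "length w" and ?j = "length w'"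
  have uv: "u \<in> F.lc ?i" "v \<in> F.lc ?j" "w \<noteq> []" "w' \<noteq> []"
    using u v by (auto simp: leads_def)
  then have cl: "u \<in> carrier (free_group r)" "v \<in> carrier (free_group r)"
    using F.lower_central_closed by blast+
  have pos: "1 \<le> ?i" "1 \<le> ?j" using uv by (auto simp: Suc_le_eq)
  have lo: "magnus u - 1 \<in> low_order ?i" "magnus v - 1 \<in> low_order ?j"
    using magnus_lower_central uv pos by blast+
  have coef_c: "coef (magnus (F.comm u v)) z =
      coef (magnus u) (take ?i z) * coef (magnus v) (drop ?i z)
      - coef (magnus v) (take ?j z) * coef (magnus u) (drop ?j z)" if z: "length z = ?i + ?j" for z
  proof -
    have "coef (magnus (F.comm u v) - 1 - ((magnus u - 1) * (magnus v - 1) - (magnus v - 1) * (magnus u - 1))) z = 0"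
      using magnus_comm(2)[OF cl lo] z by (simp only: low_order_def mem_Collect_eq)
    moreover have "z \<noteq> []" using z uv(3) by auto
    ultimately show ?thesis
      using coef_mult_leading[OF lo z] coef_mult_leading[OF lo(2,1), of z] z uv(3,4) by auto
  qed
  have zero_u: "coef (magnus u) z = 0" if "length z = ?i" "w < z" for z
    using u that by (auto simp: leads_def)
  have zero_v: "coef (magnus v) z = 0" if "length z = ?j" "w' < z" for z
    using v that by (auto simp: leads_def)
  have split: "z \<le> x @ y" if "length x + length y = length z" "take (length x) z \<le> x" "drop (length x) z \<le> y"
    for x y z :: "nat list"
  proof -
    have "take (length x) z @ drop (length x) z \<le> x @ y"
    proof (cases "take (length x) z = x")
      case True
      then show ?thesis
        using that(3) less_iff_word_above[of y "drop (length x) z"] that(1)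
          word_above_less[OF word_above_prepend] by (fastforce simp: le_less)
    next
      case False
      then have "word_above x (take (length x) z)"
        using that less_iff_word_above[of x "take (length x) z"] by auto
      then show ?thesis using word_above_less[OF word_above_append] by (meson less_imp_le)
    qed
    then show ?thesis by simp
  qed
  have uv0: "coef (magnus u) (take ?i z) * coef (magnus v) (drop ?i z) = 0"
    if "length z = ?i + ?j" "w @ w' < z" for z
    using split[of w w' z] that zero_u[of "take ?i z"] zero_v[of "drop ?i z"] by (force simp: not_le)
  have vu0: "coef (magnus v) (take ?j z) * coef (magnus u) (drop ?j z) = 0"
    if "length z = ?i + ?j" "w' @ w < z" for z
    using split[of w' w z] that zero_v[of "take ?j z"] zero_u[of "drop ?j z"] by (force simp: not_le)
  have lt: "w' @ w < w @ w'" using above by (rule word_above_less)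
  show ?thesis
    unfolding leads_def
  proof (intro conjI allI impI)
    show "F.comm u v \<in> F.lc (length (w @ w'))"
      using F.lower_central_comm_add uv pos by simp
    show "w @ w' \<noteq> []" using uv by simp
    show "coef (magnus (F.comm u v)) (w @ w') = 1"
      using vu0[OF _ lt] u v by (simp add: coef_c leads_def)
    fix z assume z: "length z = length (w @ w')" "w @ w' < z"
    have len: "length z = ?i + ?j" using z by simp
    show "coef (magnus (F.comm u v)) z = 0"
      unfolding coef_c[OF len] uv0[OF len z(2)] vu0[OF len less_trans[OF lt z(2)]] by simp
  qed
qed

end

context
  fixes r :: nat
begin

interpretation F: group "free_group r" by (rule group_free_group)

lemma coef_magnus_mult:
  assumes "u \<in> F.lc n" "v \<in> F.lc n" "length w = n" "1 \<le> n"
  shows "coef (magnus (u \<otimes>\<^bsub>free_group r\<^esub> v)) w = coef (magnus u) w + coef (magnus v) w"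
proof -
  have "w \<noteq> []" using assms by auto
  then show ?thesis
    using magnus_mult_leading(2)[of u n v r] magnus_lower_central[of u r n] magnus_lower_central[of v r n] assms
    by (auto simp: low_order_def)
qed

lemma coef_magnus_inv:
  assumes "u \<in> F.lc n" "length w = n" "1 \<le> n"
  shows "coef (magnus (inv\<^bsub>free_group r\<^esub> u)) w = - coef (magnus u) w"
proof -
  have "w \<noteq> []" using assms by auto
  then show ?thesis
    using magnus_inv_leading(2)[of u r n] magnus_lower_central[of u r n] assms F.lower_central_closed
    by (auto simp: low_order_def add_eq_0_iff)
qed

lemma coef_magnus_int_pow:
  assumes "u \<in> F.lc n" "length w = n" "1 \<le> n"
  shows "coef (magnus (u [^]\<^bsub>free_group r\<^esub> (m::int))) w = m * coef (magnus u) w"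
proof -
  have u: "u \<in> carrier (free_group r)" using assms F.lower_central_closed by blast
  have pow: "u [^]\<^bsub>free_group r\<^esub> (k::nat) \<in> F.lc n" for k
    using subgroup.one_closed[OF F.subgroup_lower_central] assms(1)
    by (induction k) (auto intro: subgroup.m_closed[OF F.subgroup_lower_central])
  have nat: "coef (magnus (u [^]\<^bsub>free_group r\<^esub> (k::nat))) w = int k * coef (magnus u) w" for k
  proof (induction k)
    case 0
    then show ?case using assms by (auto simp: magnus_one)
  next
    case (Suc k)
    then show ?case using coef_magnus_mult[OF pow[of k] assms] by (simp add: algebra_simps)
  qed
  show ?thesis
  proof (cases "0 \<le> m")
    case True
    then show ?thesis using nat[of "nat m"] by (metis int_pow_int int_nat_eq nat_0_le)
  next
    case False
    then obtain k where "m = - int k" by (metis int_cases2 le_minus_iff linorder_le_cases neg_0_le_iff_le of_nat_0_le_iff)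
    then show ?thesis
      using nat[of k] coef_magnus_inv[OF pow[of k] assms(2,3)] u by (simp add: F.int_pow_neg int_pow_int)
  qed
qed

definition weighted :: "(nat list \<times> (nat \<times> bool) list) set \<Rightarrow> (nat \<times> (nat \<times> bool) list) set" where
  "weighted L = (\<lambda>(w, u). (length w, u)) ` L"

text \<open>The nonempty products of words in \<open>W\<close>, up to length \<open>n\<close>. Their
  number is the measure that decreases when a word is eliminated.\<close>

definition words_over :: "nat list set \<Rightarrow> nat \<Rightarrow> nat list set" where
  "words_over W n = {concat ws | ws. ws \<noteq> [] \<and> set ws \<subseteq> W \<and> length (concat ws) \<le> n}"

lemma weightedI: "(w, u) \<in> L \<Longrightarrow> d = length w \<Longrightarrow> (d, u) \<in> weighted L"
  unfolding weighted_def by force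

lemma weightedE:
  assumes "(d, u) \<in> weighted L"
  obtains w where "(w, u) \<in> L" "d = length w"
  using assms unfolding weighted_def by force

lemma words_overI: "ws \<noteq> [] \<Longrightarrow> set ws \<subseteq> W \<Longrightarrow> length (concat ws) \<le> n \<Longrightarrow> concat ws \<in> words_over W n"
  unfolding words_over_def by blast

lemma finite_words_over: "finite W \<Longrightarrow> finite (words_over W n)"
  by (rule finite_subset[of _ "{z. set z \<subseteq> \<Union> (set ` W) \<and> length z \<le> n}"])
     (fastforce simp: words_over_def intro!: finite_lists_length_le)+

text \<open>Elimination of the lexicographically largest word of a prefix code keeps the leading words of
  the remaining brackets visible, and the eliminated word is never produced again.\<close>

lemma lie_leading_word:
  assumes "finite L" "\<And>w u. (w, u) \<in> L \<Longrightarrow> leads r w u"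
    and "\<And>w u s u'. (w, u) \<in> L \<Longrightarrow> (w @ s, u') \<in> L \<Longrightarrow> s = [] \<and> u = u'"
    and "1 \<le> n" "F.lie (weighted L) n f"
  shows "f \<in> F.lc (Suc n) \<or> (\<exists>w\<in>words_over (fst ` L) n. length w = n \<and> coef (magnus f) w \<noteq> 0 \<and>
    (\<forall>v. length v = n \<longrightarrow> w < v \<longrightarrow> coef (magnus f) v = 0))"
  using assms
proof (induction "card (words_over (fst ` L) n)" arbitrary: L f rule: less_induct)
  case less
  note fin = less.prems(1) and leads = less.prems(2) and code = less.prems(3)
  let ?small = "{(w, u) \<in> L. length w \<le> n}"
  show ?case
  proof (cases "?small = {}")
    case True
    \<comment> \<open>Generators of weight above \<open>n\<close> cannot occur in degrees up to
      \<open>n\<close>, so nothing is left but elements of the next term of the series.\<close>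
    have "F.lie {} d a" if "F.lie (weighted L) d a" "d \<le> n" for d a
      using that
    proof (induction rule: F.lie.induct)
      case (base d y)
      then show ?case using True by (auto simp: weighted_def)
    qed (auto intro: F.lie.intros)
    then show ?thesis using less.prems(5) F.lie_empty by blast
  next
    case False
    define w where "w = Max (fst ` ?small)"
    have finS: "finite (fst ` ?small)" using fin by (auto intro: finite_subset[of _ L])
    then have "w \<in> fst ` ?small" unfolding w_def using False by (intro Max_in) auto
    then obtain x where x: "(w, x) \<in> L" "length w \<le> n" by auto
    have wx: "leads r w x" using leads x by blast
    then have w0: "w \<noteq> []" "x \<in> F.lc (length w)" by (auto simp: leads_def)
    \<comment> \<open>Maximality of \<open>w\<close> gives \<open>v < w\<close>, and in a prefix
      code \<open>w\<close> does not extend \<open>v\<close>; hence the two words differ at some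
      letter.\<close>
    have above: "word_above w v" if "(v, y) \<in> L" "length v \<le> n" "(v, y) \<noteq> (w, x)" for v y
    proof (rule word_above_of_less)
      have "v \<le> w" unfolding w_def using that finS by (intro Max_ge) force+
      moreover have "v \<noteq> w" using code[OF x(1), of "[]" y] that by auto
      ultimately show "v < w" by simp
      show "w \<noteq> v @ s" for s using code[OF that(1), of s x] x that by auto
    qed
    define pw where "pw k = concat (replicate k w)" for k
    have pw_Suc: "pw (Suc k) = w @ pw k" for k by (simp add: pw_def)
    have pw_Suc': "pw (Suc k) = pw k @ w" for k
      by (induction k) (simp_all add: pw_def)
    have pw_add: "pw (k + l) = pw k @ pw l" for k l
      by (simp add: pw_def replicate_add)
    have pw_len: "length (pw k) = k * length w" for k
      by (induction k) (simp_all add: pw_def)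
    \<comment> \<open>Elimination drops \<open>x\<close> and adds its iterated brackets with every
      other generator. Such a bracket leads with \<open>k\<close> copies of \<open>w\<close>
      followed by \<open>v\<close>. Lengths beyond \<open>n\<close> are cut off, which keeps the set
      finite.\<close>
    define L' where "L' = {(pw k @ v, (F.comm x ^^ k) y) | v y k.
      (v, y) \<in> L \<and> (v, y) \<noteq> (w, x) \<and> k * length w + length v \<le> n}"
    have L'I: "(pw k @ v, (F.comm x ^^ k) y) \<in> L'"
      if "(v, y) \<in> L" "(v, y) \<noteq> (w, x)" "k * length w + length v \<le> n" for v y k
      using that unfolding L'_def by blast
    have "finite L'"
    proof (rule finite_subset)
      have "k \<le> n" if "k * length w + length v \<le> n" for k and v :: "nat list"
      proof -
        have "1 \<le> length w" using w0 by (simp add: Suc_le_eq)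
        then have "k * 1 \<le> k * length w" by (rule mult_le_mono2)
        then show ?thesis using that by linarith
      qed
      then show "L' \<subseteq> (\<lambda>((v, y), k). (pw k @ v, (F.comm x ^^ k) y)) ` (L \<times> {..n})"
        unfolding L'_def by (force intro: image_eqI[of _ _ "((v, y), k)" for v y k])
      show "finite ((\<lambda>((v, y), k). (pw k @ v, (F.comm x ^^ k) y)) ` (L \<times> {..n}))"
        using fin by blast
    qed
    moreover have leads': "leads r z u" if zu: "(z, u) \<in> L'" for z u
    proof -
      obtain v y k where vyk: "(v, y) \<in> L" "(v, y) \<noteq> (w, x)" "k * length w + length v \<le> n"
        "z = pw k @ v" "u = (F.comm x ^^ k) y"
        using zu unfolding L'_def by blast
      then have wv: "word_above w v" using above by auto
      have "leads r (pw k @ v) ((F.comm x ^^ k) y)" for k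
      proof (induction k)
        case 0
        then show ?case using leads vyk by (simp add: pw_def)
      next
        case (Suc k)
        have "word_above (pw k @ w @ v) (pw k @ v @ w)"
          by (intro word_above_prepend word_above_append wv)
        then have "word_above (w @ pw k @ v) ((pw k @ v) @ w)"
          using pw_Suc pw_Suc' by (metis append.assoc)
        then show ?case using leads_comm[OF wx Suc] by (simp add: pw_Suc)
      qed
      then show ?thesis using vyk by simp
    qed
    moreover have code': "s = [] \<and> u = u'" if zu: "(z, u) \<in> L'" "(z @ s, u') \<in> L'" for z u s u'
    proof -
      obtain v y k where vyk: "(v, y) \<in> L" "(v, y) \<noteq> (w, x)" "z = pw k @ v" "u = (F.comm x ^^ k) y"
        using zu unfolding L'_def by blast
      obtain v' y' k' where vyk': "(v', y') \<in> L" "(v', y') \<noteq> (w, x)" "z @ s = pw k' @ v'" "u' = (F.comm x ^^ k') y'"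
        using zu unfolding L'_def by blast
      have eq: "pw k @ v @ s = pw k' @ v'" using vyk vyk' by simp
      \<comment> \<open>If the numbers of initial copies of \<open>w\<close> differed, removing the
        common ones would make one word of the code \<open>L\<close> a prefix of another
        one.\<close>
      have "k = k'"
      proof (rule ccontr)
        assume "k \<noteq> k'"
        then consider j where "k' = k + Suc j" | j where "k = k' + Suc j"
          using less_imp_Suc_add[of k k'] less_imp_Suc_add[of k' k] by (fastforce simp: nat_neq_iff)
        then show False
        proof cases
          case (1 j)
          then have *: "v @ s = w @ (pw j @ v')" using eq pw_add[of k "Suc j"] pw_Suc[of j] by simp
          then consider t where "v = w @ t" | t where "w = v @ t"
            by (metis append_eq_append_conv2)
          then show False
          proof cases
            case (1 t)
            then show False using code[OF x(1), of t y] vyk by auto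
          next
            case (2 t)
            then show False using code[OF vyk(1), of t x] x vyk by auto
          qed
        next
          case (2 j)
          then have *: "v' = w @ (pw j @ v @ s)" using eq pw_add[of k' "Suc j"] pw_Suc[of j] by simp
          then show False using code[OF x(1), of "pw j @ v @ s" y'] vyk' w0 by auto
        qed
      qed
      then have "v' = v @ s" using eq by simp
      then show ?thesis using code[OF vyk(1), of s y'] vyk vyk' \<open>k = k'\<close> by auto
    qed
    moreover have sub: "words_over (fst ` L') n \<subseteq> words_over (fst ` L) n"
    proof
      fix z assume "z \<in> words_over (fst ` L') n"
      then obtain ws where ws: "z = concat ws" "ws \<noteq> []" "set ws \<subseteq> fst ` L'" "length z \<le> n"
        by (auto simp: words_over_def)
      have "\<exists>vs. concat vs = concat ws \<and> set vs \<subseteq> fst ` L \<and> (ws \<noteq> [] \<longrightarrow> vs \<noteq> [])"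
        using ws(3)
      proof (induction ws)
        case (Cons a ws)
        then obtain u where "(a, u) \<in> L'" by auto
        then obtain v y k where v: "(v, y) \<in> L" "a = pw k @ v" unfolding L'_def by blast
        obtain vs where vs: "concat vs = concat ws" "set vs \<subseteq> fst ` L" using Cons by auto
        have "w \<in> fst ` L" "v \<in> fst ` L" using x v by force+
        then have "set (replicate k w @ v # vs) \<subseteq> fst ` L"
          using vs(2) by (auto simp: set_replicate_conv_if)
        moreover have "concat (replicate k w @ v # vs) = concat (a # ws)"
          using v vs by (simp add: pw_def)
        ultimately show ?case by (metis append_is_Nil_conv list.distinct(1))
      next
        case Nil
        then show ?case by (intro exI[of _ "[]"]) simp
      qed
      then obtain vs where "concat vs = z" "set vs \<subseteq> fst ` L" "vs \<noteq> []"
        using ws by auto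
      then show "z \<in> words_over (fst ` L) n" using words_overI[of vs _ n] ws(4) by simp
    qed
    moreover have new: "w \<in> words_over (fst ` L) n" "w \<notin> words_over (fst ` L') n"
    proof -
      have "concat [w] = w" "set [w] \<subseteq> fst ` L" using x by force+
      then show "w \<in> words_over (fst ` L) n" using words_overI[of "[w]" _ n] x(2) by simp
      show "w \<notin> words_over (fst ` L') n"
      proof
        assume "w \<in> words_over (fst ` L') n"
        then obtain a ws u where ws: "w = concat (a # ws)" "(a, u) \<in> L'"
          by (auto simp: words_over_def neq_Nil_conv)
        then obtain v y k where v: "(v, y) \<in> L" "(v, y) \<noteq> (w, x)" "a = pw k @ v"
          unfolding L'_def by blast
        have vn: "v \<noteq> []" using leads[OF v(1)] by (auto simp: leads_def)
        have "k = 0"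
        proof (rule ccontr)
          assume "k \<noteq> 0"
          then have "length w \<le> length (pw k)" using pw_len[of k] by simp
          moreover have "length w = length (pw k) + length v + length (concat ws)"
            using arg_cong[OF ws(1), of length] v by simp
          ultimately show False using vn by simp
        qed
        then have "w = v @ concat ws" using ws v by (simp add: pw_def)
        then show False using code[OF v(1), of "concat ws" x] x v by auto
      qed
    qed
    ultimately have IH: "F.lie (weighted L') n b \<Longrightarrow> b \<in> F.lc (Suc n) \<or>
        (\<exists>w\<in>words_over (fst ` L') n. length w = n \<and> coef (magnus b) w \<noteq> 0 \<and>
        (\<forall>v. length v = n \<longrightarrow> w < v \<longrightarrow> coef (magnus b) v = 0))" for b
      using less.prems(4) finite_words_over[of "fst ` L"] fin
      by (intro less.hyps) (auto intro!: psubset_card_mono)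
    have "\<exists>m::int. \<exists>b. f = x [^]\<^bsub>free_group r\<^esub> m \<otimes>\<^bsub>free_group r\<^esub> b \<and>
        F.lie (weighted L') n b \<and> (n \<noteq> length w \<longrightarrow> m = 0)"
    proof (rule F.lie_eliminate[OF _ _ _ less.prems(5)])
      fix d y assume dy: "(d, y) \<in> weighted L'" and d: "d + length w \<le> n"
      obtain v z k where vzk: "(v, z) \<in> L" "(v, z) \<noteq> (w, x)" "d = length (pw k @ v)" "y = (F.comm x ^^ k) z"
      proof (rule weightedE[OF dy])
        fix v' assume "(v', y) \<in> L'" "d = length v'"
        then show thesis using that unfolding L'_def by blast
      qed
      then have "Suc k * length w + length v \<le> n" "F.comm x y = (F.comm x ^^ Suc k) z"
        using d by (simp_all add: pw_len)
      with L'I[OF vzk(1,2), of "Suc k"] have "(pw (Suc k) @ v, F.comm x y) \<in> L'" by metis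
      then show "(d + length w, F.comm x y) \<in> weighted L'"
        by (rule weightedI) (use vzk in \<open>simp add: pw_len\<close>)
    next
      fix d y assume "(d, y) \<in> weighted L" and dn: "d \<le> n"
      then obtain v where v: "(v, y) \<in> L" "d = length v" by (elim weightedE)
      have "(v, y) \<in> L'" if "(v, y) \<noteq> (w, x)"
        using L'I[OF v(1) that, of 0] v(2) dn by (simp add: pw_def)
      then show "(d, y) = (length w, x) \<or> (d, y) \<in> weighted L'"
        using v weightedI[of v y L' d] by auto
    qed (use w0 in \<open>auto simp: Suc_le_eq\<close>)
    then obtain m b where f: "f = x [^]\<^bsub>free_group r\<^esub> (m::int) \<otimes>\<^bsub>free_group r\<^esub> b"
      and b: "F.lie (weighted L') n b" and m: "n \<noteq> length w \<Longrightarrow> m = 0" by blast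
    have cl: "x \<in> carrier (free_group r)" "b \<in> carrier (free_group r)"
      using w0 F.lower_central_closed F.lie_closed[OF b] by blast+
    show ?thesis
    proof (cases "m = 0")
      case True
      then have "f = b" using f cl by simp
      then show ?thesis using IH[OF b] sub by blast
    next
      \<comment> \<open>The power of \<open>x\<close> leads with \<open>m\<close> times the word
        \<open>w\<close>. As \<open>w\<close> is not a product of words of the new code, the leading
        word of \<open>b\<close>, if there is one, is different from \<open>w\<close>; the larger of
        the two then survives in \<open>f\<close>.\<close>
      case False
      then have n: "n = length w" using m by blast
      have "x [^]\<^bsub>free_group r\<^esub> m \<in> F.lc n"
        using F.subgroup_int_pow_closed[OF F.subgroup_lower_central] w0 n by blast
      then have cf: "coef (magnus f) v = m * coef (magnus x) v + coef (magnus b) v" if "length v = n" for v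
        unfolding f using coef_magnus_mult[of _ n b v] coef_magnus_int_pow[of x n v m] F.lie_lower_central[OF b] w0 n that less.prems(4)
        by auto
      have xw: "coef (magnus x) w = 1" "\<And>v. length v = n \<Longrightarrow> w < v \<Longrightarrow> coef (magnus x) v = 0"
        using wx n by (auto simp: leads_def)
      from IH[OF b] show ?thesis
      proof
        assume "b \<in> F.lc (Suc n)"
        then have "coef (magnus b) v = 0" if "length v = n" for v
          using that magnus_eq_of_lower_central less.prems(4) by blast
        then show ?thesis using new(1) cf xw n False by (intro disjI2 bexI[of _ w]) auto
      next
        assume "\<exists>w\<in>words_over (fst ` L') n. length w = n \<and> coef (magnus b) w \<noteq> 0 \<and>
          (\<forall>v. length v = n \<longrightarrow> w < v \<longrightarrow> coef (magnus b) v = 0)"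
        then obtain z where z: "z \<in> words_over (fst ` L') n" "length z = n" "coef (magnus b) z \<noteq> 0"
          "\<And>v. length v = n \<Longrightarrow> z < v \<Longrightarrow> coef (magnus b) v = 0" by blast
        have "z \<noteq> w" using z new by blast
        then consider "z < w" | "w < z" by fastforce
        then show ?thesis
        proof cases
          case 1
          then show ?thesis
            using new(1) cf xw n False z(4) less_trans[OF 1] by (intro disjI2 bexI[of _ w]) auto
        next
          case 2
          then show ?thesis
            using subsetD[OF sub z(1)] cf xw z less_trans[OF 2] by (intro disjI2 bexI[of _ z]) auto
        qed
      qed
    qed
  qed
qed

text \<open>The letters generate the whole graded Lie ring, and as one-letter words they form a
  prefix code. This is the start of the elimination.\<close>

lemma lie_generators:
  assumes "f \<in> F.lc n" "1 \<le> n"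
  shows "F.lie (weighted ((\<lambda>i. ([i], [(i, True)])) ` {..<r})) n f"
proof -
  let ?Y = "weighted ((\<lambda>i. ([i], [(i, True)])) ` {..<r})"
  have mem: "[(i, b)] \<in> carrier (free_group r)" if "i < r" for i b
    using that by (simp add: free_group_def)
  have letter: "F.lie ?Y 1 [(i, b)]" if i: "i < r" for i b
  proof -
    have "(1, [(i, True)]) \<in> ?Y" using i by (force simp: weighted_def)
    then have T: "F.lie ?Y 1 [(i, True)]"
      by (rule F.lie.base) (use mem[OF i] in auto)
    have "inv\<^bsub>free_group r\<^esub> [(i, True)] = [(i, False)]"
      by (rule F.inv_equality) (use mem[OF i] in \<open>auto simp: free_group_def cancels_def\<close>)
    then show ?thesis using T F.lie.minv[OF T] by (cases b) auto
  qed
  have 1: "F.lie ?Y 1 w" if "w \<in> carrier (free_group r)" for w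
    using that
  proof (induction w)
    case Nil
    have "\<one>\<^bsub>free_group r\<^esub> \<in> F.lc 2"
      by (rule subgroup.one_closed[OF F.subgroup_lower_central])
    then show ?case
      using F.lie.lower[of "\<one>\<^bsub>free_group r\<^esub>" 1 ?Y] by (simp add: free_group_def numeral_2_eq_2)
  next
    case (Cons a w)
    then have "w \<in> carrier (free_group r)" "fst a < r" and red: "reduced (a # w)"
      by (auto simp: free_group_def reduced_Cons_iff)
    then have "F.lie ?Y 1 [a]" "F.lie ?Y 1 w"
      using letter[of "fst a" "snd a"] Cons.IH by simp_all
    then have "F.lie ?Y 1 ([a] \<otimes>\<^bsub>free_group r\<^esub> w)" by (rule F.lie.mult)
    moreover have "[a] \<otimes>\<^bsub>free_group r\<^esub> w = a # w"
      using red by (cases w) (auto simp: free_group_def)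
    ultimately show ?case by simp
  qed
  show ?thesis
    using assms(2,1)
  proof (induction n arbitrary: f rule: dec_induct)
    case base
    then show ?case using 1 by simp
  next
    case (step n)
    obtain m where m: "n = Suc m" using step by (cases n) auto
    have gen: "F.lie ?Y (Suc n) (F.comm x y)" if "x \<in> F.lc n" "y \<in> carrier (free_group r)" for x y
      using F.lie.bracket[OF step.IH[OF that(1)] 1[OF that(2)]] by simp
    have "f \<in> generate (free_group r) {F.comm x y | x y. x \<in> F.lc n \<and> y \<in> carrier (free_group r)}"
      using step.prems m by (simp add: F.lower_central_Suc_Suc)
    then show ?case
    proof (induction rule: generate.induct)
      case one
      then show ?case using subgroup.one_closed[OF F.subgroup_lower_central] by (intro F.lie.lower) auto
    next
      case (incl h)
      then show ?case using gen by blast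
    next
      case (inv h)
      then show ?case using gen F.lie.minv by blast
    next
      case (eng g h)
      show ?case by (rule F.lie.mult[OF eng.IH])
    qed
  qed
qed

text \<open>An element of \<open>F.lc n\<close> is a bracket expression in the letters. Elimination
  either shows that it lies deeper or exhibits a leading word of degree \<open>n\<close> with
  nonzero coefficient. So the Magnus map is injective on each graded component, without any count of
  ranks.\<close>

theorem lower_central_Suc_of_magnus:
  assumes "f \<in> F.lc n" "1 \<le> n" "\<And>w. length w = n \<Longrightarrow> coef (magnus f) w = 0"
  shows "f \<in> F.lc (Suc n)"
proof -
  let ?L = "(\<lambda>i. ([i], [(i, True)])) ` {..<r}"
  have "leads r [i] [(i, True)]" if "i < r" for i
    unfolding leads_def
  proof (intro conjI allI impI)
    show "[(i, True)] \<in> F.lc (length [i])" using that by (simp add: free_group_def)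
    fix v :: "nat list" assume "length v = length [i]" "[i] < v"
    then show "coef (magnus [(i, True)]) v = 0" by (auto simp: coef_magnus_letter)
  qed (auto simp: coef_magnus_letter)
  then have "f \<in> F.lc (Suc n) \<or> (\<exists>w\<in>words_over (fst ` ?L) n. length w = n \<and> coef (magnus f) w \<noteq> 0 \<and>
    (\<forall>v. length v = n \<longrightarrow> w < v \<longrightarrow> coef (magnus f) v = 0))"
    by (intro lie_leading_word[OF _ _ _ assms(2) lie_generators[OF assms(1,2)]]) auto
  then show ?thesis using assms(3) by blast
qed

text \<open>If all coefficients in degrees 1 to \<open>c - 1\<close> vanish, the previous theorem
  moves \<open>f\<close> down the series one step at a time.\<close>

theorem magnus_detects_lower_central:
  assumes "f \<in> carrier (free_group r)" "f \<notin> F.lc c"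
  shows "\<exists>w. w \<noteq> [] \<and> length w < c \<and> coef (magnus f) w \<noteq> 0"
proof (rule ccontr)
  assume none: "\<nexists>w. w \<noteq> [] \<and> length w < c \<and> coef (magnus f) w \<noteq> 0"
  have "f \<in> F.lc (Suc n)" if "n < c" for n
    using that
  proof (induction n)
    case (Suc n)
    have "coef (magnus f) w = 0" if "length w = Suc n" for w
    proof -
      have "w \<noteq> []" "length w < c" using that Suc.prems by auto
      then show ?thesis using none by blast
    qed
    moreover have "f \<in> F.lc (Suc n)" using Suc by simp
    ultimately show ?case by (intro lower_central_Suc_of_magnus[of f "Suc n"]) simp_all
  qed (use assms in simp)
  then show False using assms by (cases c) auto
qed

end

section \<open>Free nilpotent groups are residually finite p-groups\<close>

text \<open>A further prime divisor \<open>q\<close> of the order would give, by Sylow, a subgroup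
  of order \<open>q\<close> and hence a nontrivial element whose order divides both \<open>q\<close>
  and a power of \<open>p\<close>.\<close>

lemma (in group) order_prime_power:
  assumes "finite (carrier G)" "prime (p::nat)"
    and pow: "\<And>x. x \<in> carrier G \<Longrightarrow> \<exists>e. x [^] (p ^ e) = \<one>"
  shows "\<exists>s. card (carrier G) = p ^ s"
proof -
  have pos: "card (carrier G) \<noteq> 0" using assms(1) one_closed by (auto simp: card_eq_0_iff)
  have only_p: "q = p" if q: "prime q" "q dvd card (carrier G)" for q
  proof (rule ccontr)
    assume "q \<noteq> p"
    obtain m where "Coset.order G = q ^ 1 * m" using q by (auto simp: Coset.order_def dvd_def)
    then obtain H where H: "subgroup H G" "card H = q ^ 1"
      using sylow_thm[OF q(1) is_group _ assms(1)] by blast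
    have "finite H" using finite_subset[OF subgroup.subset[OF H(1)] assms(1)] .
    have "1 < card H" using H(2) prime_gt_1_nat[OF q(1)] by simp
    then have "\<not> H \<subseteq> {\<one>}" using card_mono[of "{\<one>}" H] by auto
    then obtain x where x: "x \<in> H" "x \<noteq> \<one>" by blast
    have xG: "x \<in> carrier G" by (rule subgroup.mem_carrier[OF H(1) x(1)])
    have "group (G\<lparr>carrier := H\<rparr>)" by (rule subgroup_imp_group[OF H(1)])
    then have "x [^]\<^bsub>G\<lparr>carrier := H\<rparr>\<^esub> Coset.order (G\<lparr>carrier := H\<rparr>) = \<one>"
      using group.pow_order_eq_1[of "G\<lparr>carrier := H\<rparr>" x] x \<open>finite H\<close> by simp
    then have "x [^] q = \<one>" using H(2) by (simp add: Coset.order_def nat_pow_def)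
    then have "ord x dvd q" using pow_eq_id xG by blast
    moreover obtain e where "x [^] (p ^ e) = \<one>" using pow xG by blast
    then have "ord x dvd p ^ e" using pow_eq_id xG by blast
    ultimately have "ord x dvd gcd q (p ^ e)" by simp
    also have "gcd q (p ^ e) = 1"
      using primes_coprime[OF q(1) assms(2) \<open>q \<noteq> p\<close>] by (simp add: coprime_iff_gcd_eq_1[symmetric])
    finally have "ord x = 1" by simp
    then show False using ord_eq_1[OF xG] x(2) by simp
  qed
  obtain m where m: "card (carrier G) = p ^ multiplicity p (card (carrier G)) * m" "\<not> p dvd m"
    using multiplicity_decompose'[OF pos, of p] assms(2) by (metis not_prime_unit)
  have "m = 1"
  proof (rule ccontr)
    assume "m \<noteq> 1"
    then obtain q where "prime q" "q dvd m" using prime_factor_nat by blast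
    then show False using only_p[of q] m by (metis dvd_mult)
  qed
  then show ?thesis using m by auto
qed

text \<open>The ideal of series whose reduction modulo \<open>p\<close> has order at least
  \<open>n\<close>.\<close>

definition low_order_mod :: "nat \<Rightarrow> nat \<Rightarrow> ncs set" where
  "low_order_mod p n = {a. \<forall>w. length w < n \<longrightarrow> int p dvd coef a w}"

lemma low_order_mod_add: "a \<in> low_order_mod p n \<Longrightarrow> b \<in> low_order_mod p n \<Longrightarrow> a + b \<in> low_order_mod p n"
  and low_order_mod_diff: "a \<in> low_order_mod p n \<Longrightarrow> b \<in> low_order_mod p n \<Longrightarrow> a - b \<in> low_order_mod p n"
  and low_order_mod_minus: "a \<in> low_order_mod p n \<Longrightarrow> - a \<in> low_order_mod p n"
  and low_order_mod_zero: "0 \<in> low_order_mod p n"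
  by (auto simp: low_order_mod_def)

lemma low_order_mod_mult:
  assumes "a \<in> low_order_mod p m" "b \<in> low_order_mod p n"
  shows "a * b \<in> low_order_mod p (m + n)"
proof -
  have "int p dvd coef a (take k w) * coef b (drop k w)" if "length w < m + n" "k \<le> length w" for w k
    using assms that by (cases "k < m") (auto simp: low_order_mod_def)
  then show ?thesis by (auto simp: low_order_mod_def coef_mult intro!: dvd_sum)
qed

lemma low_order_mod_mult_left: "b \<in> low_order_mod p n \<Longrightarrow> a * b \<in> low_order_mod p n"
  using low_order_mod_mult[of a p 0 b n] by (simp add: low_order_mod_def)

lemma low_order_mod_mult_right: "a \<in> low_order_mod p n \<Longrightarrow> a * b \<in> low_order_mod p n"
  using low_order_mod_mult[of a p n b 0] by (simp add: low_order_mod_def)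

lemma coef_of_nat: "coef (of_nat k) w = (if w = [] then int k else 0)"
  by (induction k) auto

lemma power_minus_1_factor: "(u::'a::ring_1) ^ n - 1 = (u - 1) * (\<Sum>k<n. u ^ k)"
proof (induction n)
  case (Suc n)
  have "(u - 1) * (\<Sum>k<Suc n. u ^ k) = (u - 1) * (\<Sum>k<n. u ^ k) + (u - 1) * u ^ n"
    by (simp add: distrib_left)
  also have "\<dots> = (u ^ n - 1) + (u - 1) * u ^ n" by (simp only: Suc)
  also have "\<dots> = u ^ Suc n - 1" by (simp add: left_diff_distrib)
  finally show ?case ..
qed simp

text \<open>Each \<open>p\<close>-th power gains at least one degree: \<open>v ^ p - 1\<close> is
  \<open>v - 1\<close> times a sum of \<open>p\<close> powers of \<open>v\<close>. Each of these is
  1 up to the ideal, so the sum is congruent to \<open>p\<close> and has order at least 1 modulo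
  \<open>p\<close>.\<close>

lemma prime_power_low_order_mod:
  assumes "u - 1 \<in> low_order_mod p 1"
  shows "u ^ (p ^ e) - 1 \<in> low_order_mod p (Suc e)"
proof (induction e)
  case (Suc e)
  define v where "v = u ^ (p ^ e)"
  have v: "v - 1 \<in> low_order_mod p (Suc e)" using Suc by (simp add: v_def)
  have "v ^ k - 1 \<in> low_order_mod p (Suc e)" for k
    unfolding power_minus_1_factor using v by (rule low_order_mod_mult_right)
  then have "(\<Sum>k<n. v ^ k - 1) \<in> low_order_mod p (Suc e)" for n
    by (induction n) (auto intro: low_order_mod_add low_order_mod_zero)
  moreover have "(\<Sum>k<p. v ^ k) = (\<Sum>k<p. v ^ k - 1) + of_nat p"
    by (simp add: sum_subtractf)
  moreover have "of_nat p \<in> low_order_mod p (Suc e)"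
    by (simp add: low_order_mod_def coef_of_nat)
  ultimately have "(\<Sum>k<p. v ^ k) \<in> low_order_mod p (Suc e)"
    by (metis low_order_mod_add)
  then have "(\<Sum>k<p. v ^ k) \<in> low_order_mod p 1"
    by (auto simp: low_order_mod_def)
  then have "v ^ p - 1 \<in> low_order_mod p (Suc e + 1)"
    unfolding power_minus_1_factor using v by (intro low_order_mod_mult)
  then show ?case by (simp add: v_def power_mult[symmetric] mult.commute)
qed (use assms in simp)

text \<open>This makes the truncated reduction finite: for elements of \<open>free_group r\<close>
  only words over \<open>r\<close> letters have to be recorded.\<close>

lemma coef_magnus_foreign_letter:
  assumes "\<not> set w \<subseteq> fst ` set u"
  shows "coef (magnus u) w = 0"
  using assms
proof (induction u arbitrary: w)
  case (Cons a u)
  have "coef (magnus_letter a) (take k w) * coef (magnus u) (drop k w) = 0" for k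
  proof (cases "set (take k w) \<subseteq> {fst a}")
    case True
    have "set w = set (take k w) \<union> set (drop k w)" by (metis append_take_drop_id set_append)
    then have "\<not> set (drop k w) \<subseteq> fst ` set u" using True Cons.prems by auto
    then show ?thesis using Cons.IH by simp
  next
    case False
    define z where "z = take k w"
    have "z \<noteq> []" "z \<noteq> [fst a]" "\<not> set z \<subseteq> {fst a}" using False unfolding z_def[symmetric] by auto
    then have "coef (magnus_letter a) z = 0"
      by (cases a; cases "snd a") (auto simp: coef_magnus_letter)
    then have "coef (magnus_letter a) (take k w) = 0" by (simp only: z_def)
    then show ?thesis by simp
  qed
  then show ?case by (simp add: coef_mult)
qed auto

context
  fixes r :: nat
begin

interpretation F: group "free_group r" by (rule group_free_group)

text \<open>The kernel of the Magnus map after reducing coefficients modulo \<open>p\<close> and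
  discarding all words of length \<open>c\<close> or more.\<close>

definition magnus_subgroup :: "nat \<Rightarrow> nat \<Rightarrow> (nat \<times> bool) list set" where
  "magnus_subgroup p c = {f \<in> carrier (free_group r). magnus f - 1 \<in> low_order_mod p c}"

lemma magnus_subgroup_normal: "magnus_subgroup p c \<lhd> free_group r"
  unfolding F.normal_inv_iff
proof (intro conjI ballI)
  show "subgroup (magnus_subgroup p c) (free_group r)"
  proof
    fix f g assume "f \<in> magnus_subgroup p c" "g \<in> magnus_subgroup p c"
    then have fg: "f \<in> carrier (free_group r)" "magnus f - 1 \<in> low_order_mod p c"
      "g \<in> carrier (free_group r)" "magnus g - 1 \<in> low_order_mod p c"
      by (auto simp: magnus_subgroup_def)
    have *: "magnus f * magnus g - 1 = (magnus f - 1) * magnus g + (magnus g - 1)"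
      by (simp add: algebra_simps)
    show "f \<otimes>\<^bsub>free_group r\<^esub> g \<in> magnus_subgroup p c"
      unfolding magnus_subgroup_def mem_Collect_eq magnus_mult *
      by (intro conjI F.m_closed low_order_mod_add low_order_mod_mult_right fg)
  next
    fix f assume f: "f \<in> magnus_subgroup p c"
    then have *: "magnus (inv\<^bsub>free_group r\<^esub> f) - 1 = - (magnus (inv\<^bsub>free_group r\<^esub> f) * (magnus f - 1))"
      using magnus_inv(2)[of f r] by (simp add: magnus_subgroup_def algebra_simps)
    then show "inv\<^bsub>free_group r\<^esub> f \<in> magnus_subgroup p c"
      using f unfolding magnus_subgroup_def mem_Collect_eq *
      by (intro conjI F.inv_closed low_order_mod_minus low_order_mod_mult_left) simp_all
  qed (auto simp: magnus_subgroup_def magnus_one low_order_mod_zero)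
next
  fix g f assume g: "g \<in> carrier (free_group r)" and f: "f \<in> magnus_subgroup p c"
  have *: "magnus g * magnus f * magnus (inv\<^bsub>free_group r\<^esub> g) - 1 = magnus g * (magnus f - 1) * magnus (inv\<^bsub>free_group r\<^esub> g)"
    using magnus_inv(1)[OF g] by (simp add: algebra_simps)
  show "g \<otimes>\<^bsub>free_group r\<^esub> f \<otimes>\<^bsub>free_group r\<^esub> inv\<^bsub>free_group r\<^esub> g \<in> magnus_subgroup p c"
    using f g unfolding magnus_subgroup_def mem_Collect_eq magnus_mult *
    by (intro conjI F.m_closed F.inv_closed low_order_mod_mult_left low_order_mod_mult_right) simp_all
qed

lemma lower_central_magnus_subgroup: "1 \<le> c \<Longrightarrow> F.lc c \<subseteq> magnus_subgroup p c"
  using magnus_lower_central[of _ r c] F.lower_central_closed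
  by (fastforce simp: magnus_subgroup_def low_order_mod_def low_order_def)

lemma magnus_subgroup_cosetI:
  assumes "f \<in> carrier (free_group r)" "g \<in> carrier (free_group r)"
    and "magnus f - magnus g \<in> low_order_mod p c"
  shows "magnus_subgroup p c #>\<^bsub>free_group r\<^esub> f = magnus_subgroup p c #>\<^bsub>free_group r\<^esub> g"
proof -
  interpret N: normal "magnus_subgroup p c" "free_group r" by (rule magnus_subgroup_normal)
  have *: "magnus f * magnus (inv\<^bsub>free_group r\<^esub> g) - 1 = (magnus f - magnus g) * magnus (inv\<^bsub>free_group r\<^esub> g)"
    using magnus_inv(1)[OF assms(2)] by (simp add: algebra_simps)
  have "f \<otimes>\<^bsub>free_group r\<^esub> inv\<^bsub>free_group r\<^esub> g \<in> magnus_subgroup p c"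
    unfolding magnus_subgroup_def mem_Collect_eq magnus_mult *
    by (intro conjI F.m_closed F.inv_closed low_order_mod_mult_right assms)
  then have "f \<in> magnus_subgroup p c #>\<^bsub>free_group r\<^esub> g"
    using assms unfolding r_coset_def
    by (auto intro!: bexI[of _ "f \<otimes>\<^bsub>free_group r\<^esub> inv\<^bsub>free_group r\<^esub> g"] simp: F.m_assoc)
  then show ?thesis using F.repr_independence[OF _ assms(2) N.subgroup_axioms] by metis
qed

text \<open>A coset is determined by the residues modulo \<open>p\<close> of the coefficients at
  finitely many words, so representatives can be chosen from a finite set of residue tables.\<close>

lemma finite_magnus_quotient:
  assumes "0 < p"
  shows "finite (carrier (free_group r Mod magnus_subgroup p c))"
proof -
  let ?N = "magnus_subgroup p c" and ?F = "carrier (free_group r)"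
  define W where "W = {w. set w \<subseteq> {..<r} \<and> length w \<le> c}"
  define \<Phi> where "\<Phi> f = (\<lambda>w\<in>W. coef (magnus f) w mod int p)" for f
  have "finite W" unfolding W_def by (rule finite_lists_length_le) simp
  have "\<Phi> ` ?F \<subseteq> W \<rightarrow>\<^sub>E {0..<int p}" using assms by (auto simp: \<Phi>_def)
  then have fin: "finite (\<Phi> ` ?F)"
    by (rule finite_subset[OF _ finite_PiE]) (use \<open>finite W\<close> in auto)
  have eq: "?N #>\<^bsub>free_group r\<^esub> f = ?N #>\<^bsub>free_group r\<^esub> g" if fg: "f \<in> ?F" "g \<in> ?F" "\<Phi> f = \<Phi> g" for f g
  proof (rule magnus_subgroup_cosetI[OF fg(1,2)])
    have "int p dvd coef (magnus f) w - coef (magnus g) w" if "length w < c" for w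
    proof (cases "set w \<subseteq> {..<r}")
      case True
      then have "w \<in> W" using that by (simp add: W_def)
      then have "coef (magnus f) w mod int p = coef (magnus g) w mod int p"
        using fun_cong[OF fg(3), of w] by (simp add: \<Phi>_def)
      then show ?thesis by (simp add: mod_eq_dvd_iff)
    next
      case False
      moreover have "fst ` set f \<subseteq> {..<r}" "fst ` set g \<subseteq> {..<r}"
        using fg(1,2) by (auto simp: free_group_def)
      ultimately have "\<not> set w \<subseteq> fst ` set f" "\<not> set w \<subseteq> fst ` set g" by blast+
      then have "coef (magnus f) w = 0" "coef (magnus g) w = 0"
        using coef_magnus_foreign_letter by blast+
      then show ?thesis by simp
    qed
    then show "magnus f - magnus g \<in> low_order_mod p c" by (simp add: low_order_mod_def)
  qed
  have "carrier (free_group r Mod ?N) \<subseteq> (\<lambda>\<phi>. ?N #>\<^bsub>free_group r\<^esub> inv_into ?F \<Phi> \<phi>) ` \<Phi> ` ?F"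
  proof
    fix X assume "X \<in> carrier (free_group r Mod ?N)"
    then obtain f where f: "f \<in> ?F" "X = ?N #>\<^bsub>free_group r\<^esub> f"
      by (auto simp: FactGroup_def RCOSETS_def)
    then have "X = ?N #>\<^bsub>free_group r\<^esub> inv_into ?F \<Phi> (\<Phi> f)"
      using eq[of f "inv_into ?F \<Phi> (\<Phi> f)"] by (simp add: inv_into_into f_inv_into_f)
    then show "X \<in> (\<lambda>\<phi>. ?N #>\<^bsub>free_group r\<^esub> inv_into ?F \<Phi> \<phi>) ` \<Phi> ` ?F" using f(1) by blast
  qed
  then show ?thesis using fin finite_subset by blast
qed

text \<open>By \<open>prime_power_low_order_mod\<close> the power \<open>p ^ c\<close> of every
  element lies in the subgroup, so the finite quotient has only elements of \<open>p\<close>-power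
  order.\<close>

lemma card_magnus_quotient:
  assumes "prime p"
  shows "\<exists>s. card (carrier (free_group r Mod magnus_subgroup p c)) = p ^ s"
proof -
  let ?N = "magnus_subgroup p c"
  interpret N: normal ?N "free_group r" by (rule magnus_subgroup_normal)
  interpret Q: group "free_group r Mod ?N" by (rule N.factorgroup_is_group)
  interpret h: group_hom "free_group r" "free_group r Mod ?N" "\<lambda>f. ?N #>\<^bsub>free_group r\<^esub> f"
    by unfold_locales (rule N.r_coset_hom_Mod)
  show ?thesis
  proof (rule Q.order_prime_power)
  show "finite (carrier (free_group r Mod ?N))"
    using finite_magnus_quotient assms prime_gt_0_nat by blast
  show "prime p" by fact
  fix X assume "X \<in> carrier (free_group r Mod ?N)"
  then obtain f where f: "f \<in> carrier (free_group r)" "X = ?N #>\<^bsub>free_group r\<^esub> f"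
    by (auto simp: FactGroup_def RCOSETS_def)
  have pow: "magnus (f [^]\<^bsub>free_group r\<^esub> (k::nat)) = magnus f ^ k" for k
    by (induction k) (simp_all add: magnus_one magnus_mult power_commutes)
  have "magnus f - 1 \<in> low_order_mod p 1"
    using magnus_order[of f] by (auto simp: low_order_def low_order_mod_def)
  then have "magnus (f [^]\<^bsub>free_group r\<^esub> (p ^ c)) - 1 \<in> low_order_mod p (Suc c)"
    unfolding pow by (rule prime_power_low_order_mod)
  then have "magnus (f [^]\<^bsub>free_group r\<^esub> (p ^ c)) - 1 \<in> low_order_mod p c"
    unfolding low_order_mod_def mem_Collect_eq by (meson less_SucI)
  then have "f [^]\<^bsub>free_group r\<^esub> (p ^ c) \<in> ?N"
    unfolding magnus_subgroup_def mem_Collect_eq by (intro conjI F.nat_pow_closed f(1))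
  then have "?N #>\<^bsub>free_group r\<^esub> (f [^]\<^bsub>free_group r\<^esub> (p ^ c)) = ?N"
    by (intro F.coset_join2[OF _ N.subgroup_axioms] F.nat_pow_closed f(1))
  moreover have "X [^]\<^bsub>free_group r Mod ?N\<^esub> (p ^ c) = ?N #>\<^bsub>free_group r\<^esub> (f [^]\<^bsub>free_group r\<^esub> (p ^ c))"
    unfolding f(2) by (rule h.hom_nat_pow[OF f(1), symmetric])
  ultimately have "X [^]\<^bsub>free_group r Mod ?N\<^esub> (p ^ c) = \<one>\<^bsub>free_group r Mod ?N\<^esub>"
    by (simp only: one_FactGroup)
  then show "\<exists>e. X [^]\<^bsub>free_group r Mod ?N\<^esub> (p ^ e) = \<one>\<^bsub>free_group r Mod ?N\<^esub>" by blast
  qed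
qed

text \<open>Each element of \<open>E\<close> has a nonzero Magnus coefficient in degree below
  \<open>c\<close>. A prime exceeding the absolute values of these finitely many coefficients
  divides none of them.\<close>

lemma free_nilpotent_residually_p:
  assumes "finite E" "E \<subseteq> carrier (free_group r)" "E \<inter> F.lc c = {}"
  shows "\<exists>p. prime p \<and> magnus_subgroup p c \<inter> E = {}"
proof -
  have "\<forall>f\<in>E. \<exists>w. w \<noteq> [] \<and> length w < c \<and> coef (magnus f) w \<noteq> 0"
    using magnus_detects_lower_central assms by blast
  then obtain w where w: "\<And>f. f \<in> E \<Longrightarrow> w f \<noteq> [] \<and> length (w f) < c \<and> coef (magnus f) (w f) \<noteq> 0"
    by metis
  define b where "b = Max ((\<lambda>f. nat \<bar>coef (magnus f) (w f)\<bar>) ` E)"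
  obtain p where p: "prime p" "b < p" using bigger_prime[of b] by blast
  have "f \<notin> magnus_subgroup p c" if "f \<in> E" for f
  proof
    assume "f \<in> magnus_subgroup p c"
    then have "int p dvd coef (magnus f - 1) (w f)"
      using w[OF that] by (auto simp: magnus_subgroup_def low_order_mod_def)
    then have "int p dvd coef (magnus f) (w f)" using w[OF that] by simp
    then have "int p \<le> \<bar>coef (magnus f) (w f)\<bar>"
      using w[OF that] dvd_imp_le_int[of "coef (magnus f) (w f)" "int p"] by simp
    moreover have "nat \<bar>coef (magnus f) (w f)\<bar> \<le> b"
      unfolding b_def by (rule Max_ge[OF finite_imageI[OF assms(1)] imageI[OF that]])
    ultimately show False using p(2) by simp
  qed
  then have "magnus_subgroup p c \<inter> E = {}" by (simp only: disjoint_iff) metis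
  then show ?thesis using p(1) by (intro exI conjI)
qed

end

section \<open>Parafree groups\<close>

lemma (in group_hom) hom_lower_central: "x \<in> lower_central G n \<Longrightarrow> h x \<in> lower_central H n"
proof (induction n arbitrary: x rule: induct_nat_012)
  case (ge2 n)
  have "x \<in> generate G {G.comm x y | x y. x \<in> lower_central G (Suc n) \<and> y \<in> carrier G}"
    using ge2(3) by (simp only: G.lower_central_Suc_Suc)
  then have "x \<in> carrier G \<and> h x \<in> lower_central H (Suc (Suc n))"
  proof (induction rule: generate.induct)
    case one
    then show ?case using subgroup.one_closed[OF H.subgroup_lower_central] by simp
  next
    case (incl u)
    then obtain a b where ab: "u = G.comm a b" "a \<in> lower_central G (Suc n)" "b \<in> carrier G" by blast
    have a: "a \<in> carrier G" by (rule G.lower_central_closed[OF ab(2)])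
    have "h u = H.comm (h a) (h b)" using ab a by (simp add: G.comm_def H.comm_def)
    then show ?case using H.lower_central_comm[OF ge2(2)[OF ab(2)]] ab a by simp
  next
    case (inv u)
    then obtain a b where ab: "u = G.comm a b" "a \<in> lower_central G (Suc n)" "b \<in> carrier G" by blast
    have a: "a \<in> carrier G" by (rule G.lower_central_closed[OF ab(2)])
    have "h u = H.comm (h a) (h b)" using ab a by (simp add: G.comm_def H.comm_def)
    then have "h u \<in> lower_central H (Suc (Suc n))"
      using H.lower_central_comm[OF ge2(2)[OF ab(2)]] ab a by simp
    then show ?case using subgroup.m_inv_closed[OF H.subgroup_lower_central] ab a by simp
  next
    case (eng u v)
    then show ?case using subgroup.m_closed[OF H.subgroup_lower_central] by simp
  qed
  then show ?case by blast
qed simp_all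

lemma (in comm_group) lower_central_2: "lower_central G (Suc (Suc 0)) = {\<one>}"
proof -
  have "comm x y = \<one>" if "x \<in> carrier G" "y \<in> carrier G" for x y
    using that m_comm[of x y] unfolding comm_def by (simp add: m_assoc inv_cancel_left)
  then have "{comm x y | x y. x \<in> lower_central G (Suc 0) \<and> y \<in> carrier G} \<subseteq> {\<one>}" by auto
  then have "lower_central G (Suc (Suc 0)) \<subseteq> generate G {\<one>}"
    unfolding lower_central_Suc_Suc by (rule mono_generate)
  then show ?thesis using generate_one subgroup.one_closed[OF subgroup_lower_central] by blast
qed

section \<open>Homomorphisms from the free group\<close>

definition letter_image :: "('p, 'q) monoid_scheme \<Rightarrow> ('i \<Rightarrow> 'p) \<Rightarrow> 'i \<times> bool \<Rightarrow> 'p" where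
  "letter_image P q a = (if snd a then q (fst a) else inv\<^bsub>P\<^esub> (q (fst a)))"

definition word_image :: "('p, 'q) monoid_scheme \<Rightarrow> ('i \<Rightarrow> 'p) \<Rightarrow> ('i \<times> bool) list \<Rightarrow> 'p" where
  "word_image P q w = foldr (\<lambda>a x. letter_image P q a \<otimes>\<^bsub>P\<^esub> x) w \<one>\<^bsub>P\<^esub>"

text \<open>The universal property in the model of reduced words: evaluation respects
  \<open>cons_reduce\<close>, because the images of two cancelling letters are inverse to each
  other.\<close>

lemma free_group_hom:
  assumes "group P" "\<And>i. i < r \<Longrightarrow> q i \<in> carrier P"
  shows "word_image P q \<in> hom (free_group r) P" "i < r \<Longrightarrow> word_image P q [(i, True)] = q i"
proof -
  interpret P: group P by fact
  have letter: "letter_image P q a \<in> carrier P" if "fst a < r" for a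
    using that assms(2) by (simp add: letter_image_def)
  have closed: "word_image P q w \<in> carrier P" if "fst ` set w \<subseteq> {..<r}" for w
    using that by (induction w) (auto simp: word_image_def letter)
  have cons: "word_image P q (cons_reduce a w) = letter_image P q a \<otimes>\<^bsub>P\<^esub> word_image P q w"
    if aw: "fst a < r" "fst ` set w \<subseteq> {..<r}" for a w
  proof (cases w)
    case (Cons b v)
    show ?thesis
    proof (cases "cancels a b")
      case True
      then have ab: "fst a = fst b" "snd a \<noteq> snd b" by (auto simp: cancels_def)
      have v: "word_image P q v \<in> carrier P" "q (fst b) \<in> carrier P"
        using closed[of v] aw Cons assms(2) by auto
      have "letter_image P q a \<otimes>\<^bsub>P\<^esub> (letter_image P q b \<otimes>\<^bsub>P\<^esub> word_image P q v) = word_image P q v"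
        using ab v by (cases "snd a") (auto simp: letter_image_def P.inv_cancel_left)
      then show ?thesis using Cons True by (simp add: word_image_def)
    qed (use Cons in \<open>simp add: word_image_def\<close>)
  qed (simp add: word_image_def)
  have "word_image P q (foldr cons_reduce u v) = word_image P q u \<otimes>\<^bsub>P\<^esub> word_image P q v"
    if "fst ` set u \<subseteq> {..<r}" "fst ` set v \<subseteq> {..<r}" for u v
    using that(1)
  proof (induction u)
    case Nil
    then show ?case using closed[OF that(2)] by (simp add: word_image_def)
  next
    case (Cons a u)
    have "fst ` set (foldr cons_reduce u v) \<subseteq> {..<r}"
      using set_foldr_cons_reduce[of u v] Cons.prems that(2) by fastforce
    then have "word_image P q (foldr cons_reduce (a # u) v)
        = letter_image P q a \<otimes>\<^bsub>P\<^esub> (word_image P q u \<otimes>\<^bsub>P\<^esub> word_image P q v)"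
      using cons Cons by simp
    then show ?case
      using letter[of a] closed[of u] closed[OF that(2)] Cons.prems by (simp add: word_image_def P.m_assoc)
  qed
  then show "word_image P q \<in> hom (free_group r) P"
    using closed by (auto simp: hom_def free_group_def)
  show "word_image P q [(i, True)] = q i" if "i < r"
    using assms(2)[OF that] by (simp add: word_image_def letter_image_def)
qed

text \<open>The isomorphism of the class-\<open>c\<close> quotients, pulled back to \<open>G\<close>
  so that no quotient of \<open>G\<close> appears later: \<open>\<theta>\<close> has kernel
  \<open>lower_central G c\<close>, and \<open>x\<close> lifts the free generators.\<close>

locale nilpotent_quotient_iso = group G for G :: "('a, 'b) monoid_scheme" (structure) +
  fixes r c :: nat and \<theta> :: "'a \<Rightarrow> (nat \<times> bool) list set" and x :: "nat \<Rightarrow> 'a"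
  assumes c: "1 \<le> c"
    and \<theta>_hom: "\<theta> \<in> hom G (free_group r Mod lower_central (free_group r) c)"
    and \<theta>_kernel: "g \<in> carrier G \<Longrightarrow> \<theta> g = lower_central (free_group r) c \<Longrightarrow> g \<in> lower_central G c"
    and \<theta>_zero: "g \<in> lower_central G c \<Longrightarrow> \<theta> g = lower_central (free_group r) c"
    and x: "i < r \<Longrightarrow> x i \<in> carrier G" "i < r \<Longrightarrow> \<theta> (x i) = lower_central (free_group r) c #>\<^bsub>free_group r\<^esub> [(i, True)]"
begin

sublocale F: group "free_group r" by (rule group_free_group)

abbreviation "Fc \<equiv> lower_central (free_group r) c"

sublocale Fc: normal Fc "free_group r" by (rule F.normal_lower_central)
sublocale FQ: group "free_group r Mod Fc" by (rule Fc.factorgroup_is_group)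
sublocale \<theta>: group_hom G "free_group r Mod Fc" \<theta> by unfold_locales (rule \<theta>_hom)

lemma coset_rep:
  assumes "g \<in> carrier G"
  obtains f where "f \<in> carrier (free_group r)" "\<theta> g = Fc #>\<^bsub>free_group r\<^esub> f"
  using \<theta>.hom_closed[OF assms] that by (auto simp: FactGroup_def RCOSETS_def)

text \<open>Induction on the reduced word. For \<open>H = carrier G\<close> it says that
  \<open>\<theta>\<close> is surjective; for smaller \<open>H\<close> it shows that the
  \<open>x i\<close> generate \<open>G\<close> modulo the \<open>c\<close>-th term.\<close>

lemma subgroup_meets_cosets:
  assumes H: "subgroup H G" and xH: "\<And>i. i < r \<Longrightarrow> x i \<in> H" and "w \<in> carrier (free_group r)"
  shows "\<exists>h\<in>H. \<theta> h = Fc #>\<^bsub>free_group r\<^esub> w"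
  using assms(3)
proof (induction w)
  case Nil
  have "\<theta> \<one> = Fc" using \<theta>.hom_one by (simp add: FactGroup_def)
  moreover have "Fc #>\<^bsub>free_group r\<^esub> [] = Fc"
    using F.coset_mult_one[OF Fc.subset] by (simp add: free_group_def)
  ultimately show ?case using subgroup.one_closed[OF H] by metis
next
  case (Cons a w)
  then have w: "w \<in> carrier (free_group r)" and a: "fst a < r" and red: "reduced (a # w)"
    by (auto simp: free_group_def reduced_Cons_iff)
  obtain h where h: "h \<in> H" "\<theta> h = Fc #>\<^bsub>free_group r\<^esub> w" using Cons.IH[OF w] by blast
  have aF: "[a] \<in> carrier (free_group r)" "[(fst a, True)] \<in> carrier (free_group r)"
    using a by (auto simp: free_group_def)
  have "\<exists>k\<in>H. \<theta> k = Fc #>\<^bsub>free_group r\<^esub> [a]"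
  proof (cases "snd a")
    case True
    then have "a = (fst a, True)" by (simp add: prod_eq_iff)
    then show ?thesis using x(2)[OF a] xH[OF a] by metis
  next
    case False
    then have "[a] \<otimes>\<^bsub>free_group r\<^esub> [(fst a, True)] = \<one>\<^bsub>free_group r\<^esub>"
      by (cases a) (auto simp: free_group_def cancels_def)
    then have "inv\<^bsub>free_group r\<^esub> [(fst a, True)] = [a]"
      by (rule F.inv_equality[OF _ aF(2,1)])
    then have "inv\<^bsub>free_group r Mod Fc\<^esub> (Fc #>\<^bsub>free_group r\<^esub> [(fst a, True)]) = Fc #>\<^bsub>free_group r\<^esub> [a]"
      using Fc.inv_FactGroup[of "Fc #>\<^bsub>free_group r\<^esub> [(fst a, True)]"] Fc.rcos_inv[OF aF(2)] aF(2)
      by (simp add: FactGroup_def RCOSETS_def) blast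
    then have "\<theta> (inv (x (fst a))) = Fc #>\<^bsub>free_group r\<^esub> [a]"
      using x[OF a] by (simp add: \<theta>.hom_inv)
    then show ?thesis using subgroup.m_inv_closed[OF H xH[OF a]] by blast
  qed
  then obtain k where k: "k \<in> H" "\<theta> k = Fc #>\<^bsub>free_group r\<^esub> [a]" by blast
  have "\<theta> (k \<otimes> h) = \<theta> k \<otimes>\<^bsub>free_group r Mod Fc\<^esub> \<theta> h"
    using k(1) h(1) subgroup.mem_carrier[OF H] by (intro \<theta>.hom_mult) auto
  also have "\<dots> = Fc #>\<^bsub>free_group r\<^esub> ([a] \<otimes>\<^bsub>free_group r\<^esub> w)"
    unfolding k(2) h(2) using Fc.rcos_sum[OF aF(1) w] by (simp add: FactGroup_def)
  also have "[a] \<otimes>\<^bsub>free_group r\<^esub> w = a # w"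
    using red by (cases w) (auto simp: free_group_def)
  finally show ?case using subgroup.m_closed[OF H k(1) h(1)] by blast
qed

lemma subgroup_eq_carrier:
  assumes H: "subgroup H G" and xH: "\<And>i. i < r \<Longrightarrow> x i \<in> H" and cH: "lower_central G c \<subseteq> H"
  shows "H = carrier G"
proof
  show "H \<subseteq> carrier G" using H by (rule subgroup.subset)
  show "carrier G \<subseteq> H"
  proof
    fix g assume g: "g \<in> carrier G"
    obtain f where "f \<in> carrier (free_group r)" "\<theta> g = Fc #>\<^bsub>free_group r\<^esub> f"
      using coset_rep[OF g] .
    then obtain h where h: "h \<in> H" "\<theta> h = \<theta> g"
      using subgroup_meets_cosets[OF H xH] by metis
    have hG: "h \<in> carrier G" by (rule subgroup.mem_carrier[OF H h(1)])
    have "\<theta> (g \<otimes> inv h) = \<theta> g \<otimes>\<^bsub>free_group r Mod Fc\<^esub> inv\<^bsub>free_group r Mod Fc\<^esub> \<theta> g"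
      using g hG h(2) by simp
    also have "\<dots> = \<one>\<^bsub>free_group r Mod Fc\<^esub>"
      by (rule FQ.r_inv[OF \<theta>.hom_closed[OF g]])
    also have "\<dots> = Fc" by (simp add: FactGroup_def)
    finally have "g \<otimes> inv h \<in> H" using \<theta>_kernel[of "g \<otimes> inv h"] g hG cH by auto
    then have "g \<otimes> inv h \<otimes> h \<in> H" using subgroup.m_closed[OF H _ h(1)] by blast
    then show "g \<in> H" using g hG by (simp add: m_assoc)
  qed
qed

text \<open>The homomorphism induced on the quotient of the free group, composed with
  \<open>\<theta>\<close>. Its value may be computed from any representative of the coset, since
  \<open>h\<close> kills \<open>Fc\<close>.\<close>

lemma hom_descend:
  assumes P: "group P" and h: "h \<in> hom (free_group r) P" and kill: "\<And>f. f \<in> Fc \<Longrightarrow> h f = \<one>\<^bsub>P\<^esub>"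
  obtains k where "k \<in> hom G P"
    "\<And>g f. g \<in> carrier G \<Longrightarrow> f \<in> carrier (free_group r) \<Longrightarrow> \<theta> g = Fc #>\<^bsub>free_group r\<^esub> f \<Longrightarrow> k g = h f"
proof -
  interpret h: group_hom "free_group r" P h
    using h P by (simp add: group_hom_def group_hom_axioms_def F.is_group)
  define k where "k g = h (SOME f. f \<in> \<theta> g)" for g
  have k: "k g = h f" if g: "g \<in> carrier G" and f: "f \<in> carrier (free_group r)"
    and gf: "\<theta> g = Fc #>\<^bsub>free_group r\<^esub> f" for g f
  proof -
    have "f \<in> Fc #>\<^bsub>free_group r\<^esub> f" by (rule F.rcos_self[OF f Fc.subgroup_axioms])
    then have "(SOME f. f \<in> \<theta> g) \<in> \<theta> g" unfolding gf by (rule someI)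
    then obtain n where n: "n \<in> Fc" "(SOME f. f \<in> \<theta> g) = n \<otimes>\<^bsub>free_group r\<^esub> f"
      unfolding gf r_coset_def by blast
    have "n \<in> carrier (free_group r)" using n(1) by (rule Fc.mem_carrier)
    then show ?thesis unfolding k_def n(2) using f kill[OF n(1)] by simp
  qed
  have "k \<in> hom G P"
  proof (rule homI)
    fix g assume g: "g \<in> carrier G"
    obtain f where f: "f \<in> carrier (free_group r)" "\<theta> g = Fc #>\<^bsub>free_group r\<^esub> f" using coset_rep[OF g] .
    show "k g \<in> carrier P" unfolding k[OF g f] using f(1) by simp
    fix g' assume g': "g' \<in> carrier G"
    obtain f' where f': "f' \<in> carrier (free_group r)" "\<theta> g' = Fc #>\<^bsub>free_group r\<^esub> f'" using coset_rep[OF g'] .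
    have "\<theta> (g \<otimes> g') = Fc #>\<^bsub>free_group r\<^esub> (f \<otimes>\<^bsub>free_group r\<^esub> f')"
      unfolding \<theta>.hom_mult[OF g g'] f(2) f'(2) using Fc.rcos_sum[OF f(1) f'(1)] by (simp add: FactGroup_def)
    then have "k (g \<otimes> g') = h (f \<otimes>\<^bsub>free_group r\<^esub> f')"
      by (intro k m_closed g g' F.m_closed f(1) f'(1))
    then show "k (g \<otimes> g') = k g \<otimes>\<^bsub>P\<^esub> k g'"
      using f(1) f'(1) by (simp add: k[OF g f] k[OF g' f'])
  qed
  then show thesis using k that by blast
qed

text \<open>For targets whose \<open>c\<close>-th lower central term is trivial, \<open>G\<close> is
  as good as free on the \<open>x i\<close>: evaluation of words in \<open>P\<close> kills
  \<open>Fc\<close> and therefore descends to \<open>G\<close>. The companion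
  \<open>hom_unique\<close> holds because the set where two homomorphisms agree is a
  subgroup.\<close>

lemma hom_extend:
  assumes P: "group P" "lower_central P c = {\<one>\<^bsub>P\<^esub>}" and q: "\<And>i. i < r \<Longrightarrow> q i \<in> carrier P"
  obtains h where "h \<in> hom G P" "\<And>i. i < r \<Longrightarrow> h (x i) = q i"
proof -
  interpret h: group_hom "free_group r" P "word_image P q"
    using free_group_hom(1)[OF P(1) q] P by (simp add: group_hom_def group_hom_axioms_def F.is_group)
  have kill: "word_image P q f = \<one>\<^bsub>P\<^esub>" if "f \<in> Fc" for f
    using h.hom_lower_central[OF that] P(2) by blast
  show thesis
  proof (rule hom_descend[OF P(1) free_group_hom(1)[OF P(1) q] kill])
    fix k assume k: "k \<in> hom G P" "\<And>g f. g \<in> carrier G \<Longrightarrow> f \<in> carrier (free_group r) \<Longrightarrow>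
      \<theta> g = Fc #>\<^bsub>free_group r\<^esub> f \<Longrightarrow> k g = word_image P q f"
    have "k (x i) = q i" if "i < r" for i
      using k(2)[OF x(1)[OF that] _ x(2)[OF that]] free_group_hom(2)[OF P(1) q that] that
      by (simp add: free_group_def)
    then show thesis using that k(1) by blast
  qed
qed

lemma hom_unique:
  assumes P: "group P" "lower_central P c = {\<one>\<^bsub>P\<^esub>}" and "h \<in> hom G P" "h' \<in> hom G P"
    and eq: "\<And>i. i < r \<Longrightarrow> h (x i) = h' (x i)" and g: "g \<in> carrier G"
  shows "h g = h' g"
proof -
  interpret P: group P by fact
  interpret h: group_hom G P h using assms by (simp add: group_hom_def group_hom_axioms_def is_group)
  interpret h': group_hom G P h' using assms by (simp add: group_hom_def group_hom_axioms_def is_group)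
  have "subgroup {g \<in> carrier G. h g = h' g} G"
    by unfold_locales auto
  then have "{g \<in> carrier G. h g = h' g} = carrier G"
  proof (rule subgroup_eq_carrier)
    show "x i \<in> {g \<in> carrier G. h g = h' g}" if "i < r" for i using that eq x(1) by simp
    show "lower_central G c \<subseteq> {g \<in> carrier G. h g = h' g}"
      using h.hom_lower_central h'.hom_lower_central P(2) lower_central_closed by fastforce
  qed
  then show ?thesis using g by blast
qed

end

lemma (in group) parafree_iso:
  assumes "parafree G r" "1 \<le> c"
  obtains \<theta> x where "nilpotent_quotient_iso G r c \<theta> x"
proof -
  interpret F: group "free_group r" by (rule group_free_group)
  let ?Fc = "lower_central (free_group r) c" and ?Gc = "lower_central G c"
  interpret Fc: normal ?Fc "free_group r" by (rule F.normal_lower_central)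
  interpret Gc: normal ?Gc G by (rule normal_lower_central)
  interpret GQ: group "G Mod ?Gc" by (rule Gc.factorgroup_is_group)
  interpret FQ: group "free_group r Mod ?Fc" by (rule Fc.factorgroup_is_group)
  have "G Mod ?Gc \<cong> free_group r Mod ?Fc"
    using assms unfolding parafree_def same_nilpotent_genus_def by blast
  then obtain \<phi> where \<phi>: "\<phi> \<in> iso (G Mod ?Gc) (free_group r Mod ?Fc)"
    unfolding is_iso_def by blast
  then have \<phi>h: "\<phi> \<in> hom (G Mod ?Gc) (free_group r Mod ?Fc)"
    and \<phi>b: "bij_betw \<phi> (carrier (G Mod ?Gc)) (carrier (free_group r Mod ?Fc))"
    by (auto simp: iso_def)
  interpret \<phi>: group_hom "G Mod ?Gc" "free_group r Mod ?Fc" \<phi> by unfold_locales (rule \<phi>h)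
  define \<theta> where "\<theta> g = \<phi> (?Gc #> g)" for g
  have \<theta>h: "\<theta> \<in> hom G (free_group r Mod ?Fc)"
    using Group.hom_compose[OF Gc.r_coset_hom_Mod \<phi>h] by (simp add: \<theta>_def[abs_def] comp_def)
  have "\<exists>g\<in>carrier G. \<theta> g = ?Fc #>\<^bsub>free_group r\<^esub> [(i, True)]" if "i < r" for i
  proof -
    have "[(i, True)] \<in> carrier (free_group r)" using that by (simp add: free_group_def)
    then have "?Fc #>\<^bsub>free_group r\<^esub> [(i, True)] \<in> carrier (free_group r Mod ?Fc)"
      by (auto simp: FactGroup_def RCOSETS_def)
    then have "?Fc #>\<^bsub>free_group r\<^esub> [(i, True)] \<in> \<phi> ` carrier (G Mod ?Gc)"
      using \<phi>b by (simp add: bij_betw_def)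
    then obtain X where "X \<in> carrier (G Mod ?Gc)" "\<phi> X = ?Fc #>\<^bsub>free_group r\<^esub> [(i, True)]" by auto
    then show ?thesis by (auto simp: \<theta>_def FactGroup_def RCOSETS_def)
  qed
  then obtain x where x: "\<And>i. i < r \<Longrightarrow> x i \<in> carrier G"
    "\<And>i. i < r \<Longrightarrow> \<theta> (x i) = ?Fc #>\<^bsub>free_group r\<^esub> [(i, True)]" by metis
  have one: "\<phi> ?Gc = ?Fc" using \<phi>.hom_one by (simp add: FactGroup_def)
  have zero: "\<theta> g = ?Fc" if "g \<in> ?Gc" for g
    using Gc.rcos_const[OF is_group that] one by (simp add: \<theta>_def)
  have ker: "g \<in> ?Gc" if g: "g \<in> carrier G" "\<theta> g = ?Fc" for g
  proof -
    have "?Gc #> g \<in> carrier (G Mod ?Gc)" "?Gc \<in> carrier (G Mod ?Gc)"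
      using g GQ.one_closed by (auto simp: FactGroup_def RCOSETS_def)
    then have "?Gc #> g = ?Gc"
      using g(2) one \<phi>b unfolding \<theta>_def bij_betw_def by (metis inj_onD)
    then show ?thesis using rcos_self[OF g(1) Gc.subgroup_axioms] by simp
  qed
  show thesis
    by (rule that, unfold_locales) (fact assms(2) \<theta>h x zero ker)+
qed

text \<open>The elements of \<open>E\<close> are represented by free group elements outside
  \<open>Fc\<close>, separated there by a subgroup \<open>magnus_subgroup r p c\<close>. The
  resulting projection kills \<open>Fc\<close> and is transported to \<open>G\<close>.\<close>

lemma (in nilpotent_quotient_iso) p_quotient:
  assumes "finite E" "E \<subseteq> carrier G" "E \<inter> lower_central G c = {}"
  obtains p s and Q :: "(nat \<times> bool) list set monoid" and \<pi>
  where "prime (p::nat)" "group Q" "finite (carrier Q)" "card (carrier Q) = p ^ s" "\<pi> \<in> hom G Q"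
    "\<pi> ` carrier G = carrier Q" "\<And>e. e \<in> E \<Longrightarrow> \<pi> e \<noteq> \<one>\<^bsub>Q\<^esub>"
proof -
  have "\<exists>f\<in>carrier (free_group r). \<theta> e = Fc #>\<^bsub>free_group r\<^esub> f" if "e \<in> E" for e
    using coset_rep[of e] assms(2) that by blast
  then obtain l where l: "\<And>e. e \<in> E \<Longrightarrow> l e \<in> carrier (free_group r)"
    "\<And>e. e \<in> E \<Longrightarrow> \<theta> e = Fc #>\<^bsub>free_group r\<^esub> l e" by metis
  have notF: "l e \<notin> Fc" if "e \<in> E" for e
  proof
    assume "l e \<in> Fc"
    then have "\<theta> e = Fc" using l(2)[OF that] Fc.rcos_const[OF F.is_group] by simp
    then have "e \<in> lower_central G c" using that assms(2) by (intro \<theta>_kernel) auto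
    then show False using that assms(3) by blast
  qed
  obtain p where p: "prime p" "magnus_subgroup r p c \<inter> l ` E = {}"
    using free_nilpotent_residually_p[of "l ` E" r c] assms(1) l(1) notF by blast
  let ?N = "magnus_subgroup r p c"
  define Q where "Q = free_group r Mod ?N"
  interpret N: normal ?N "free_group r" by (rule magnus_subgroup_normal)
  have Q: "group Q" unfolding Q_def by (rule N.factorgroup_is_group)
  obtain s where s: "card (carrier Q) = p ^ s" using card_magnus_quotient[OF p(1)] unfolding Q_def by blast
  have "?N #>\<^bsub>free_group r\<^esub> f = \<one>\<^bsub>Q\<^esub>" if "f \<in> Fc" for f
    using N.rcos_const[OF F.is_group] lower_central_magnus_subgroup[OF c, of r p] that
    by (auto simp: Q_def FactGroup_def)
  then obtain \<pi> where \<pi>: "\<pi> \<in> hom G Q" "\<And>g f. g \<in> carrier G \<Longrightarrow> f \<in> carrier (free_group r) \<Longrightarrow>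
      \<theta> g = Fc #>\<^bsub>free_group r\<^esub> f \<Longrightarrow> \<pi> g = ?N #>\<^bsub>free_group r\<^esub> f"
    using hom_descend[OF Q, of "\<lambda>f. ?N #>\<^bsub>free_group r\<^esub> f"] N.r_coset_hom_Mod unfolding Q_def by blast
  have surj: "\<pi> ` carrier G = carrier Q"
  proof
    show "\<pi> ` carrier G \<subseteq> carrier Q" using \<pi>(1) by (auto simp: hom_def)
    show "carrier Q \<subseteq> \<pi> ` carrier G"
    proof
      fix X assume "X \<in> carrier Q"
      then obtain f where f: "f \<in> carrier (free_group r)" "X = ?N #>\<^bsub>free_group r\<^esub> f"
        by (auto simp: Q_def FactGroup_def RCOSETS_def)
      obtain g where "g \<in> carrier G" "\<theta> g = Fc #>\<^bsub>free_group r\<^esub> f"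
        using subgroup_meets_cosets[OF subgroup_self x(1) f(1)] by blast
      then show "X \<in> \<pi> ` carrier G" using \<pi>(2) f by blast
    qed
  qed
  have "\<pi> e \<noteq> \<one>\<^bsub>Q\<^esub>" if "e \<in> E" for e
  proof
    assume "\<pi> e = \<one>\<^bsub>Q\<^esub>"
    moreover have "\<pi> e = ?N #>\<^bsub>free_group r\<^esub> l e" using \<pi>(2) l assms(2) that by blast
    ultimately have "?N #>\<^bsub>free_group r\<^esub> l e = ?N" by (simp add: Q_def FactGroup_def)
    then have "l e \<in> ?N" using F.rcos_self[OF l(1)[OF that] N.subgroup_axioms] by simp
    then show False using p(2) that by blast
  qed
  moreover have "finite (carrier Q)" using finite_magnus_quotient prime_gt_0_nat[OF p(1)] by (simp add: Q_def)
  ultimately show thesis using that p(1) Q s \<pi>(1) surj by metis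
qed

lemma (in group) parafree_residually_p:
  assumes "parafree G r" "finite E" "E \<subseteq> carrier G - {\<one>}"
  obtains p s and Q :: "(nat \<times> bool) list set monoid" and \<pi>
  where "prime (p::nat)" "group Q" "finite (carrier Q)" "card (carrier Q) = p ^ s" "\<pi> \<in> hom G Q"
    "\<pi> ` carrier G = carrier Q" "\<And>e. e \<in> E \<Longrightarrow> \<pi> e \<noteq> \<one>\<^bsub>Q\<^esub>"
proof -
  have "(\<Inter>n\<in>{1..}. lower_central G n) = {\<one>}"
    using assms(1) by (simp add: parafree_def residually_nilpotent_def)
  then have "\<forall>e\<in>E. \<exists>n. 1 \<le> n \<and> e \<notin> lower_central G n"
    using assms(3) by blast
  then obtain n where n: "\<And>e. e \<in> E \<Longrightarrow> e \<notin> lower_central G (n e)" by metis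
  \<comment> \<open>One level below which all of \<open>E\<close> disappears. The successor ensures
    \<open>1 \<le> c\<close>, also when \<open>E\<close> is empty.\<close>
  define c where "c = Suc (Max (n ` E))"
  have "e \<notin> lower_central G c" if "e \<in> E" for e
  proof -
    have "n e \<le> c" unfolding c_def using assms(2) that by (intro le_SucI Max_ge) auto
    then show ?thesis using n[OF that] lower_central_antimono by blast
  qed
  then have disj: "E \<inter> lower_central G c = {}" by blast
  have "1 \<le> c" by (simp add: c_def)
  then obtain \<theta> x where "nilpotent_quotient_iso G r c \<theta> x" using parafree_iso[OF assms(1)] by blast
  then interpret nilpotent_quotient_iso G r c \<theta> x .
  show thesis
  proof (rule p_quotient[OF assms(2) _ disj])
    show "E \<subseteq> carrier G" using assms(3) by blast
  qed (rule that)
qed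

text \<open>With no generators the abelianisation is trivial, so \<open>G\<close> is perfect and its
  lower central series is constant; residual nilpotence forces it to be trivial.\<close>

lemma (in group) parafree_0_trivial:
  assumes "parafree G 0"
  shows "carrier G = {\<one>}"
proof -
  obtain \<theta> x where "nilpotent_quotient_iso G 0 (Suc (Suc 0)) \<theta> x" using parafree_iso[OF assms, of "Suc (Suc 0)"] by auto
  then interpret nilpotent_quotient_iso G 0 "Suc (Suc 0)" \<theta> x .
  have 2: "lower_central G (Suc (Suc 0)) = carrier G"
    by (rule subgroup_eq_carrier[OF subgroup_lower_central]) auto
  have "lower_central G (Suc n) = carrier G" for n
  proof (induction n)
    case (Suc n)
    have "lower_central G (Suc (Suc n)) = generate G {comm x y | x y. x \<in> carrier G \<and> y \<in> carrier G}"
      unfolding lower_central_Suc_Suc Suc ..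
    also have "\<dots> = lower_central G (Suc (Suc 0))" unfolding lower_central_Suc_Suc by simp
    finally show ?case using 2 by simp
  qed simp
  then have "lower_central G n = carrier G" for n
    by (cases n) auto
  then have "(\<Inter>n\<in>{1..}. lower_central G n) = carrier G" by simp
  then show ?thesis using assms by (simp add: parafree_def residually_nilpotent_def)
qed

text \<open>The case \<open>c = 2\<close>: the abelianisation is free abelian on the images of the
  \<open>x i\<close>, and the \<open>\<phi> i\<close> are the coordinate functions. The second
  property says that the \<open>x i\<close> and all commutators generate \<open>G\<close>.\<close>

lemma (in group) parafree_int_homs:
  assumes "parafree G r"
  obtains x \<phi> where "\<And>i. i < r \<Longrightarrow> x i \<in> carrier G"
    "\<And>H. subgroup H G \<Longrightarrow> (\<And>i. i < r \<Longrightarrow> x i \<in> H) \<Longrightarrow>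
      (\<And>a b. a \<in> carrier G \<Longrightarrow> b \<in> carrier G \<Longrightarrow> comm a b \<in> H) \<Longrightarrow> H = carrier G"
    "\<And>i. i < r \<Longrightarrow> \<phi> i \<in> hom G integer_group"
    "\<And>i j. i < r \<Longrightarrow> j < r \<Longrightarrow> \<phi> i (x j) = (if i = j then 1 else 0)"
proof -
  obtain \<theta> x where "nilpotent_quotient_iso G r (Suc (Suc 0)) \<theta> x" using parafree_iso[OF assms, of "Suc (Suc 0)"] by auto
  then interpret nilpotent_quotient_iso G r "Suc (Suc 0)" \<theta> x .
  interpret Z: comm_group integer_group by (rule abelian_integer_group)
  have "\<exists>\<phi>. \<phi> \<in> hom G integer_group \<and> (\<forall>j<r. \<phi> (x j) = (if i = j then 1 else 0))" for i
  proof (rule hom_extend[OF Z.is_group Z.lower_central_2, of "\<lambda>j. if i = j then 1 else 0"])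
    show "\<exists>\<phi>. \<phi> \<in> hom G integer_group \<and> (\<forall>j<r. \<phi> (x j) = (if i = j then 1 else 0))"
      if "h \<in> hom G integer_group" "\<And>j. j < r \<Longrightarrow> h (x j) = (if i = j then 1 else 0)" for h
      using that by blast
  qed simp
  then obtain \<phi> where \<phi>: "\<And>i. \<phi> i \<in> hom G integer_group"
    "\<And>i j. j < r \<Longrightarrow> \<phi> i (x j) = (if i = j then 1 else 0)" by metis
  have "H = carrier G" if H: "subgroup H G" "\<And>i. i < r \<Longrightarrow> x i \<in> H"
    and com: "\<And>a b. a \<in> carrier G \<Longrightarrow> b \<in> carrier G \<Longrightarrow> comm a b \<in> H" for H
  proof (rule subgroup_eq_carrier[OF H])
    show "lower_central G (Suc (Suc 0)) \<subseteq> H"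
      unfolding lower_central_Suc_Suc by (rule generate_subgroup_incl[OF _ H(1)]) (use com in auto)
  qed
  note gen = this
  show thesis
  proof (rule that[of x \<phi>])
    show "x i \<in> carrier G" if "i < r" for i using that by (rule x(1))
    show "H = carrier G" if "subgroup H G" "\<And>i. i < r \<Longrightarrow> x i \<in> H"
      "\<And>a b. a \<in> carrier G \<Longrightarrow> b \<in> carrier G \<Longrightarrow> comm a b \<in> H" for H
      using that by (rule gen)
  qed (simp_all add: \<phi>)
qed

text \<open>The coordinate \<open>\<phi> 0\<close> takes every natural number as a value, on the
  powers of \<open>x 0\<close>.\<close>

lemma (in group) parafree_infinite:
  assumes "parafree G r" "1 \<le> r"
  shows "infinite (carrier G)"
proof
  assume fin: "finite (carrier G)"
  obtain x \<phi> where x: "\<And>i. i < r \<Longrightarrow> x i \<in> carrier G" and \<phi>: "\<And>i. i < r \<Longrightarrow> \<phi> i \<in> hom G integer_group"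
    and \<phi>x: "\<And>i j. i < r \<Longrightarrow> j < r \<Longrightarrow> \<phi> i (x j) = (if i = j then 1 else (0::int))"
    using parafree_int_homs[OF assms(1)] by metis
  have r: "0 < r" using assms by simp
  interpret \<phi>: group_hom G integer_group "\<phi> 0"
    using \<phi>[OF r] by (simp add: group_hom_def group_hom_axioms_def is_group group_integer_group)
  have "\<phi> 0 (x 0 [^] (n::nat)) = int n" for n
    using \<phi>x[OF r r] x[OF r] by (induction n) auto
  then have "range int \<subseteq> \<phi> 0 ` carrier G"
    using x[OF r] by (metis image_subsetI nat_pow_closed rev_image_eqI)
  then have "finite (range int)" using fin finite_subset by blast
  then show False using finite_imageD[of int UNIV] by (simp add: inj_on_def)
qed

section \<open>Finite p-groups\<close>

text \<open>Orbit counting, organised as an induction that removes one nontrivial orbit at a time.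
  Its size divides \<open>p ^ s\<close> by the fibre count over the orbit and is not 1, hence it is
  divisible by \<open>p\<close>.\<close>

lemma p_group_fixed_points:
  assumes Q: "group Q" "finite (carrier Q)" "card (carrier Q) = p ^ s" "prime (p::nat)"
    and X: "finite X" "\<And>g x. g \<in> carrier Q \<Longrightarrow> x \<in> X \<Longrightarrow> act g x \<in> X"
    and one: "\<And>x. x \<in> X \<Longrightarrow> act \<one>\<^bsub>Q\<^esub> x = x"
    and mult: "\<And>g h x. g \<in> carrier Q \<Longrightarrow> h \<in> carrier Q \<Longrightarrow> x \<in> X \<Longrightarrow> act (g \<otimes>\<^bsub>Q\<^esub> h) x = act g (act h x)"
  shows "[card X = card {x \<in> X. \<forall>g\<in>carrier Q. act g x = x}] (mod p)"
  using X one mult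
proof (induction "card X" arbitrary: X rule: less_induct)
  case less
  interpret Q: group Q by fact
  let ?fix = "\<lambda>X. {x \<in> X. \<forall>g\<in>carrier Q. act g x = x}"
  show ?case
  proof (cases "?fix X = X")
    case False
    then obtain x where x: "x \<in> X" "x \<notin> ?fix X" by blast
    define Orb where "Orb = (\<lambda>g. act g x) ` carrier Q"
    define H where "H = {g \<in> carrier Q. act g x = x}"
    have OX: "Orb \<subseteq> X" using less.prems(2) x(1) by (auto simp: Orb_def)
    have inv: "act (inv\<^bsub>Q\<^esub> g) (act g y) = y" if "g \<in> carrier Q" "y \<in> X" for g y
      using less.prems(4)[of "inv\<^bsub>Q\<^esub> g" g y] less.prems(3)[OF that(2)] that by simp
    have fib: "card {g \<in> carrier Q. act g x = y} = card H" if "y \<in> Orb" for y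
    proof -
      obtain g where g: "g \<in> carrier Q" "y = act g x" using \<open>y \<in> Orb\<close> by (auto simp: Orb_def)
      have "bij_betw (\<lambda>h. g \<otimes>\<^bsub>Q\<^esub> h) H {k \<in> carrier Q. act k x = y}"
      proof (rule bij_betwI[of _ _ _ "\<lambda>k. inv\<^bsub>Q\<^esub> g \<otimes>\<^bsub>Q\<^esub> k"])
        show "(\<lambda>h. g \<otimes>\<^bsub>Q\<^esub> h) \<in> H \<rightarrow> {k \<in> carrier Q. act k x = y}"
          using g x(1) less.prems(4) by (auto simp: H_def)
        show "(\<lambda>k. inv\<^bsub>Q\<^esub> g \<otimes>\<^bsub>Q\<^esub> k) \<in> {k \<in> carrier Q. act k x = y} \<rightarrow> H"
          using g x(1) less.prems(4) inv by (auto simp: H_def)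
      qed (use g in \<open>auto simp: H_def Q.inv_cancel_left\<close>)
      then show ?thesis by (metis bij_betw_same_card)
    qed
    have finO: "finite Orb" using Q(2) by (simp add: Orb_def)
    have "card (carrier Q) = (\<Sum>y\<in>Orb. card {g \<in> carrier Q. act g x = y})"
      using sum.group[of "carrier Q" Orb "\<lambda>g. act g x" "\<lambda>_. 1::nat"] Q(2) finO by (simp add: Orb_def)
    also have "\<dots> = card Orb * card H" using fib by simp
    finally have "card Orb dvd p ^ s" using Q(3) by simp
    then obtain i where i: "card Orb = p ^ i" using Q(4) divides_primepow_nat by blast
    have "card Orb \<noteq> 1"
    proof
      assume "card Orb = 1"
      then obtain z where z: "Orb = {z}" by (rule card_1_singletonE)
      have "x \<in> Orb" unfolding Orb_def using less.prems(3)[OF x(1)] Q.one_closed by (metis image_eqI)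
      then have "Orb = {x}" using z by simp
      then show False using x by (auto simp: Orb_def)
    qed
    then have pO: "p dvd card Orb" using i by (cases i) auto
    have nonempty: "0 < card Orb" using finO Q.one_closed by (auto simp: Orb_def card_gt_0_iff)
    have actO: "act g y \<in> X - Orb" if "g \<in> carrier Q" "y \<in> X - Orb" for g y
    proof -
      have "y \<in> Orb" if yO: "act g y \<in> Orb"
      proof -
        obtain h where h: "h \<in> carrier Q" "act g y = act h x" using yO by (auto simp: Orb_def)
        have "y = act (inv\<^bsub>Q\<^esub> g) (act h x)" using inv[of g y] \<open>g \<in> carrier Q\<close> \<open>y \<in> X - Orb\<close> h(2) by simp
        also have "\<dots> = act (inv\<^bsub>Q\<^esub> g \<otimes>\<^bsub>Q\<^esub> h) x" using less.prems(4) \<open>g \<in> carrier Q\<close> h x(1) by simp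
        finally show ?thesis using \<open>g \<in> carrier Q\<close> h unfolding Orb_def by blast
      qed
      then show ?thesis using that less.prems(2) by blast
    qed
    have fixO: "?fix (X - Orb) = ?fix X"
    proof -
      have "y \<notin> Orb" if y: "y \<in> X" "\<forall>g\<in>carrier Q. act g y = y" for y
      proof
        assume "y \<in> Orb"
        then obtain h where h: "h \<in> carrier Q" "y = act h x" by (auto simp: Orb_def)
        then have "x = act (inv\<^bsub>Q\<^esub> h) y" using inv x(1) by simp
        then have "x = y" using y h by simp
        then show False using x y by blast
      qed
      then show ?thesis by blast
    qed
    have "card (X - Orb) < card X"
      using nonempty card_Diff_subset[OF finO OX] card_mono[OF less.prems(1) OX] by linarith
    then have IH: "[card (X - Orb) = card (?fix (X - Orb))] (mod p)"
      using less.prems by (intro less.hyps actO) auto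
    have split: "card X = card (X - Orb) + card Orb"
      using card_Diff_subset[OF finO OX] card_mono[OF less.prems(1) OX] by linarith
    have "[card Orb = 0] (mod p)" using pO by (simp add: cong_0_iff)
    from cong_add[OF IH this] show ?thesis unfolding split fixO by simp
  qed simp
qed

text \<open>Used twice: for conjugation, where it yields a central element, and for translation of
  solutions of the Fox equations, where it yields a nonzero constant solution.\<close>

lemma p_group_second_fixed_point:
  assumes Q: "group Q" "finite (carrier Q)" "card (carrier Q) = p ^ s" "prime (p::nat)"
    and X: "finite X" "p dvd card X" "\<And>g x. g \<in> carrier Q \<Longrightarrow> x \<in> X \<Longrightarrow> act g x \<in> X"
    and one: "\<And>x. x \<in> X \<Longrightarrow> act \<one>\<^bsub>Q\<^esub> x = x"
    and mult: "\<And>g h x. g \<in> carrier Q \<Longrightarrow> h \<in> carrier Q \<Longrightarrow> x \<in> X \<Longrightarrow> act (g \<otimes>\<^bsub>Q\<^esub> h) x = act g (act h x)"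
    and x0: "x0 \<in> X" "\<And>g. g \<in> carrier Q \<Longrightarrow> act g x0 = x0"
  obtains x where "x \<in> X" "x \<noteq> x0" "\<And>g. g \<in> carrier Q \<Longrightarrow> act g x = x"
proof -
  let ?F = "{x \<in> X. \<forall>g\<in>carrier Q. act g x = x}"
  have "[card X = card ?F] (mod p)"
    by (rule p_group_fixed_points[OF Q X(1,3) one mult])
  then have "p dvd card ?F" using X(2) by (simp add: cong_dvd_iff)
  have "\<not> ?F \<subseteq> {x0}"
  proof
    assume "?F \<subseteq> {x0}"
    then have "?F = {x0}" using x0 by blast
    then have "card ?F = 1" by simp
    then show False using \<open>p dvd card ?F\<close> Q(4) not_prime_unit by fastforce
  qed
  then show thesis using that by blast
qed

context group
begin

lemma p_group_center:
  assumes "finite (carrier G)" "card (carrier G) = p ^ s" "prime (p::nat)" "carrier G \<noteq> {\<one>}"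
  obtains z where "z \<in> carrier G" "z \<noteq> \<one>" "\<And>g. g \<in> carrier G \<Longrightarrow> z \<otimes> g = g \<otimes> z"
proof -
  have "s \<noteq> 0"
  proof
    assume "s = 0"
    then obtain y where "carrier G = {y}" using assms(2) by (auto simp: card_1_singleton_iff)
    then show False using assms(4) one_closed by auto
  qed
  then have dvd: "p dvd card (carrier G)" using assms(2) by simp
  obtain z where z: "z \<in> carrier G" "z \<noteq> \<one>" "\<And>g. g \<in> carrier G \<Longrightarrow> g \<otimes> z \<otimes> inv g = z"
  proof (rule p_group_second_fixed_point[OF is_group assms(1-3) assms(1) dvd, of "\<lambda>g x. g \<otimes> x \<otimes> inv g" \<one>])
    show "g \<otimes> h \<otimes> y \<otimes> inv (g \<otimes> h) = g \<otimes> (h \<otimes> y \<otimes> inv h) \<otimes> inv g"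
      if "g \<in> carrier G" "h \<in> carrier G" "y \<in> carrier G" for g h y
      using that by (simp add: m_assoc inv_mult_group)
  qed auto
  have "z \<otimes> g = g \<otimes> z" if "g \<in> carrier G" for g
  proof -
    have "z \<otimes> g = g \<otimes> z \<otimes> inv g \<otimes> g" using z(3)[OF that] by simp
    also have "\<dots> = g \<otimes> z" using that z(1) by (simp add: m_assoc)
    finally show ?thesis .
  qed
  then show thesis using that z by blast
qed

fun upper_central :: "nat \<Rightarrow> 'a set" where
  "upper_central 0 = {\<one>}"
| "upper_central (Suc n) = {x \<in> carrier G. \<forall>y\<in>carrier G. comm x y \<in> upper_central n}"

lemma upper_central_normal: "upper_central n \<lhd> G"
proof (induction n)
  case 0
  then show ?case using one_is_normal by simp
next
  case (Suc n)
  interpret Z: normal "upper_central n" G by fact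
  have conj: "g \<otimes> z \<otimes> inv g \<in> upper_central n" if "g \<in> carrier G" "z \<in> upper_central n" for g z
    using that Z.inv_op_closed2 by blast
  have sub: "subgroup (upper_central (Suc n)) G"
  proof
    show "\<one> \<in> upper_central (Suc n)" using Z.one_closed by (simp add: comm_def)
    fix x y assume x: "x \<in> upper_central (Suc n)" and y: "y \<in> upper_central (Suc n)"
    have "comm (x \<otimes> y) w \<in> upper_central n" if w: "w \<in> carrier G" for w
    proof -
      have "x \<otimes> comm y w \<otimes> inv x \<otimes> comm x w \<in> upper_central n"
        using x y w by (intro Z.m_closed conj) auto
      moreover have "x \<otimes> comm y w \<otimes> inv x \<otimes> comm x w = comm (x \<otimes> y) w"
        using x y w by (simp add: word_simps)
      ultimately show ?thesis by metis
    qed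
    then show "x \<otimes> y \<in> upper_central (Suc n)" using x y by simp
  next
    fix x assume x: "x \<in> upper_central (Suc n)"
    have "comm (inv x) w \<in> upper_central n" if w: "w \<in> carrier G" for w
    proof -
      have "inv x \<otimes> inv (comm x w) \<otimes> inv (inv x) \<in> upper_central n"
        using x w by (intro conj Z.m_inv_closed) auto
      moreover have "inv x \<otimes> inv (comm x w) \<otimes> inv (inv x) = comm (inv x) w"
        using x w by (simp add: word_simps)
      ultimately show ?thesis by metis
    qed
    then show "inv x \<in> upper_central (Suc n)" using x by simp
  qed auto
  have "g \<otimes> x \<otimes> inv g \<in> upper_central (Suc n)" if g: "g \<in> carrier G" and x: "x \<in> upper_central (Suc n)" for g x
  proof -
    have "comm (g \<otimes> x \<otimes> inv g) w \<in> upper_central n" if w: "w \<in> carrier G" for w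
    proof -
      have "g \<otimes> comm x (inv g \<otimes> w \<otimes> g) \<otimes> inv g \<in> upper_central n"
        using x w g by (intro conj) auto
      moreover have "g \<otimes> comm x (inv g \<otimes> w \<otimes> g) \<otimes> inv g = comm (g \<otimes> x \<otimes> inv g) w"
        using x w g by (simp add: word_simps)
      ultimately show ?thesis by metis
    qed
    then show ?thesis using x g by simp
  qed
  then show ?case using sub normal_inv_iff by blast
qed

lemma upper_central_mono: "upper_central n \<subseteq> upper_central (Suc n)"
proof
  interpret Z: normal "upper_central n" G by (rule upper_central_normal)
  fix x assume x: "x \<in> upper_central n"
  then have xG: "x \<in> carrier G" by (rule Z.mem_carrier)
  have "comm x y \<in> upper_central n" if y: "y \<in> carrier G" for y
  proof -
    have "x \<otimes> (y \<otimes> inv x \<otimes> inv y) \<in> upper_central n"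
      by (rule Z.m_closed[OF x Z.inv_op_closed2[OF y Z.m_inv_closed[OF x]]])
    then show ?thesis using xG y by (simp add: comm_def m_assoc)
  qed
  then show "x \<in> upper_central (Suc n)" using xG by simp
qed

text \<open>A nontrivial central element of the quotient by the \<open>n\<close>-th term, lifted to
  \<open>G\<close>, has all its commutators in that term.\<close>

lemma upper_central_strict:
  assumes fin: "finite (carrier G)" "card (carrier G) = p ^ s" "prime (p::nat)" and "upper_central n \<noteq> carrier G"
  shows "upper_central n \<subset> upper_central (Suc n)"
proof -
  let ?Z = "upper_central n"
  interpret Z: normal ?Z G by (rule upper_central_normal)
  interpret GZ: group "G Mod ?Z" by (rule Z.factorgroup_is_group)
  have car: "carrier (G Mod ?Z) = rcosets ?Z" by (simp add: FactGroup_def)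
  have lag: "card (rcosets ?Z) * card ?Z = p ^ s"
    using lagrange_finite[OF fin(1) Z.subgroup_axioms] fin(2) by (simp add: Coset.order_def)
  then have "card (rcosets ?Z) dvd p ^ s" by (metis dvd_triv_left)
  then obtain t where t: "card (carrier (G Mod ?Z)) = p ^ t"
    unfolding car using fin(3) divides_primepow_nat by blast
  have finq: "finite (carrier (G Mod ?Z))"
    unfolding car RCOSETS_def using fin(1) by auto
  obtain y where y: "y \<in> carrier G" "y \<notin> ?Z" using assms(4) Z.subset by blast
  have "?Z #> y \<noteq> ?Z" using rcos_self[OF y(1) Z.subgroup_axioms] y(2) by auto
  moreover have "?Z #> y \<in> carrier (G Mod ?Z)" unfolding car RCOSETS_def using y(1) by blast
  ultimately have "carrier (G Mod ?Z) \<noteq> {\<one>\<^bsub>G Mod ?Z\<^esub>}" by auto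
  then obtain X where X: "X \<in> carrier (G Mod ?Z)" "X \<noteq> \<one>\<^bsub>G Mod ?Z\<^esub>"
    "\<And>Y. Y \<in> carrier (G Mod ?Z) \<Longrightarrow> X \<otimes>\<^bsub>G Mod ?Z\<^esub> Y = Y \<otimes>\<^bsub>G Mod ?Z\<^esub> X"
    using GZ.p_group_center[OF finq t fin(3)] by blast
  obtain x where x: "x \<in> carrier G" "X = ?Z #> x" using X(1) unfolding car RCOSETS_def by blast
  have "x \<notin> ?Z" using X(2) x Z.rcos_const[OF is_group] by (auto simp: FactGroup_def)
  moreover have "comm x w \<in> ?Z" if w: "w \<in> carrier G" for w
  proof -
    have "?Z #> w \<in> carrier (G Mod ?Z)" unfolding car RCOSETS_def using w by blast
    from X(3)[OF this] have "?Z #> (x \<otimes> w) = ?Z #> (w \<otimes> x)"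
      unfolding x(2) using Z.rcos_sum[OF x(1) w] Z.rcos_sum[OF w x(1)] by (simp add: FactGroup_def)
    then have "x \<otimes> w \<in> ?Z #> (w \<otimes> x)"
      using rcos_self[OF m_closed[OF x(1) w] Z.subgroup_axioms] by simp
    then obtain z where z: "z \<in> ?Z" "x \<otimes> w = z \<otimes> (w \<otimes> x)" unfolding r_coset_def by blast
    have "comm x w = x \<otimes> w \<otimes> inv (w \<otimes> x)" using x(1) w by (simp add: word_simps)
    also have "\<dots> = z" unfolding z(2) using x(1) w Z.mem_carrier[OF z(1)] by (simp add: m_assoc)
    finally show ?thesis using z(1) by simp
  qed
  ultimately show ?thesis using upper_central_mono x(1) by auto
qed

text \<open>The upper central series grows until it reaches \<open>G\<close>, say after
  \<open>m\<close> steps. The lower series then descends at least as fast; as it is numbered from 1,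
  the term with index \<open>Suc j\<close> lies in the upper term \<open>m - j\<close>.\<close>

lemma p_group_nilpotent:
  assumes fin: "finite (carrier G)" "card (carrier G) = p ^ s" "prime (p::nat)"
  obtains c where "1 \<le> c" "\<And>n. c \<le> n \<Longrightarrow> lower_central G n = {\<one>}"
proof -
  have grow: "n \<le> card (upper_central n) \<or> upper_central n = carrier G" for n
  proof (induction n)
    case (Suc n)
    have sub: "upper_central (Suc n) \<subseteq> carrier G" by auto
    show ?case
    proof (cases "upper_central n = carrier G")
      case True
      then show ?thesis using upper_central_mono[of n] sub by auto
    next
      case False
      have "card (upper_central n) < card (upper_central (Suc n))"
        by (rule psubset_card_mono[OF finite_subset[OF sub fin(1)] upper_central_strict[OF fin False]])
      then show ?thesis using Suc False by simp
    qed
  qed simp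
  have "upper_central n \<subseteq> carrier G" for n by (cases n) auto
  then have "card (upper_central (Suc (card (carrier G)))) \<le> card (carrier G)"
    by (intro card_mono fin(1))
  then have "\<not> Suc (card (carrier G)) \<le> card (upper_central (Suc (card (carrier G))))"
    by (simp only: not_less_eq_eq Suc_le_mono simp_thms)
  then have "upper_central (Suc (card (carrier G))) = carrier G" using grow by blast
  then obtain m where m: "upper_central m = carrier G" by blast
  have "j \<le> m \<Longrightarrow> lower_central G (Suc j) \<subseteq> upper_central (m - j)" for j
  proof (induction j)
    case (Suc j)
    interpret Z: normal "upper_central (m - Suc j)" G by (rule upper_central_normal)
    have mj: "m - j = Suc (m - Suc j)" using Suc.prems by simp
    have "comm x y \<in> upper_central (m - Suc j)" if "x \<in> lower_central G (Suc j)" "y \<in> carrier G" for x y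
    proof -
      have "x \<in> upper_central (Suc (m - Suc j))" using Suc that mj by auto
      then show ?thesis using that(2) by simp
    qed
    then show ?case
      unfolding lower_central_Suc_Suc by (intro generate_subgroup_incl Z.subgroup_axioms) auto
  qed (simp add: m)
  from this[of m] have "lower_central G (Suc m) \<subseteq> {\<one>}" by simp
  then have "lower_central G n = {\<one>}" if "Suc m \<le> n" for n
    using lower_central_antimono[OF that] subgroup.one_closed[OF subgroup_lower_central, of n] by blast
  then show thesis using that[of "Suc m"] by simp
qed

end

section \<open>Derivations into finite modules\<close>

text \<open>The wreath product with \<open>Q\<close> acting on functions by left translation. Its
  multiplication reproduces the cocycle rule, so the homomorphisms to it with second component
  \<open>\<pi>\<close> are the derivations into functions on \<open>Q\<close> along
  \<open>\<pi>\<close>.\<close>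

definition wreath :: "('c, 'd) monoid_scheme \<Rightarrow> ('q, 'e) monoid_scheme \<Rightarrow> (('q \<Rightarrow> 'c) \<times> 'q) monoid" where
  "wreath A Q =
     \<lparr>carrier = (carrier Q \<rightarrow>\<^sub>E carrier A) \<times> carrier Q,
      monoid.mult = (\<lambda>(v, a) (w, b). (\<lambda>x\<in>carrier Q. v x \<otimes>\<^bsub>A\<^esub> w (inv\<^bsub>Q\<^esub> a \<otimes>\<^bsub>Q\<^esub> x), a \<otimes>\<^bsub>Q\<^esub> b)),
      one = (\<lambda>x\<in>carrier Q. \<one>\<^bsub>A\<^esub>, \<one>\<^bsub>Q\<^esub>)\<rparr>"

lemma group_wreath:
  assumes "group A" "group Q"
  shows "group (wreath A Q)"
proof -
  interpret A: group A by fact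
  interpret Q: group Q by fact
  have closed: "f x \<in> carrier A" if "f \<in> carrier Q \<rightarrow>\<^sub>E carrier A" "x \<in> carrier Q" for f x
    using that by (rule PiE_mem)
  show ?thesis
  proof (rule groupI)
    fix u v w assume u: "u \<in> carrier (wreath A Q)" and v: "v \<in> carrier (wreath A Q)"
    then show "u \<otimes>\<^bsub>wreath A Q\<^esub> v \<in> carrier (wreath A Q)"
      by (auto simp: wreath_def closed)
    assume w: "w \<in> carrier (wreath A Q)"
    obtain u1 u2 v1 v2 w1 w2 where uvw: "u = (u1, u2)" "v = (v1, v2)" "w = (w1, w2)" by (metis surj_pair)
    have U: "u1 \<in> carrier Q \<rightarrow>\<^sub>E carrier A" "v1 \<in> carrier Q \<rightarrow>\<^sub>E carrier A" "w1 \<in> carrier Q \<rightarrow>\<^sub>E carrier A"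
      "u2 \<in> carrier Q" "v2 \<in> carrier Q" "w2 \<in> carrier Q"
      using u v w by (auto simp: uvw wreath_def)
    show "u \<otimes>\<^bsub>wreath A Q\<^esub> v \<otimes>\<^bsub>wreath A Q\<^esub> w = u \<otimes>\<^bsub>wreath A Q\<^esub> (v \<otimes>\<^bsub>wreath A Q\<^esub> w)"
      using U by (auto simp: uvw wreath_def Q.m_assoc Q.inv_mult_group A.m_assoc closed intro!: restrict_ext)
  next
    show "\<one>\<^bsub>wreath A Q\<^esub> \<in> carrier (wreath A Q)" by (auto simp: wreath_def)
  next
    fix u assume u: "u \<in> carrier (wreath A Q)"
    obtain v a where uva: "u = (v, a)" by (metis surj_pair)
    have va: "v \<in> carrier Q \<rightarrow>\<^sub>E carrier A" "a \<in> carrier Q" using u by (auto simp: uva wreath_def)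
    show "\<one>\<^bsub>wreath A Q\<^esub> \<otimes>\<^bsub>wreath A Q\<^esub> u = u"
      using va by (auto simp: uva wreath_def closed intro!: PiE_ext[OF _ va(1)])
    have "(\<lambda>x\<in>carrier Q. inv\<^bsub>A\<^esub> (v (a \<otimes>\<^bsub>Q\<^esub> x)), inv\<^bsub>Q\<^esub> a) \<in> carrier (wreath A Q)"
      using va by (auto simp: wreath_def closed)
    moreover have "(\<lambda>x\<in>carrier Q. inv\<^bsub>A\<^esub> (v (a \<otimes>\<^bsub>Q\<^esub> x)), inv\<^bsub>Q\<^esub> a) \<otimes>\<^bsub>wreath A Q\<^esub> u = \<one>\<^bsub>wreath A Q\<^esub>"
      using va by (auto simp: uva wreath_def closed intro!: restrict_ext)
    ultimately show "\<exists>w\<in>carrier (wreath A Q). w \<otimes>\<^bsub>wreath A Q\<^esub> u = \<one>\<^bsub>wreath A Q\<^esub>" by blast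
  qed
qed

text \<open>The derivation on words with values \<open>u (s, \<cdot>)\<close> on the letters \<open>s\<close>, with respect to the action
  \<open>(g f)(x) = f (g\<^sup>-\<^sup>1 x)\<close>.\<close>

fun fox :: "('a, 'b) monoid_scheme \<Rightarrow> ('i \<Rightarrow> 'a) \<Rightarrow> ('i \<times> 'a \<Rightarrow> 'r::ab_group_add) \<Rightarrow> ('i \<times> bool) list \<Rightarrow> 'a \<Rightarrow> 'r" where
  "fox H \<sigma> u [] x = 0"
| "fox H \<sigma> u (a # w) x = (if snd a then u (fst a, x) else - u (fst a, \<sigma> (fst a) \<otimes>\<^bsub>H\<^esub> x))
     + fox H \<sigma> u w (inv\<^bsub>H\<^esub> (letter_image H \<sigma> a) \<otimes>\<^bsub>H\<^esub> x)"

definition exponent_sum :: "('i \<Rightarrow> int) \<Rightarrow> ('i \<times> bool) list \<Rightarrow> int" where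
  "exponent_sum c w = (\<Sum>a\<leftarrow>w. if snd a then c (fst a) else - c (fst a))"

definition inverse_word :: "('i \<times> bool) list \<Rightarrow> ('i \<times> bool) list" where
  "inverse_word w = rev (map (apsnd Not) w)"

lemma exponent_sum_Cons: "exponent_sum c (a # w) = (if snd a then c (fst a) else - c (fst a)) + exponent_sum c w"
  by (simp add: exponent_sum_def)

lemma exponent_sum_append: "exponent_sum c (v @ w) = exponent_sum c v + exponent_sum c w"
  by (simp add: exponent_sum_def)

lemma exponent_sum_inverse_word: "exponent_sum c (inverse_word w) = - exponent_sum c w"
  by (induction w) (auto simp: exponent_sum_def inverse_word_def)

lemma fst_inverse_word: "fst ` set (inverse_word w) = fst ` set w"
  by (force simp: inverse_word_def)

context group
begin

lemma letter_image_closed: "\<sigma> ` S \<subseteq> carrier G \<Longrightarrow> fst a \<in> S \<Longrightarrow> letter_image G \<sigma> a \<in> carrier G"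
  by (auto simp: letter_image_def)

lemma word_image_Nil: "word_image G \<sigma> [] = \<one>"
  by (simp add: word_image_def)

lemma word_image_Cons: "word_image G \<sigma> (a # w) = letter_image G \<sigma> a \<otimes> word_image G \<sigma> w"
  by (simp add: word_image_def)

lemma word_image_closed: "\<sigma> ` S \<subseteq> carrier G \<Longrightarrow> fst ` set w \<subseteq> S \<Longrightarrow> word_image G \<sigma> w \<in> carrier G"
  by (induction w) (auto simp: word_image_Nil word_image_Cons letter_image_closed)

lemma word_image_append:
  assumes "\<sigma> ` S \<subseteq> carrier G" "fst ` set v \<subseteq> S" "fst ` set w \<subseteq> S"
  shows "word_image G \<sigma> (v @ w) = word_image G \<sigma> v \<otimes> word_image G \<sigma> w"
  using assms(2)
proof (induction v)
  case (Cons a v)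
  have "letter_image G \<sigma> a \<in> carrier G" "word_image G \<sigma> v \<in> carrier G"
    using letter_image_closed[OF assms(1)] word_image_closed[OF assms(1)] Cons.prems by auto
  then show ?case
    using Cons word_image_closed[OF assms(1,3)] by (simp add: word_image_Cons m_assoc)
qed (use word_image_closed[OF assms(1,3)] in \<open>simp add: word_image_Nil\<close>)

lemma word_image_inverse:
  assumes "\<sigma> ` S \<subseteq> carrier G" "fst ` set w \<subseteq> S"
  shows "word_image G \<sigma> (inverse_word w) = inv (word_image G \<sigma> w)"
  using assms(2)
proof (induction w)
  case (Cons a w)
  have a: "letter_image G \<sigma> a \<in> carrier G" "letter_image G \<sigma> (apsnd Not a) = inv (letter_image G \<sigma> a)"
    using Cons.prems assms(1) by (auto simp: letter_image_def)
  have w: "word_image G \<sigma> w \<in> carrier G" using word_image_closed[OF assms(1)] Cons.prems by auto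
  have "inverse_word (a # w) = inverse_word w @ [apsnd Not a]" by (simp add: inverse_word_def)
  then have "word_image G \<sigma> (inverse_word (a # w)) = word_image G \<sigma> (inverse_word w) \<otimes> word_image G \<sigma> [apsnd Not a]"
    using Cons.prems by (simp only:) (rule word_image_append[OF assms(1)], auto simp: fst_inverse_word)
  then show ?case using Cons a w by (simp add: word_image_Cons word_image_Nil inv_mult_group)
qed (simp add: word_image_Nil inverse_word_def)

lemma generate_word:
  assumes "S \<subseteq> carrier G" "g \<in> generate G S"
  obtains w where "fst ` set w \<subseteq> S" "word_image G (\<lambda>s. s) w = g"
proof -
  have S: "(\<lambda>s. s) ` S \<subseteq> carrier G" using assms(1) by simp
  have "\<exists>w. fst ` set w \<subseteq> S \<and> word_image G (\<lambda>s. s) w = g"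
    using assms(2)
  proof (induction rule: generate.induct)
    case one
    then show ?case by (intro exI[of _ "[]"]) (simp add: word_image_Nil)
  next
    case (incl h)
    then show ?case using assms(1)
      by (intro exI[of _ "[(h, True)]"]) (auto simp: word_image_Nil word_image_Cons letter_image_def)
  next
    case (inv h)
    then show ?case using assms(1)
      by (intro exI[of _ "[(h, False)]"]) (auto simp: word_image_Nil word_image_Cons letter_image_def)
  next
    case (eng g h)
    then obtain v w where "fst ` set v \<subseteq> S" "word_image G (\<lambda>s. s) v = g"
      "fst ` set w \<subseteq> S" "word_image G (\<lambda>s. s) w = h" by blast
    then show ?case by (intro exI[of _ "v @ w"]) (auto simp: word_image_append[OF S])
  qed
  then show thesis using that by blast
qed

lemma fox_append:
  assumes "\<sigma> ` S \<subseteq> carrier G" "fst ` set v \<subseteq> S" "fst ` set w \<subseteq> S" "x \<in> carrier G"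
  shows "fox G \<sigma> u (v @ w) x = fox G \<sigma> u v x + fox G \<sigma> u w (inv (word_image G \<sigma> v) \<otimes> x)"
  using assms(2,4)
proof (induction v arbitrary: x)
  case (Cons a v)
  have "letter_image G \<sigma> a \<in> carrier G" "word_image G \<sigma> v \<in> carrier G"
    using letter_image_closed[OF assms(1)] word_image_closed[OF assms(1)] Cons.prems by auto
  then show ?case using Cons by (simp add: word_image_Cons inv_mult_group m_assoc)
qed (simp add: word_image_Nil)

text \<open>The action in the Fox derivation multiplies arguments on the left, hence commutes with
  right translation. This makes the group act on the solution sets.\<close>

lemma fox_translate:
  assumes "\<sigma> ` S \<subseteq> carrier G" "fst ` set w \<subseteq> S" "x \<in> carrier G" "g \<in> carrier G"
    and "\<And>s x. s \<in> S \<Longrightarrow> x \<in> carrier G \<Longrightarrow> v (s, x) = u (s, x \<otimes> g)"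
  shows "fox G \<sigma> v w x = fox G \<sigma> u w (x \<otimes> g)"
  using assms(2,3)
proof (induction w arbitrary: x)
  case (Cons a w)
  have "letter_image G \<sigma> a \<in> carrier G" "\<sigma> (fst a) \<in> carrier G" "fst a \<in> S"
    using letter_image_closed[OF assms(1)] assms(1) Cons.prems by auto
  then show ?case using Cons assms(4,5) by (simp add: m_assoc)
qed simp

lemma fox_diff:
  "fox G \<sigma> (\<lambda>z. u z - v z) w x = fox G \<sigma> u w x - fox G \<sigma> v w x"
  by (induction w arbitrary: x) auto

lemma fox_cong_mod:
  fixes u v :: "'i \<times> 'a \<Rightarrow> int"
  assumes "\<sigma> ` S \<subseteq> carrier G" "fst ` set w \<subseteq> S" "x \<in> carrier G"
    and "\<And>s x. s \<in> S \<Longrightarrow> x \<in> carrier G \<Longrightarrow> [u (s, x) = v (s, x)] (mod m)"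
  shows "[fox G \<sigma> u w x = fox G \<sigma> v w x] (mod m)"
  using assms(2,3)
proof (induction w arbitrary: x)
  case (Cons a w)
  have "letter_image G \<sigma> a \<in> carrier G" "\<sigma> (fst a) \<in> carrier G" "fst a \<in> S"
    using letter_image_closed[OF assms(1)] assms(1) Cons.prems by auto
  then show ?case using Cons assms(4) by (auto intro!: cong_add cong_diff)
qed simp

text \<open>On functions that do not depend on the group coordinate the action is trivial, and a
  derivation is just a homomorphism from words to the integers.\<close>

lemma fox_constant:
  fixes u :: "'i \<times> 'a \<Rightarrow> int"
  assumes "\<sigma> ` S \<subseteq> carrier G" "fst ` set w \<subseteq> S" "x \<in> carrier G"
    and "\<And>s x. s \<in> S \<Longrightarrow> x \<in> carrier G \<Longrightarrow> u (s, x) = c s"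
  shows "fox G \<sigma> u w x = exponent_sum c w"
  using assms(2,3)
proof (induction w arbitrary: x)
  case (Cons a w)
  have "letter_image G \<sigma> a \<in> carrier G" "\<sigma> (fst a) \<in> carrier G" "fst a \<in> S"
    using letter_image_closed[OF assms(1)] assms(1) Cons.prems by auto
  then show ?case using Cons assms(4) by (simp add: exponent_sum_def)
qed (simp add: exponent_sum_def)

end

definition fox_solutions :: "('q, 'e) monoid_scheme \<Rightarrow> ('i \<Rightarrow> 'q) \<Rightarrow> 'i set \<Rightarrow> ('i \<times> bool) list set \<Rightarrow> nat \<Rightarrow> ('i \<times> 'q \<Rightarrow> int) set" where
  "fox_solutions Q \<sigma> S R m =
     {u \<in> S \<times> carrier Q \<rightarrow>\<^sub>E {0..<int m}. \<forall>w\<in>R. \<forall>x\<in>carrier Q. int m dvd fox Q \<sigma> u w x}"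

definition relators :: "('a, 'b) monoid_scheme \<Rightarrow> 'a set \<Rightarrow> ('a \<times> bool) list set" where
  "relators G S = {w. fst ` set w \<subseteq> S \<and> word_image G (\<lambda>s. s) w = \<one>\<^bsub>G\<^esub>}"

text \<open>The first component of a homomorphism to the wreath product is a derivation, so its
  value on a word is computed letter by letter from the values on \<open>S\<close>. Only a
  congruence holds, because the coefficient group stores reduced residues.\<close>

lemma fox_wreath:
  assumes G: "group G" and Q: "group Q" and m: "0 < m" and S: "S \<subseteq> carrier G"
    and h: "h \<in> hom G (wreath (integer_mod_group m) Q)" and \<pi>: "\<And>g. g \<in> carrier G \<Longrightarrow> snd (h g) = \<pi> g"
    and u: "\<And>s x. s \<in> S \<Longrightarrow> x \<in> carrier Q \<Longrightarrow> u (s, x) = fst (h s) x"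
    and w: "fst ` set w \<subseteq> S" and x: "x \<in> carrier Q"
  shows "[fst (h (word_image G (\<lambda>s. s) w)) x = fox Q \<pi> u w x] (mod int m)"
proof -
  interpret G: group G by fact
  interpret Q: group Q by fact
  interpret Z: group "integer_mod_group m" by (rule group_integer_mod_group)
  interpret P: group "wreath (integer_mod_group m) Q" by (intro group_wreath Z.is_group Q)
  interpret h: group_hom G "wreath (integer_mod_group m) Q" h
    using h by (simp add: group_hom_def group_hom_axioms_def G P.is_group)
  have S': "(\<lambda>s. s) ` S \<subseteq> carrier G" using S by simp
  have mult: "[fst (h (g \<otimes>\<^bsub>G\<^esub> k)) x = fst (h g) x + fst (h k) (inv\<^bsub>Q\<^esub> (\<pi> g) \<otimes>\<^bsub>Q\<^esub> x)] (mod int m)"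
    if "g \<in> carrier G" "k \<in> carrier G" "x \<in> carrier Q" for g k x
  proof -
    obtain v a v' b where hg: "h g = (v, a)" "h k = (v', b)" by (metis surj_pair)
    have "fst (h (g \<otimes>\<^bsub>G\<^esub> k)) x = (v x + v' (inv\<^bsub>Q\<^esub> a \<otimes>\<^bsub>Q\<^esub> x)) mod int m"
      using that by (simp add: h.hom_mult hg wreath_def)
    moreover have "a = \<pi> g" using \<pi>[OF that(1)] hg by simp
    ultimately show ?thesis by (simp add: hg cong_def)
  qed
  have one: "fst (h \<one>\<^bsub>G\<^esub>) x = 0" if "x \<in> carrier Q" for x
    using that unfolding h.hom_one by (simp add: wreath_def)
  have \<pi>h: "\<pi> (g \<otimes>\<^bsub>G\<^esub> k) = \<pi> g \<otimes>\<^bsub>Q\<^esub> \<pi> k" if "g \<in> carrier G" "k \<in> carrier G" for g k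
    using that by (simp flip: \<pi> add: h.hom_mult wreath_def case_prod_unfold)
  have \<pi>c: "\<pi> g \<in> carrier Q" if "g \<in> carrier G" for g
    using h.hom_closed[OF that] that by (auto simp flip: \<pi> simp: wreath_def)
  interpret \<pi>: group_hom G Q \<pi>
    using \<pi>h \<pi>c by (auto simp: group_hom_def group_hom_axioms_def G Q hom_def)
  show ?thesis using w x
  proof (induction w arbitrary: x)
    case Nil
    then show ?case using one by (simp add: G.word_image_Nil del: h.hom_one)
  next
    case (Cons a w)
    have s: "fst a \<in> S" "fst a \<in> carrier G" using Cons.prems S by auto
    have a: "letter_image G (\<lambda>s. s) a \<in> carrier G" using G.letter_image_closed[OF S' s(1)] .
    have w: "word_image G (\<lambda>s. s) w \<in> carrier G" using G.word_image_closed[OF S'] Cons.prems by auto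
    have \<pi>a: "\<pi> (letter_image G (\<lambda>s. s) a) = letter_image Q \<pi> a"
      using s by (simp add: letter_image_def)
    have "[fst (h (letter_image G (\<lambda>s. s) a)) x = (if snd a then u (fst a, x) else - u (fst a, \<pi> (fst a) \<otimes>\<^bsub>Q\<^esub> x))] (mod int m)"
    proof (cases "snd a")
      case True
      then show ?thesis using u s Cons.prems by (simp add: letter_image_def)
    next
      case False
      have c: "\<pi> (fst a) \<otimes>\<^bsub>Q\<^esub> x \<in> carrier Q" using s Cons.prems by simp
      \<comment> \<open>The value on an inverse letter follows by applying the cocycle rule to
        \<open>s \<otimes> inv s\<close>, where the derivation vanishes.\<close>
      have "[fst (h (fst a \<otimes>\<^bsub>G\<^esub> inv\<^bsub>G\<^esub> (fst a))) (\<pi> (fst a) \<otimes>\<^bsub>Q\<^esub> x) = fst (h (fst a)) (\<pi> (fst a) \<otimes>\<^bsub>Q\<^esub> x)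
          + fst (h (inv\<^bsub>G\<^esub> (fst a))) (inv\<^bsub>Q\<^esub> (\<pi> (fst a)) \<otimes>\<^bsub>Q\<^esub> (\<pi> (fst a) \<otimes>\<^bsub>Q\<^esub> x))] (mod int m)"
        by (rule mult) (use s c in auto)
      moreover have "inv\<^bsub>Q\<^esub> (\<pi> (fst a)) \<otimes>\<^bsub>Q\<^esub> (\<pi> (fst a) \<otimes>\<^bsub>Q\<^esub> x) = x"
        using s Cons.prems by (intro Q.inv_cancel_left) auto
      ultimately have "[u (fst a, \<pi> (fst a) \<otimes>\<^bsub>Q\<^esub> x) + fst (h (inv\<^bsub>G\<^esub> (fst a))) x = 0] (mod int m)"
        using s c u[OF s(1) c] one[OF c] by (simp add: cong_sym)
      then show ?thesis using False
        by (simp add: letter_image_def cong_iff_dvd_diff add.commute)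
    qed
    then have "[fst (h (letter_image G (\<lambda>s. s) a)) x + fst (h (word_image G (\<lambda>s. s) w)) (inv\<^bsub>Q\<^esub> (letter_image Q \<pi> a) \<otimes>\<^bsub>Q\<^esub> x)
      = fox Q \<pi> u (a # w) x] (mod int m)"
      using Cons a \<pi>.hom_closed[OF a] unfolding fox.simps \<pi>a by (intro cong_add) auto
    then show ?case
      using mult[OF a w, of x] Cons.prems unfolding G.word_image_Cons \<pi>a by (auto intro: cong_trans)
  qed
qed

text \<open>The wreath product is a finite \<open>p\<close>-group and so nilpotent. Hence every
  choice of functions \<open>v i\<close> extends to a homomorphism sending \<open>x i\<close> to
  \<open>(v i, \<pi> (x i))\<close>. These choices number
  \<open>(p ^ k) ^ (r * card (carrier Q))\<close>, and each yields a different solution of the Fox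
  equations.\<close>

lemma (in group) parafree_solutions_ge:
  fixes Q :: "('q, 'e) monoid_scheme"
  assumes pf: "parafree G r" and S: "S \<subseteq> carrier G" "generate G S = carrier G" "finite S"
    and Q: "group Q" "finite (carrier Q)" "card (carrier Q) = p ^ s" "prime (p::nat)"
    and \<pi>: "\<pi> \<in> hom G Q" and R: "R \<subseteq> relators G S"
  shows "(p ^ k) ^ (r * card (carrier Q)) \<le> card (fox_solutions Q \<pi> S R (p ^ k))"
proof -
  let ?m = "p ^ k"
  let ?P = "wreath (integer_mod_group ?m) Q"
  have m: "0 < ?m" using Q(4) prime_gt_0_nat by simp
  have carZ: "carrier (integer_mod_group ?m) = {0..<int ?m}" using m by (simp add: carrier_integer_mod_group del: of_nat_power)
  interpret Q: group Q by fact
  interpret P: group ?P by (intro group_wreath group_integer_mod_group Q)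
  have carP: "carrier ?P = (carrier Q \<rightarrow>\<^sub>E {0..<int ?m}) \<times> carrier Q" by (simp add: wreath_def carZ)
  have finV: "finite (carrier Q \<rightarrow>\<^sub>E {0..<int ?m})" using Q(2) by (intro finite_PiE) auto
  have cardV: "card (carrier Q \<rightarrow>\<^sub>E {0..<int ?m}) = ?m ^ card (carrier Q)" using Q(2) by (simp add: card_PiE del: of_nat_power)
  have cardP: "card (carrier ?P) = p ^ (k * card (carrier Q) + s)"
    unfolding carP card_cartesian_product cardV Q(3) power_add power_mult ..
  have finP: "finite (carrier ?P)" using finV Q(2) by (simp add: carP)
  obtain c1 where c1: "1 \<le> c1" "\<And>n. c1 \<le> n \<Longrightarrow> lower_central ?P n = {\<one>\<^bsub>?P\<^esub>}"
    using P.p_group_nilpotent[OF finP cardP Q(4)] by blast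
  obtain c2 where c2: "1 \<le> c2" "\<And>n. c2 \<le> n \<Longrightarrow> lower_central Q n = {\<one>\<^bsub>Q\<^esub>}"
    using Q.p_group_nilpotent[OF Q(2,3,4)] by blast
  \<comment> \<open>One level for two purposes: existence of homomorphisms to the wreath product,
    and uniqueness of homomorphisms to \<open>Q\<close>, by which the second components all equal
    \<open>\<pi>\<close>.\<close>
  define c where "c = max c1 c2"
  have cc: "1 \<le> c" "lower_central ?P c = {\<one>\<^bsub>?P\<^esub>}" "lower_central Q c = {\<one>\<^bsub>Q\<^esub>}"
    using c1 c2 by (auto simp: c_def)
  obtain \<theta> x where "nilpotent_quotient_iso G r c \<theta> x" using parafree_iso[OF pf cc(1)] by blast
  then interpret nilpotent_quotient_iso G r c \<theta> x .
  have \<pi>x: "\<pi> (x i) \<in> carrier Q" if "i < r" for i using \<pi> x(1)[OF that] by (auto simp: hom_def)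
  let ?V = "{..<r} \<rightarrow>\<^sub>E (carrier Q \<rightarrow>\<^sub>E {0..<int ?m})"
  have "\<exists>h. h \<in> hom G ?P \<and> (\<forall>i<r. h (x i) = (v i, \<pi> (x i)))" if v: "v \<in> ?V" for v
  proof (rule hom_extend[OF P.is_group cc(2), of "\<lambda>i. (v i, \<pi> (x i))"])
    show "(v i, \<pi> (x i)) \<in> carrier ?P" if "i < r" for i
      using PiE_mem[OF v, of i] \<pi>x[OF that] that unfolding carP by simp
    fix h assume "h \<in> hom G ?P" "\<And>i. i < r \<Longrightarrow> h (x i) = (v i, \<pi> (x i))"
    then show ?thesis by blast
  qed
  then obtain H where "\<forall>v. v \<in> ?V \<longrightarrow> H v \<in> hom G ?P \<and> (\<forall>i<r. H v (x i) = (v i, \<pi> (x i)))"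
    using choice[of "\<lambda>v h. v \<in> ?V \<longrightarrow> h \<in> hom G ?P \<and> (\<forall>i<r. h (x i) = (v i, \<pi> (x i)))"] by blast
  then have H: "\<And>v. v \<in> ?V \<Longrightarrow> H v \<in> hom G ?P" "\<And>v i. v \<in> ?V \<Longrightarrow> i < r \<Longrightarrow> H v (x i) = (v i, \<pi> (x i))"
    by blast+
  have snd_hom: "(\<lambda>g. snd (h g)) \<in> hom G Q" if h: "h \<in> hom G ?P" for h
  proof (rule homI)
    show "snd (h g) \<in> carrier Q" if "g \<in> carrier G" for g
      using hom_in_carrier[OF h that] unfolding carP by auto
    show "snd (h (g \<otimes> g')) = snd (h g) \<otimes>\<^bsub>Q\<^esub> snd (h g')" if "g \<in> carrier G" "g' \<in> carrier G" for g g'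
      using hom_mult[OF h that] by (simp add: wreath_def case_prod_unfold)
  qed
  have H_snd: "snd (H v g) = \<pi> g" if v: "v \<in> ?V" and g: "g \<in> carrier G" for v g
    by (rule hom_unique[OF Q(1) cc(3) snd_hom[OF H(1)[OF v]] \<pi> _ g]) (simp add: H(2)[OF v])
  define \<Phi> where "\<Phi> v = (\<lambda>(s, q)\<in>S \<times> carrier Q. fst (H v s) q)" for v
  have \<Phi>: "\<Phi> v (s, q) = fst (H v s) q" if "s \<in> S" "q \<in> carrier Q" for v s q
    using that by (simp add: \<Phi>_def)
  have "\<Phi> v \<in> fox_solutions Q \<pi> S R ?m" if v: "v \<in> ?V" for v
  proof -
    have rng: "fst (H v s) \<in> carrier Q \<rightarrow>\<^sub>E {0..<int ?m}" if "s \<in> S" for s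
      using hom_in_carrier[OF H(1)[OF v], of s] subsetD[OF S(1) that] unfolding carP by (simp add: mem_Times_iff)
    have "fst (H v s) q \<in> {0..<int ?m}" if "s \<in> S" "q \<in> carrier Q" for s q
      using PiE_mem[OF rng[OF that(1)] that(2)] .
    then have "\<Phi> v \<in> S \<times> carrier Q \<rightarrow>\<^sub>E {0..<int ?m}" by (auto simp: \<Phi>_def)
    moreover have "int ?m dvd fox Q \<pi> (\<Phi> v) w q" if w: "w \<in> R" and q: "q \<in> carrier Q" for w q
    proof -
      have w': "fst ` set w \<subseteq> S" "word_image G (\<lambda>s. s) w = \<one>" using w R by (auto simp: relators_def)
      have "[fst (H v (word_image G (\<lambda>s. s) w)) q = fox Q \<pi> (\<Phi> v) w q] (mod int ?m)"
        using fox_wreath[OF is_group Q(1) m S(1) H(1)[OF v] H_snd[OF v] \<Phi> w'(1) q] .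
      moreover have "H v \<one> = \<one>\<^bsub>?P\<^esub>" using hom_one[OF H(1)[OF v] is_group P.is_group] .
      ultimately show ?thesis using q unfolding w'(2)
        by (simp add: wreath_def cong_iff_dvd_diff del: of_nat_power)
    qed
    ultimately show ?thesis by (simp add: fox_solutions_def)
  qed
  \<comment> \<open>Homomorphisms that agree on \<open>S\<close> agree on \<open>G\<close>, in
    particular at the elements \<open>x i\<close>, where the values \<open>v i\<close> can be read
    off.\<close>
  moreover have "inj_on \<Phi> ?V"
  proof (rule inj_onI)
    fix v v' assume v: "v \<in> ?V" "v' \<in> ?V" "\<Phi> v = \<Phi> v'"
    interpret h: group_hom G ?P "H v" using H(1)[OF v(1)] by (simp add: group_hom_def group_hom_axioms_def is_group P.is_group)
    interpret h': group_hom G ?P "H v'" using H(1)[OF v(2)] by (simp add: group_hom_def group_hom_axioms_def is_group P.is_group)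
    have "H v s = H v' s" if s: "s \<in> S" for s
    proof -
      have sG: "s \<in> carrier G" using s S by blast
      have 1: "fst (H v s) \<in> carrier Q \<rightarrow>\<^sub>E {0..<int ?m}" "fst (H v' s) \<in> carrier Q \<rightarrow>\<^sub>E {0..<int ?m}"
        using h.hom_closed[OF sG] h'.hom_closed[OF sG] unfolding carP by auto
      have "fst (H v s) q = fst (H v' s) q" if "q \<in> carrier Q" for q
        using \<Phi>[OF s that, of v] \<Phi>[OF s that, of v'] v(3) by simp
      then have "fst (H v s) = fst (H v' s)" by (rule PiE_ext[OF 1])
      then show ?thesis using H_snd[OF v(1) sG] H_snd[OF v(2) sG] by (simp add: prod_eq_iff)
    qed
    then have "S \<subseteq> {g \<in> carrier G. H v g = H v' g}" using S(1) by blast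
    moreover have "subgroup {g \<in> carrier G. H v g = H v' g} G" by unfold_locales auto
    ultimately have "generate G S \<subseteq> {g \<in> carrier G. H v g = H v' g}" by (rule generate_subgroup_incl)
    then have "H v (x i) = H v' (x i)" if "i < r" for i using x(1)[OF that] S(2) by blast
    then have "v i = v' i" if "i \<in> {..<r}" for i using H(2)[OF v(1)] H(2)[OF v(2)] that by simp
    then show "v = v'" by (rule PiE_ext[OF v(1,2)])
  qed
  moreover have "finite (fox_solutions Q \<pi> S R ?m)"
    unfolding fox_solutions_def using finite_PiE[of "S \<times> carrier Q" "\<lambda>_. {0..<int ?m}"] S(3) Q(2) by simp
  ultimately have "card ?V \<le> card (fox_solutions Q \<pi> S R ?m)" by (intro card_inj_on_le[of \<Phi>]) auto
  moreover have "card ?V = ?m ^ (r * card (carrier Q))"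
    by (simp only: card_PiE[OF finite_lessThan] prod_constant cardV card_lessThan power_mult[symmetric] mult.commute mult.left_commute)
  ultimately show ?thesis by simp
qed

context group
begin

lemma fox_add: "fox G \<sigma> (\<lambda>z. u z + v z) w x = fox G \<sigma> u w x + fox G \<sigma> v w x"
  by (induction w arbitrary: x) auto

lemma fox_minus: "fox G \<sigma> (\<lambda>z. - u z) w x = - fox G \<sigma> u w x"
  by (induction w arbitrary: x) auto

lemma parafree_special_relators:
  assumes pf: "parafree G r" and S: "S \<subseteq> carrier G" "generate G S = carrier G" "finite S"
  obtains W R where "finite R" "R \<subseteq> relators G S" "\<And>i. i < r \<Longrightarrow> fst ` set (W i) \<subseteq> S"
    "\<And>c m s. (\<And>i. i < r \<Longrightarrow> m dvd exponent_sum c (W i)) \<Longrightarrow> (\<And>w. w \<in> R \<Longrightarrow> m dvd exponent_sum c w) \<Longrightarrow>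
      s \<in> S \<Longrightarrow> m dvd c s"
proof -
  let ?ev = "word_image G (\<lambda>s. s)"
  have S': "(\<lambda>s. s) ` S \<subseteq> carrier G" using S(1) by simp
  obtain x \<phi> where x: "\<And>i. i < r \<Longrightarrow> x i \<in> carrier G" and
    sub: "\<And>H. subgroup H G \<Longrightarrow> (\<And>i. i < r \<Longrightarrow> x i \<in> H) \<Longrightarrow>
      (\<And>a b. a \<in> carrier G \<Longrightarrow> b \<in> carrier G \<Longrightarrow> comm a b \<in> H) \<Longrightarrow> H = carrier G"
    using parafree_int_homs[OF pf] by metis
  define rep where "rep g = (SOME w. fst ` set w \<subseteq> S \<and> ?ev w = g)" for g
  have rep: "fst ` set (rep g) \<subseteq> S \<and> ?ev (rep g) = g" if "g \<in> carrier G" for g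
  proof -
    have "g \<in> generate G S" using that S(2) by simp
    then have "\<exists>w. fst ` set w \<subseteq> S \<and> ?ev w = g" by (rule generate_word[OF S(1)]) blast
    then show ?thesis unfolding rep_def by (rule someI_ex)
  qed
  define W where "W i = rep (x i)" for i
  have W: "fst ` set (W i) \<subseteq> S" "?ev (W i) = x i" if "i < r" for i
    using rep[OF x[OF that]] by (simp_all add: W_def)
  \<comment> \<open>Words whose exponent sums are divisible by everything that divides those of all
    \<open>W i\<close>. Their values form a subgroup with all \<open>x i\<close> and, since
    commutator words have exponent sum 0, all commutators; so it is \<open>G\<close>.\<close>
  define good where "good y \<longleftrightarrow> fst ` set y \<subseteq> S \<and>
    (\<forall>c m. (\<forall>i<r. m dvd exponent_sum c (W i)) \<longrightarrow> m dvd exponent_sum c y)" for y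
  have good_append: "good (v @ w)" if "good v" "good w" for v w
    using that by (auto simp: good_def exponent_sum_append)
  have good_inverse: "good (inverse_word w)" if "good w" for w
    using that by (simp add: good_def fst_inverse_word exponent_sum_inverse_word)
  define H where "H = ?ev ` {y. good y}"
  have HG: "H \<subseteq> carrier G" using word_image_closed[OF S'] by (auto simp: H_def good_def)
  have "subgroup H G"
  proof (rule subgroupI)
    show "H \<subseteq> carrier G" by (rule HG)
    have "good []" by (simp add: good_def exponent_sum_def)
    then show "H \<noteq> {}" by (auto simp: H_def)
    fix a assume "a \<in> H"
    then obtain y where y: "good y" "a = ?ev y" by (auto simp: H_def)
    then have "inv a = ?ev (inverse_word y)" using word_image_inverse[OF S'] by (simp add: good_def)
    then show "inv a \<in> H" using good_inverse[OF y(1)] by (auto simp: H_def)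
    fix b assume "b \<in> H"
    then obtain z where z: "good z" "b = ?ev z" by (auto simp: H_def)
    have "a \<otimes> b = ?ev (y @ z)" using y z word_image_append[OF S'] by (simp add: good_def)
    then show "a \<otimes> b \<in> H" using good_append[OF y(1) z(1)] by (auto simp: H_def)
  qed
  moreover have "x i \<in> H" if "i < r" for i
    using W[OF that] that by (auto simp: H_def good_def intro!: image_eqI[of _ _ "W i"])
  moreover have "comm a b \<in> H" if ab: "a \<in> carrier G" "b \<in> carrier G" for a b
  proof -
    let ?v = "rep a" and ?w = "rep b"
    have v: "fst ` set ?v \<subseteq> S" "?ev ?v = a" and w: "fst ` set ?w \<subseteq> S" "?ev ?w = b"
      using rep ab by auto
    let ?z = "?v @ ?w @ inverse_word ?v @ inverse_word ?w"
    have "good ?z" using v w by (auto simp: good_def exponent_sum_append exponent_sum_inverse_word fst_inverse_word image_Un)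
    moreover have "?ev ?z = comm a b"
      using v w ab by (simp add: word_image_append[OF S'] word_image_inverse[OF S'] fst_inverse_word image_Un comm_def m_assoc)
    ultimately show ?thesis unfolding H_def by (intro image_eqI[of _ _ ?z]) simp_all
  qed
  ultimately have "H = carrier G" by (rule sub)
  have "\<exists>y. good y \<and> ?ev y = s" if "s \<in> S" for s
  proof -
    have "s \<in> ?ev ` {y. good y}" using \<open>H = carrier G\<close> S(1) that unfolding H_def by blast
    then show ?thesis by (rule imageE) (intro exI conjI, auto)
  qed
  then obtain y where y: "\<And>s. s \<in> S \<Longrightarrow> good (y s)" "\<And>s. s \<in> S \<Longrightarrow> ?ev (y s) = s"
    using bchoice[of S "\<lambda>s y. good y \<and> ?ev y = s"] by auto
  define R where "R = (\<lambda>s. (s, True) # inverse_word (y s)) ` S"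
  show thesis
  proof (rule that[OF _ _ W(1)])
    show "finite R" using S(3) by (simp add: R_def)
    show "R \<subseteq> relators G S"
    proof
      fix w assume "w \<in> R"
      then obtain s where s: "s \<in> S" "w = (s, True) # inverse_word (y s)" by (auto simp: R_def)
      have "fst ` set (y s) \<subseteq> S" using y(1)[OF s(1)] by (simp add: good_def)
      then show "w \<in> relators G S"
        using s S(1) y(2)[OF s(1)] word_image_inverse[OF S', of "y s"]
        by (auto simp: relators_def fst_inverse_word word_image_Cons letter_image_def)
    qed
    fix c m s assume c: "\<And>i. i < r \<Longrightarrow> m dvd exponent_sum c (W i)" "\<And>w. w \<in> R \<Longrightarrow> m dvd exponent_sum c w" and s: "s \<in> S"
    have "m dvd exponent_sum c (y s)" using y(1)[OF s] c(1) by (simp add: good_def)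
    moreover have "m dvd exponent_sum c ((s, True) # inverse_word (y s))" using c(2) s by (simp add: R_def)
    then have "m dvd c s - exponent_sum c (y s)"
      by (simp add: exponent_sum_Cons exponent_sum_inverse_word)
    ultimately show "m dvd c s" using dvd_add[of m "c s - exponent_sum c (y s)" "exponent_sum c (y s)"] by simp
  qed
qed

context
  fixes \<sigma> :: "'i \<Rightarrow> 'a" and S :: "'i set" and m :: nat
  assumes \<sigma>: "\<sigma> ` S \<subseteq> carrier G" and m: "0 < m"
begin

lemma fox_mod:
  assumes "fst ` set w \<subseteq> S" "x \<in> carrier G"
  shows "int m dvd fox G \<sigma> (\<lambda>z\<in>S \<times> carrier G. u z mod int m) w x \<longleftrightarrow> int m dvd fox G \<sigma> u w x"
proof -
  have "[fox G \<sigma> (\<lambda>z\<in>S \<times> carrier G. u z mod int m) w x = fox G \<sigma> u w x] (mod int m)"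
    by (rule fox_cong_mod[OF \<sigma> assms]) simp
  then show ?thesis by (rule cong_dvd_iff)
qed

lemma subgroup_fox_solutions:
  assumes R: "\<And>w. w \<in> R \<Longrightarrow> fst ` set w \<subseteq> S"
  shows "subgroup (fox_solutions G \<sigma> S R m) (product_group (S \<times> carrier G) (\<lambda>_. integer_mod_group m))"
    (is "subgroup ?N ?E")
proof -
  have E: "group ?E" by simp
  have car: "carrier (integer_mod_group m) = {0..<int m}" using m by (simp add: carrier_integer_mod_group)
  have carE: "carrier ?E = S \<times> carrier G \<rightarrow>\<^sub>E {0..<int m}" by (simp add: car)
  have mem: "(\<lambda>z\<in>S \<times> carrier G. u z mod int m) \<in> ?N" if "\<And>w x. w \<in> R \<Longrightarrow> x \<in> carrier G \<Longrightarrow> int m dvd fox G \<sigma> u w x" for u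
    using that m R by (auto simp: fox_solutions_def fox_mod)
  show ?thesis
  proof (rule group.subgroupI[OF E])
    show NE: "?N \<subseteq> carrier ?E" unfolding carE fox_solutions_def by blast
    show "?N \<noteq> {}" using mem[of "\<lambda>_. 0"] fox_diff[of \<sigma> "\<lambda>_. 0::int" "\<lambda>_. 0"] by fastforce
    fix u assume u: "u \<in> ?N"
    have "inv\<^bsub>?E\<^esub> u = (\<lambda>z\<in>S \<times> carrier G. inv\<^bsub>integer_mod_group m\<^esub> u z)"
      using u NE by (intro inv_product_group) auto
    also have "\<dots> = (\<lambda>z\<in>S \<times> carrier G. (- u z) mod int m)"
    proof (rule restrict_ext)
      fix z assume "z \<in> S \<times> carrier G"
      then have "u z \<in> {0..<int m}" using u by (auto simp: fox_solutions_def)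
      then show "inv\<^bsub>integer_mod_group m\<^esub> u z = (- u z) mod int m" using car by simp
    qed
    finally show "inv\<^bsub>?E\<^esub> u \<in> ?N"
      using u mem[of "\<lambda>z. - u z"] by (simp add: fox_solutions_def fox_minus)
    fix v assume v: "v \<in> ?N"
    show "u \<otimes>\<^bsub>?E\<^esub> v \<in> ?N"
      using u v mem[of "\<lambda>z. u z + v z"] by (simp add: fox_solutions_def fox_add)
  qed
qed

text \<open>A Nakayama-type argument. The solutions form a finite \<open>p\<close>-group on which
  the group acts by right translation; if it is nontrivial, there is a nonzero invariant solution.
  An invariant solution is constant on each copy of the group, its equations are conditions on
  exponent sums, and these force it to be zero.\<close>

lemma fox_solutions_trivial:
  assumes fin: "finite (carrier G)" "card (carrier G) = p ^ s" "prime (p::nat)" and mp: "m = p ^ k" and S: "finite S"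
    and R: "\<And>w. w \<in> R \<Longrightarrow> fst ` set w \<subseteq> S"
    and cs: "\<And>c s. (\<And>w. w \<in> R \<Longrightarrow> int m dvd exponent_sum c w) \<Longrightarrow> s \<in> S \<Longrightarrow> int m dvd c s"
  shows "fox_solutions G \<sigma> S R m = {\<lambda>z\<in>S \<times> carrier G. 0}"
proof (rule ccontr)
  let ?N = "fox_solutions G \<sigma> S R m" and ?X = "S \<times> carrier G"
  let ?E = "product_group ?X (\<lambda>_. integer_mod_group m)" and ?o = "\<lambda>z\<in>?X. 0::int"
  assume ne: "?N \<noteq> {?o}"
  have sg: "subgroup ?N ?E" by (rule subgroup_fox_solutions[OF R])
  have E: "group ?E" by simp
  have o: "?o \<in> ?N" using subgroup.one_closed[OF sg] by simp
  have finE: "finite (?X \<rightarrow>\<^sub>E {0..<int m})" using fin(1) S by (intro finite_PiE) auto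
  have carE: "carrier ?E = ?X \<rightarrow>\<^sub>E {0..<int m}" using m by (simp add: carrier_integer_mod_group)
  have finN: "finite ?N" using finE by (rule rev_finite_subset) (auto simp: fox_solutions_def)
  have "card (rcosets\<^bsub>?E\<^esub> ?N) * card ?N = card (?X \<rightarrow>\<^sub>E {0..<int m})"
    using group.lagrange_finite[OF E _ sg] finE unfolding carE Coset.order_def by simp
  also have "\<dots> = p ^ (k * card ?X)"
    using fin(1) S by (simp add: card_PiE mp power_mult del: of_nat_power)
  finally have "card ?N dvd p ^ (k * card ?X)" by (metis dvd_triv_right)
  then obtain j where j: "card ?N = p ^ j" using fin(3) by (auto simp: divides_primepow_nat)
  have "j \<noteq> 0"
  proof
    assume "j = 0"
    then obtain a where "?N = {a}" using j by (auto simp: card_1_singleton_iff)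
    then show False using o ne by auto
  qed
  then have dvd: "p dvd card ?N" using j by simp
  define act where "act g u = (\<lambda>(s, x)\<in>?X. u (s, x \<otimes> g) :: int)" for g and u :: "'i \<times> 'a \<Rightarrow> int"
  have act: "act g u (s, x) = u (s, x \<otimes> g)" if "s \<in> S" "x \<in> carrier G" for g u s x
    using that by (simp add: act_def)
  have a1: "act g u \<in> ?N" if g: "g \<in> carrier G" and u: "u \<in> ?N" for g u
  proof -
    have "u \<in> ?X \<rightarrow>\<^sub>E {0..<int m}" using u by (simp add: fox_solutions_def)
    then have "u (s, x \<otimes> g) \<in> {0..<int m}" if "s \<in> S" "x \<in> carrier G" for s x
      by (rule PiE_mem) (use that g in simp)
    then have "act g u \<in> ?X \<rightarrow>\<^sub>E {0..<int m}" by (auto simp: act_def)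
    moreover have "int m dvd fox G \<sigma> (act g u) w x" if "w \<in> R" "x \<in> carrier G" for w x
      using fox_translate[OF \<sigma> R[OF that(1)] that(2) g, of "act g u" u] act u that g
      by (simp add: fox_solutions_def)
    ultimately show ?thesis by (simp add: fox_solutions_def)
  qed
  have a2: "act \<one> u = u" if "u \<in> ?N" for u
  proof (rule ext)
    fix z show "act \<one> u z = u z"
      using that by (cases z) (auto simp: act_def fox_solutions_def PiE_def extensional_def)
  qed
  have a3: "act (g \<otimes> h) u = act g (act h u)" if "g \<in> carrier G" "h \<in> carrier G" for g h u
    using that unfolding act_def by (intro restrict_ext) (auto simp: m_assoc)
  have a4: "act g ?o = ?o" if "g \<in> carrier G" for g
    using that unfolding act_def by (intro restrict_ext) auto
  have "\<exists>u. u \<in> ?N \<and> u \<noteq> ?o \<and> (\<forall>g\<in>carrier G. act g u = u)"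
  proof (rule p_group_second_fixed_point[where act = act and X = ?N and ?x0.0 = ?o, OF is_group fin finN dvd a1 a2 a3 o a4])
    fix u assume "u \<in> ?N" "u \<noteq> ?o" "\<And>g. g \<in> carrier G \<Longrightarrow> act g u = u"
    then show ?thesis by blast
  qed
  then obtain u where u: "u \<in> ?N" "u \<noteq> ?o" "\<And>g. g \<in> carrier G \<Longrightarrow> act g u = u" by auto
  define c where "c s = u (s, \<one>)" for s
  have uc: "u (s, x) = c s" if "s \<in> S" "x \<in> carrier G" for s x
  proof -
    have "c s = act x u (s, \<one>)" unfolding c_def u(3)[OF that(2)] ..
    then show ?thesis using act[OF that(1) one_closed] that(2) by simp
  qed
  have "int m dvd exponent_sum c w" if "w \<in> R" for w
  proof -
    have "fox G \<sigma> u w \<one> = exponent_sum c w" by (rule fox_constant[OF \<sigma> R[OF that] one_closed]) (rule uc)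
    moreover have "int m dvd fox G \<sigma> u w \<one>" using u(1) that one_closed unfolding fox_solutions_def by blast
    ultimately show ?thesis by simp
  qed
  then have dc: "int m dvd c s" if "s \<in> S" for s by (rule cs[OF _ that])
  have "c s = 0" if "s \<in> S" for s
  proof -
    have "c s \<in> {0..<int m}" unfolding c_def
      by (rule PiE_mem[of u ?X]) (use u(1) that in \<open>auto simp: fox_solutions_def\<close>)
    then show ?thesis using zdvd_imp_le[OF dc[OF that]] by force
  qed
  then have "u = ?o"
    using u(1) uc by (intro PiE_ext[of u ?X "\<lambda>_. UNIV" ?o]) (auto simp: fox_solutions_def PiE_def)
  then show False using u(2) by simp
qed

text \<open>A solution is mapped to its Fox values along the \<open>r\<close> words
  \<open>W i\<close>. Two solutions with the same image differ by a solution for the enlarged set of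
  words, which is zero by the previous lemma.\<close>

lemma card_fox_solutions_le:
  assumes fin: "finite (carrier G)" "card (carrier G) = p ^ s" "prime (p::nat)" and mp: "m = p ^ k" and S: "finite S"
    and R: "\<And>w. w \<in> R \<Longrightarrow> fst ` set w \<subseteq> S" and W: "\<And>i. i < r \<Longrightarrow> fst ` set (W i) \<subseteq> S"
    and cs: "\<And>c s. (\<And>i. i < r \<Longrightarrow> int m dvd exponent_sum c (W i)) \<Longrightarrow>
      (\<And>w. w \<in> R \<Longrightarrow> int m dvd exponent_sum c w) \<Longrightarrow> s \<in> S \<Longrightarrow> int m dvd c s"
  shows "card (fox_solutions G \<sigma> S R m) \<le> m ^ (r * card (carrier G))"
proof -
  let ?N = "fox_solutions G \<sigma> S R m" and ?X = "S \<times> carrier G"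
  let ?Y = "{..<r} \<times> carrier G \<rightarrow>\<^sub>E {0..<int m}"
  have triv: "fox_solutions G \<sigma> S (R \<union> W ` {..<r}) m = {\<lambda>z\<in>?X. 0}"
    by (rule fox_solutions_trivial[OF fin mp S]) (use R W cs in auto)
  define \<Phi> where "\<Phi> u = (\<lambda>(i, x)\<in>{..<r} \<times> carrier G. fox G \<sigma> u (W i) x mod int m)" for u :: "'i \<times> 'a \<Rightarrow> int"
  have im: "\<Phi> ` ?N \<subseteq> ?Y" using m by (intro image_subsetI) (auto simp: \<Phi>_def)
  have inj: "inj_on \<Phi> ?N"
  proof (rule inj_onI)
    fix u v assume u: "u \<in> ?N" and v: "v \<in> ?N" and eq: "\<Phi> u = \<Phi> v"
    have "int m dvd fox G \<sigma> (\<lambda>z. u z - v z) w x" if "w \<in> R \<union> W ` {..<r}" "x \<in> carrier G" for w x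
      using that(1)
    proof
      assume "w \<in> R"
      then show ?thesis using u v that(2) by (simp add: fox_solutions_def fox_diff)
    next
      assume "w \<in> W ` {..<r}"
      then obtain i where i: "i < r" "w = W i" by auto
      have "fox G \<sigma> u (W i) x mod int m = fox G \<sigma> v (W i) x mod int m"
        using fun_cong[OF eq, of "(i, x)"] i that(2) by (simp add: \<Phi>_def)
      then show ?thesis by (simp add: fox_diff i(2) mod_eq_dvd_iff)
    qed
    moreover have "fst ` set w \<subseteq> S" if "w \<in> R \<union> W ` {..<r}" for w using that R W by auto
    ultimately have "(\<lambda>z\<in>?X. (u z - v z) mod int m) \<in> fox_solutions G \<sigma> S (R \<union> W ` {..<r}) m"
      using m by (simp add: fox_solutions_def fox_mod)
    then have eq0: "(\<lambda>z\<in>?X. (u z - v z) mod int m) = (\<lambda>z\<in>?X. 0)" unfolding triv by simp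
    have d: "(u z - v z) mod int m = 0" if "z \<in> ?X" for z
      using fun_cong[OF eq0, of z] that by simp
    have uv: "u \<in> ?X \<rightarrow>\<^sub>E {0..<int m}" "v \<in> ?X \<rightarrow>\<^sub>E {0..<int m}" using u v by (auto simp: fox_solutions_def)
    show "u = v"
    proof (rule PiE_ext[OF uv])
      fix z assume z: "z \<in> ?X"
      have "u z mod int m = v z mod int m"
        using d[OF z] unfolding mod_eq_dvd_iff by (rule mod_0_imp_dvd)
      moreover have "u z mod int m = u z" "v z mod int m = v z"
        using PiE_mem[OF uv(1) z] PiE_mem[OF uv(2) z] by (simp_all only: mod_pos_pos_trivial atLeastLessThan_iff)
      ultimately show "u z = v z" by simp
    qed
  qed
  have finZ: "finite ({..<r} \<times> carrier G)" using fin(1) by simp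
  then have "finite ?Y" by (rule finite_PiE) simp
  have "card ?N \<le> card ?Y" by (rule card_inj_on_le[OF inj im \<open>finite ?Y\<close>])
  also have "card ?Y = m ^ (r * card (carrier G))"
    unfolding card_PiE[OF finZ] prod_constant card_cartesian_product by simp
  finally show ?thesis .
qed

end

end

section \<open>Integer linear systems and eigenvalues\<close>

text \<open>Fraction-free elimination. The free coordinates are \<open>J\<close>, and \<open>Z / \<delta>\<close> expresses all
  coordinates of a solution through the free ones; for solutions modulo an ideal this holds after
  multiplication by \<open>\<delta>\<close>.\<close>

definition solves :: "('x \<Rightarrow> int) set \<Rightarrow> 'x set \<Rightarrow> ('r::comm_ring_1 \<Rightarrow> bool) \<Rightarrow> ('x \<Rightarrow> 'r) \<Rightarrow> bool" where
  "solves R X N u \<longleftrightarrow> (\<forall>a\<in>R. N (\<Sum>x\<in>X. of_int (a x) * u x))"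

definition expressed :: "('x \<Rightarrow> int) set \<Rightarrow> 'x set \<Rightarrow> 'x set \<Rightarrow> int \<Rightarrow> ('x \<Rightarrow> 'x \<Rightarrow> int) \<Rightarrow> ('r::comm_ring_1 \<Rightarrow> bool) \<Rightarrow> bool" where
  "expressed R X J \<delta> Z N \<longleftrightarrow> (\<forall>u. solves R X N u \<longrightarrow>
     (\<forall>x\<in>X. N (of_int \<delta> * u x - (\<Sum>j\<in>J. of_int (Z x j) * u j))))"

text \<open>Written through the free coordinates, the new equation becomes
  \<open>\<Sum>j. b j * u j\<close>. Multiplication by \<open>b j0\<close> allows solving for
  \<open>u j0\<close>. As \<open>N\<close> is membership in an ideal, one computation covers both
  equality over the complex numbers and divisibility by \<open>m\<close>.\<close>

lemma expressed_step:
  fixes N :: "'r::comm_ring_1 \<Rightarrow> bool" and a :: "'x \<Rightarrow> int"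
  assumes N: "\<And>a b. N a \<Longrightarrow> N b \<Longrightarrow> N (a + b)" "\<And>a c. N a \<Longrightarrow> N (c * a)" "N 0"
    and fin: "finite X" "finite J" and J: "j0 \<in> J"
    and ex: "expressed R X J \<delta> Z N"
  defines "b \<equiv> \<lambda>j. \<Sum>x\<in>X. a x * Z x j"
  shows "expressed (insert a R) X (J - {j0}) (b j0 * \<delta>) (\<lambda>x j. b j0 * Z x j - b j * Z x j0) N"
  unfolding expressed_def
proof (intro allI impI ballI)
  fix u :: "'x \<Rightarrow> 'r" and x assume u: "solves (insert a R) X N u" and x: "x \<in> X"
  define d where "d x = of_int \<delta> * u x - (\<Sum>j\<in>J. of_int (Z x j) * u j)" for x
  have d: "N (d y)" if "y \<in> X" for y
    using ex u that by (auto simp: expressed_def solves_def d_def)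
  have Nsum: "N (\<Sum>y\<in>F. of_int (a y) * d y)" if "F \<subseteq> X" for F
    using finite_subset[OF that fin(1)] that
  proof (induction F rule: finite_induct)
    case (insert y F)
    then show ?case using d N by simp
  qed (use N in simp)
  have au: "N (\<Sum>y\<in>X. of_int (a y) * u y)" using u by (simp add: solves_def)
  define w where "w y = (\<Sum>j\<in>J. of_int (Z y j) * u j)" for y
  have swap: "(\<Sum>y\<in>X. of_int (a y) * w y) = (\<Sum>j\<in>J. of_int (b j) * u j)"
    unfolding b_def w_def of_int_sum sum_distrib_left sum_distrib_right
    by (subst sum.swap) (simp add: mult.assoc)
  have "(\<Sum>y\<in>X. of_int (a y) * d y) = of_int \<delta> * (\<Sum>y\<in>X. of_int (a y) * u y) - (\<Sum>y\<in>X. of_int (a y) * w y)"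
    unfolding d_def w_def[symmetric] right_diff_distrib sum_subtractf sum_distrib_left
    by (simp add: mult.left_commute)
  then have bu: "(\<Sum>j\<in>J. of_int (b j) * u j) = of_int \<delta> * (\<Sum>y\<in>X. of_int (a y) * u y) + (- 1) * (\<Sum>y\<in>X. of_int (a y) * d y)"
    unfolding swap[symmetric] by simp
  have "N (\<Sum>j\<in>J. of_int (b j) * u j)"
    unfolding bu by (rule N(1)[OF N(2)[OF au] N(2)[OF Nsum[OF subset_refl]]])
  then have "N (of_int (b j0) * d x + of_int (Z x j0) * (\<Sum>j\<in>J. of_int (b j) * u j))"
    by (intro N(1) N(2) d x)
  moreover have "of_int (b j0) * d x + of_int (Z x j0) * (\<Sum>j\<in>J. of_int (b j) * u j)
    = of_int (b j0 * \<delta>) * u x - (\<Sum>j\<in>J. of_int (b j0 * Z x j - b j * Z x j0) * u j)"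
    unfolding d_def by (simp add: algebra_simps sum_distrib_left sum_subtractf sum.distrib)
  moreover have "(\<Sum>j\<in>J. of_int (b j0 * Z x j - b j * Z x j0) * u j) = (\<Sum>j\<in>J - {j0}. of_int (b j0 * Z x j - b j * Z x j0) * u j)"
    using sum.remove[OF fin(2) J, of "\<lambda>j. of_int (b j0 * Z x j - b j * Z x j0) * u j"] by simp
  ultimately show "N (of_int (b j0 * \<delta>) * u x - (\<Sum>j\<in>J - {j0}. of_int (b j0 * Z x j - b j * Z x j0) * u j))"
    by simp
qed

lemma expressed_antimono: "expressed R X J \<delta> Z N \<Longrightarrow> R \<subseteq> R' \<Longrightarrow> expressed R' X J \<delta> Z N"
  unfolding expressed_def solves_def by blast

lemma expressed_empty:
  fixes X :: "'a set" and N :: "'b::comm_ring_1 \<Rightarrow> bool"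
  assumes "finite X" "N 0"
  shows "expressed {} X X 1 (\<lambda>i j. if i = j then 1 else 0) N"
  unfolding expressed_def
proof (intro allI impI ballI)
  fix u :: "'a \<Rightarrow> 'b" and x assume x: "x \<in> X"
  have "(\<Sum>j\<in>X. of_int (if x = j then 1 else 0) * u j) = (\<Sum>j\<in>X. if x = j then u j else 0)"
    by (intro sum.cong) auto
  also have "\<dots> = u x" using x assms(1) by (simp add: sum.delta')
  finally show "N (of_int 1 * u x - (\<Sum>j\<in>X. of_int (if x = j then 1 else 0) * u j))"
    using assms(2) by simp
qed

text \<open>One equation at a time: either it is a consequence of the earlier ones or it removes one
  free coordinate. The point is that \<open>J\<close>, \<open>\<delta>\<close> and \<open>Z\<close>
  serve all moduli and the complex numbers simultaneously.\<close>

lemma integer_elimination: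
  assumes "finite X" "finite R"
  obtains J \<delta> Z where "J \<subseteq> X" "\<delta> \<noteq> 0" "\<And>i j. i \<in> J \<Longrightarrow> j \<in> J \<Longrightarrow> Z i j = (if i = j then \<delta> else 0)"
    "\<And>a j. a \<in> R \<Longrightarrow> j \<in> J \<Longrightarrow> (\<Sum>x\<in>X. a x * Z x j) = 0"
    "\<And>m. expressed R X J \<delta> Z (\<lambda>y. (m::int) dvd y)"
    "expressed R X J \<delta> Z (\<lambda>y::complex. y = 0)"
proof -
  define Pr where "Pr R J \<delta> Z \<longleftrightarrow> J \<subseteq> X \<and> \<delta> \<noteq> 0 \<and> (\<forall>i\<in>J. \<forall>j\<in>J. Z i j = (if i = j then \<delta> else 0))
    \<and> (\<forall>a\<in>R. \<forall>j\<in>J. (\<Sum>x\<in>X. a x * Z x j) = 0)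
    \<and> (\<forall>m. expressed R X J \<delta> Z (\<lambda>y. (m::int) dvd y)) \<and> expressed R X J \<delta> Z (\<lambda>y::complex. y = 0)"
    for R J \<delta> Z
  have "\<exists>J \<delta> Z. Pr R J \<delta> Z"
    using assms(2)
  proof (induction R rule: finite_induct)
    case empty
    show ?case
      by (intro exI[of _ X] exI[of _ 1] exI[of _ "\<lambda>i j. if i = j then 1 else 0"])
         (simp add: Pr_def expressed_empty[OF assms(1)])
  next
    case (insert a R)
    then obtain J \<delta> Z where "Pr R J \<delta> Z" by blast
    then have IH: "J \<subseteq> X" "\<delta> \<noteq> 0" "\<And>i j. i \<in> J \<Longrightarrow> j \<in> J \<Longrightarrow> Z i j = (if i = j then \<delta> else 0)"
      "\<And>a j. a \<in> R \<Longrightarrow> j \<in> J \<Longrightarrow> (\<Sum>x\<in>X. a x * Z x j) = 0"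
      "\<And>m. expressed R X J \<delta> Z (\<lambda>y. (m::int) dvd y)" "expressed R X J \<delta> Z (\<lambda>y::complex. y = 0)"
      unfolding Pr_def by blast+
    define b where "b j = (\<Sum>x\<in>X. a x * Z x j)" for j
    have finJ: "finite J" using IH(1) assms(1) finite_subset by blast
    show ?case
    proof (cases "\<forall>j\<in>J. b j = 0")
      case True
      have "expressed (insert a R) X J \<delta> Z (\<lambda>y. m dvd y)" for m :: int
        by (rule expressed_antimono[OF IH(5)]) blast
      moreover have "expressed (insert a R) X J \<delta> Z (\<lambda>y::complex. y = 0)"
        by (rule expressed_antimono[OF IH(6)]) blast
      ultimately show ?thesis
        using IH(1-4) True by (intro exI[of _ J] exI[of _ \<delta>] exI[of _ Z]) (auto simp: b_def Pr_def)
    next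
      case False
      then obtain j0 where j0: "j0 \<in> J" "b j0 \<noteq> 0" by blast
      let ?Z = "\<lambda>x j. b j0 * Z x j - b j * Z x j0"
      have bZ: "(\<Sum>x\<in>X. a' x * ?Z x j) = b j0 * (\<Sum>x\<in>X. a' x * Z x j) - b j * (\<Sum>x\<in>X. a' x * Z x j0)" for a' j
        by (simp add: right_diff_distrib sum_subtractf sum_distrib_left mult.left_commute)
      have "expressed (insert a R) X (J - {j0}) (b j0 * \<delta>) ?Z (\<lambda>y. m dvd y)" for m :: int
        unfolding b_def by (rule expressed_step) (use IH(5) assms(1) finJ j0 in auto)
      moreover have "expressed (insert a R) X (J - {j0}) (b j0 * \<delta>) ?Z (\<lambda>y::complex. y = 0)"
        unfolding b_def by (rule expressed_step) (use IH(6) assms(1) finJ j0 in auto)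
      moreover have "(\<Sum>x\<in>X. a' x * ?Z x j) = 0" if "a' \<in> insert a R" "j \<in> J - {j0}" for a' j
        using that IH(4) j0 unfolding bZ by (auto simp: b_def)
      moreover have "?Z i j = (if i = j then b j0 * \<delta> else 0)" if "i \<in> J - {j0}" "j \<in> J - {j0}" for i j
        using that IH(3) j0(1) by auto
      ultimately show ?thesis
        using IH(1,2) j0 by (intro exI[of _ "J - {j0}"] exI[of _ "b j0 * \<delta>"] exI[of _ ?Z]) (auto simp: Pr_def)
    qed
  qed
  then obtain J \<delta> Z where "Pr R J \<delta> Z" by blast
  then show thesis unfolding Pr_def by (elim conjE) (rule that; blast)
qed

section \<open>Counting solutions modulo prime powers\<close>

lemma card_le_fibres:
  assumes "finite A" "finite B" "f ` A \<subseteq> B" "\<And>b. b \<in> B \<Longrightarrow> card {a \<in> A. f a = b} \<le> n"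
  shows "card A \<le> card B * n"
proof -
  have "card A = (\<Sum>b\<in>B. card {a \<in> A. f a = b})"
    using sum.group[OF assms(1,2,3), of "\<lambda>_. 1::nat"] by simp
  also have "\<dots> \<le> card B * n" using sum_bounded_above[of B _ n] assms(4) by auto
  finally show ?thesis .
qed

text \<open>A solution is unique modulo \<open>m' = m / gcd \<delta> m\<close>, so it is determined
  by the quotient \<open>y div m'\<close>, which takes at most \<open>gcd \<delta> m\<close>
  values.\<close>

lemma card_linear_congruence_le:
  fixes \<delta> t :: int
  assumes "\<delta> \<noteq> 0" "0 < m"
  shows "card {y \<in> {0..<int m}. int m dvd \<delta> * y - t} \<le> nat \<bar>\<delta>\<bar>"
proof -
  define g where "g = gcd \<delta> (int m)"
  have g: "0 < g" "g dvd \<delta>" "g dvd int m" using assms by (auto simp: g_def)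
  define m' where "m' = int m div g"
  have m': "int m = m' * g" "0 < m'"
    using g assms(2) by (auto simp: m'_def pos_imp_zdiv_pos_iff zdvd_imp_le)
  let ?A = "{y \<in> {0..<int m}. int m dvd \<delta> * y - t}"
  have "inj_on (\<lambda>y. y div m') ?A"
  proof (rule inj_onI)
    fix y z assume y: "y \<in> ?A" and z: "z \<in> ?A" and eq: "y div m' = z div m'"
    have "int m dvd (\<delta> * y - t) - (\<delta> * z - t)" using y z by (intro dvd_diff[of _ "\<delta> * y - t" "\<delta> * z - t"]) auto
    then have "int m dvd \<delta> * (y - z)" by (simp add: right_diff_distrib)
    moreover obtain \<delta>' where \<delta>': "\<delta> = g * \<delta>'" using g by blast
    ultimately have "m' dvd \<delta>' * (y - z)" using g(1) m'(1) by (simp add: mult.assoc mult.commute[of m'])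
    moreover have "coprime (\<delta> div g) m'"
      unfolding g_def m'_def using assms(1) by (intro div_gcd_coprime) simp
    then have "coprime m' \<delta>'" using \<delta>' g(1) by (simp add: coprime_commute)
    ultimately have "m' dvd y - z" by (simp add: coprime_dvd_mult_right_iff)
    then have "y mod m' = z mod m'" by (simp add: mod_eq_dvd_iff)
    then show "y = z" using eq by (metis mult_div_mod_eq)
  qed
  moreover have "(\<lambda>y. y div m') ` ?A \<subseteq> {0..<g}"
  proof
    fix q assume "q \<in> (\<lambda>y. y div m') ` ?A"
    then obtain y where y: "0 \<le> y" "y < int m" "q = y div m'" by auto
    have "y div m' < g"
    proof (rule ccontr)
      assume "\<not> y div m' < g"
      then have "g * m' \<le> (y div m') * m'" using m'(2) by (intro mult_right_mono) auto
      also have "\<dots> = y - y mod m'" by (simp add: minus_mod_eq_div_mult)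
      also have "\<dots> \<le> y" using m'(2) by simp
      finally show False using y m'(1) by (simp add: mult.commute)
    qed
    then show "q \<in> {0..<g}" using y m'(2) by (simp add: pos_imp_zdiv_nonneg_iff)
  qed
  ultimately have "card ?A \<le> card {0..<g}" by (intro card_inj_on_le) auto
  also have "\<dots> \<le> nat \<bar>\<delta>\<bar>" using dvd_imp_le_int[OF assms(1) g(2)] g(1) by simp
  finally show ?thesis .
qed

text \<open>The factor \<open>b\<close> does not depend on \<open>k\<close>, so for large
  \<open>k\<close> it cannot make up for a smaller exponent. This removes the powers of
  \<open>\<delta>\<close> from the counts below.\<close>

lemma power_bound_exponent:
  fixes p :: nat
  assumes "2 \<le> p" "\<And>k. (p ^ k) ^ d \<le> (p ^ k) ^ e * b"
  shows "d \<le> e"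
proof (rule ccontr)
  assume "\<not> d \<le> e"
  then obtain n where n: "d = e + Suc n" using less_imp_Suc_add[of e d] by auto
  have "p ^ k \<le> b" for k
  proof -
    have "(p ^ k) ^ e * p ^ k \<le> (p ^ k) ^ e * (p ^ k) ^ Suc n"
      using assms(1) by (intro mult_le_mono2) (simp add: Suc_leI)
    also have "\<dots> = (p ^ k) ^ d" by (simp add: n power_add)
    also have "\<dots> \<le> (p ^ k) ^ e * b" by (rule assms(2))
    finally have "(p ^ k) ^ e * p ^ k \<le> (p ^ k) ^ e * b" .
    moreover have "0 < (p ^ k) ^ e" using assms(1) by simp
    ultimately show ?thesis using nat_mult_le_cancel1 by blast
  qed
  moreover have "b < p ^ b"
  proof -
    have "b < 2 ^ b" by (rule less_exp)
    also have "\<dots> \<le> p ^ b" using assms(1) by (rule power_mono) simp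
    finally show ?thesis .
  qed
  ultimately show False using not_le by blast
qed

lemma finite_linear_congruence: "finite {y \<in> {0..<int m}. P y}"
  by (rule finite_subset[of _ "{0..<int m}"]) auto

definition solutions :: "('x \<Rightarrow> int) set \<Rightarrow> 'x set \<Rightarrow> nat \<Rightarrow> ('x \<Rightarrow> int) set" where
  "solutions R X m = {u \<in> X \<rightarrow>\<^sub>E {0..<int m}. \<forall>a\<in>R. int m dvd (\<Sum>x\<in>X. a x * u x)}"

lemma finite_solutions: "finite X \<Longrightarrow> finite (solutions R X m)"
  unfolding solutions_def using finite_PiE[of X "\<lambda>_. {0..<int m}"] by simp

context
  fixes X :: "'x set" and R :: "('x \<Rightarrow> int) set" and J :: "'x set" and \<delta> :: int and Z :: "'x \<Rightarrow> 'x \<Rightarrow> int"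
  assumes X: "finite X" and J: "J \<subseteq> X" and \<delta>: "\<delta> \<noteq> 0"
    and diag: "\<And>i j. i \<in> J \<Longrightarrow> j \<in> J \<Longrightarrow> Z i j = (if i = j then \<delta> else 0)"
    and RZ: "\<And>a j. a \<in> R \<Longrightarrow> j \<in> J \<Longrightarrow> (\<Sum>x\<in>X. a x * Z x j) = 0"
    and ex: "\<And>m. expressed R X J \<delta> Z (\<lambda>y. (m::int) dvd y)"
begin

lemma finite_J: "finite J" using J X finite_subset by blast

text \<open>There are \<open>m ^ card J\<close> restrictions to the free coordinates, and over each
  of them every coordinate solves a linear congruence with leading coefficient
  \<open>\<delta>\<close>.\<close>

lemma card_solutions_le:
  assumes m: "0 < m"
  shows "card (solutions R X m) \<le> m ^ card J * nat \<bar>\<delta>\<bar> ^ card X"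
proof -
  have "card (solutions R X m) \<le> card (J \<rightarrow>\<^sub>E {0..<int m}) * nat \<bar>\<delta>\<bar> ^ card X"
  proof (rule card_le_fibres[where f = "\<lambda>u. restrict u J"])
    show "(\<lambda>u. restrict u J) ` solutions R X m \<subseteq> J \<rightarrow>\<^sub>E {0..<int m}"
      using J by (fastforce simp: solutions_def PiE_iff)
    fix v
    define t where "t x = (\<Sum>j\<in>J. Z x j * v j)" for x
    have "{u \<in> solutions R X m. restrict u J = v} \<subseteq> Pi\<^sub>E X (\<lambda>x. {y \<in> {0..<int m}. int m dvd \<delta> * y - t x})"
    proof
      fix u assume u: "u \<in> {u \<in> solutions R X m. restrict u J = v}"
      then have "solves R X (\<lambda>y. int m dvd y) u" by (simp add: solves_def solutions_def)
      then have "int m dvd \<delta> * u x - (\<Sum>j\<in>J. Z x j * u j)" if "x \<in> X" for x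
        using ex[of "int m"] that by (simp add: expressed_def)
      moreover have "(\<Sum>j\<in>J. Z x j * u j) = t x" for x
        unfolding t_def using u by (intro sum.cong) (auto simp: restrict_def)
      ultimately show "u \<in> Pi\<^sub>E X (\<lambda>x. {y \<in> {0..<int m}. int m dvd \<delta> * y - t x})"
        using u by (auto simp: solutions_def PiE_iff)
    qed
    then have "card {u \<in> solutions R X m. restrict u J = v} \<le> card (Pi\<^sub>E X (\<lambda>x. {y \<in> {0..<int m}. int m dvd \<delta> * y - t x}))"
      by (intro card_mono finite_PiE X finite_linear_congruence)
    also have "\<dots> = (\<Prod>x\<in>X. card {y \<in> {0..<int m}. int m dvd \<delta> * y - t x})" by (rule card_PiE[OF X])
    also have "\<dots> \<le> (\<Prod>x\<in>X. nat \<bar>\<delta>\<bar>)" by (intro prod_mono conjI card_linear_congruence_le \<delta> m) auto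
    finally show "card {u \<in> solutions R X m. restrict u J = v} \<le> nat \<bar>\<delta>\<bar> ^ card X" by simp
  qed (use finite_solutions[OF X] finite_PiE[OF finite_J, of "\<lambda>_. {0..<int m}"] in auto)
  then show ?thesis by (simp add: card_PiE[OF finite_J])
qed

text \<open>Arbitrary values \<open>v\<close> on the free coordinates produce the solution
  \<open>Z v\<close>. On \<open>J\<close> this map is multiplication by \<open>\<delta>\<close>,
  which bounds its fibres.\<close>

lemma card_solutions_ge:
  assumes m: "0 < m"
  shows "m ^ card J \<le> card (solutions R X m) * nat \<bar>\<delta>\<bar> ^ card J"
proof -
  define f where "f v = (\<lambda>x\<in>X. (\<Sum>j\<in>J. Z x j * v j) mod int m)" for v :: "'x \<Rightarrow> int"
  have "card (J \<rightarrow>\<^sub>E {0..<int m}) \<le> card (solutions R X m) * nat \<bar>\<delta>\<bar> ^ card J"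
  proof (rule card_le_fibres[where f = f])
    show "f ` (J \<rightarrow>\<^sub>E {0..<int m}) \<subseteq> solutions R X m"
    proof
      fix u assume "u \<in> f ` (J \<rightarrow>\<^sub>E {0..<int m})"
      then obtain v where u: "u = f v" by blast
      have "int m dvd (\<Sum>x\<in>X. a x * u x)" if "a \<in> R" for a
      proof -
        let ?s = "\<lambda>x. \<Sum>j\<in>J. Z x j * v j"
        have "int m dvd a x * u x - a x * ?s x" if "x \<in> X" for x
        proof -
          have "int m dvd u x - ?s x" using that by (simp add: u f_def mod_eq_dvd_iff[symmetric])
          then show ?thesis by (simp add: right_diff_distrib[symmetric])
        qed
        then have "int m dvd (\<Sum>x\<in>X. a x * u x) - (\<Sum>x\<in>X. a x * ?s x)"
          unfolding sum_subtractf[symmetric] by (intro dvd_sum)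
        also have "(\<Sum>x\<in>X. a x * ?s x) = (\<Sum>j\<in>J. (\<Sum>x\<in>X. a x * Z x j) * v j)"
          unfolding sum_distrib_left sum_distrib_right by (subst sum.swap) (simp add: mult.assoc)
        also have "\<dots> = 0" using RZ[OF that] by simp
        finally show ?thesis by simp
      qed
      then show "u \<in> solutions R X m" using m by (auto simp: solutions_def u f_def)
    qed
    fix u
    have "{v \<in> J \<rightarrow>\<^sub>E {0..<int m}. f v = u} \<subseteq> Pi\<^sub>E J (\<lambda>j. {y \<in> {0..<int m}. int m dvd \<delta> * y - u j})"
    proof
      fix v assume v: "v \<in> {v \<in> J \<rightarrow>\<^sub>E {0..<int m}. f v = u}"
      have "int m dvd \<delta> * v j - u j" if j: "j \<in> J" for j
      proof -
        have "(\<Sum>i\<in>J. Z j i * v i) = (\<Sum>i\<in>J. if j = i then \<delta> * v i else 0)"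
          using diag[OF j] by (intro sum.cong) auto
        also have "\<dots> = \<delta> * v j" using j finite_J by (simp add: sum.delta')
        finally have "u j = (\<delta> * v j) mod int m" using v j J by (auto simp: f_def)
        then show ?thesis by (simp add: mod_eq_dvd_iff[symmetric])
      qed
      then show "v \<in> Pi\<^sub>E J (\<lambda>j. {y \<in> {0..<int m}. int m dvd \<delta> * y - u j})"
        using v by (auto simp: PiE_iff)
    qed
    then have "card {v \<in> J \<rightarrow>\<^sub>E {0..<int m}. f v = u} \<le> card (Pi\<^sub>E J (\<lambda>j. {y \<in> {0..<int m}. int m dvd \<delta> * y - u j}))"
      by (intro card_mono finite_PiE finite_J finite_linear_congruence)
    also have "\<dots> = (\<Prod>j\<in>J. card {y \<in> {0..<int m}. int m dvd \<delta> * y - u j})" by (rule card_PiE[OF finite_J])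
    also have "\<dots> \<le> (\<Prod>j\<in>J. nat \<bar>\<delta>\<bar>)" by (intro prod_mono conjI card_linear_congruence_le \<delta> m) auto
    finally show "card {v \<in> J \<rightarrow>\<^sub>E {0..<int m}. f v = u} \<le> nat \<bar>\<delta>\<bar> ^ card J" by simp
  qed (use finite_solutions[OF X] finite_PiE[OF finite_J, of "\<lambda>_. {0..<int m}"] in auto)
  then show ?thesis by (simp add: card_PiE[OF finite_J])
qed

lemma free_rank_ge:
  assumes "2 \<le> p" "\<And>k. (p ^ k) ^ d \<le> card (solutions R X (p ^ k))"
  shows "d \<le> card J"
  by (rule power_bound_exponent[OF assms(1)]) (rule order.trans[OF assms(2) card_solutions_le], use assms(1) in simp)

lemma free_rank_le:
  assumes "2 \<le> p" "\<And>k. card (solutions R X (p ^ k)) \<le> (p ^ k) ^ d"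
  shows "card J \<le> d"
  by (rule power_bound_exponent[OF assms(1)])
     (rule order.trans[OF card_solutions_ge mult_le_mono1[OF assms(2)]], use assms(1) in simp)

end

section \<open>Traces, triangular form and spectral estimates\<close>

definition mtrace :: "'a::comm_ring_1 mat \<Rightarrow> 'a" where
  "mtrace A = (\<Sum>i<dim_row A. A $$ (i, i))"

lemma mtrace_mult_comm:
  assumes "A \<in> carrier_mat n m" "B \<in> carrier_mat m n"
  shows "mtrace (A * B) = mtrace (B * A)"
proof -
  have "mtrace (A * B) = (\<Sum>i<n. \<Sum>j<m. A $$ (i, j) * B $$ (j, i))"
    using assms by (auto simp: mtrace_def scalar_prod_def lessThan_atLeast0 intro!: sum.cong)
  also have "\<dots> = (\<Sum>j<m. \<Sum>i<n. B $$ (j, i) * A $$ (i, j))"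
    by (subst sum.swap) (simp add: mult.commute)
  also have "\<dots> = mtrace (B * A)"
    using assms by (auto simp: mtrace_def scalar_prod_def lessThan_atLeast0 intro!: sum.cong)
  finally show ?thesis .
qed

lemma mtrace_similar:
  assumes "similar_mat_wit A B P Q"
  shows "mtrace A = mtrace B"
proof -
  define n where "n = dim_row A"
  note w = similar_mat_witD[OF n_def assms]
  have "mtrace A = mtrace (P * (B * Q))" using w by (simp add: assoc_mult_mat[of _ n n _ n _ n])
  also have "\<dots> = mtrace (B * Q * P)" using w by (intro mtrace_mult_comm[of _ n n]) auto
  also have "B * Q * P = B" using w by (simp add: assoc_mult_mat[of _ n n _ n _ n])
  finally show ?thesis .
qed

lemma upper_triangular_mult:
  fixes A B :: "'a::comm_ring_1 mat"
  assumes A: "A \<in> carrier_mat n n" "upper_triangular A" and B: "B \<in> carrier_mat n n" "upper_triangular B"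
  shows "upper_triangular (A * B)" "i < n \<Longrightarrow> (A * B) $$ (i, i) = A $$ (i, i) * B $$ (i, i)"
proof -
  have z: "A $$ (i, k) * B $$ (k, j) = 0" if "i < n" "j < n" "k < n" "k < i \<or> j < k" for i j k
    using that A B upper_triangularD[OF A(2), of k i] upper_triangularD[OF B(2), of j k] by auto
  show "upper_triangular (A * B)"
  proof
    fix i j assume ij: "j < i" "i < dim_row (A * B)"
    then have "A $$ (i, k) * B $$ (k, j) = 0" if "k < n" for k
      using z[of i j k] A that by (metis carrier_matD(1) index_mult_mat(2) less_trans linorder_neqE_nat)
    then show "(A * B) $$ (i, j) = 0"
      using ij A B by (auto simp: scalar_prod_def intro!: sum.neutral)
  qed
  assume i: "i < n"
  have "(A * B) $$ (i, i) = (\<Sum>k\<in>{0..<n}. A $$ (i, k) * B $$ (k, i))"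
    using i A B by (auto simp: scalar_prod_def)
  also have "\<dots> = (\<Sum>k\<in>{i}. A $$ (i, k) * B $$ (k, i))"
    using i z[OF i i] by (intro sum.mono_neutral_right) (auto simp: nat_neq_iff)
  finally show "(A * B) $$ (i, i) = A $$ (i, i) * B $$ (i, i)" by simp
qed

lemma upper_triangular_pow:
  fixes A :: "'a::comm_ring_1 mat"
  assumes A: "A \<in> carrier_mat n n" "upper_triangular A"
  shows "upper_triangular (A ^\<^sub>m k) \<and> (\<forall>i<n. (A ^\<^sub>m k) $$ (i, i) = (A $$ (i, i)) ^ k)"
proof (induction k)
  case 0
  then show ?case using A by (auto simp: upper_triangular_one)
next
  case (Suc k)
  have "A ^\<^sub>m k \<in> carrier_mat n n" using A by simp
  then show ?case using Suc upper_triangular_mult[of "A ^\<^sub>m k" n A] A by (auto simp: mult.commute)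
qed

text \<open>The lowest nonvanishing coefficient of a split polynomial is, up to sign, the product of
  its nonzero roots.\<close>

lemma coeff_prod_list_linear:
  fixes ls :: "'a::idom list"
  shows "Polynomial.coeff (\<Prod>a\<leftarrow>ls. [:- a, 1:]) (length (filter (\<lambda>a. a = 0) ls))
    = (\<Prod>a\<leftarrow>filter (\<lambda>a. a \<noteq> 0) ls. - a)"
proof -
  have *: "(\<Prod>a\<leftarrow>ls. [:- a, 1:]) = Polynomial.monom 1 (length (filter (\<lambda>a. a = 0) ls)) * (\<Prod>a\<leftarrow>filter (\<lambda>a. a \<noteq> 0) ls. [:- a, 1:])"
  proof (induction ls)
    case (Cons a ls)
    let ?m = "Polynomial.monom (1::'a) (length (filter (\<lambda>a. a = 0) ls))" and ?R = "\<Prod>a\<leftarrow>filter (\<lambda>a. a \<noteq> 0) ls. [:- a, 1:]"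
    have "(\<Prod>a\<leftarrow>a # ls. [:- a, 1:]) = [:- a, 1:] * (?m * ?R)" using Cons by simp
    also have "\<dots> = Polynomial.monom 1 (length (filter (\<lambda>a. a = 0) (a # ls))) * (\<Prod>a\<leftarrow>filter (\<lambda>a. a \<noteq> 0) (a # ls). [:- a, 1:])"
    proof (cases "a = 0")
      case False
      then show ?thesis using mult.left_commute[of "[:- a, 1:]" ?m ?R] by (simp del: mult_pCons_left)
    qed (simp add: monom_Suc)
    finally show ?case .
  qed simp
  have "Polynomial.coeff (\<Prod>a\<leftarrow>bs. [:- a, 1:]) 0 = (\<Prod>a\<leftarrow>bs. - a)" for bs :: "'a list"
    by (induction bs) (auto simp: mult.commute poly_0_coeff_0[symmetric])
  then show ?thesis unfolding * by (simp add: coeff_monom_mult)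
qed

lemma poly_prod_list_linear_root: "a \<in> set es \<Longrightarrow> poly (\<Prod>b\<leftarrow>es. [:- b, 1:]) (a::'a::idom) = 0"
  by (induction es) auto

text \<open>The Schur form triangularises \<open>T\<close> and \<open>C\<close> simultaneously, so
  the trace of each power of \<open>C\<close> is a sum over the eigenvalues \<open>ls\<close>,
  listed with multiplicity. The product of the nonzero ones is up to sign a coefficient of the
  integral characteristic polynomial; being nonzero and nonnegative, it is at least 1.\<close>

lemma integer_positive_trace_powers:
  fixes T0 :: "int mat" and K :: real
  assumes T0: "T0 \<in> carrier_mat N N"
  defines "T \<equiv> map_mat complex_of_int T0"
  assumes ev: "\<And>\<mu>. eigenvalue T \<mu> \<Longrightarrow> \<exists>l. \<mu> = complex_of_real l \<and> 0 \<le> l \<and> l \<le> K"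
  defines "C \<equiv> mat N N (\<lambda>(i, j). (if i = j then 1 else 0) - T $$ (i, j) / complex_of_real K)"
  obtains ls where "length ls = N" "\<And>l. l \<in> set ls \<Longrightarrow> 0 \<le> l \<and> l \<le> K"
    "\<And>k. mtrace (C ^\<^sub>m k) = complex_of_real (\<Sum>l\<leftarrow>ls. (1 - l / K) ^ k)"
    "1 \<le> (\<Prod>l\<leftarrow>filter (\<lambda>l. l \<noteq> 0) ls. l)"
proof -
  have T: "T \<in> carrier_mat N N" using T0 by (simp add: T_def)
  obtain es where es: "char_poly T = (\<Prod>a\<leftarrow>es. [:- a, 1:])" "length es = N"
    using char_poly_factorized[OF T] by blast
  obtain B P Q where sd: "schur_decomposition T es = (B, P, Q)" by (cases "schur_decomposition T es") auto
  have wit: "similar_mat_wit T B P Q" and ut: "upper_triangular B" and dg: "diag_mat B = es"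
    using schur_decomposition[OF T es(1) sd] by auto
  note w = similar_mat_witD2[OF T wit]
  have "\<exists>l. a = complex_of_real l \<and> 0 \<le> l \<and> l \<le> K" if "a \<in> set es" for a
  proof -
    have "poly (char_poly T) a = 0" unfolding es(1) using that by (rule poly_prod_list_linear_root)
    then have "eigenvalue T a" by (simp only: eigenvalue_root_char_poly[OF T])
    then show ?thesis by (rule ev)
  qed
  then have "\<forall>a\<in>set es. \<exists>l. a = complex_of_real l \<and> 0 \<le> l \<and> l \<le> K" by blast
  from bchoice[OF this] obtain f where f: "\<And>a. a \<in> set es \<Longrightarrow> a = complex_of_real (f a) \<and> 0 \<le> f a \<and> f a \<le> K"
    by blast
  define ls where "ls = map f es"
  have es_ls: "es = map complex_of_real ls" unfolding ls_def map_map comp_def by (rule map_idI[symmetric]) (use f in simp)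
  have Bii: "B $$ (i, i) = complex_of_real (ls ! i)" if "i < N" for i
  proof -
    have "B $$ (i, i) = diag_mat B ! i" using that w(5) by (simp add: diag_mat_def)
    also have "\<dots> = map complex_of_real ls ! i" by (simp only: dg es_ls[symmetric])
    also have "\<dots> = complex_of_real (ls ! i)" using that es(2) by (simp add: ls_def)
    finally show ?thesis .
  qed
  define B' where "B' = mat N N (\<lambda>(i, j). (if i = j then 1 else 0) - B $$ (i, j) / complex_of_real K)"
  have C: "C \<in> carrier_mat N N" and B': "B' \<in> carrier_mat N N" by (simp_all add: C_def B'_def)
  have Ceq: "C = 1\<^sub>m N + (- 1 / complex_of_real K) \<cdot>\<^sub>m T" and B'eq: "B' = 1\<^sub>m N + (- 1 / complex_of_real K) \<cdot>\<^sub>m B"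
    using T w by (auto simp: C_def B'_def intro!: eq_matI)
  let ?c = "- 1 / complex_of_real K"
  have cB: "?c \<cdot>\<^sub>m B \<in> carrier_mat N N" and PB: "P * B \<in> carrier_mat N N" using w by auto
  have "P * B' = P + ?c \<cdot>\<^sub>m (P * B)"
    unfolding B'eq mult_add_distrib_mat[OF w(6) one_carrier_mat cB] mult_smult_distrib[OF w(6) w(5)]
    using w(6) by simp
  then have "P * B' * Q = P * Q + ?c \<cdot>\<^sub>m (P * B) * Q"
    by (simp only: add_mult_distrib_mat[OF w(6) smult_carrier_mat[OF PB] w(7)])
  also have "\<dots> = C"
    unfolding mult_smult_assoc_mat[OF PB w(7)] Ceq w(1) w(3)[symmetric] ..
  finally have "C = P * B' * Q" ..
  then have witC: "similar_mat_wit C B' P Q"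
    by (intro similar_mat_witI[OF w(1,2) _ C B' w(6,7)])
  have ut': "upper_triangular B'"
    using ut w by (auto simp: B'_def upper_triangular_def)
  have tr: "mtrace (C ^\<^sub>m k) = complex_of_real (\<Sum>l\<leftarrow>ls. (1 - l / K) ^ k)" for k
  proof -
    have "mtrace (C ^\<^sub>m k) = mtrace (B' ^\<^sub>m k)" by (rule mtrace_similar[OF similar_mat_wit_pow[OF witC]])
    also have "\<dots> = (\<Sum>i<N. (B' $$ (i, i)) ^ k)"
      unfolding mtrace_def using upper_triangular_pow[OF B' ut', of k] B' by (intro sum.cong) auto
    also have "\<dots> = (\<Sum>i<N. complex_of_real ((1 - ls ! i / K) ^ k))"
      using Bii by (intro sum.cong) (auto simp: B'_def)
    also have "\<dots> = complex_of_real (\<Sum>l\<leftarrow>ls. (1 - l / K) ^ k)"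
      using es(2) by (simp add: sum_list_sum_nth ls_def atLeast0LessThan)
    finally show ?thesis .
  qed
  have "1 \<le> (\<Prod>l\<leftarrow>filter (\<lambda>l. l \<noteq> 0) ls. l)"
  proof -
    define z where "z = length (filter (\<lambda>a. a = 0) es)"
    define c where "c = Polynomial.coeff (char_poly T0) z"
    have "char_poly T = map_poly complex_of_int (char_poly T0)"
      unfolding T_def by (rule of_int_hom.char_poly_hom[OF T0])
    then have "complex_of_int c = Polynomial.coeff (char_poly T) z" by (simp add: c_def)
    also have "\<dots> = (\<Prod>a\<leftarrow>filter (\<lambda>a. a \<noteq> 0) es. - a)"
      unfolding es(1) z_def by (rule coeff_prod_list_linear)
    also have "filter (\<lambda>a. a \<noteq> 0) es = map complex_of_real (filter (\<lambda>l. l \<noteq> 0) ls)"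
      unfolding es_ls by (simp add: filter_map comp_def)
    also have "(\<Prod>a\<leftarrow>map complex_of_real (filter (\<lambda>l. l \<noteq> 0) ls). - a)
      = complex_of_real (\<Prod>l\<leftarrow>filter (\<lambda>l. l \<noteq> 0) ls. - l)"
      by (induction ls) auto
    finally have c: "real_of_int c = (\<Prod>l\<leftarrow>filter (\<lambda>l. l \<noteq> 0) ls. - l)"
      by (metis of_real_eq_iff of_real_of_int_eq)
    have pos: "0 \<le> l" if "l \<in> set ls" for l using f that by (auto simp: ls_def)
    have abs: "\<bar>\<Prod>l\<leftarrow>filter (\<lambda>l. l \<noteq> 0) bs. - l\<bar> = (\<Prod>l\<leftarrow>filter (\<lambda>l. l \<noteq> 0) bs. l) \<and>
        (\<Prod>l\<leftarrow>filter (\<lambda>l. l \<noteq> 0) bs. l) \<noteq> 0" if "\<And>l. l \<in> set bs \<Longrightarrow> 0 \<le> l" for bs :: "real list"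
      using that by (induction bs) (auto simp: abs_mult)
    have "real_of_int \<bar>c\<bar> = (\<Prod>l\<leftarrow>filter (\<lambda>l. l \<noteq> 0) ls. l)" "c \<noteq> 0"
      using abs[OF pos] c by auto
    moreover have "1 \<le> \<bar>c\<bar>" using \<open>c \<noteq> 0\<close> by linarith
    ultimately show ?thesis by linarith
  qed
  moreover have "length ls = N" "\<And>l. l \<in> set ls \<Longrightarrow> 0 \<le> l \<and> l \<le> K"
    using es(2) f by (auto simp: ls_def)
  ultimately show thesis using that tr by blast
qed

text \<open>Two regimes separated by \<open>e\<close>. If \<open>x \<le> e\<close> then the left
  side is at most 1 and \<open>- ln x\<close> is at least \<open>- ln e\<close>. Otherwise
  \<open>k\<close> factors are at most \<open>1 - e\<close>, and the extra factor provided by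
  \<open>Suc k\<close> is absorbed by \<open>1 - x \<le> - ln x\<close>.\<close>

lemma power_le_log:
  assumes "0 < x" "x \<le> 1" "0 < e" "e < (1::real)"
  shows "(1 - x) ^ Suc k \<le> (1 / (- ln e) + (1 - e) ^ k) * (- ln x)"
proof (cases "x \<le> e")
  case True
  have "ln x \<le> ln e" using True assms by simp
  moreover have "ln e < 0" using assms by simp
  ultimately have "1 \<le> (1 / (- ln e)) * (- ln x)" by (simp add: field_simps)
  moreover have "0 \<le> (1 - e) ^ k * (- ln x)" using assms by (intro mult_nonneg_nonneg) auto
  moreover have "(1 - x) ^ Suc k \<le> 1" using assms by (intro power_le_one) auto
  ultimately show ?thesis unfolding distrib_right by linarith
next
  case False
  have "(1 - x) ^ Suc k = (1 - x) ^ k * (1 - x)" by simp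
  also have "\<dots> \<le> (1 - e) ^ k * (- ln x)"
    using False assms ln_le_minus_one[of x] by (intro mult_mono power_mono) auto
  also have "\<dots> \<le> (1 / (- ln e) + (1 - e) ^ k) * (- ln x)"
    unfolding distrib_right using assms by (simp add: divide_nonpos_neg mult_nonneg_nonneg)
  finally show ?thesis .
qed

text \<open>The heart of the approximation argument. The logarithmic weights
  \<open>ln (K / l)\<close> of the nonzero eigenvalues add up to at most
  \<open>length ls * ln K\<close>, because the product of these eigenvalues is at least 1. So the
  excess of the trace over the kernel dimension is bounded in terms of \<open>k\<close>,
  \<open>e\<close>, \<open>K\<close> and the size only.\<close>

lemma spectral_sum_bounds:
  fixes ls :: "real list" and K :: real
  assumes ls: "\<And>l. l \<in> set ls \<Longrightarrow> 0 \<le> l \<and> l \<le> K" and prod: "1 \<le> (\<Prod>l\<leftarrow>filter (\<lambda>l. l \<noteq> 0) ls. l)" and K: "1 \<le> K"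
  defines "z \<equiv> length (filter (\<lambda>l. l = 0) ls)"
  shows "real z \<le> (\<Sum>l\<leftarrow>ls. (1 - l / K) ^ k)"
    "0 < e \<Longrightarrow> e < 1 \<Longrightarrow> (\<Sum>l\<leftarrow>ls. (1 - l / K) ^ Suc k) \<le> real z + (1 / (- ln e) + (1 - e) ^ k) * (real (length ls) * ln K)"
    "(\<lambda>k. \<Sum>l\<leftarrow>ls. (1 - l / K) ^ k) \<longlonglongrightarrow> real z"
proof -
  have split: "(\<Sum>l\<leftarrow>bs. (1 - l / K) ^ k) = real (length (filter (\<lambda>l. l = 0) bs)) + (\<Sum>l\<leftarrow>filter (\<lambda>l. l \<noteq> 0) bs. (1 - l / K) ^ k)" for bs k
    by (induction bs) auto
  let ?nz = "filter (\<lambda>l. l \<noteq> 0) ls"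
  have nz: "0 < l \<and> l \<le> K" if "l \<in> set ?nz" for l
    using ls[of l] that unfolding set_filter mem_Collect_eq by (simp add: less_le)
  have "0 \<le> x" if x: "x \<in> set (map (\<lambda>l. (1 - l / K) ^ k) ?nz)" for x
  proof -
    obtain l where l: "l \<in> set ?nz" "x = (1 - l / K) ^ k" using x unfolding set_map by blast
    have "l / K \<le> 1" using nz[OF l(1)] K by simp
    then show ?thesis unfolding l(2) by (intro zero_le_power) simp
  qed
  then have "0 \<le> (\<Sum>l\<leftarrow>?nz. (1 - l / K) ^ k)" by (rule sum_list_nonneg)
  then show "real z \<le> (\<Sum>l\<leftarrow>ls. (1 - l / K) ^ k)" unfolding split[where bs = ls] z_def by simp
  have tends: "(\<lambda>k. \<Sum>l\<leftarrow>bs. (1 - l / K) ^ k) \<longlonglongrightarrow> 0" if "\<And>l. l \<in> set bs \<Longrightarrow> 0 < l \<and> l \<le> K" for bs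
    using that
  proof (induction bs)
    case (Cons a bs)
    have "0 < a / K" "a / K \<le> 1" using Cons.prems[of a] K by auto
    then have "(\<lambda>k. (1 - a / K) ^ k) \<longlonglongrightarrow> 0" by (intro LIMSEQ_realpow_zero) auto
    then show ?case using tendsto_add[OF _ Cons.IH] Cons.prems by fastforce
  qed simp
  show "(\<lambda>k. \<Sum>l\<leftarrow>ls. (1 - l / K) ^ k) \<longlonglongrightarrow> real z"
    unfolding split[where bs = ls] z_def using tendsto_add[OF tendsto_const tends[of ?nz, OF nz]] by simp
  assume e: "0 < e" "e < 1"
  define c where "c = 1 / (- ln e) + (1 - e) ^ k"
  have "ln e < 0" using e by simp
  then have "0 \<le> 1 / (- ln e)" by (intro divide_nonneg_nonneg) auto
  moreover have "0 \<le> (1 - e) ^ k" using e by simp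
  ultimately have c: "0 \<le> c" unfolding c_def by (rule add_nonneg_nonneg)
  have "(\<Sum>l\<leftarrow>?nz. (1 - l / K) ^ Suc k) \<le> (\<Sum>l\<leftarrow>?nz. c * (ln K - ln l))"
  proof (rule sum_list_mono)
    fix l assume "l \<in> set ?nz"
    then have l: "0 < l" "l \<le> K" using nz by auto
    then have "(1 - l / K) ^ Suc k \<le> c * (- ln (l / K))"
      unfolding c_def using K e by (intro power_le_log) auto
    then show "(1 - l / K) ^ Suc k \<le> c * (ln K - ln l)" using l K by (simp add: ln_div)
  qed
  also have "\<dots> = c * (real (length ?nz) * ln K - (\<Sum>l\<leftarrow>?nz. ln l))"
    by (induction ls) (simp_all add: algebra_simps)
  also have "\<dots> \<le> c * (real (length ls) * ln K)"
  proof (rule mult_left_mono[OF _ c])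
    have prod_pos: "0 < (\<Prod>l\<leftarrow>bs. l) \<and> ln (\<Prod>l\<leftarrow>bs. l) = (\<Sum>l\<leftarrow>bs. ln l)" if "\<And>l. l \<in> set bs \<Longrightarrow> 0 < l" for bs :: "real list"
      using that by (induction bs) (auto simp: ln_mult)
    have "0 \<le> ln (\<Prod>l\<leftarrow>?nz. l)" using prod by simp
    then have "0 \<le> (\<Sum>l\<leftarrow>?nz. ln l)" using prod_pos[of ?nz] nz by fastforce
    moreover have "real (length ?nz) * ln K \<le> real (length ls) * ln K"
      using K by (intro mult_right_mono) auto
    ultimately show "real (length ?nz) * ln K - (\<Sum>l\<leftarrow>?nz. ln l) \<le> real (length ls) * ln K" by linarith
  qed
  finally show "(\<Sum>l\<leftarrow>ls. (1 - l / K) ^ Suc k) \<le> real z + (1 / (- ln e) + (1 - e) ^ k) * (real (length ls) * ln K)"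
    unfolding split[where bs = ls] z_def c_def by (rule add_left_mono)
qed

section \<open>Square-summable functions\<close>

text \<open>All square-summable functions on the type; subsets are handled by conditions on the
  support. The type is made a real inner product space with the real part of the usual product,
  which suffices for traces; the complex structure is added by \<open>mult_i\<close>.\<close>

typedef 'x ell2 = "{f :: 'x \<Rightarrow> complex. (\<lambda>x. (cmod (f x))\<^sup>2) summable_on UNIV}"
  morphisms ell2_fun Ell2
  by (rule exI[of _ "\<lambda>_. 0"]) simp

setup_lifting type_definition_ell2

lemma ell2_fun_summable: "(\<lambda>x. (cmod (ell2_fun f x))\<^sup>2) summable_on A"
  using ell2_fun[of f] summable_on_subset_banach[of _ UNIV A] by auto

lemma square_summable_add:
  assumes "(\<lambda>x. (cmod (f x))\<^sup>2) summable_on A" "(\<lambda>x. (cmod (g x))\<^sup>2) summable_on A"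
  shows "(\<lambda>x. (cmod (f x + g x))\<^sup>2) summable_on A"
proof (rule summable_on_comparison_test[of "\<lambda>x. 2 * (cmod (f x))\<^sup>2 + 2 * (cmod (g x))\<^sup>2"])
  show "(\<lambda>x. 2 * (cmod (f x))\<^sup>2 + 2 * (cmod (g x))\<^sup>2) summable_on A"
    by (intro summable_on_add summable_on_cmult_right assms)
  fix x
  have "(cmod (f x + g x))\<^sup>2 \<le> (cmod (f x) + cmod (g x))\<^sup>2"
    by (intro power_mono norm_triangle_ineq) simp
  also have "\<dots> \<le> 2 * (cmod (f x))\<^sup>2 + 2 * (cmod (g x))\<^sup>2"
    using zero_le_power2[of "cmod (f x) - cmod (g x)"] by (simp add: power2_sum power2_diff)
  finally show "(cmod (f x + g x))\<^sup>2 \<le> 2 * (cmod (f x))\<^sup>2 + 2 * (cmod (g x))\<^sup>2" .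
qed simp

lemma square_summable_scale:
  "(\<lambda>x. (cmod (f x))\<^sup>2) summable_on A \<Longrightarrow> (\<lambda>x. (cmod (c * f x))\<^sup>2) summable_on A"
  by (simp add: norm_mult power_mult_distrib summable_on_cmult_right)

lemma abs_summable_product:
  assumes "(\<lambda>x. (cmod (f x))\<^sup>2) summable_on A" "(\<lambda>x. (cmod (g x))\<^sup>2) summable_on A"
  shows "(\<lambda>x. f x * g x) abs_summable_on A"
proof (rule summable_on_comparison_test[of "\<lambda>x. (cmod (f x))\<^sup>2 + (cmod (g x))\<^sup>2"])
  show "(\<lambda>x. (cmod (f x))\<^sup>2 + (cmod (g x))\<^sup>2) summable_on A" by (intro summable_on_add assms)
  fix x
  show "cmod (f x * g x) \<le> (cmod (f x))\<^sup>2 + (cmod (g x))\<^sup>2"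
    using sum_squares_bound[of "cmod (f x)" "cmod (g x)"] zero_le_power2[of "cmod (f x)"] zero_le_power2[of "cmod (g x)"]
      mult_nonneg_nonneg[OF norm_ge_zero[of "f x"] norm_ge_zero[of "g x"]]
    unfolding norm_mult by linarith
qed simp

lemma cmod_square_inner: "(cmod z)\<^sup>2 = inner z z"
  by (simp add: power2_norm_eq_inner)

lemma summable_inner:
  assumes "(\<lambda>x. (cmod (f x))\<^sup>2) summable_on A" "(\<lambda>x. (cmod (g x))\<^sup>2) summable_on A"
  shows "(\<lambda>x. inner (f x) (g x)) summable_on A"
proof (rule abs_summable_summable)
  show "(\<lambda>x. inner (f x) (g x)) abs_summable_on A"
  proof (rule abs_summable_on_comparison_test[OF abs_summable_product[OF assms]])
    show "norm (inner (f x) (g x)) \<le> norm (f x * g x)" for x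
      using Cauchy_Schwarz_ineq2[of "f x" "g x"] by (simp add: norm_mult)
  qed
qed

instantiation ell2 :: (type) real_inner
begin

lift_definition zero_ell2 :: "'a ell2" is "\<lambda>_. 0" by simp
lift_definition plus_ell2 :: "'a ell2 \<Rightarrow> 'a ell2 \<Rightarrow> 'a ell2" is "\<lambda>f g x. f x + g x"
  by (simp add: square_summable_add)
lift_definition uminus_ell2 :: "'a ell2 \<Rightarrow> 'a ell2" is "\<lambda>f x. - f x" by simp
lift_definition minus_ell2 :: "'a ell2 \<Rightarrow> 'a ell2 \<Rightarrow> 'a ell2" is "\<lambda>f g x. f x - g x"
  using square_summable_add[of _ UNIV "\<lambda>x. - _ x"] by fastforce
lift_definition scaleR_ell2 :: "real \<Rightarrow> 'a ell2 \<Rightarrow> 'a ell2" is "\<lambda>r f x. complex_of_real r * f x"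
  by (simp add: square_summable_scale del: norm_mult)
definition inner_ell2 :: "'a ell2 \<Rightarrow> 'a ell2 \<Rightarrow> real" where
  "inner_ell2 f g = (\<Sum>\<^sub>\<infinity>x. inner (ell2_fun f x) (ell2_fun g x))"
definition norm_ell2 :: "'a ell2 \<Rightarrow> real" where "norm_ell2 f = sqrt (inner f f)"
definition dist_ell2 :: "'a ell2 \<Rightarrow> 'a ell2 \<Rightarrow> real" where "dist_ell2 f g = norm (f - g)"
definition sgn_ell2 :: "'a ell2 \<Rightarrow> 'a ell2" where "sgn_ell2 f = scaleR (inverse (norm f)) f"
definition uniformity_ell2 :: "('a ell2 \<times> 'a ell2) filter" where
  "uniformity_ell2 = (INF e\<in>{0<..}. principal {(f, g). dist f g < e})"
definition open_ell2 :: "'a ell2 set \<Rightarrow> bool" where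
  "open_ell2 U \<longleftrightarrow> (\<forall>f\<in>U. eventually (\<lambda>(f', g). f' = f \<longrightarrow> g \<in> U) uniformity)"

instance
proof
  fix f g h :: "'a ell2" and a b :: real
  show "f + g + h = f + (g + h)" "f + g = g + f" "0 + f = f" "- f + f = 0" "f - g = f + - g"
    "a *\<^sub>R (f + g) = a *\<^sub>R f + a *\<^sub>R g" "(a + b) *\<^sub>R f = a *\<^sub>R f + b *\<^sub>R f"
    "a *\<^sub>R b *\<^sub>R f = (a * b) *\<^sub>R f" "1 *\<^sub>R f = f"
    by (transfer; simp add: algebra_simps)+
  note sq = ell2_fun_summable
  show "inner f g = inner g f" by (simp add: inner_ell2_def inner_commute)
  show "inner (f + g) h = inner f h + inner g h"
    using infsum_add[OF summable_inner[OF sq[of f UNIV] sq[of h]] summable_inner[OF sq[of g UNIV] sq[of h]]]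
    by (simp add: inner_ell2_def plus_ell2.rep_eq inner_add_left)
  show "inner (a *\<^sub>R f) g = a * (inner f g)"
    by (simp add: inner_ell2_def scaleR_ell2.rep_eq scaleR_conv_of_real[symmetric] infsum_cmult_right')
  show nonneg: "0 \<le> inner f f" by (simp add: inner_ell2_def infsum_nonneg)
  show "(inner f f = 0) = (f = 0)"
  proof
    assume "inner f f = 0"
    then have "inner (ell2_fun f x) (ell2_fun f x) = 0" for x
      using nonneg_infsum_le_0D[of "\<lambda>x. inner (ell2_fun f x) (ell2_fun f x)" UNIV x] summable_inner[OF sq[of f UNIV] sq[of f]]
      by (simp add: inner_ell2_def)
    then show "f = 0" by (intro ell2_fun_inject[THEN iffD1] ext) (simp add: zero_ell2.rep_eq)
  qed (simp add: inner_ell2_def zero_ell2.rep_eq)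
  show "norm f = sqrt (inner f f)" by (rule norm_ell2_def)
qed (rule dist_ell2_def sgn_ell2_def uniformity_ell2_def open_ell2_def)+

end

lemma ell2_eqI: "(\<And>x. ell2_fun f x = ell2_fun g x) \<Longrightarrow> f = g"
  by (metis ell2_fun_inject ext)

lemma ell2_fun_simps [simp]:
  "ell2_fun 0 x = 0" "ell2_fun (f + g) x = ell2_fun f x + ell2_fun g x"
  "ell2_fun (f - g) x = ell2_fun f x - ell2_fun g x" "ell2_fun (- f) x = - ell2_fun f x"
  "ell2_fun (a *\<^sub>R f) x = complex_of_real a * ell2_fun f x"
  by (transfer; simp)+

lemma ell2_fun_sum: "ell2_fun (sum F A) x = (\<Sum>a\<in>A. ell2_fun (F a) x)"
  by (induction A rule: infinite_finite_induct) auto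

lemma norm_ell2_square: "(norm f)\<^sup>2 = (\<Sum>\<^sub>\<infinity>x. (cmod (ell2_fun f x))\<^sup>2)"
  by (simp add: power2_norm_eq_inner inner_ell2_def cmod_square_inner)

lemma sum_square_le_norm_ell2:
  assumes "finite F"
  shows "(\<Sum>x\<in>F. (cmod (ell2_fun f x))\<^sup>2) \<le> (norm f)\<^sup>2"
  unfolding norm_ell2_square by (rule finite_sum_le_infsum[OF ell2_fun_summable assms]) auto

lemma cmod_le_norm_ell2: "cmod (ell2_fun f x) \<le> norm f"
  by (rule power2_le_imp_le[OF _ norm_ge_zero]) (use sum_square_le_norm_ell2[of "{x}" f] in simp)

lemma norm_ell2_le:
  assumes "\<And>F. finite F \<Longrightarrow> (\<Sum>x\<in>F. (cmod (ell2_fun f x))\<^sup>2) \<le> b\<^sup>2" "0 \<le> b"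
  shows "norm f \<le> b"
proof (rule power2_le_imp_le)
  show "(norm f)\<^sup>2 \<le> b\<^sup>2"
    unfolding norm_ell2_square by (rule infsum_le_finite_sums[OF ell2_fun_summable]) (use assms in auto)
qed fact

text \<open>Coordinates converge, and estimates for finite partial sums pass to the pointwise limit.
  They give both its square-summability and the convergence in norm.\<close>

instance ell2 :: (type) banach
proof
  fix X :: "nat \<Rightarrow> 'a ell2"
  assume X: "Cauchy X"
  have pw: "convergent (\<lambda>n. ell2_fun (X n) x)" for x
  proof (rule Cauchy_convergent, rule metric_CauchyI)
    fix e :: real assume "0 < e"
    then obtain M where "\<forall>m\<ge>M. \<forall>n\<ge>M. dist (X m) (X n) < e" using X metric_CauchyD by blast
    moreover have "dist (ell2_fun (X m) x) (ell2_fun (X n) x) \<le> dist (X m) (X n)" for m n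
      using cmod_le_norm_ell2[of "X m - X n" x] by (simp add: dist_norm)
    ultimately show "\<exists>M. \<forall>m\<ge>M. \<forall>n\<ge>M. dist (ell2_fun (X m) x) (ell2_fun (X n) x) < e"
      by (meson le_less_trans)
  qed
  define l where "l x = lim (\<lambda>n. ell2_fun (X n) x)" for x
  have l: "(\<lambda>n. ell2_fun (X n) x) \<longlonglongrightarrow> l x" for x
    using pw[of x] unfolding l_def by (simp add: convergent_LIMSEQ_iff)
  have tail: "(\<Sum>x\<in>F. (cmod (ell2_fun (X m) x - l x))\<^sup>2) \<le> e\<^sup>2"
    if "finite F" "\<forall>n\<ge>M. dist (X m) (X n) < e" for F e M m
  proof (rule LIMSEQ_le_const2)
    show "(\<lambda>n. \<Sum>x\<in>F. (cmod (ell2_fun (X m) x - ell2_fun (X n) x))\<^sup>2) \<longlonglongrightarrow> (\<Sum>x\<in>F. (cmod (ell2_fun (X m) x - l x))\<^sup>2)"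
      by (intro tendsto_intros l)
    have "(\<Sum>x\<in>F. (cmod (ell2_fun (X m) x - ell2_fun (X n) x))\<^sup>2) \<le> e\<^sup>2" if "M \<le> n" for n
    proof -
      have "norm (X m - X n) \<le> e" using \<open>\<forall>n\<ge>M. dist (X m) (X n) < e\<close> that by (force simp: dist_norm)
      then have "(norm (X m - X n))\<^sup>2 \<le> e\<^sup>2" by (intro power_mono) auto
      then show ?thesis using sum_square_le_norm_ell2[OF \<open>finite F\<close>, of "X m - X n"] by simp
    qed
    then show "\<exists>N. \<forall>n\<ge>N. (\<Sum>x\<in>F. (cmod (ell2_fun (X m) x - ell2_fun (X n) x))\<^sup>2) \<le> e\<^sup>2" by blast
  qed
  obtain M1 where M1: "\<forall>m\<ge>M1. \<forall>n\<ge>M1. dist (X m) (X n) < 1" using X metric_CauchyD[of X 1] by auto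
  have "(\<lambda>x. (cmod (ell2_fun (X M1) x - l x))\<^sup>2) summable_on UNIV"
  proof (rule nonneg_bdd_above_summable_on)
    show "bdd_above (sum (\<lambda>x. (cmod (ell2_fun (X M1) x - l x))\<^sup>2) ` {F. F \<subseteq> UNIV \<and> finite F})"
      using tail[of _ M1 M1 1] M1 by (intro bdd_aboveI[of _ "1\<^sup>2"]) auto
  qed simp
  then have "(\<lambda>x. (cmod (ell2_fun (X M1) x + (-1) * (ell2_fun (X M1) x - l x)))\<^sup>2) summable_on UNIV"
    by (intro square_summable_add ell2_fun_summable square_summable_scale)
  then have ls: "(\<lambda>x. (cmod (l x))\<^sup>2) summable_on UNIV" by simp
  have lf: "ell2_fun (Ell2 l) = l" using ls by (simp add: Ell2_inverse)
  have "X \<longlonglongrightarrow> Ell2 l"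
  proof (rule metric_LIMSEQ_I)
    fix e :: real assume e: "0 < e"
    then obtain M where M: "\<forall>m\<ge>M. \<forall>n\<ge>M. dist (X m) (X n) < e / 2" using X metric_CauchyD[of X "e / 2"] by auto
    have "dist (X m) (Ell2 l) < e" if "M \<le> m" for m
    proof -
      have "norm (X m - Ell2 l) \<le> e / 2"
        using tail[of _ M m "e / 2"] M that e by (intro norm_ell2_le) (auto simp: lf)
      then show ?thesis using e by (simp add: dist_norm)
    qed
    then show "\<exists>M. \<forall>m\<ge>M. dist (X m) (Ell2 l) < e" by blast
  qed
  then show "convergent X" by (auto simp: convergent_def)
qed

text \<open>A relation rather than a function, since each projection is constructed where it is
  needed: as a limit of powers, as a limit along decreasing subspaces, or as a combination of two
  others.\<close>

definition is_proj :: "'a::real_inner set \<Rightarrow> 'a \<Rightarrow> 'a \<Rightarrow> bool" where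
  "is_proj V x p \<longleftrightarrow> p \<in> V \<and> (\<forall>v\<in>V. inner (x - p) v = 0)"

lemma is_proj_inner: assumes "is_proj V x p" shows "inner p x = inner p p"
proof -
  have "inner (x - p) p = 0" using assms unfolding is_proj_def by blast
  then show ?thesis by (simp add: inner_diff_left inner_commute[of p x])
qed

lemma is_proj_mono:
  assumes "is_proj V x p" "is_proj W x q" "V \<subseteq> W"
  shows "inner (q - p) p = 0" "inner p x \<le> inner q x"
proof -
  have "inner (x - p) p = 0" "inner (x - q) p = 0"
    using assms unfolding is_proj_def by blast+
  then show 0: "inner (q - p) p = 0" by (simp add: inner_diff_left)
  have "inner q q = inner (q - p) (q - p) + inner p p"
    using 0 by (simp add: inner_diff_left inner_diff_right inner_commute)
  then have "inner p p \<le> inner q q" by simp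
  then show "inner p x \<le> inner q x" using is_proj_inner assms by metis
qed

text \<open>By Pythagoras the squared distance of two of the projections is the difference of their
  values \<open>inner (p m) x\<close>. These values decrease and are nonnegative, so the projections
  form a Cauchy sequence.\<close>

lemma is_proj_decreasing_Inter:
  fixes V :: "nat \<Rightarrow> 'a::{real_inner, banach} set"
  assumes closed: "\<And>m. closed (V m)" and dec: "\<And>m n. m \<le> n \<Longrightarrow> V n \<subseteq> V m"
    and p: "\<And>m. is_proj (V m) x (p m)"
  obtains q where "is_proj (\<Inter>m. V m) x q" "(\<lambda>m. inner (p m) x) \<longlonglongrightarrow> inner q x"
proof -
  define a where "a m = inner (p m) x" for m
  have a: "a m = inner (p m) (p m)" for m using is_proj_inner[OF p] by (simp add: a_def)
  have dist: "inner (p m - p n) (p m - p n) = a m - a n" if "m \<le> n" for m n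
    using is_proj_mono(1)[OF p p dec[OF that]]
    by (simp add: a inner_diff_left inner_diff_right inner_commute)
  have "decseq a"
  proof (rule decseq_SucI)
    fix n
    show "a (Suc n) \<le> a n" using dist[of n "Suc n"] inner_ge_zero[of "p n - p (Suc n)"] by simp
  qed
  moreover have "0 \<le> a n" for n by (simp add: a)
  ultimately have "convergent a" using decseq_convergent[of a 0] by (metis convergentI)
  then have ca: "Cauchy a" by (rule convergent_Cauchy)
  have "Cauchy p"
  proof (rule metric_CauchyI)
    fix e :: real assume e: "0 < e"
    then obtain M where M: "\<And>m n. M \<le> m \<Longrightarrow> M \<le> n \<Longrightarrow> dist (a m) (a n) < e\<^sup>2"
      using ca metric_CauchyD[of a "e\<^sup>2"] by auto
    have "dist (p m) (p n) < e" if "M \<le> m" "M \<le> n" for m n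
    proof -
      have "(norm (p m - p n))\<^sup>2 = \<bar>a m - a n\<bar>"
      proof (cases "m \<le> n")
        case True
        then show ?thesis using dist[OF True] inner_ge_zero[of "p m - p n"] by (simp add: power2_norm_eq_inner)
      next
        case False
        then have "n \<le> m" by simp
        then show ?thesis using dist[OF \<open>n \<le> m\<close>] inner_ge_zero[of "p n - p m"]
          by (simp add: power2_norm_eq_inner[symmetric] norm_minus_commute abs_minus_commute)
      qed
      also have "\<dots> < e\<^sup>2" using M[OF that] by (simp add: dist_real_def)
      finally have "norm (p m - p n) < e" by (rule power2_less_imp_less) (use e in simp)
      then show ?thesis by (simp add: dist_norm)
    qed
    then show "\<exists>M. \<forall>m\<ge>M. \<forall>n\<ge>M. dist (p m) (p n) < e" by blast
  qed
  then obtain q where q: "p \<longlonglongrightarrow> q" using Cauchy_convergent_iff convergent_def by blast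
  have "q \<in> V m" for m
  proof (rule closed_sequentially[OF closed])
    show "(\<lambda>k. p (k + m)) \<longlonglongrightarrow> q" using q by (rule LIMSEQ_ignore_initial_segment)
    show "p (k + m) \<in> V m" for k using p[of "k + m"] dec[of m "k + m"] by (auto simp: is_proj_def)
  qed
  moreover have "inner (x - q) v = 0" if "v \<in> (\<Inter>m. V m)" for v
  proof -
    have "(\<lambda>m. inner (x - p m) v) \<longlonglongrightarrow> inner (x - q) v" by (intro tendsto_intros q)
    moreover have "inner (x - p m) v = 0" for m using p[of m] that by (auto simp: is_proj_def)
    ultimately show ?thesis by (simp add: LIMSEQ_const_iff)
  qed
  ultimately have "is_proj (\<Inter>m. V m) x q" by (simp add: is_proj_def)
  moreover have "(\<lambda>m. inner (p m) x) \<longlonglongrightarrow> inner q x" by (intro tendsto_intros q)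
  ultimately show thesis by (rule that)
qed

text \<open>For \<open>D\<^sup>\<bottom> \<subseteq> Z\<close> the projection onto \<open>Z \<inter> D\<close> is \<open>P\<^sub>Z + P\<^sub>D - 1\<close>.\<close>

lemma is_proj_Int:
  assumes "is_proj Z x p" "is_proj D x d" "x - d \<in> Z" "p - x + d \<in> D"
    and sub: "\<And>u v. u \<in> Z \<Longrightarrow> v \<in> Z \<Longrightarrow> u - v \<in> Z"
  shows "is_proj (Z \<inter> D) x (p - x + d)"
proof -
  have "p - (x - d) \<in> Z" by (rule sub[OF _ assms(3)]) (use assms(1) in \<open>simp add: is_proj_def\<close>)
  moreover have "p - (x - d) = p - x + d" by simp
  ultimately have "p - x + d \<in> Z" by metis
  moreover have "inner (x - (p - x + d)) v = 0" if "v \<in> Z \<inter> D" for v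
  proof -
    have "inner (x - p) v = 0" "inner (x - d) v = 0" using assms that by (auto simp: is_proj_def)
    moreover have "x - (p - x + d) = (x - p) + (x - d)" by simp
    ultimately show ?thesis by (simp only: inner_add_left)
  qed
  ultimately show ?thesis using assms(4) by (simp add: is_proj_def)
qed

text \<open>Spectral calculus is replaced by the numbers \<open>a k = inner ((C ^^ k) x) x\<close>:
  they decrease, and the squared distance of the \<open>k\<close>-th and \<open>l\<close>-th
  iterates is \<open>a (k + k) - 2 * a (k + l) + a (l + l)\<close>.\<close>

lemma contraction_powers_converge:
  fixes C :: "'a::{real_inner, banach} \<Rightarrow> 'a"
  assumes lin: "\<And>x y. C (x - y) = C x - C y"
    and sym: "\<And>x y. inner (C x) y = inner x (C y)"
    and pos: "\<And>x. 0 \<le> inner (C x) x" and le: "\<And>x. inner (C x) x \<le> inner x x"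
  obtains p where "(\<lambda>k. (C ^^ k) x) \<longlonglongrightarrow> p" "is_proj {v. C v = v} x p"
proof -
  \<comment> \<open>As operators, \<open>C - C^2\<close> is the sum of
    \<open>(1 - C) C (1 - C)\<close> and \<open>C (1 - C) C\<close>, both nonnegative by
    assumption.\<close>
  have sq: "inner (C x) (C x) \<le> inner (C x) x" for x
  proof -
    have "0 \<le> inner (C (x - C x)) (x - C x) + (inner (C x) (C x) - inner (C (C x)) (C x))"
      using pos[of "x - C x"] le[of "C x"] by simp
    also have "\<dots> = inner (C x) x - inner (C x) (C x)"
      by (simp add: lin inner_diff_left inner_diff_right sym)
    finally show ?thesis by simp
  qed
  have norm_C: "norm (C x) \<le> norm x" for x
    using order.trans[OF sq le] by (simp add: norm_le)
  have symk: "inner ((C ^^ k) x) y = inner x ((C ^^ k) y)" for k x y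
    by (induction k arbitrary: x y) (simp_all add: sym funpow_swap1)
  define a where "a k = inner ((C ^^ k) x) x" for k
  have a_add: "inner ((C ^^ k) x) ((C ^^ l) x) = a (k + l)" for k l
    unfolding a_def by (metis symk funpow_add comp_apply inner_commute)
  have dist: "inner ((C ^^ k) x - (C ^^ l) x) ((C ^^ k) x - (C ^^ l) x) = a (k + k) - 2 * a (k + l) + a (l + l)" for k l
    by (simp add: inner_diff_left inner_diff_right a_add add.commute)
  have "a (Suc k) \<le> a k \<and> 0 \<le> a k" for k
  proof (cases "even k")
    case True
    then obtain j where j: "k = j + j" by (metis evenE mult_2)
    have "a (Suc k) = inner (C ((C ^^ j) x)) ((C ^^ j) x)" using a_add[of "Suc j" j] by (simp add: j)
    then show ?thesis using le[of "(C ^^ j) x"] a_add[of j j] by (simp add: j) (metis inner_ge_zero)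
  next
    case False
    then obtain j where j: "k = Suc j + j" by (metis oddE mult_2 add_Suc Suc_eq_plus1)
    have "a k = inner (C ((C ^^ j) x)) ((C ^^ j) x)" using a_add[of "Suc j" j] by (simp add: j)
    moreover have "a (Suc k) = inner (C ((C ^^ j) x)) (C ((C ^^ j) x))" using a_add[of "Suc j" "Suc j"] by (simp add: j)
    ultimately show ?thesis using sq[of "(C ^^ j) x"] pos[of "(C ^^ j) x"] by simp
  qed
  then have "decseq a" "\<And>k. 0 \<le> a k" by (auto intro: decseq_SucI)
  then have "convergent a" using decseq_convergent[of a 0] by (metis convergentI)
  then have ca: "Cauchy a" by (rule convergent_Cauchy)
  have "Cauchy (\<lambda>k. (C ^^ k) x)"
  proof (rule metric_CauchyI)
    fix e :: real assume e: "0 < e"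
    then obtain M where M: "\<And>m n. M \<le> m \<Longrightarrow> M \<le> n \<Longrightarrow> dist (a m) (a n) < e\<^sup>2 / 2"
      using ca metric_CauchyD[of a "e\<^sup>2 / 2"] by auto
    have "dist ((C ^^ m) x) ((C ^^ n) x) < e" if "M \<le> m" "M \<le> n" for m n
    proof -
      have "dist (a (m + m)) (a (m + n)) < e\<^sup>2 / 2" "dist (a (m + n)) (a (n + n)) < e\<^sup>2 / 2"
        using that by (intro M; simp)+
      then have "a (m + m) - 2 * a (m + n) + a (n + n) < e\<^sup>2"
        unfolding dist_real_def by linarith
      then have "(norm ((C ^^ m) x - (C ^^ n) x))\<^sup>2 < e\<^sup>2"
        by (simp only: power2_norm_eq_inner dist)
      then have "norm ((C ^^ m) x - (C ^^ n) x) < e" by (rule power2_less_imp_less) (use e in simp)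
      then show ?thesis by (simp add: dist_norm)
    qed
    then show "\<exists>M. \<forall>m\<ge>M. \<forall>n\<ge>M. dist ((C ^^ m) x) ((C ^^ n) x) < e" by blast
  qed
  then obtain p where p: "(\<lambda>k. (C ^^ k) x) \<longlonglongrightarrow> p" using Cauchy_convergent_iff convergent_def by blast
  have "(\<lambda>k. C ((C ^^ k) x)) \<longlonglongrightarrow> C p"
  proof (rule metric_LIMSEQ_I)
    fix e :: real assume "0 < e"
    then obtain M where M: "\<forall>n\<ge>M. dist ((C ^^ n) x) p < e" using metric_LIMSEQ_D[OF p] by blast
    have "dist (C ((C ^^ n) x)) (C p) \<le> dist ((C ^^ n) x) p" for n
      using norm_C[of "(C ^^ n) x - p"] by (simp add: dist_norm lin)
    then show "\<exists>M. \<forall>n\<ge>M. dist (C ((C ^^ n) x)) (C p) < e" using M by (meson le_less_trans)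
  qed
  moreover have "(\<lambda>k. C ((C ^^ k) x)) \<longlonglongrightarrow> p"
    using LIMSEQ_Suc[OF p] by simp
  ultimately have "C p = p" by (rule LIMSEQ_unique)
  moreover have "inner (x - p) v = 0" if "C v = v" for v
  proof -
    have "(C ^^ k) v = v" for k by (induction k) (simp_all add: that)
    then have "inner ((C ^^ k) x) v = inner x v" for k by (simp add: symk)
    moreover have "(\<lambda>k. inner ((C ^^ k) x) v) \<longlonglongrightarrow> inner p v" by (intro tendsto_intros p)
    ultimately have "inner x v = inner p v" by (simp add: LIMSEQ_const_iff)
    then show ?thesis by (simp add: inner_diff_left)
  qed
  ultimately have "is_proj {v. C v = v} x p" by (simp add: is_proj_def)
  then show thesis using p that by blast
qed

text \<open>Here \<open>C\<close> is \<open>1 - A* A / K\<close> with \<open>B = A*\<close>. The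
  bound on \<open>A\<close> puts it between 0 and 1, and its fixed vectors are exactly the kernel of
  \<open>A\<close>.\<close>

lemma kernel_projection:
  fixes A :: "'a::{real_inner, banach} \<Rightarrow> 'b::real_inner" and B :: "'b \<Rightarrow> 'a"
  assumes A: "\<And>x y. A (x - y) = A x - A y" and B: "\<And>x y. B (x - y) = B x - B y"
    and adj: "\<And>x y. inner (A x) y = inner x (B y)"
    and bound: "\<And>x. inner (A x) (A x) \<le> K * inner x x" and K: "0 < K"
  defines "C \<equiv> \<lambda>x. x - B (A x) /\<^sub>R K"
  obtains p where "(\<lambda>k. (C ^^ k) x) \<longlonglongrightarrow> p" "is_proj {v. A v = 0} x p"
proof -
  have sym: "inner (B (A x)) y = inner x (B (A y))" for x y
    by (metis adj inner_commute)
  have inner_C: "inner (C x) x = inner x x - inner (A x) (A x) / K" for x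
    by (simp add: C_def inner_diff_left adj[symmetric] inner_commute[of "B (A x)"] divide_inverse mult.commute)
  obtain p where p: "(\<lambda>k. (C ^^ k) x) \<longlonglongrightarrow> p" "is_proj {v. C v = v} x p"
  proof (rule contraction_powers_converge[of C x])
    show "C (x - y) = C x - C y" for x y
      by (simp add: C_def A B scaleR_diff_right)
    show "inner (C x) y = inner x (C y)" for x y
      by (simp add: C_def inner_diff_left inner_diff_right sym)
    show "0 \<le> inner (C x) x" for x
      using bound[of x] K by (simp add: inner_C field_simps)
    show "inner (C x) x \<le> inner x x" for x
      using K by (simp add: inner_C)
  qed
  have "C v = v \<longleftrightarrow> A v = 0" for v
  proof
    assume "C v = v"
    then have "inner (A v) (A v) = 0" using inner_C[of v] K by simp
    then show "A v = 0" by simp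
  next
    assume "A v = 0"
    moreover have "B 0 = 0" using B[of 0 0] by simp
    ultimately show "C v = v" by (simp add: C_def)
  qed
  then show thesis using p that by simp
qed

section \<open>Projections and the von Neumann dimension\<close>

lemma l2_inner_Re:
  assumes "\<And>x. x \<notin> X \<Longrightarrow> ell2_fun g x = 0"
  shows "Re (l2_inner X (ell2_fun f) (ell2_fun g)) = inner f g"
proof -
  have "Re (l2_inner X (ell2_fun f) (ell2_fun g)) = (\<Sum>\<^sub>\<infinity>x\<in>X. Re (ell2_fun f x * cnj (ell2_fun g x)))"
    unfolding l2_inner_def
    using infsum_Re[of "\<lambda>x. ell2_fun f x * cnj (ell2_fun g x)" X]
      abs_summable_summable[OF abs_summable_product[of "ell2_fun f" X "\<lambda>x. cnj (ell2_fun g x)"]]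
      ell2_fun_summable[of f X] ell2_fun_summable[of g X] by simp
  also have "\<dots> = (\<Sum>\<^sub>\<infinity>x\<in>X. inner (ell2_fun f x) (ell2_fun g x))"
    by (simp add: inner_complex_def)
  also have "\<dots> = inner f g"
    unfolding inner_ell2_def using assms by (intro infsum_cong_neutral) auto
  finally show ?thesis .
qed

text \<open>Complex orthogonality to \<open>g\<close> is real orthogonality to both \<open>g\<close>
  and \<open>mult_i g\<close>; this links the real inner product with
  \<open>l2_inner\<close>.\<close>

lift_definition mult_i :: "'x ell2 \<Rightarrow> 'x ell2" is "\<lambda>f x. \<i> * f x"
  by (simp add: norm_mult)

lemma l2_inner_eq_0:
  assumes "\<And>x. x \<notin> X \<Longrightarrow> ell2_fun g x = 0" "inner f g = 0" "inner f (mult_i g) = 0"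
  shows "l2_inner X (ell2_fun f) (ell2_fun g) = 0"
proof -
  have "Re (l2_inner X (ell2_fun f) (ell2_fun (mult_i g))) = 0"
    using assms by (subst l2_inner_Re) (auto simp: mult_i.rep_eq)
  moreover have "l2_inner X (ell2_fun f) (ell2_fun (mult_i g)) = - \<i> * l2_inner X (ell2_fun f) (ell2_fun g)"
    unfolding l2_inner_def infsum_cmult_right'[symmetric]
    by (intro infsum_cong) (simp add: mult_i.rep_eq)
  ultimately have "Im (l2_inner X (ell2_fun f) (ell2_fun g)) = 0" by simp
  moreover have "Re (l2_inner X (ell2_fun f) (ell2_fun g)) = 0"
    using assms by (simp add: l2_inner_Re)
  ultimately show ?thesis by (simp add: complex_eq_iff)
qed

text \<open>Identifies the definite description in \<open>l2_proj\<close>. Closure under differences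
  gives uniqueness, closure under \<open>mult_i\<close> upgrades real to complex
  orthogonality.\<close>

lemma l2_proj_eq:
  assumes supp: "\<And>v x. v \<in> W \<Longrightarrow> x \<notin> X \<Longrightarrow> ell2_fun v x = 0"
    and diff: "\<And>u v. u \<in> W \<Longrightarrow> v \<in> W \<Longrightarrow> u - v \<in> W" and i: "\<And>v. v \<in> W \<Longrightarrow> mult_i v \<in> W"
    and p: "is_proj W e p"
  shows "l2_proj X (ell2_fun ` W) (ell2_fun e) = ell2_fun p"
  unfolding l2_proj_def
proof (rule the_equality)
  have orth: "l2_inner X (\<lambda>x. ell2_fun e x - ell2_fun q x) (ell2_fun v) = 0"
    if "\<forall>v\<in>W. inner (e - q) v = 0" "v \<in> W" for q v
    using l2_inner_eq_0[of X v "e - q"] that supp i by (simp add: minus_ell2.rep_eq)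
  show "ell2_fun p \<in> ell2_fun ` W \<and> (\<forall>v\<in>ell2_fun ` W. l2_inner X (\<lambda>x. ell2_fun e x - ell2_fun p x) v = 0)"
    using p orth by (auto simp: is_proj_def)
  fix q' assume q': "q' \<in> ell2_fun ` W \<and> (\<forall>v\<in>ell2_fun ` W. l2_inner X (\<lambda>x. ell2_fun e x - q' x) v = 0)"
  then obtain q where q: "q \<in> W" "q' = ell2_fun q" by blast
  have pW: "p \<in> W" using p by (simp add: is_proj_def)
  have "inner (e - q) v = 0" if "v \<in> W" for v
  proof -
    have "l2_inner X (ell2_fun (e - q)) (ell2_fun v) = 0"
      using q' q that by (simp add: minus_ell2.rep_eq)
    then show ?thesis using l2_inner_Re[of X v "e - q"] supp that by simp
  qed
  then have "inner (e - q) (p - q) = 0" "inner (e - p) (p - q) = 0"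
    using p diff[OF pW q(1)] by (auto simp: is_proj_def)
  then have "inner (p - q) (p - q) = 0" by (simp add: inner_diff_left)
  then have "p = q" by simp
  then show "q' = ell2_fun p" using q by simp
qed

lift_definition unit_vec2 :: "'x \<Rightarrow> 'x ell2" is "\<lambda>y x. if x = y then 1 else 0"
proof -
  fix y :: 'x
  have "(\<lambda>x. (cmod (if x = y then 1 else 0))\<^sup>2) summable_on {y}" by simp
  then show "(\<lambda>x. (cmod (if x = y then 1 else 0))\<^sup>2) summable_on UNIV"
    by (rule summable_on_cong_neutral[THEN iffD1, rotated -1]) auto
qed

lemma inner_unit_vec2: "inner f (unit_vec2 y) = Re (ell2_fun f y)"
proof -
  have "inner f (unit_vec2 y) = (\<Sum>\<^sub>\<infinity>x\<in>{y}. inner (ell2_fun f x) (ell2_fun (unit_vec2 y) x))"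
    unfolding inner_ell2_def by (rule infsum_cong_neutral) (auto simp: unit_vec2.rep_eq)
  then show ?thesis by (simp add: unit_vec2.rep_eq inner_complex_def)
qed

lemma vN_dim_eq:
  assumes supp: "\<And>v x. v \<in> W \<Longrightarrow> x \<notin> I \<times> carrier G \<Longrightarrow> ell2_fun v x = 0"
    and diff: "\<And>u v. u \<in> W \<Longrightarrow> v \<in> W \<Longrightarrow> u - v \<in> W" and i: "\<And>v. v \<in> W \<Longrightarrow> mult_i v \<in> W"
    and p: "\<And>s. s \<in> I \<Longrightarrow> is_proj W (unit_vec2 (s, \<one>\<^bsub>G\<^esub>)) (p s)" and "group G"
  shows "vN_dim G I (ell2_fun ` W) = (\<Sum>s\<in>I. inner (p s) (unit_vec2 (s, \<one>\<^bsub>G\<^esub>)))"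
proof -
  have e: "(\<lambda>z. if z = y then 1 else 0) = ell2_fun (unit_vec2 y)" for y
    by (simp add: unit_vec2.rep_eq)
  have one: "\<one>\<^bsub>G\<^esub> \<in> carrier G" using \<open>group G\<close> by (simp add: group.is_monoid monoid.one_closed)
  have "Re (l2_inner (I \<times> carrier G) (l2_proj (I \<times> carrier G) (ell2_fun ` W) (ell2_fun (unit_vec2 (s, \<one>\<^bsub>G\<^esub>))))
      (ell2_fun (unit_vec2 (s, \<one>\<^bsub>G\<^esub>)))) = inner (p s) (unit_vec2 (s, \<one>\<^bsub>G\<^esub>))" if "s \<in> I" for s
  proof -
    have *: "l2_proj (I \<times> carrier G) (ell2_fun ` W) (ell2_fun (unit_vec2 (s, \<one>\<^bsub>G\<^esub>))) = ell2_fun (p s)"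
      by (rule l2_proj_eq) (use supp diff i p[OF that] in auto)
    show ?thesis unfolding *
    by (rule l2_inner_Re) (use that one in \<open>auto simp: unit_vec2.rep_eq\<close>)
  qed
  then show ?thesis unfolding vN_dim_def Let_def e by (intro sum.cong) auto
qed

lemma pow_mat_Suc_left:
  fixes A :: "'a::comm_ring_1 mat"
  assumes "A \<in> carrier_mat n n"
  shows "A ^\<^sub>m Suc k = A * A ^\<^sub>m k"
proof (induction k)
  case (Suc k)
  have "A ^\<^sub>m k \<in> carrier_mat n n" using assms by simp
  then have "A * A ^\<^sub>m k * A = A * (A ^\<^sub>m k * A)"
    using assms by (intro assoc_mult_mat) auto
  then show ?case using Suc by simp
qed (use assms in simp)

lemma inner_finite_support:
  assumes "finite X" "\<And>x. x \<notin> X \<Longrightarrow> ell2_fun g x = 0"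
  shows "inner f g = (\<Sum>x\<in>X. inner (ell2_fun f x) (ell2_fun g x))"
proof -
  have "inner f g = (\<Sum>\<^sub>\<infinity>x\<in>X. inner (ell2_fun f x) (ell2_fun g x))"
    unfolding inner_ell2_def by (rule infsum_cong_neutral) (use assms in auto)
  then show ?thesis using assms by simp
qed

lemma finite_support_ell2:
  assumes "finite X"
  shows "ell2_fun (Ell2 (\<lambda>x. if x \<in> X then f x else 0)) x = (if x \<in> X then f x else 0)"
proof -
  have "(\<lambda>x. (cmod (if x \<in> X then f x else 0))\<^sup>2) summable_on X" using assms by simp
  then have "(\<lambda>x. (cmod (if x \<in> X then f x else 0))\<^sup>2) summable_on UNIV"
    by (rule iffD1[OF summable_on_cong_neutral, rotated -1]) auto
  then have "ell2_fun (Ell2 (\<lambda>x. if x \<in> X then f x else 0)) = (\<lambda>x. if x \<in> X then f x else 0)"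
    by (simp add: Ell2_inverse)
  then show ?thesis by simp
qed

lemma tendsto_ell2_fun: assumes "X \<longlonglongrightarrow> l" shows "(\<lambda>n. ell2_fun (X n) x) \<longlonglongrightarrow> ell2_fun l x"
proof (rule metric_tendsto_imp_tendsto[OF assms always_eventually], intro allI)
  fix n show "dist (ell2_fun (X n) x) (ell2_fun l x) \<le> dist (X n) l"
    using cmod_le_norm_ell2[of "X n - l" x] by (simp add: dist_norm)
qed

section \<open>Integer matrices acting on finitely many coordinates\<close>

definition Cop :: "real \<Rightarrow> ('x ell2 \<Rightarrow> 'y ell2) \<Rightarrow> ('y ell2 \<Rightarrow> 'x ell2) \<Rightarrow> 'x ell2 \<Rightarrow> 'x ell2" where
  "Cop K A B u = u - B (A u) /\<^sub>R K"

definition Ctrace :: "'x set \<Rightarrow> real \<Rightarrow> ('x ell2 \<Rightarrow> 'y ell2) \<Rightarrow> ('y ell2 \<Rightarrow> 'x ell2) \<Rightarrow> nat \<Rightarrow> real" where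
  "Ctrace X K A B k = (\<Sum>x\<in>X. Re (ell2_fun ((Cop K A B ^^ k) (unit_vec2 x)) x))"

context
  fixes X :: "'x set" and P :: "'y set" and a :: "'y \<Rightarrow> 'x \<Rightarrow> int" and K :: real
    and A :: "'x ell2 \<Rightarrow> 'y ell2" and B :: "'y ell2 \<Rightarrow> 'x ell2"
  assumes X: "finite X" and P: "finite P" and K: "1 \<le> K"
    and A: "\<And>u \<rho>. ell2_fun (A u) \<rho> = (if \<rho> \<in> P then \<Sum>x\<in>X. of_int (a \<rho> x) * ell2_fun u x else 0)"
    and B: "\<And>v x. ell2_fun (B v) x = (if x \<in> X then \<Sum>\<rho>\<in>P. of_int (a \<rho> x) * ell2_fun v \<rho> else 0)"
    and bound: "\<And>u. inner (A u) (A u) \<le> K * inner u u"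
begin

private abbreviation (input) "C \<equiv> Cop K A B"
private abbreviation (input) "tr \<equiv> Ctrace X K A B"

lemma inner_A: "inner (A u) v = inner u (B v)"
proof -
  have "inner (A u) v = (\<Sum>\<rho>\<in>P. inner (ell2_fun (A u) \<rho>) (ell2_fun v \<rho>))"
    using inner_finite_support[OF P, of "A u" v] by (simp add: A inner_commute)
  also have "\<dots> = (\<Sum>\<rho>\<in>P. \<Sum>x\<in>X. inner (of_int (a \<rho> x) * ell2_fun u x) (ell2_fun v \<rho>))"
    by (simp add: A inner_sum_left)
  also have "\<dots> = (\<Sum>x\<in>X. \<Sum>\<rho>\<in>P. inner (ell2_fun u x) (of_int (a \<rho> x) * ell2_fun v \<rho>))"
    by (subst sum.swap) (simp add: inner_complex_def algebra_simps)
  also have "\<dots> = (\<Sum>x\<in>X. inner (ell2_fun u x) (ell2_fun (B v) x))"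
    by (simp add: B inner_sum_right)
  also have "\<dots> = inner u (B v)"
    by (rule inner_finite_support[OF X, symmetric]) (simp add: B)
  finally show ?thesis .
qed

lemma A_diff: "A (u - v) = A u - A v"
  by (rule ell2_eqI) (simp add: A right_diff_distrib sum_subtractf)

lemma B_diff: "B (u - v) = B u - B v"
  by (rule ell2_eqI) (simp add: B right_diff_distrib sum_subtractf)

lemma ell2_fun_Cop:
  "ell2_fun (C u) x = ell2_fun u x - (if x \<in> X then (\<Sum>y\<in>X. of_int (\<Sum>\<rho>\<in>P. a \<rho> x * a \<rho> y) * ell2_fun u y) / of_real K else 0)"
proof -
  have "(\<Sum>\<rho>\<in>P. of_int (a \<rho> x) * ell2_fun (A u) \<rho>) = (\<Sum>y\<in>X. of_int (\<Sum>\<rho>\<in>P. a \<rho> x * a \<rho> y) * ell2_fun u y)"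
    by (simp add: A sum_distrib_left sum_distrib_right sum.swap[of _ X P] mult.assoc)
  then show ?thesis by (simp add: Cop_def B divide_inverse mult.commute)
qed

text \<open>After enumerating \<open>X\<close> the operator \<open>B A\<close> is an integer matrix.
  An eigenvector gives \<open>inner (A u) (A u) = Re \<mu> * inner u u\<close>, which together with
  the bound on \<open>A\<close> places the eigenvalues in the interval from 0 to
  \<open>K\<close>.\<close>

lemma Ctrace_eigenvalues:
  obtains ls where "length ls = card X" "\<And>l. l \<in> set ls \<Longrightarrow> 0 \<le> l \<and> l \<le> K"
    "\<And>k. tr k = (\<Sum>l\<leftarrow>ls. (1 - l / K) ^ k)" "1 \<le> (\<Prod>l\<leftarrow>filter (\<lambda>l. l \<noteq> 0) ls. l)"
proof -
  define N where "N = card X"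
  obtain e where e: "bij_betw e {0..<N} X" using ex_bij_betw_nat_finite[OF X] unfolding N_def by blast
  have eX: "e i \<in> X" if "i < N" for i using e that by (auto simp: bij_betw_def)
  have e_eq: "e i = e j \<longleftrightarrow> i = j" if "i < N" "j < N" for i j
    using e that by (auto simp: bij_betw_def inj_on_def)
  have sum_e_r: "(\<Sum>x\<in>X. g x) = (\<Sum>i\<in>{0..<N}. g (e i))" for g :: "'x \<Rightarrow> real"
    by (rule sum.reindex_bij_betw[OF e, symmetric])
  have sum_e_c: "(\<Sum>x\<in>X. g x) = (\<Sum>i\<in>{0..<N}. g (e i))" for g :: "'x \<Rightarrow> complex"
    by (rule sum.reindex_bij_betw[OF e, symmetric])
  define T0 where "T0 = mat N N (\<lambda>(i, j). \<Sum>\<rho>\<in>P. a \<rho> (e i) * a \<rho> (e j))"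
  define T where "T = map_mat complex_of_int T0"
  have T0: "T0 \<in> carrier_mat N N" by (simp add: T0_def)
  define M where "M = mat N N (\<lambda>(i, j). (if i = j then 1 else 0) - T $$ (i, j) / complex_of_real K)"
  have ev: "\<exists>l. \<mu> = complex_of_real l \<and> 0 \<le> l \<and> l \<le> K" if "eigenvalue T \<mu>" for \<mu>
  proof -
    obtain v where v: "v \<in> carrier_vec N" "v \<noteq> 0\<^sub>v N" "T *\<^sub>v v = \<mu> \<cdot>\<^sub>v v"
    proof -
      have "dim_row T = N" using T0 by (simp add: T_def)
      moreover obtain v where "eigenvector T v \<mu>" using \<open>eigenvalue T \<mu>\<close> unfolding eigenvalue_def by blast
      ultimately show thesis using that unfolding eigenvector_def by metis
    qed
    define f where "f x = v $ (inv_into {0..<N} e x)" for x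
    have f: "f (e i) = v $ i" if "i < N" for i
      using that bij_betw_inv_into_left[OF e, of i] by (simp add: f_def)
    obtain u where u: "\<And>x. ell2_fun u x = (if x \<in> X then f x else 0)"
      using finite_support_ell2[OF X, of f] by (rule that)
    have Tv: "(\<Sum>j\<in>{0..<N}. of_int (\<Sum>\<rho>\<in>P. a \<rho> (e i) * a \<rho> (e j)) * v $ j) = \<mu> * v $ i" if "i < N" for i
    proof -
      have "(T *\<^sub>v v) $ i = (\<mu> \<cdot>\<^sub>v v) $ i" using v(3) by simp
      then show ?thesis using that v(1) T0 by (simp add: T_def T0_def scalar_prod_def)
    qed
    have BAu: "ell2_fun (B (A u)) x = \<mu> * ell2_fun u x" for x
    proof (cases "x \<in> X")
      case True
      then obtain i where i: "i < N" "x = e i" using e by (auto simp: bij_betw_def)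
      have "ell2_fun (B (A u)) x = (\<Sum>y\<in>X. of_int (\<Sum>\<rho>\<in>P. a \<rho> x * a \<rho> y) * ell2_fun u y)"
        using True by (simp add: A B sum_distrib_left sum_distrib_right sum.swap[of _ X P] mult.assoc)
      also have "\<dots> = (\<Sum>j\<in>{0..<N}. of_int (\<Sum>\<rho>\<in>P. a \<rho> (e i) * a \<rho> (e j)) * v $ j)"
        unfolding sum_e_c i(2) using eX f u by (intro sum.cong) auto
      finally show ?thesis using Tv[OF i(1)] i f[OF i(1)] u True by simp
    qed (simp add: B u)
    have S0: "inner u u = (\<Sum>x\<in>X. (cmod (ell2_fun u x))\<^sup>2)"
      using inner_finite_support[OF X, of u u] u by (simp add: cmod_square_inner)
    have pos: "0 < inner u u"
    proof (rule ccontr)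
      assume "\<not> 0 < inner u u"
      then have "u = 0" using inner_ge_zero[of u] by simp
      then have "ell2_fun u (e i) = 0" for i by simp
      then have "v $ i = 0" if "i < N" for i using u[of "e i"] f[OF that] eX[OF that] by simp
      then have "v = 0\<^sub>v N" using v(1) by (intro eq_vecI) auto
      then show False using v(2) by simp
    qed
    have re_im: "(cmod z)\<^sup>2 = Re z * Re z + Im z * Im z" for z
      by (simp add: cmod_power2 flip: power2_eq_square)
    have re: "inner (A u) (A u) = Re \<mu> * inner u u"
    proof -
      have "inner (A u) (A u) = (\<Sum>x\<in>X. inner (ell2_fun u x) (\<mu> * ell2_fun u x))"
        unfolding inner_A BAu[symmetric] by (rule inner_finite_support[OF X]) (simp add: B)
      also have "\<dots> = (\<Sum>x\<in>X. Re \<mu> * (cmod (ell2_fun u x))\<^sup>2)"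
        by (intro sum.cong) (simp_all add: inner_complex_def re_im algebra_simps)
      finally show ?thesis by (simp add: S0 sum_distrib_left)
    qed
    \<comment> \<open>The eigenvalue is real because \<open>Im \<mu> * inner u u\<close> equals the
      real product of \<open>A u\<close> with \<open>i A u\<close>, which vanishes.\<close>
    have im: "Im \<mu> * inner u u = 0"
    proof -
      have "Im \<mu> * inner u u = (\<Sum>x\<in>X. inner (ell2_fun (B (A u)) x) (\<i> * ell2_fun u x))"
        unfolding S0 sum_distrib_left BAu
        by (intro sum.cong) (simp_all add: inner_complex_def re_im algebra_simps)
      also have "\<dots> = inner (B (A u)) (mult_i u)"
        by (subst inner_finite_support[OF X, of "mult_i u"]) (simp_all add: u mult_i.rep_eq)
      also have "\<dots> = inner (A u) (A (mult_i u))" by (metis inner_A inner_commute)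
      also have "A (mult_i u) = mult_i (A u)"
        by (rule ell2_eqI) (simp add: A mult_i.rep_eq sum_distrib_left mult.left_commute)
      also have "inner (A u) (mult_i (A u)) = 0"
        unfolding inner_ell2_def by (simp add: mult_i.rep_eq inner_complex_def algebra_simps)
      finally show ?thesis .
    qed
    have "0 \<le> Re \<mu> * inner u u" "Re \<mu> * inner u u \<le> K * inner u u"
      using re bound[of u] inner_ge_zero[of "A u"] by auto
    then have "0 \<le> Re \<mu>" "Re \<mu> \<le> K" using pos by (auto simp: zero_le_mult_iff)
    moreover have "\<mu> = complex_of_real (Re \<mu>)" using im pos by (simp add: complex_eq_iff)
    ultimately show ?thesis by blast
  qed
  obtain ls where ls: "length ls = N" "\<And>l. l \<in> set ls \<Longrightarrow> 0 \<le> l \<and> l \<le> K"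
    "\<And>k. mtrace (M ^\<^sub>m k) = complex_of_real (\<Sum>l\<leftarrow>ls. (1 - l / K) ^ k)" "1 \<le> (\<Prod>l\<leftarrow>filter (\<lambda>l. l \<noteq> 0) ls. l)"
    using integer_positive_trace_powers[OF T0 ev[unfolded T_def]] unfolding M_def T_def by blast
  have CC: "M \<in> carrier_mat N N" by (simp add: M_def)
  have entries: "ell2_fun ((C ^^ k) (unit_vec2 (e j))) (e i) = (M ^\<^sub>m k) $$ (i, j)" if j: "j < N" and "i < N" for i j k
    using that(2)
  proof (induction k arbitrary: i)
    case 0
    then show ?case using j CC e_eq by (simp add: unit_vec2.rep_eq M_def)
  next
    case (Suc k)
    let ?u = "(C ^^ k) (unit_vec2 (e j))"
    have Ck: "M ^\<^sub>m k \<in> carrier_mat N N" using CC by simp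
    have "(M ^\<^sub>m Suc k) $$ (i, j) = (\<Sum>l\<in>{0..<N}. M $$ (i, l) * (M ^\<^sub>m k) $$ (l, j))"
      unfolding pow_mat_Suc_left[OF CC] using Suc.prems j CC Ck by (simp add: scalar_prod_def)
    also have "\<dots> = (\<Sum>l\<in>{0..<N}. (if i = l then ell2_fun ?u (e l) else 0) - of_int (\<Sum>\<rho>\<in>P. a \<rho> (e i) * a \<rho> (e l)) * ell2_fun ?u (e l) / of_real K)"
      using Suc by (intro sum.cong) (auto simp: M_def T_def T0_def algebra_simps)
    also have "\<dots> = ell2_fun ?u (e i) - (\<Sum>l\<in>{0..<N}. of_int (\<Sum>\<rho>\<in>P. a \<rho> (e i) * a \<rho> (e l)) * ell2_fun ?u (e l)) / of_real K"
      using Suc.prems by (simp add: sum_subtractf sum_divide_distrib sum.delta')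
    also have "\<dots> = ell2_fun (C ?u) (e i)"
      using eX[OF Suc.prems] by (simp add: ell2_fun_Cop sum_e_c del: of_int_sum)
    finally show ?case by simp
  qed
  have "tr k = (\<Sum>l\<leftarrow>ls. (1 - l / K) ^ k)" for k
  proof -
    have "mtrace (M ^\<^sub>m k) = (\<Sum>i\<in>{0..<N}. ell2_fun ((C ^^ k) (unit_vec2 (e i))) (e i))"
      using CC entries by (simp add: mtrace_def lessThan_atLeast0)
    then have "tr k = Re (mtrace (M ^\<^sub>m k))"
      unfolding Ctrace_def sum_e_r by simp
    then show ?thesis unfolding ls(3) by simp
  qed
  then show thesis using that ls unfolding N_def by blast
qed

text \<open>The limit is the trace of the projection onto the kernel of \<open>A\<close>, with
  \<open>q x\<close> the projection of the unit vector at \<open>x\<close>. Each kernel vector is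
  recovered from its free coordinates by \<open>z = Z / \<delta>\<close>, so the trace becomes the
  sum over \<open>j\<close> in \<open>J\<close> of the products of \<open>q j\<close> with the
  column \<open>z j\<close>. That column lies in the kernel, hence each product is its own entry at
  \<open>j\<close>, namely 1.\<close>

lemma Ctrace_limit:
  assumes J: "J \<subseteq> X" and \<delta>: "\<delta> \<noteq> 0"
    and diag: "\<And>i j. i \<in> J \<Longrightarrow> j \<in> J \<Longrightarrow> Z i j = (if i = j then \<delta> else 0)"
    and RZ: "\<And>r j. r \<in> a ` P \<Longrightarrow> j \<in> J \<Longrightarrow> (\<Sum>x\<in>X. r x * Z x j) = 0"
    and ex: "expressed (a ` P) X J \<delta> Z (\<lambda>y::complex. y = 0)"
  shows "tr \<longlonglongrightarrow> real (card J)"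
proof -
  have finJ: "finite J" using J X finite_subset by blast
  have K0: "0 < K" using K by simp
  have Cop: "C = (\<lambda>x. x - B (A x) /\<^sub>R K)" by (rule ext) (rule Cop_def)
  have "\<exists>q. (\<lambda>k. (C ^^ k) (unit_vec2 y)) \<longlonglongrightarrow> q \<and> is_proj {v. A v = 0} (unit_vec2 y) q" for y
  proof (rule kernel_projection[of A B K "unit_vec2 y", OF A_diff B_diff inner_A bound K0])
    fix q assume "(\<lambda>k. ((\<lambda>x. x - B (A x) /\<^sub>R K) ^^ k) (unit_vec2 y)) \<longlonglongrightarrow> q" "is_proj {v. A v = 0} (unit_vec2 y) q"
    then show ?thesis unfolding Cop by (intro exI[of _ q] conjI)
  qed
  then obtain q where "\<forall>y. (\<lambda>k. (C ^^ k) (unit_vec2 y)) \<longlonglongrightarrow> q y \<and> is_proj {v. A v = 0} (unit_vec2 y) (q y)"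
    using choice[of "\<lambda>y q. (\<lambda>k. (C ^^ k) (unit_vec2 y)) \<longlonglongrightarrow> q \<and> is_proj {v. A v = 0} (unit_vec2 y) q"] by blast
  then have q: "\<And>y. (\<lambda>k. (C ^^ k) (unit_vec2 y)) \<longlonglongrightarrow> q y" "\<And>y. is_proj {v. A v = 0} (unit_vec2 y) (q y)"
    by simp_all
  have lim: "tr \<longlonglongrightarrow> (\<Sum>x\<in>X. Re (ell2_fun (q x) x))"
    unfolding Ctrace_def[abs_def] by (intro tendsto_intros tendsto_ell2_fun q)
  have Aq: "A (q y) = 0" for y using q(2) by (simp add: is_proj_def)
  have kernel: "of_int \<delta> * ell2_fun v x = (\<Sum>j\<in>J. of_int (Z x j) * ell2_fun v j)" if Av: "A v = 0" and x: "x \<in> X" for v x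
  proof -
    have "(\<Sum>x\<in>X. of_int (a \<rho> x) * ell2_fun v x) = 0" if "\<rho> \<in> P" for \<rho>
      using A[of v \<rho>] Av that by simp
    then have "solves (a ` P) X (\<lambda>y. y = 0) (ell2_fun v)" by (simp add: solves_def)
    then show ?thesis using ex x by (simp add: expressed_def)
  qed
  have sym: "Re (ell2_fun (q x) y) = Re (ell2_fun (q y) x)" for x y
  proof -
    have "inner (unit_vec2 y - q y) (q x) = 0" "inner (unit_vec2 x - q x) (q y) = 0"
      using q(2) Aq by (auto simp: is_proj_def)
    then have "inner (q x) (unit_vec2 y) = inner (q y) (unit_vec2 x)"
      by (simp add: inner_diff_left) (metis inner_commute)
    then show ?thesis by (simp add: inner_unit_vec2)
  qed
  define z where "z x j = real_of_int (Z x j) / real_of_int \<delta>" for x j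
  have qx: "Re (ell2_fun (q x) x) = (\<Sum>j\<in>J. z x j * Re (ell2_fun (q j) x))" if "x \<in> X" for x
  proof -
    have "of_int \<delta> * Re (ell2_fun (q x) x) = Re (\<Sum>j\<in>J. of_int (Z x j) * ell2_fun (q x) j)"
      unfolding kernel[OF Aq that, symmetric] by simp
    also have "\<dots> = (\<Sum>j\<in>J. of_int (Z x j) * Re (ell2_fun (q j) x))"
      by (simp add: sym[of x])
    finally have "Re (ell2_fun (q x) x) = (\<Sum>j\<in>J. of_int (Z x j) * Re (ell2_fun (q j) x)) / of_int \<delta>"
      using \<delta> by (simp add: field_simps)
    then show ?thesis by (simp add: z_def sum_divide_distrib)
  qed
  have one: "(\<Sum>x\<in>X. z x j * Re (ell2_fun (q j) x)) = 1" if j: "j \<in> J" for j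
  proof -
    obtain \<zeta> where \<zeta>: "\<And>x. ell2_fun \<zeta> x = (if x \<in> X then of_real (z x j) else 0)"
      using finite_support_ell2[OF X, of "\<lambda>x. of_real (z x j)"] by (rule that)
    have "A \<zeta> = 0"
    proof (rule ell2_eqI)
      fix \<rho>
      have "(\<Sum>x\<in>X. of_int (a \<rho> x) * ell2_fun \<zeta> x) = complex_of_real (of_int (\<Sum>x\<in>X. a \<rho> x * Z x j) / of_int \<delta>)"
        by (simp add: \<zeta> z_def sum_divide_distrib)
      moreover have "(\<Sum>x\<in>X. a \<rho> x * Z x j) = 0" if "\<rho> \<in> P" using RZ[of "a \<rho>" j] j that by simp
      ultimately show "ell2_fun (A \<zeta>) \<rho> = ell2_fun 0 \<rho>" by (simp only: A) simp
    qed
    then have "inner (unit_vec2 j - q j) \<zeta> = 0" using q(2)[of j] by (simp add: is_proj_def)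
    then have "inner (q j) \<zeta> = inner \<zeta> (unit_vec2 j)" by (simp add: inner_diff_left) (metis inner_commute)
    also have "\<dots> = z j j" using j J by (auto simp: inner_unit_vec2 \<zeta>)
    also have "\<dots> = 1" using diag[OF j j] \<delta> by (simp add: z_def)
    finally show ?thesis
      using inner_finite_support[OF X, of \<zeta> "q j"] by (simp add: \<zeta> inner_complex_def mult.commute)
  qed
  have "(\<Sum>x\<in>X. Re (ell2_fun (q x) x)) = (\<Sum>x\<in>X. \<Sum>j\<in>J. z x j * Re (ell2_fun (q j) x))"
    using qx by simp
  also have "\<dots> = real (card J)" using one by (subst sum.swap) simp
  finally show ?thesis using lim by simp
qed

text \<open>The limit of the traces is both the multiplicity of the eigenvalue 0 and the number of
  free coordinates, so these agree. The number of free coordinates is compared with \<open>d\<close>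
  by the counts modulo powers of \<open>p\<close>.\<close>

theorem Ctrace_bounds:
  assumes p: "prime (p::nat)"
  shows "(\<And>k. (p ^ k) ^ d \<le> card (solutions (a ` P) X (p ^ k))) \<Longrightarrow> real d \<le> tr k"
    and "(\<And>k. card (solutions (a ` P) X (p ^ k)) \<le> (p ^ k) ^ d) \<Longrightarrow> 0 < e \<Longrightarrow> e < 1 \<Longrightarrow>
      tr (Suc k) \<le> real d + (1 / (- ln e) + (1 - e) ^ k) * (real (card X) * ln K)"
proof -
  have p2: "2 \<le> p" using p by (rule prime_ge_2_nat)
  obtain J \<delta> Z where J: "J \<subseteq> X" "\<delta> \<noteq> 0" "\<And>i j. i \<in> J \<Longrightarrow> j \<in> J \<Longrightarrow> Z i j = (if i = j then \<delta> else 0)"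
    "\<And>r j. r \<in> a ` P \<Longrightarrow> j \<in> J \<Longrightarrow> (\<Sum>x\<in>X. r x * Z x j) = 0"
    "\<And>m. expressed (a ` P) X J \<delta> Z (\<lambda>y. (m::int) dvd y)"
    "expressed (a ` P) X J \<delta> Z (\<lambda>y::complex. y = 0)"
    using integer_elimination[OF X finite_imageI[OF P, of a]] by blast
  obtain ls where ls: "length ls = card X" "\<And>l. l \<in> set ls \<Longrightarrow> 0 \<le> l \<and> l \<le> K"
    "\<And>k. tr k = (\<Sum>l\<leftarrow>ls. (1 - l / K) ^ k)" "1 \<le> (\<Prod>l\<leftarrow>filter (\<lambda>l. l \<noteq> 0) ls. l)"
    using Ctrace_eigenvalues by blast
  let ?z = "length (filter (\<lambda>l. l = 0) ls)"
  have "tr = (\<lambda>k. \<Sum>l\<leftarrow>ls. (1 - l / K) ^ k)" using ls(3) by (rule ext)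
  then have "tr \<longlonglongrightarrow> real ?z" using spectral_sum_bounds(3)[OF ls(2,4) K] by simp
  moreover have "tr \<longlonglongrightarrow> real (card J)" by (rule Ctrace_limit[OF J(1-4,6)])
  ultimately have "real ?z = real (card J)" by (rule LIMSEQ_unique)
  then have zJ: "?z = card J" by simp
  show "real d \<le> tr k" if "\<And>k. (p ^ k) ^ d \<le> card (solutions (a ` P) X (p ^ k))"
  proof -
    have "d \<le> card J" by (rule free_rank_ge[OF X J(1-5) p2 that])
    then show ?thesis using spectral_sum_bounds(1)[OF ls(2,4) K, of k] unfolding zJ ls(3)[of k] by linarith
  qed
  show "tr (Suc k) \<le> real d + (1 / (- ln e) + (1 - e) ^ k) * (real (card X) * ln K)"
    if "\<And>k. card (solutions (a ` P) X (p ^ k)) \<le> (p ^ k) ^ d" "0 < e" "e < 1"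
  proof -
    have "card J \<le> d" by (rule free_rank_le[OF X J(1-5) p2 that(1)])
    then have "real ?z + (1 / (- ln e) + (1 - e) ^ k) * (real (length ls) * ln K)
        \<le> real d + (1 / (- ln e) + (1 - e) ^ k) * (real (card X) * ln K)"
      unfolding zJ ls(1) by (intro add_right_mono of_nat_mono)
    with spectral_sum_bounds(2)[OF ls(2,4) K that(2,3)] show ?thesis
      unfolding ls(3)[of "Suc k"] by (rule order.trans)
  qed
qed

end

section \<open>Matrices over the group ring\<close>

definition pull :: "'y set \<Rightarrow> ('y \<Rightarrow> 'x) \<Rightarrow> 'x ell2 \<Rightarrow> 'y ell2" where
  "pull A f u = Ell2 (\<lambda>y. if y \<in> A then ell2_fun u (f y) else 0)"

lemma ell2_fun_pull:
  assumes "inj_on f A"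
  shows "ell2_fun (pull A f u) y = (if y \<in> A then ell2_fun u (f y) else 0)"
proof -
  have "(\<lambda>x. (cmod (ell2_fun u x))\<^sup>2) summable_on f ` A" by (rule ell2_fun_summable)
  then have "((\<lambda>x. (cmod (ell2_fun u x))\<^sup>2) \<circ> f) summable_on A" using summable_on_reindex[OF assms] by blast
  then have "(\<lambda>y. (cmod (if y \<in> A then ell2_fun u (f y) else 0))\<^sup>2) summable_on UNIV"
    by (rule iffD1[OF summable_on_cong_neutral, rotated -1]) auto
  then have "ell2_fun (pull A f u) = (\<lambda>y. if y \<in> A then ell2_fun u (f y) else 0)"
    unfolding pull_def by (simp add: Ell2_inverse)
  then show ?thesis by simp
qed

lemma norm_pull:
  assumes "inj_on f A"
  shows "norm (pull A f u) \<le> norm u"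
proof (rule norm_ell2_le)
  fix F :: "'a set" assume F: "finite F"
  have inj: "inj_on f (F \<inter> A)" using assms by (rule inj_on_subset) auto
  have "(\<Sum>y\<in>F. (cmod (ell2_fun (pull A f u) y))\<^sup>2) = (\<Sum>y\<in>F \<inter> A. (cmod (ell2_fun u (f y)))\<^sup>2)"
    using F by (intro sum.mono_neutral_cong_right) (auto simp: ell2_fun_pull[OF assms])
  also have "\<dots> = (\<Sum>x\<in>f ` (F \<inter> A). (cmod (ell2_fun u x))\<^sup>2)"
    by (simp add: sum.reindex[OF inj])
  also have "\<dots> \<le> (norm u)\<^sup>2" using F by (intro sum_square_le_norm_ell2) auto
  finally show "(\<Sum>y\<in>F. (cmod (ell2_fun (pull A f u) y))\<^sup>2) \<le> (norm u)\<^sup>2" .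
qed simp

lemma inner_pull:
  assumes f: "bij_betw f A B" and f': "\<And>y. y \<in> A \<Longrightarrow> f' (f y) = y" "inj_on f' B"
  shows "inner (pull A f u) v = inner u (pull B f' v)"
proof -
  have inj: "inj_on f A" using f by (rule bij_betw_imp_inj_on)
  have "inner (pull A f u) v = (\<Sum>\<^sub>\<infinity>y\<in>A. inner (ell2_fun u (f y)) (ell2_fun v (f' (f y))))"
    unfolding inner_ell2_def by (rule infsum_cong_neutral) (auto simp: ell2_fun_pull[OF inj] f'(1))
  also have "\<dots> = (\<Sum>\<^sub>\<infinity>x\<in>B. inner (ell2_fun u x) (ell2_fun v (f' x)))"
    by (rule infsum_reindex_bij_betw[OF f])
  also have "\<dots> = inner u (pull B f' v)"
    unfolding inner_ell2_def by (rule infsum_cong_neutral) (auto simp: ell2_fun_pull[OF f'(2)])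
  finally show ?thesis .
qed

text \<open>A matrix over the integral group ring of \<open>H\<close> is a list of entries \<open>(c, y, x, h)\<close>; such an entry
  contributes \<open>c u(x, h g)\<close> to the value of the associated operator at \<open>(y, g)\<close>.\<close>

definition gr_list :: "('a, 'b) monoid_scheme \<Rightarrow> (int \<times> 'y \<times> 'x \<times> 'a) list \<Rightarrow> bool" where
  "gr_list H L \<longleftrightarrow> (\<forall>(c, y, x, h)\<in>set L. h \<in> carrier H)"

definition gr_adj :: "('a, 'b) monoid_scheme \<Rightarrow> (int \<times> 'y \<times> 'x \<times> 'a) list \<Rightarrow> (int \<times> 'x \<times> 'y \<times> 'a) list" where
  "gr_adj H = map (\<lambda>(c, y, x, h). (c, x, y, inv\<^bsub>H\<^esub> h))"

definition gr_map :: "('a \<Rightarrow> 'q) \<Rightarrow> (int \<times> 'y \<times> 'x \<times> 'a) list \<Rightarrow> (int \<times> 'y \<times> 'x \<times> 'q) list" where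
  "gr_map \<pi> = map (\<lambda>(c, y, x, h). (c, y, x, \<pi> h))"

definition gr_weight :: "(int \<times> 'y \<times> 'x \<times> 'a) list \<Rightarrow> int" where
  "gr_weight L = (\<Sum>(c, y, x, h)\<leftarrow>L. \<bar>c\<bar>)"

definition gr_fun :: "('a, 'b) monoid_scheme \<Rightarrow> (int \<times> 'y \<times> 'x \<times> 'a) list \<Rightarrow> ('x \<Rightarrow> 'a \<Rightarrow> 'r::comm_ring_1) \<Rightarrow> 'y \<Rightarrow> 'a \<Rightarrow> 'r" where
  "gr_fun H L u y' g = (\<Sum>(c, y, x, h)\<leftarrow>L. if y = y' then of_int c * u x (h \<otimes>\<^bsub>H\<^esub> g) else 0)"

definition gr_coeff :: "('a, 'b) monoid_scheme \<Rightarrow> (int \<times> 'y \<times> 'x \<times> 'a) list \<Rightarrow> 'y \<times> 'a \<Rightarrow> 'x \<times> 'a \<Rightarrow> int" where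
  "gr_coeff H L = (\<lambda>(y', g) (x', g'). \<Sum>(c, y, x, h)\<leftarrow>L. if y = y' \<and> x = x' \<and> g' = h \<otimes>\<^bsub>H\<^esub> g then c else 0)"

definition gr_op :: "('a, 'b) monoid_scheme \<Rightarrow> (int \<times> 'y \<times> 'x \<times> 'a) list \<Rightarrow> ('x \<times> 'a) ell2 \<Rightarrow> ('y \<times> 'a) ell2" where
  "gr_op H L u = (\<Sum>(c, y, x, h)\<leftarrow>L. of_int c *\<^sub>R pull ({y} \<times> carrier H) (\<lambda>(_, g). (x, h \<otimes>\<^bsub>H\<^esub> g)) u)"

context group
begin

lemma inv_mult_eq_iff: "h \<in> carrier G \<Longrightarrow> a \<in> carrier G \<Longrightarrow> b \<in> carrier G \<Longrightarrow> inv h \<otimes> a = b \<longleftrightarrow> a = h \<otimes> b"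
  by (auto simp flip: m_assoc)

lemma gr_fun_Cons: "gr_fun G ((c, y, x, h) # L) u y' g = (if y = y' then of_int c * u x (h \<otimes> g) else 0) + gr_fun G L u y' g"
  by (simp add: gr_fun_def)

lemma gr_op_Cons: "gr_op G ((c, y, x, h) # L) u = of_int c *\<^sub>R pull ({y} \<times> carrier G) (\<lambda>(_, g). (x, h \<otimes> g)) u + gr_op G L u"
  by (simp add: gr_op_def)

lemma gr_op_Nil: "gr_op G [] u = 0"
  by (simp add: gr_op_def)

lemma inj_translate: "h \<in> carrier G \<Longrightarrow> inj_on (\<lambda>(_, g). (x, h \<otimes> g)) ({y} \<times> carrier G)"
  by (auto simp: inj_on_def)

lemma gr_list_adj: "gr_list G L \<Longrightarrow> gr_list G (gr_adj G L)"
  by (auto simp: gr_list_def gr_adj_def)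

lemma ell2_fun_gr_op:
  assumes "gr_list G L"
  shows "ell2_fun (gr_op G L u) (y', g) = (if g \<in> carrier G then gr_fun G L (\<lambda>x g. ell2_fun u (x, g)) y' g else 0)"
  using assms
proof (induction L)
  case (Cons t L)
  obtain c y x h where t: "t = (c, y, x, h)" by (metis surj_pair)
  have h: "h \<in> carrier G" and L: "gr_list G L" using Cons.prems by (auto simp: t gr_list_def)
  show ?case
    using Cons.IH[OF L] by (simp add: t gr_op_Cons gr_fun_Cons ell2_fun_pull[OF inj_translate[OF h]])
qed (simp add: gr_op_Nil gr_fun_def)

lemma gr_op_diff:
  fixes L :: "(int \<times> 'c \<times> 'x \<times> 'a) list"
  assumes "gr_list G L"
  shows "gr_op G L (u - v) = gr_op G L u - gr_op G L v"
proof (rule ell2_eqI)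
  fix z :: "'c \<times> 'a"
  obtain y g where z: "z = (y, g)" by (metis surj_pair)
  have "gr_fun G L (\<lambda>x g. ell2_fun (u - v) (x, g)) y g = gr_fun G L (\<lambda>x g. ell2_fun u (x, g)) y g - gr_fun G L (\<lambda>x g. ell2_fun v (x, g)) y g"
    by (induction L) (auto simp: gr_fun_def right_diff_distrib)
  then show "ell2_fun (gr_op G L (u - v)) z = ell2_fun (gr_op G L u - gr_op G L v) z"
    by (simp add: z ell2_fun_gr_op[OF assms])
qed

lemma norm_gr_op: "gr_list G L \<Longrightarrow> norm (gr_op G L u) \<le> of_int (gr_weight L) * norm u"
proof (induction L)
  case (Cons t L)
  obtain c y x h where t: "t = (c, y, x, h)" by (metis surj_pair)
  have h: "h \<in> carrier G" and L: "gr_list G L" using Cons.prems by (auto simp: t gr_list_def)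
  let ?p = "pull ({y} \<times> carrier G) (\<lambda>(_, g). (x, h \<otimes> g)) u"
  have "norm (gr_op G (t # L) u) \<le> norm (of_int c *\<^sub>R ?p) + norm (gr_op G L u)"
    unfolding t gr_op_Cons by (rule norm_triangle_ineq)
  also have "\<dots> \<le> \<bar>of_int c\<bar> * norm u + of_int (gr_weight L) * norm u"
    using norm_pull[OF inj_translate[OF h], of y x u] Cons.IH[OF L]
    by (intro add_mono) (auto intro!: mult_left_mono)
  finally show ?case by (simp add: t gr_weight_def distrib_right)
qed (simp add: gr_op_Nil gr_weight_def)

lemma gr_weight_nonneg: "0 \<le> gr_weight L"
  by (induction L) (auto simp: gr_weight_def)

lemma inner_gr_op_bound:
  assumes "gr_list G L"
  shows "inner (gr_op G L u) (gr_op G L u) \<le> of_int ((1 + gr_weight L)\<^sup>2) * inner u u"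
proof -
  have "norm (gr_op G L u) \<le> of_int (gr_weight L) * norm u" by (rule norm_gr_op[OF assms])
  also have "\<dots> \<le> of_int (1 + gr_weight L) * norm u" by (intro mult_right_mono) auto
  finally have "(norm (gr_op G L u))\<^sup>2 \<le> (of_int (1 + gr_weight L) * norm u)\<^sup>2"
    by (intro power_mono) auto
  then show ?thesis by (simp add: power2_norm_eq_inner power_mult_distrib)
qed

lemma inner_gr_op: "gr_list G L \<Longrightarrow> inner (gr_op G L u) v = inner u (gr_op G (gr_adj G L) v)"
proof (induction L)
  case (Cons t L)
  obtain c y x h where t: "t = (c, y, x, h)" by (metis surj_pair)
  have h: "h \<in> carrier G" and L: "gr_list G L" using Cons.prems by (auto simp: t gr_list_def)
  have bij: "bij_betw (\<lambda>(_, g). (x, h \<otimes> g)) ({y} \<times> carrier G) ({x} \<times> carrier G)"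
  proof (rule bij_betw_byWitness[where f' = "\<lambda>(_, g). (y, inv h \<otimes> g)"])
    show "\<forall>a\<in>{y} \<times> carrier G. (\<lambda>(_, g). (y, inv h \<otimes> g)) ((\<lambda>(_, g). (x, h \<otimes> g)) a) = a"
      "\<forall>a\<in>{x} \<times> carrier G. (\<lambda>(_, g). (x, h \<otimes> g)) ((\<lambda>(_, g). (y, inv h \<otimes> g)) a) = a"
      using h by (auto simp flip: m_assoc)
  qed (use h in auto)
  have "inner (pull ({y} \<times> carrier G) (\<lambda>(_, g). (x, h \<otimes> g)) u) v
      = inner u (pull ({x} \<times> carrier G) (\<lambda>(_, g). (y, inv h \<otimes> g)) v)"
    by (rule inner_pull[OF bij _ inj_translate[OF inv_closed[OF h]]]) (use h in \<open>auto simp flip: m_assoc\<close>)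
  then show ?case
    using Cons.IH[OF L] by (simp add: t gr_op_Cons gr_adj_def inner_add_left inner_add_right)
qed (simp add: gr_op_Nil gr_adj_def)

lemma gr_fun_coeff:
  fixes u :: "'x \<Rightarrow> 'a \<Rightarrow> 'r::comm_ring_1"
  assumes "finite (carrier G)" "finite X" "g \<in> carrier G" "gr_list G L" "\<And>c y x h. (c, y, x, h) \<in> set L \<Longrightarrow> x \<in> X"
  shows "gr_fun G L u y' g = (\<Sum>z\<in>X \<times> carrier G. of_int (gr_coeff G L (y', g) z) * case_prod u z)"
  using assms(4,5)
proof (induction L)
  case (Cons t L)
  obtain c y x h where t: "t = (c, y, x, h)" by (metis surj_pair)
  have h: "h \<in> carrier G" and L: "gr_list G L" and x: "x \<in> X" using Cons.prems by (auto simp: t gr_list_def)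
  have coeff: "gr_coeff G (t # L) (y', g) z = (if z = (x, h \<otimes> g) then (if y = y' then c else 0) else 0) + gr_coeff G L (y', g) z" for z
    by (cases z) (auto simp: t gr_coeff_def)
  have "(\<Sum>z\<in>X \<times> carrier G. of_int (gr_coeff G (t # L) (y', g) z) * case_prod u z)
      = (\<Sum>z\<in>X \<times> carrier G. if z = (x, h \<otimes> g) then (if y = y' then of_int c * u x (h \<otimes> g) else 0) else 0)
        + (\<Sum>z\<in>X \<times> carrier G. of_int (gr_coeff G L (y', g) z) * case_prod u z)"
    unfolding sum.distrib[symmetric] coeff by (intro sum.cong) (auto simp: distrib_right)
  also have "(\<Sum>z\<in>X \<times> carrier G. if z = (x, h \<otimes> g) then (if y = y' then of_int c * u x (h \<otimes> g) else 0) else 0)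
      = (if y = y' then of_int c * u x (h \<otimes> g) else 0)"
    using assms(1-3) h x by (subst sum.delta) auto
  also have "(\<Sum>z\<in>X \<times> carrier G. of_int (gr_coeff G L (y', g) z) * case_prod u z) = gr_fun G L u y' g"
    by (rule Cons.IH[OF L, symmetric]) (use Cons.prems(2) in auto)
  finally show ?case by (simp add: t gr_fun_Cons)
qed (simp add: gr_fun_def gr_coeff_def case_prod_unfold)

lemma gr_coeff_adj:
  assumes "gr_list G L" "g \<in> carrier G" "g' \<in> carrier G"
  shows "gr_coeff G (gr_adj G L) (x, g') (y, g) = gr_coeff G L (y, g) (x, g')"
  using assms(1)
proof (induction L)
  case (Cons t L)
  obtain c y1 x1 h where t: "t = (c, y1, x1, h)" by (metis surj_pair)
  have h: "h \<in> carrier G" and L: "gr_list G L" using Cons.prems by (auto simp: t gr_list_def)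
  have "g = inv h \<otimes> g' \<longleftrightarrow> g' = h \<otimes> g"
    using inv_mult_eq_iff[OF h assms(3,2)] by metis
  then show ?case using Cons.IH[OF L] by (simp add: t gr_coeff_def gr_adj_def conj_commute conj_left_commute)
qed (simp add: gr_coeff_def gr_adj_def)

end

text \<open>The map of group rings induced by \<open>\<pi>\<close>, summing coefficients over
  fibres. It is a relation because it concerns finitely supported vectors only; \<open>E\<close> is
  a set containing the support.\<close>

definition pushes :: "('a, 'b) monoid_scheme \<Rightarrow> ('a \<Rightarrow> 'q) \<Rightarrow> ('x \<times> 'a) ell2 \<Rightarrow> ('x \<times> 'q) ell2 \<Rightarrow> bool" where
  "pushes G \<pi> u v \<longleftrightarrow> (\<exists>E. finite E \<and> E \<subseteq> carrier G \<and> (\<forall>x g. g \<notin> E \<longrightarrow> ell2_fun u (x, g) = 0) \<and>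
     (\<forall>x q. ell2_fun v (x, q) = (\<Sum>g\<in>E. if \<pi> g = q then ell2_fun u (x, g) else 0)))"

lemma pushes_superset:
  assumes "\<And>x q. ell2_fun v (x, q) = (\<Sum>g\<in>E. if \<pi> g = q then ell2_fun u (x, g) else 0)"
    "\<And>x g. g \<notin> E \<Longrightarrow> ell2_fun u (x, g) = 0" "E \<subseteq> F" "finite F"
  shows "ell2_fun v (x, q) = (\<Sum>g\<in>F. if \<pi> g = q then ell2_fun u (x, g) else 0)"
  unfolding assms(1) using assms(2-4) by (intro sum.mono_neutral_left) auto

lemma pushes_lincomb:
  assumes "pushes G \<pi> u v" "pushes G \<pi> u' v'"
  shows "pushes G \<pi> (a *\<^sub>R u + b *\<^sub>R u') (a *\<^sub>R v + b *\<^sub>R v')"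
proof -
  obtain E where E: "finite E" "E \<subseteq> carrier G" "\<And>x g. g \<notin> E \<Longrightarrow> ell2_fun u (x, g) = 0"
    "\<And>x q. ell2_fun v (x, q) = (\<Sum>g\<in>E. if \<pi> g = q then ell2_fun u (x, g) else 0)"
    using assms(1) unfolding pushes_def by auto
  obtain E' where E': "finite E'" "E' \<subseteq> carrier G" "\<And>x g. g \<notin> E' \<Longrightarrow> ell2_fun u' (x, g) = 0"
    "\<And>x q. ell2_fun v' (x, q) = (\<Sum>g\<in>E'. if \<pi> g = q then ell2_fun u' (x, g) else 0)"
    using assms(2) unfolding pushes_def by auto
  have fin: "finite (E \<union> E')" using E E' by simp
  have v: "ell2_fun v (x, q) = (\<Sum>g\<in>E \<union> E'. if \<pi> g = q then ell2_fun u (x, g) else 0)" for x q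
    by (rule pushes_superset[OF E(4,3) Un_upper1 fin])
  have v': "ell2_fun v' (x, q) = (\<Sum>g\<in>E \<union> E'. if \<pi> g = q then ell2_fun u' (x, g) else 0)" for x q
    by (rule pushes_superset[OF E'(4,3) Un_upper2 fin])
  have "ell2_fun (a *\<^sub>R v + b *\<^sub>R v') (x, q)
      = (\<Sum>g\<in>E \<union> E'. if \<pi> g = q then ell2_fun (a *\<^sub>R u + b *\<^sub>R u') (x, g) else 0)" for x q
    unfolding ell2_fun_simps v v' sum_distrib_left sum.distrib[symmetric] by (intro sum.cong) auto
  moreover have "ell2_fun (a *\<^sub>R u + b *\<^sub>R u') (x, g) = 0" if "g \<notin> E \<union> E'" for x g
    using that E(3) E'(3) by simp
  ultimately show ?thesis unfolding pushes_def using E(2) E'(2) fin by (intro exI[of _ "E \<union> E'"]) simp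
qed

text \<open>A translation by \<open>h\<close> in \<open>G\<close> becomes the translation by
  \<open>\<pi> h\<close> in \<open>Q\<close>. The support moves by \<open>inv h\<close>, which
  determines the witness \<open>?E\<close>.\<close>

lemma pushes_gr_op:
  assumes G: "group G" and Q: "group Q" and \<pi>: "\<pi> \<in> hom G Q" and L: "gr_list G L" and uv: "pushes G \<pi> u v"
  shows "pushes G \<pi> (gr_op G L u) (gr_op Q (gr_map \<pi> L) v)"
  using L
proof (induction L)
  case Nil
  then show ?case by (auto simp: pushes_def gr_map_def gr_op_def)
next
  case (Cons t L)
  interpret G: group G by fact
  interpret Q: group Q by fact
  interpret \<pi>: group_hom G Q \<pi> using \<pi> by (simp add: group_hom_def group_hom_axioms_def G Q)
  obtain c y x h where t: "t = (c, y, x, h)" by (metis surj_pair)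
  have h: "h \<in> carrier G" and L: "gr_list G L" using Cons.prems by (auto simp: t gr_list_def)
  have \<pi>h: "\<pi> h \<in> carrier Q" using h by simp
  obtain E where E: "finite E" "E \<subseteq> carrier G" "\<And>x g. g \<notin> E \<Longrightarrow> ell2_fun u (x, g) = 0"
    "\<And>x q. ell2_fun v (x, q) = (\<Sum>g\<in>E. if \<pi> g = q then ell2_fun u (x, g) else 0)"
    using uv unfolding pushes_def by auto
  let ?u = "pull ({y} \<times> carrier G) (\<lambda>(_, g). (x, h \<otimes>\<^bsub>G\<^esub> g)) u"
  let ?v = "pull ({y} \<times> carrier Q) (\<lambda>(_, q). (x, \<pi> h \<otimes>\<^bsub>Q\<^esub> q)) v"
  let ?E = "(\<lambda>g. inv\<^bsub>G\<^esub> h \<otimes>\<^bsub>G\<^esub> g) ` E"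
  have fu: "ell2_fun ?u (y', g) = (if y' = y \<and> g \<in> carrier G then ell2_fun u (x, h \<otimes>\<^bsub>G\<^esub> g) else 0)" for y' g
    by (simp add: ell2_fun_pull[OF G.inj_translate[OF h]])
  have fv: "ell2_fun ?v (y', q) = (if y' = y \<and> q \<in> carrier Q then ell2_fun v (x, \<pi> h \<otimes>\<^bsub>Q\<^esub> q) else 0)" for y' q
    by (simp add: ell2_fun_pull[OF Q.inj_translate[OF \<pi>h]])
  have inj: "inj_on (\<lambda>g. inv\<^bsub>G\<^esub> h \<otimes>\<^bsub>G\<^esub> g) E"
    using G.inj_on_cmult[OF G.inv_closed[OF h]] E(2) by (rule inj_on_subset)
  have "pushes G \<pi> ?u ?v"
    unfolding pushes_def
  proof (intro exI[of _ ?E] conjI allI impI)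
    show "finite ?E" using E by simp
    show "?E \<subseteq> carrier G" using E h by auto
    show "ell2_fun ?u (y', g) = 0" if g: "g \<notin> ?E" for y' g
    proof (cases "g \<in> carrier G")
      case True
      then have "g = inv\<^bsub>G\<^esub> h \<otimes>\<^bsub>G\<^esub> (h \<otimes>\<^bsub>G\<^esub> g)" using h by (simp flip: G.m_assoc)
      then have "h \<otimes>\<^bsub>G\<^esub> g \<notin> E" using g by blast
      then show ?thesis by (simp add: fu E(3))
    qed (simp add: fu)
    fix y' q
    show "ell2_fun ?v (y', q) = (\<Sum>g\<in>?E. if \<pi> g = q then ell2_fun ?u (y', g) else 0)"
    proof (cases "y' = y \<and> q \<in> carrier Q")
      case True
      have eq: "\<pi> (inv\<^bsub>G\<^esub> h \<otimes>\<^bsub>G\<^esub> g) = q \<longleftrightarrow> \<pi> g = \<pi> h \<otimes>\<^bsub>Q\<^esub> q" if "g \<in> E" for g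
        using subsetD[OF E(2) that] h True Q.inv_mult_eq_iff[of "\<pi> h" "\<pi> g" q] by simp
      have hg: "h \<otimes>\<^bsub>G\<^esub> (inv\<^bsub>G\<^esub> h \<otimes>\<^bsub>G\<^esub> g) = g" "inv\<^bsub>G\<^esub> h \<otimes>\<^bsub>G\<^esub> g \<in> carrier G" if "g \<in> E" for g
        using E(2) that h by (auto simp flip: G.m_assoc)
      have "(\<Sum>g\<in>?E. if \<pi> g = q then ell2_fun ?u (y', g) else 0)
          = (\<Sum>g\<in>E. if \<pi> g = \<pi> h \<otimes>\<^bsub>Q\<^esub> q then ell2_fun u (x, g) else 0)"
        unfolding sum.reindex[OF inj] comp_def using True eq hg by (intro sum.cong) (simp_all add: fu)
      then show ?thesis using True by (simp add: fv E(4))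
    next
      case False
      have "(if \<pi> g = q then ell2_fun ?u (y', g) else 0) = 0" if "g \<in> ?E" for g
        using False that E(2) h by (auto simp: fu)
      then have "(\<Sum>g\<in>?E. if \<pi> g = q then ell2_fun ?u (y', g) else 0) = 0" by (intro sum.neutral) blast
      then show ?thesis using False unfolding fv by presburger
    qed
  qed
  from pushes_lincomb[OF this Cons.IH[OF L], of "of_int c" 1] show ?case
    by (simp add: t G.gr_op_Cons Q.gr_op_Cons gr_map_def)
qed

text \<open>The weight bounds the operator norm, so this bounds its square. Adding 1 makes the
  constant at least 1 and its logarithm nonnegative. It only depends on the integer coefficients and
  so is unchanged in quotients.\<close>

definition gr_bound :: "(int \<times> 'y \<times> 'x \<times> 'a) list \<Rightarrow> real" where
  "gr_bound L = of_int ((1 + gr_weight L)\<^sup>2)"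

definition gr_contraction :: "('a, 'b) monoid_scheme \<Rightarrow> (int \<times> 'y \<times> 'x \<times> 'a) list \<Rightarrow> ('x \<times> 'a) ell2 \<Rightarrow> ('x \<times> 'a) ell2" where
  "gr_contraction H L = Cop (gr_bound L) (gr_op H L) (gr_op H (gr_adj H L))"

definition gr_trace :: "('a, 'b) monoid_scheme \<Rightarrow> (int \<times> 'y \<times> 'x \<times> 'a) list \<Rightarrow> 'x set \<Rightarrow> nat \<Rightarrow> real" where
  "gr_trace H L X k = (\<Sum>x\<in>X. Re (ell2_fun ((gr_contraction H L ^^ k) (unit_vec2 (x, \<one>\<^bsub>H\<^esub>))) (x, \<one>\<^bsub>H\<^esub>)))"

lemma gr_contraction_apply:
  "gr_contraction H L u = 1 *\<^sub>R u + (- inverse (gr_bound L)) *\<^sub>R gr_op H (gr_adj H L) (gr_op H L u)"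
  by (simp add: gr_contraction_def Cop_def)

lemma gr_bound_map: "gr_bound (gr_map \<pi> L) = gr_bound L"
proof -
  have "gr_weight (gr_map \<pi> L) = gr_weight L" by (induction L) (auto simp: gr_weight_def gr_map_def)
  then show ?thesis by (simp add: gr_bound_def)
qed

lemma gr_adj_map:
  assumes "group G" "group Q" "\<pi> \<in> hom G Q" "gr_list G L"
  shows "gr_adj Q (gr_map \<pi> L) = gr_map \<pi> (gr_adj G L)"
proof -
  interpret group_hom G Q \<pi> using assms by (simp add: group_hom_def group_hom_axioms_def)
  show ?thesis using assms(4) by (auto simp: gr_adj_def gr_map_def gr_list_def)
qed

lemma pushes_gr_contraction:
  assumes "group G" "group Q" "\<pi> \<in> hom G Q" "gr_list G L" "pushes G \<pi> u v"
  shows "pushes G \<pi> ((gr_contraction G L ^^ k) u) ((gr_contraction Q (gr_map \<pi> L) ^^ k) v)"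
proof (induction k)
  case (Suc k)
  have adj: "gr_list G (gr_adj G L)" by (rule group.gr_list_adj[OF assms(1,4)])
  show ?case
    unfolding funpow.simps comp_apply gr_contraction_apply[of _ _ "(_ ^^ _) _"] gr_bound_map gr_adj_map[OF assms(1-4)]
    by (intro pushes_lincomb pushes_gr_op[OF assms(1-3)] assms(4) adj Suc)
qed (use assms in simp)

lemma pushes_unit_vec2:
  assumes "group G" "group Q" "\<pi> \<in> hom G Q"
  shows "pushes G \<pi> (unit_vec2 (x, \<one>\<^bsub>G\<^esub>)) (unit_vec2 (x, \<one>\<^bsub>Q\<^esub>))"
proof -
  interpret group_hom G Q \<pi> using assms by (simp add: group_hom_def group_hom_axioms_def)
  show ?thesis
    unfolding pushes_def by (intro exI[of _ "{\<one>\<^bsub>G\<^esub>}"]) (auto simp: unit_vec2.rep_eq)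
qed

text \<open>For fixed \<open>k\<close> the iterates of the unit vectors have finite support. If
  \<open>\<pi>\<close> maps no nontrivial element of the support to the identity, then the fibre sum
  at the identity of \<open>Q\<close> has only the term at the identity of \<open>G\<close>.\<close>

lemma gr_trace_quotient:
  fixes G :: "('a, 'b) monoid_scheme" and L :: "(int \<times> 'y \<times> 'x \<times> 'a) list"
  assumes G: "group G" and L: "gr_list G L" and X: "finite X"
  obtains E where "finite E" "E \<subseteq> carrier G - {\<one>\<^bsub>G\<^esub>}"
    "\<And>(Q :: ('q, 'e) monoid_scheme) \<pi>. group Q \<Longrightarrow> \<pi> \<in> hom G Q \<Longrightarrow> (\<And>e. e \<in> E \<Longrightarrow> \<pi> e \<noteq> \<one>\<^bsub>Q\<^esub>) \<Longrightarrow>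
      gr_trace Q (gr_map \<pi> L) X k = gr_trace G L X k"
proof -
  interpret G: group G by fact
  let ?c = "\<lambda>x. (gr_contraction G L ^^ k) (unit_vec2 (x, \<one>\<^bsub>G\<^esub>))"
  have "\<exists>E. finite E \<and> E \<subseteq> carrier G \<and> (\<forall>y g. g \<notin> E \<longrightarrow> ell2_fun (?c x) (y, g) = 0)" for x
  proof -
    \<comment> \<open>Pushing along the identity map is a way to obtain the finite support in
      \<open>G\<close> itself.\<close>
    have id: "(\<lambda>g. g) \<in> hom G G" by (auto simp: hom_def)
    show ?thesis
      using pushes_gr_contraction[OF G G id L pushes_unit_vec2[OF G G id], of k x] unfolding pushes_def by blast
  qed
  then have "\<forall>x. \<exists>E. finite E \<and> E \<subseteq> carrier G \<and> (\<forall>y g. g \<notin> E \<longrightarrow> ell2_fun (?c x) (y, g) = 0)" ..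
  from choice[OF this] obtain E where
    E: "\<And>x. finite (E x)" "\<And>x. E x \<subseteq> carrier G" "\<And>x y g. g \<notin> E x \<Longrightarrow> ell2_fun (?c x) (y, g) = 0"
    by blast
  show thesis
  proof (rule that[of "(\<Union>x\<in>X. E x) - {\<one>\<^bsub>G\<^esub>}"])
    show "finite ((\<Union>x\<in>X. E x) - {\<one>\<^bsub>G\<^esub>})" using X E(1) by simp
    show "(\<Union>x\<in>X. E x) - {\<one>\<^bsub>G\<^esub>} \<subseteq> carrier G - {\<one>\<^bsub>G\<^esub>}" using E(2) by blast
    fix Q :: "('q, 'e) monoid_scheme" and \<pi>
    assume Q: "group Q" and \<pi>: "\<pi> \<in> hom G Q" and ne: "\<And>e. e \<in> (\<Union>x\<in>X. E x) - {\<one>\<^bsub>G\<^esub>} \<Longrightarrow> \<pi> e \<noteq> \<one>\<^bsub>Q\<^esub>"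
    interpret \<pi>: group_hom G Q \<pi> using G Q \<pi> by (simp add: group_hom_def group_hom_axioms_def)
    have "ell2_fun ((gr_contraction Q (gr_map \<pi> L) ^^ k) (unit_vec2 (x, \<one>\<^bsub>Q\<^esub>))) (x, \<one>\<^bsub>Q\<^esub>) = ell2_fun (?c x) (x, \<one>\<^bsub>G\<^esub>)"
      if x: "x \<in> X" for x
    proof -
      let ?d = "(gr_contraction Q (gr_map \<pi> L) ^^ k) (unit_vec2 (x, \<one>\<^bsub>Q\<^esub>))"
      have "pushes G \<pi> (?c x) ?d"
        by (rule pushes_gr_contraction[OF G Q \<pi> L pushes_unit_vec2[OF G Q \<pi>]])
      then obtain F where F: "finite F" "F \<subseteq> carrier G" "\<And>y g. g \<notin> F \<Longrightarrow> ell2_fun (?c x) (y, g) = 0"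
        "\<And>y q. ell2_fun ?d (y, q) = (\<Sum>g\<in>F. if \<pi> g = q then ell2_fun (?c x) (y, g) else 0)"
        unfolding pushes_def by blast
      have "ell2_fun ?d (x, \<one>\<^bsub>Q\<^esub>) = (\<Sum>g\<in>F. if g = \<one>\<^bsub>G\<^esub> then ell2_fun (?c x) (x, g) else 0)"
        unfolding F(4)
      proof (rule sum.cong)
        fix g assume "g \<in> F"
        show "(if \<pi> g = \<one>\<^bsub>Q\<^esub> then ell2_fun (?c x) (x, g) else 0) = (if g = \<one>\<^bsub>G\<^esub> then ell2_fun (?c x) (x, g) else 0)"
        proof (cases "g \<in> E x - {\<one>\<^bsub>G\<^esub>}")
          case True
          then show ?thesis using ne[of g] x by auto
        next
          case False
          then show ?thesis using E(3)[of g x x] by auto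
        qed
      qed simp
      also have "\<dots> = ell2_fun (?c x) (x, \<one>\<^bsub>G\<^esub>)"
        using F(1,3) by (simp add: sum.delta)
      finally show ?thesis .
    qed
    then show "gr_trace Q (gr_map \<pi> L) X k = gr_trace G L X k"
      unfolding gr_trace_def by (intro sum.cong) simp_all
  qed
qed

section \<open>Normalised traces over a finite group\<close>

context group
begin

lemma gr_op_translate:
  assumes "gr_list G L" "q \<in> carrier G" "g \<in> carrier G"
    and "\<And>x g. g \<in> carrier G \<Longrightarrow> ell2_fun v (x, g) = ell2_fun u (x, g \<otimes> q)"
  shows "ell2_fun (gr_op G L v) (y, g) = ell2_fun (gr_op G L u) (y, g \<otimes> q)"
proof -
  have "gr_fun G L (\<lambda>x g. ell2_fun v (x, g)) y g = gr_fun G L (\<lambda>x g. ell2_fun u (x, g)) y (g \<otimes> q)"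
    using assms(1)
  proof (induction L)
    case (Cons t L)
    obtain c y1 x h where t: "t = (c, y1, x, h)" by (metis surj_pair)
    have h: "h \<in> carrier G" and L: "gr_list G L" using Cons.prems by (auto simp: t gr_list_def)
    show ?case using Cons.IH[OF L] h assms by (simp add: t gr_fun_Cons m_assoc)
  qed (simp add: gr_fun_def)
  then show ?thesis using assms by (simp add: ell2_fun_gr_op)
qed

lemma gr_contraction_translate:
  assumes "gr_list G L" "q \<in> carrier G" "g \<in> carrier G"
    and "\<And>x g. g \<in> carrier G \<Longrightarrow> ell2_fun v (x, g) = ell2_fun u (x, g \<otimes> q)"
  shows "ell2_fun ((gr_contraction G L ^^ k) v) (x, g) = ell2_fun ((gr_contraction G L ^^ k) u) (x, g \<otimes> q)"
  using assms(3)
proof (induction k arbitrary: x g)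
  case (Suc k)
  have "ell2_fun (gr_op G (gr_adj G L) (gr_op G L ((gr_contraction G L ^^ k) v))) (x, g)
      = ell2_fun (gr_op G (gr_adj G L) (gr_op G L ((gr_contraction G L ^^ k) u))) (x, g \<otimes> q)"
    by (rule gr_op_translate[OF gr_list_adj[OF assms(1)] assms(2) Suc.prems])
      (rule gr_op_translate[OF assms(1,2)], auto intro: Suc.IH)
  then show ?case
    unfolding funpow.simps comp_apply gr_contraction_apply[of _ _ "(_ ^^ _) _"] ell2_fun_simps Suc.IH[OF Suc.prems]
    by simp
qed (simp add: assms(4))

text \<open>The operators commute with right translation, so the diagonal entry at
  \<open>(x, q)\<close> does not depend on \<open>q\<close>, and the full trace is the order of the
  group times the trace at the identity.\<close>

lemma Ctrace_gr_trace:
  assumes fin: "finite (carrier G)" "finite X" and L: "gr_list G L"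
  shows "Ctrace (X \<times> carrier G) (gr_bound L) (gr_op G L) (gr_op G (gr_adj G L)) k
    = real (card (carrier G)) * gr_trace G L X k"
proof -
  have "ell2_fun ((gr_contraction G L ^^ k) (unit_vec2 (x, \<one>))) (x, \<one>) = ell2_fun ((gr_contraction G L ^^ k) (unit_vec2 (x, q))) (x, q)"
    if "q \<in> carrier G" for x q
    using gr_contraction_translate[OF L that one_closed, of "unit_vec2 (x, \<one>)" "unit_vec2 (x, q)" k x] that
    by (simp add: unit_vec2.rep_eq)
  then have "(\<Sum>z\<in>X \<times> carrier G. Re (ell2_fun ((gr_contraction G L ^^ k) (unit_vec2 z)) z))
      = (\<Sum>x\<in>X. \<Sum>q\<in>carrier G. Re (ell2_fun ((gr_contraction G L ^^ k) (unit_vec2 (x, \<one>))) (x, \<one>)))"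
    unfolding sum.cartesian_product by (intro sum.cong) auto
  then show ?thesis
    unfolding Ctrace_def gr_trace_def gr_contraction_def[symmetric] by (simp add: sum_distrib_left)
qed

text \<open>The bounds for the integer matrix divided by the order of the group. The error term
  there is proportional to the number of coordinates, \<open>card X\<close> times the order, so
  after the division it no longer depends on the order.\<close>

theorem gr_trace_bounds:
  fixes L :: "(int \<times> 'y \<times> 'x \<times> 'a) list"
  assumes fin: "finite (carrier G)" "finite X" "finite Y" and L: "gr_list G L"
    and XY: "\<And>c y x h. (c, y, x, h) \<in> set L \<Longrightarrow> x \<in> X \<and> y \<in> Y" and p: "prime (p::nat)"
  defines "N \<equiv> \<lambda>m. card (solutions (gr_coeff G L ` (Y \<times> carrier G)) (X \<times> carrier G) m)"
    and "K \<equiv> gr_bound L"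
  shows "(\<And>k. (p ^ k) ^ (r * card (carrier G)) \<le> N (p ^ k)) \<Longrightarrow> real r \<le> gr_trace G L X k"
    and "(\<And>k. N (p ^ k) \<le> (p ^ k) ^ (r * card (carrier G))) \<Longrightarrow> 0 < e \<Longrightarrow> e < 1 \<Longrightarrow>
      gr_trace G L X (Suc k) \<le> real r + (1 / (- ln e) + (1 - e) ^ k) * (real (card X) * ln K)"
proof -
  let ?X = "X \<times> carrier G" and ?P = "Y \<times> carrier G" and ?a = "gr_coeff G L"
  let ?A = "gr_op G L" and ?B = "gr_op G (gr_adj G L)"
  have X: "finite ?X" and P: "finite ?P" using fin by auto
  have "(1::int) \<le> (1 + gr_weight L)\<^sup>2" using gr_weight_nonneg[of L] by (intro one_le_power) simp
  then have K: "1 \<le> K" unfolding K_def gr_bound_def by linarith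
  have zero: "gr_fun G M u y g = 0" if "\<And>c y' x h. (c, y', x, h) \<in> set M \<Longrightarrow> y' \<noteq> y" for y g and M :: "(int \<times> 'u \<times> 'v \<times> 'a) list" and u :: "'v \<Rightarrow> 'a \<Rightarrow> complex"
    using that
  proof (induction M)
    case (Cons t M)
    obtain c y' x h where t: "t = (c, y', x, h)" by (metis surj_pair)
    have "gr_fun G M u y g = 0" by (rule Cons.IH) (use Cons.prems in auto)
    moreover have "y' \<noteq> y" using Cons.prems[of c y' x h] by (simp add: t)
    ultimately show ?case by (simp add: t gr_fun_Cons)
  qed (simp add: gr_fun_def)
  have A: "ell2_fun (?A u) \<rho> = (if \<rho> \<in> ?P then \<Sum>x\<in>?X. of_int (?a \<rho> x) * ell2_fun u x else 0)" for u \<rho>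
  proof (cases \<rho>)
    case (Pair y g)
    show ?thesis
    proof (cases "y \<in> Y")
      case True
      then show ?thesis
        using gr_fun_coeff[OF fin(1,2) _ L, of g "\<lambda>x g. ell2_fun u (x, g)" y] XY by (simp add: Pair ell2_fun_gr_op[OF L])
    next
      case False
      then have "gr_fun G L (\<lambda>x g. ell2_fun u (x, g)) y g = 0" using XY by (intro zero) blast
      then show ?thesis using False by (simp add: Pair ell2_fun_gr_op[OF L])
    qed
  qed
  have adjXY: "y \<in> Y \<and> x \<in> X" if "(c, x, y, h) \<in> set (gr_adj G L)" for c x y h
    using that XY by (auto simp: gr_adj_def)
  have Ladj: "gr_list G (gr_adj G L)" by (rule gr_list_adj[OF L])
  have B: "ell2_fun (?B v) z = (if z \<in> ?X then \<Sum>\<rho>\<in>?P. of_int (?a \<rho> z) * ell2_fun v \<rho> else 0)" for v z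
  proof (cases z)
    case (Pair x g)
    show ?thesis
    proof (cases "x \<in> X \<and> g \<in> carrier G")
      case True
      have "gr_fun G (gr_adj G L) (\<lambda>x g. ell2_fun v (x, g)) x g
          = (\<Sum>\<rho>\<in>?P. of_int (gr_coeff G (gr_adj G L) (x, g) \<rho>) * case_prod (\<lambda>x g. ell2_fun v (x, g)) \<rho>)"
        by (rule gr_fun_coeff[OF fin(1,3) _ Ladj]) (use True adjXY in auto)
      also have "\<dots> = (\<Sum>\<rho>\<in>?P. of_int (?a \<rho> z) * ell2_fun v \<rho>)"
        using True by (intro sum.cong) (auto simp: Pair gr_coeff_adj[OF L])
      finally show ?thesis using True by (simp add: Pair ell2_fun_gr_op[OF Ladj])
    next
      case False
      have "gr_fun G (gr_adj G L) (\<lambda>x g. ell2_fun v (x, g)) x g = 0" if "x \<notin> X"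
        using adjXY that by (intro zero) blast
      then show ?thesis using False by (auto simp: Pair ell2_fun_gr_op[OF Ladj])
    qed
  qed
  have bound: "inner (?A u) (?A u) \<le> K * inner u u" for u
    unfolding K_def gr_bound_def by (rule inner_gr_op_bound[OF L])
  have C: "Ctrace ?X K ?A ?B k = real (card (carrier G)) * gr_trace G L X k" for k
    unfolding K_def by (rule Ctrace_gr_trace[OF fin(1,2) L])
  have pos: "0 < real (card (carrier G))" using fin(1) by (auto simp: card_gt_0_iff)
  show "real r \<le> gr_trace G L X k" if "\<And>k. (p ^ k) ^ (r * card (carrier G)) \<le> N (p ^ k)"
  proof -
    have "real (r * card (carrier G)) \<le> real (card (carrier G)) * gr_trace G L X k"
      using Ctrace_bounds(1)[OF X P K A B bound p that[unfolded N_def], of k] unfolding C .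
    then show ?thesis using pos by (simp add: mult.commute)
  qed
  show "gr_trace G L X (Suc k) \<le> real r + (1 / (- ln e) + (1 - e) ^ k) * (real (card X) * ln K)"
    if "\<And>k. N (p ^ k) \<le> (p ^ k) ^ (r * card (carrier G))" "0 < e" "e < 1"
  proof -
    have "real (card (carrier G)) * gr_trace G L X (Suc k)
        \<le> real (r * card (carrier G)) + (1 / (- ln e) + (1 - e) ^ k) * (real (card ?X) * ln K)"
      using Ctrace_bounds(2)[OF X P K A B bound p that[unfolded N_def], of k] unfolding C .
    also have "\<dots> = real (card (carrier G)) * (real r + (1 / (- ln e) + (1 - e) ^ k) * (real (card X) * ln K))"
      by (simp add: card_cartesian_product distrib_left mult.commute mult.left_commute)
    finally show ?thesis using pos by simp
  qed
qed

end

section \<open>Traces of Fox matrices\<close>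

fun fox_terms :: "('a, 'b) monoid_scheme \<Rightarrow> ('i \<Rightarrow> 'a) \<Rightarrow> 'y \<Rightarrow> ('i \<times> bool) list \<Rightarrow> (int \<times> 'y \<times> 'i \<times> 'a) list" where
  "fox_terms H \<sigma> y [] = []"
| "fox_terms H \<sigma> y (a # w) = (if snd a then (1, y, fst a, \<one>\<^bsub>H\<^esub>) else (- 1, y, fst a, \<sigma> (fst a)))
     # map (\<lambda>(c, y, i, h). (c, y, i, h \<otimes>\<^bsub>H\<^esub> inv\<^bsub>H\<^esub> (letter_image H \<sigma> a))) (fox_terms H \<sigma> y w)"

text \<open>Each row is indexed by the word that it comes from; the list of words must therefore be
  distinct for the rows to be the Fox equations.\<close>

definition fox_matrix :: "('a, 'b) monoid_scheme \<Rightarrow> ('i \<Rightarrow> 'a) \<Rightarrow> ('i \<times> bool) list list \<Rightarrow> (int \<times> ('i \<times> bool) list \<times> 'i \<times> 'a) list" where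
  "fox_matrix H \<sigma> ws = concat (map (\<lambda>w. fox_terms H \<sigma> w w) ws)"

lemma gr_map_Cons: "gr_map \<pi> ((c, y, x, h) # M) = (c, y, x, \<pi> h) # gr_map \<pi> M"
  by (simp add: gr_map_def)

context group
begin

lemma fox_terms_mem:
  assumes "\<sigma> ` S \<subseteq> carrier G" "fst ` set w \<subseteq> S" "(c, y', i, h) \<in> set (fox_terms G \<sigma> y w)"
  shows "y' = y \<and> i \<in> S \<and> h \<in> carrier G"
  using assms(2,3)
proof (induction w arbitrary: c y' i h)
  case (Cons a w)
  have a: "letter_image G \<sigma> a \<in> carrier G" "\<sigma> (fst a) \<in> carrier G" "fst a \<in> S"
    using letter_image_closed[OF assms(1)] assms(1) Cons.prems by auto
  have IH: "y1 = y \<and> i1 \<in> S \<and> h1 \<in> carrier G" if "(c1, y1, i1, h1) \<in> set (fox_terms G \<sigma> y w)" for c1 y1 i1 h1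
    by (rule Cons.IH[OF _ that]) (use Cons.prems in auto)
  show ?case using Cons.prems(2) a by (auto split: if_splits dest!: IH)
qed simp

lemma gr_fun_shift:
  assumes "gr_list G M" "x \<in> carrier G" "g \<in> carrier G"
  shows "gr_fun G (map (\<lambda>(c, y, i, h). (c, y, i, h \<otimes> x)) M) u y' g = gr_fun G M u y' (x \<otimes> g)"
  using assms by (induction M) (auto simp: gr_fun_def gr_list_def m_assoc)

lemma gr_fun_fox_terms:
  assumes "\<sigma> ` S \<subseteq> carrier G" "fst ` set w \<subseteq> S" "g \<in> carrier G"
  shows "gr_fun G (fox_terms G \<sigma> y w) u y' g = (if y = y' then fox G \<sigma> (case_prod u) w g else 0)"
  using assms(2,3)
proof (induction w arbitrary: g)
  case (Cons a w)
  have a: "letter_image G \<sigma> a \<in> carrier G" "\<sigma> (fst a) \<in> carrier G" "fst a \<in> S"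
    using letter_image_closed[OF assms(1)] assms(1) Cons.prems by auto
  have "gr_list G (fox_terms G \<sigma> y w)"
    unfolding gr_list_def using fox_terms_mem[OF assms(1), of w] Cons.prems by (auto dest!: fox_terms_mem[OF assms(1), rotated])
  from gr_fun_shift[OF this _ Cons.prems(2), of "inv (letter_image G \<sigma> a)" u y'] have "gr_fun G (map (\<lambda>(c, y, i, h). (c, y, i, h \<otimes> inv (letter_image G \<sigma> a))) (fox_terms G \<sigma> y w)) u y' g
      = (if y = y' then fox G \<sigma> (case_prod u) w (inv (letter_image G \<sigma> a) \<otimes> g) else 0)"
    using Cons a by simp
  then show ?case using Cons.prems by (cases "y = y'") (simp_all add: gr_fun_Cons)
qed (simp add: gr_fun_def)

lemma gr_fun_append: "gr_fun G (L @ M) u y g = gr_fun G L u y g + gr_fun G M u y g"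
  by (simp add: gr_fun_def)

lemma gr_fun_fox_matrix:
  assumes "\<sigma> ` S \<subseteq> carrier G" "\<And>w. w \<in> set ws \<Longrightarrow> fst ` set w \<subseteq> S" "g \<in> carrier G" "distinct ws"
  shows "gr_fun G (fox_matrix G \<sigma> ws) u w g = (if w \<in> set ws then fox G \<sigma> (case_prod u) w g else 0)"
  using assms(2,4)
proof (induction ws)
  case (Cons v ws)
  have "gr_fun G (fox_terms G \<sigma> v v) u w g = (if v = w then fox G \<sigma> (case_prod u) v g else 0)"
    by (rule gr_fun_fox_terms[OF assms(1) _ assms(3)]) (use Cons.prems in auto)
  then show ?case using Cons by (auto simp: fox_matrix_def gr_fun_append)
qed (simp add: fox_matrix_def gr_fun_def)

lemma fox_matrix_mem:
  assumes "\<sigma> ` S \<subseteq> carrier G" "\<And>w. w \<in> set ws \<Longrightarrow> fst ` set w \<subseteq> S" "(c, y, i, h) \<in> set (fox_matrix G \<sigma> ws)"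
  shows "y \<in> set ws \<and> i \<in> S \<and> h \<in> carrier G"
proof -
  obtain w where w: "w \<in> set ws" "(c, y, i, h) \<in> set (fox_terms G \<sigma> w w)"
    using assms(3) by (auto simp: fox_matrix_def)
  then show ?thesis using fox_terms_mem[OF assms(1) assms(2)[OF w(1)] w(2)] by blast
qed

lemma gr_list_fox_matrix:
  assumes "\<sigma> ` S \<subseteq> carrier G" "\<And>w. w \<in> set ws \<Longrightarrow> fst ` set w \<subseteq> S"
  shows "gr_list G (fox_matrix G \<sigma> ws)"
  unfolding gr_list_def using fox_matrix_mem[OF assms] by blast

lemma gr_map_fox_terms:
  assumes Q: "group Q" and \<pi>: "\<pi> \<in> hom G Q" and \<sigma>: "\<sigma> ` S \<subseteq> carrier G" and w: "fst ` set w \<subseteq> S"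
  shows "gr_map \<pi> (fox_terms G \<sigma> y w) = fox_terms Q (\<lambda>s. \<pi> (\<sigma> s)) y w"
  using w
proof (induction w)
  case (Cons a w)
  interpret \<pi>: group_hom G Q \<pi> using Q \<pi> by (simp add: group_hom_def group_hom_axioms_def is_group)
  have a: "letter_image G \<sigma> a \<in> carrier G" "\<sigma> (fst a) \<in> carrier G"
    using letter_image_closed[OF \<sigma>] \<sigma> Cons.prems by auto
  have l: "\<pi> (letter_image G \<sigma> a) = letter_image Q (\<lambda>s. \<pi> (\<sigma> s)) a"
    using a(2) by (simp add: letter_image_def)
  have w: "fst ` set w \<subseteq> S" using Cons.prems by simp
  have "gr_map \<pi> (map (\<lambda>(c, y, i, h). (c, y, i, h \<otimes> inv (letter_image G \<sigma> a))) (fox_terms G \<sigma> y w))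
      = map (\<lambda>(c, y, i, h). (c, y, i, h \<otimes>\<^bsub>Q\<^esub> inv\<^bsub>Q\<^esub> (\<pi> (letter_image G \<sigma> a)))) (gr_map \<pi> (fox_terms G \<sigma> y w))"
    using fox_terms_mem[OF \<sigma> w] a(1) by (fastforce simp: gr_map_def)
  then have "gr_map \<pi> (map (\<lambda>(c, y, i, h). (c, y, i, h \<otimes> inv (letter_image G \<sigma> a))) (fox_terms G \<sigma> y w))
      = map (\<lambda>(c, y, i, h). (c, y, i, h \<otimes>\<^bsub>Q\<^esub> inv\<^bsub>Q\<^esub> (letter_image Q (\<lambda>s. \<pi> (\<sigma> s)) a))) (fox_terms Q (\<lambda>s. \<pi> (\<sigma> s)) y w)"
    unfolding Cons.IH[OF w] l .
  then show ?case by (simp add: gr_map_Cons)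
qed (simp add: gr_map_def)

lemma gr_map_fox_matrix:
  assumes Q: "group Q" and \<pi>: "\<pi> \<in> hom G Q" and \<sigma>: "\<sigma> ` S \<subseteq> carrier G" and ws: "\<And>w. w \<in> set ws \<Longrightarrow> fst ` set w \<subseteq> S"
  shows "gr_map \<pi> (fox_matrix G \<sigma> ws) = fox_matrix Q (\<lambda>s. \<pi> (\<sigma> s)) ws"
proof -
  have "gr_map \<pi> (fox_matrix G \<sigma> ws) = concat (map (\<lambda>w. gr_map \<pi> (fox_terms G \<sigma> w w)) ws)"
    by (simp add: fox_matrix_def gr_map_def map_concat comp_def)
  also have "map (\<lambda>w. gr_map \<pi> (fox_terms G \<sigma> w w)) ws = map (\<lambda>w. fox_terms Q (\<lambda>s. \<pi> (\<sigma> s)) w w) ws"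
    by (intro map_cong refl gr_map_fox_terms[OF Q \<pi> \<sigma>] ws)
  finally show ?thesis by (simp add: fox_matrix_def)
qed

lemma solutions_fox_matrix:
  assumes fin: "finite (carrier G)" "finite S" and \<sigma>: "\<sigma> ` S \<subseteq> carrier G"
    and ws: "\<And>w. w \<in> set ws \<Longrightarrow> fst ` set w \<subseteq> S" "distinct ws"
  shows "solutions (gr_coeff G (fox_matrix G \<sigma> ws) ` (set ws \<times> carrier G)) (S \<times> carrier G) m = fox_solutions G \<sigma> S (set ws) m"
proof -
  have eq: "(\<Sum>z\<in>S \<times> carrier G. gr_coeff G (fox_matrix G \<sigma> ws) (w, g) z * u z) = fox G \<sigma> u w g"
    if wg: "w \<in> set ws" "g \<in> carrier G" for w g and u :: "'c \<times> 'a \<Rightarrow> int"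
  proof -
    have "gr_fun G (fox_matrix G \<sigma> ws) (curry u) w g
        = (\<Sum>z\<in>S \<times> carrier G. of_int (gr_coeff G (fox_matrix G \<sigma> ws) (w, g) z) * case_prod (curry u) z)"
      by (rule gr_fun_coeff[OF fin wg(2) gr_list_fox_matrix[OF \<sigma> ws(1)]]) (use fox_matrix_mem[OF \<sigma> ws(1)] in blast)+
    then show ?thesis using gr_fun_fox_matrix[OF \<sigma> ws(1) wg(2) ws(2), of "curry u" w] wg(1) by simp
  qed
  show ?thesis unfolding solutions_def fox_solutions_def
    by (intro Collect_cong conj_cong refl) (auto simp: eq)
qed

lemma gr_kernel_projection:
  assumes L: "gr_list G L"
  obtains q where "\<And>x. is_proj {v. gr_op G L v = 0} (unit_vec2 (x, \<one>)) (q x)"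
    "\<And>X. gr_trace G L X \<longlonglongrightarrow> (\<Sum>x\<in>X. inner (q x) (unit_vec2 (x, \<one>)))"
proof -
  have "(1::int) \<le> (1 + gr_weight L)\<^sup>2" using gr_weight_nonneg[of L] by (intro one_le_power) simp
  then have K: "0 < gr_bound L" unfolding gr_bound_def by linarith
  have C: "gr_contraction G L = (\<lambda>x. x - gr_op G (gr_adj G L) (gr_op G L x) /\<^sub>R gr_bound L)"
    by (rule ext) (simp add: gr_contraction_def Cop_def)
  have "\<exists>p. (\<lambda>k. (gr_contraction G L ^^ k) (unit_vec2 (x, \<one>))) \<longlonglongrightarrow> p \<and> is_proj {v. gr_op G L v = 0} (unit_vec2 (x, \<one>)) p" for x
  proof (rule kernel_projection[of "gr_op G L" "gr_op G (gr_adj G L)" "gr_bound L" "unit_vec2 (x, \<one>)"])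
    show "inner (gr_op G L u) (gr_op G L u) \<le> gr_bound L * inner u u" for u
      unfolding gr_bound_def by (rule inner_gr_op_bound[OF L])
    fix p assume "(\<lambda>k. ((\<lambda>x. x - gr_op G (gr_adj G L) (gr_op G L x) /\<^sub>R gr_bound L) ^^ k) (unit_vec2 (x, \<one>))) \<longlonglongrightarrow> p"
      "is_proj {v. gr_op G L v = 0} (unit_vec2 (x, \<one>)) p"
    then show ?thesis unfolding C by blast
  qed (use L K gr_list_adj[OF L] in \<open>auto simp: gr_op_diff inner_gr_op\<close>)
  then have "\<forall>x. \<exists>p. (\<lambda>k. (gr_contraction G L ^^ k) (unit_vec2 (x, \<one>))) \<longlonglongrightarrow> p \<and> is_proj {v. gr_op G L v = 0} (unit_vec2 (x, \<one>)) p" ..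
  from choice[OF this] obtain q where q: "\<And>x. (\<lambda>k. (gr_contraction G L ^^ k) (unit_vec2 (x, \<one>))) \<longlonglongrightarrow> q x"
    "\<And>x. is_proj {v. gr_op G L v = 0} (unit_vec2 (x, \<one>)) (q x)" by blast
  show thesis
  proof (rule that[OF q(2)])
    fix X show "gr_trace G L X \<longlonglongrightarrow> (\<Sum>x\<in>X. inner (q x) (unit_vec2 (x, \<one>)))"
      unfolding gr_trace_def[abs_def] inner_unit_vec2 by (intro tendsto_sum tendsto_Re tendsto_ell2_fun q(1))
  qed
qed

text \<open>For the given \<open>k\<close> the trace is computed in a suitable finite
  \<open>p\<close>-quotient, where the wreath product construction supplies enough solutions. The
  argument works for any list of relators.\<close>

lemma parafree_gr_trace_ge:
  assumes pf: "parafree G r" and S: "S \<subseteq> carrier G" "generate G S = carrier G" "finite S"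
    and ws: "set ws \<subseteq> relators G S" "distinct ws"
  shows "real r \<le> gr_trace G (fox_matrix G (\<lambda>s. s) ws) S k"
proof -
  have S': "(\<lambda>s. s) ` S \<subseteq> carrier G" using S(1) by simp
  have ws': "fst ` set w \<subseteq> S" if "w \<in> set ws" for w using subsetD[OF ws(1) that] by (simp add: relators_def)
  have L: "gr_list G (fox_matrix G (\<lambda>s. s) ws)" by (rule gr_list_fox_matrix[OF S' ws'])
  obtain E where E: "finite E" "E \<subseteq> carrier G - {\<one>}"
    "\<And>(Q :: (nat \<times> bool) list set monoid) \<pi>. group Q \<Longrightarrow> \<pi> \<in> hom G Q \<Longrightarrow> (\<And>e. e \<in> E \<Longrightarrow> \<pi> e \<noteq> \<one>\<^bsub>Q\<^esub>) \<Longrightarrow>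
      gr_trace Q (gr_map \<pi> (fox_matrix G (\<lambda>s. s) ws)) S k = gr_trace G (fox_matrix G (\<lambda>s. s) ws) S k"
    using gr_trace_quotient[OF is_group L S(3)] by blast
  show ?thesis
  proof (rule parafree_residually_p[OF pf E(1,2)])
    fix p s :: nat and Q :: "(nat \<times> bool) list set monoid" and \<pi>
    assume Q: "prime p" "group Q" "finite (carrier Q)" "card (carrier Q) = p ^ s" "\<pi> \<in> hom G Q"
      and ne: "\<And>e. e \<in> E \<Longrightarrow> \<pi> e \<noteq> \<one>\<^bsub>Q\<^esub>"
    interpret Q: group Q by fact
    have \<pi>S: "\<pi> ` S \<subseteq> carrier Q" using S(1) Q(5) by (auto simp: hom_def)
    have sol: "solutions (gr_coeff Q (fox_matrix Q \<pi> ws) ` (set ws \<times> carrier Q)) (S \<times> carrier Q) m = fox_solutions Q \<pi> S (set ws) m" for m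
      by (rule Q.solutions_fox_matrix[OF Q(3) S(3) \<pi>S ws' ws(2)])
    have map: "gr_map \<pi> (fox_matrix G (\<lambda>s. s) ws) = fox_matrix Q \<pi> ws"
      using gr_map_fox_matrix[OF Q(2,5) S' ws'] by simp
    have "real r \<le> gr_trace Q (fox_matrix Q \<pi> ws) S k"
    proof (rule Q.gr_trace_bounds(1)[OF Q(3) S(3) _ Q.gr_list_fox_matrix[OF \<pi>S ws'] _ Q(1)])
      show "x \<in> S \<and> y \<in> set ws" if "(c, y, x, h) \<in> set (fox_matrix Q \<pi> ws)" for c y x h
        using Q.fox_matrix_mem[OF \<pi>S ws' that] by blast
      show "(p ^ k) ^ (r * card (carrier Q))
          \<le> card (solutions (gr_coeff Q (fox_matrix Q \<pi> ws) ` (set ws \<times> carrier Q)) (S \<times> carrier Q) (p ^ k))" for k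
        unfolding sol by (rule parafree_solutions_ge[OF pf S Q(2,3,4,1,5) ws(1)])
    qed simp
    then show ?thesis using E(3)[OF Q(2,5) ne] unfolding map by simp
  qed
qed

text \<open>The words are the special relators, fixed before \<open>k\<close> and \<open>e\<close>.
  The quotient varies with \<open>k\<close>, but the right-hand side does not mention it, and
  \<open>gr_bound\<close> is the same for the image of the matrix.\<close>

lemma parafree_gr_trace_le:
  assumes pf: "parafree G r" and S: "S \<subseteq> carrier G" "generate G S = carrier G" "finite S"
  obtains ws where "set ws \<subseteq> relators G S" "distinct ws"
    "\<And>k e. 0 < e \<Longrightarrow> e < 1 \<Longrightarrow> gr_trace G (fox_matrix G (\<lambda>s. s) ws) S (Suc k)
      \<le> real r + (1 / (- ln e) + (1 - e) ^ k) * (real (card S) * ln (gr_bound (fox_matrix G (\<lambda>s. s) ws)))"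
proof -
  have S': "(\<lambda>s. s) ` S \<subseteq> carrier G" using S(1) by simp
  obtain W R where R: "finite R" "R \<subseteq> relators G S" and W: "\<And>i. i < r \<Longrightarrow> fst ` set (W i) \<subseteq> S"
    and cs: "\<And>c m s. (\<And>i. i < r \<Longrightarrow> m dvd exponent_sum c (W i)) \<Longrightarrow> (\<And>w. w \<in> R \<Longrightarrow> m dvd exponent_sum c w) \<Longrightarrow>
      s \<in> S \<Longrightarrow> m dvd c s"
    using parafree_special_relators[OF pf S] by metis
  obtain ws where ws: "set ws = R" "distinct ws" using finite_distinct_list[OF R(1)] by blast
  have ws': "fst ` set w \<subseteq> S" if "w \<in> set ws" for w using R(2) that ws(1) by (auto simp: relators_def)
  have L: "gr_list G (fox_matrix G (\<lambda>s. s) ws)" by (rule gr_list_fox_matrix[OF S' ws'])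
  show thesis
  proof (rule that[OF _ ws(2)])
    show "set ws \<subseteq> relators G S" using R ws by simp
    fix k and e :: real assume e: "0 < e" "e < 1"
    obtain E where E: "finite E" "E \<subseteq> carrier G - {\<one>}"
      "\<And>(Q :: (nat \<times> bool) list set monoid) \<pi>. group Q \<Longrightarrow> \<pi> \<in> hom G Q \<Longrightarrow> (\<And>e. e \<in> E \<Longrightarrow> \<pi> e \<noteq> \<one>\<^bsub>Q\<^esub>) \<Longrightarrow>
        gr_trace Q (gr_map \<pi> (fox_matrix G (\<lambda>s. s) ws)) S (Suc k) = gr_trace G (fox_matrix G (\<lambda>s. s) ws) S (Suc k)"
      using gr_trace_quotient[OF is_group L S(3)] by blast
    show "gr_trace G (fox_matrix G (\<lambda>s. s) ws) S (Suc k)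
      \<le> real r + (1 / (- ln e) + (1 - e) ^ k) * (real (card S) * ln (gr_bound (fox_matrix G (\<lambda>s. s) ws)))"
    proof (rule parafree_residually_p[OF pf E(1,2)])
      fix p s :: nat and Q :: "(nat \<times> bool) list set monoid" and \<pi>
      assume Q: "prime p" "group Q" "finite (carrier Q)" "card (carrier Q) = p ^ s" "\<pi> \<in> hom G Q"
        and ne: "\<And>e. e \<in> E \<Longrightarrow> \<pi> e \<noteq> \<one>\<^bsub>Q\<^esub>"
      interpret Q: group Q by fact
      have \<pi>S: "\<pi> ` S \<subseteq> carrier Q" using S(1) Q(5) by (auto simp: hom_def)
      have sol: "solutions (gr_coeff Q (fox_matrix Q \<pi> ws) ` (set ws \<times> carrier Q)) (S \<times> carrier Q) m = fox_solutions Q \<pi> S (set ws) m" for m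
        by (rule Q.solutions_fox_matrix[OF Q(3) S(3) \<pi>S ws' ws(2)])
      have map: "gr_map \<pi> (fox_matrix G (\<lambda>s. s) ws) = fox_matrix Q \<pi> ws"
        using gr_map_fox_matrix[OF Q(2,5) S' ws'] by simp
      have "gr_trace Q (fox_matrix Q \<pi> ws) S (Suc k)
        \<le> real r + (1 / (- ln e) + (1 - e) ^ k) * (real (card S) * ln (gr_bound (fox_matrix Q \<pi> ws)))"
      proof (rule Q.gr_trace_bounds(2)[OF Q(3) S(3) _ Q.gr_list_fox_matrix[OF \<pi>S ws'] _ Q(1) _ e])
        show "x \<in> S \<and> y \<in> set ws" if "(c, y, x, h) \<in> set (fox_matrix Q \<pi> ws)" for c y x h
          using Q.fox_matrix_mem[OF \<pi>S ws' that] by blast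
        show "card (solutions (gr_coeff Q (fox_matrix Q \<pi> ws) ` (set ws \<times> carrier Q)) (S \<times> carrier Q) (p ^ k))
            \<le> (p ^ k) ^ (r * card (carrier Q))" for k
          unfolding sol
        proof (rule Q.card_fox_solutions_le[OF \<pi>S _ Q(3,4,1) refl S(3) ws' W])
          show "0 < p ^ k" using Q(1) prime_gt_0_nat by simp
          show "int (p ^ k) dvd c s" if "\<And>i. i < r \<Longrightarrow> int (p ^ k) dvd exponent_sum c (W i)"
            "\<And>w. w \<in> set ws \<Longrightarrow> int (p ^ k) dvd exponent_sum c w" "s \<in> S" for c s
            by (rule cs[OF that(1) that(2)[unfolded ws(1)] that(3)])
        qed
      qed simp
      then show ?thesis using E(3)[OF Q(2,5) ne] gr_bound_map[of \<pi> "fox_matrix G (\<lambda>s. s) ws"] unfolding map by simp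
    qed
  qed
qed

end

lemma le_from_spectral_bound:
  fixes t C :: real
  assumes lim: "f \<longlonglongrightarrow> t" and bound: "\<And>k e. 0 < e \<Longrightarrow> e < 1 \<Longrightarrow> f (Suc k) \<le> r + (1 / (- ln e) + (1 - e) ^ k) * C"
  shows "t \<le> r"
proof -
  have e: "t \<le> r + 1 / (- ln e) * C" if "0 < e" "e < 1" for e :: real
  proof (rule LIMSEQ_le[OF LIMSEQ_Suc[OF lim]])
    have z: "(\<lambda>k. (1 - e) ^ k) \<longlonglongrightarrow> 0" using that by (intro LIMSEQ_realpow_zero) simp_all
    have "(\<lambda>k. r + (1 / (- ln e) + (1 - e) ^ k) * C) \<longlonglongrightarrow> r + (1 / (- ln e) + 0) * C"
      by (intro tendsto_add tendsto_mult tendsto_const z)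
    then show "(\<lambda>k. r + (1 / (- ln e) + (1 - e) ^ k) * C) \<longlonglongrightarrow> r + 1 / (- ln e) * C" by simp
    show "\<exists>N. \<forall>k\<ge>N. f (Suc k) \<le> r + (1 / (- ln e) + (1 - e) ^ k) * C" using bound[OF that] by blast
  qed
  \<comment> \<open>The choice \<open>e = exp (- (n + 1))\<close> turns \<open>1 / (- ln e)\<close>
    into \<open>1 / (n + 1)\<close>; the limit in \<open>k\<close> has already been taken.\<close>
  have "t \<le> r + inverse (real (Suc n)) * C" for n
    using e[of "exp (- real (Suc n))"] by (simp add: divide_inverse add.commute)
  moreover have "(\<lambda>n. r + inverse (real (Suc n)) * C) \<longlonglongrightarrow> r + 0 * C"
    by (intro tendsto_intros LIMSEQ_inverse_real_of_nat)
  ultimately show ?thesis using LIMSEQ_le_const[of "\<lambda>n. r + inverse (real (Suc n)) * C" r t] by auto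
qed

section \<open>Coboundaries\<close>

context group
begin

lemma gr_op_scaleR:
  fixes L :: "(int \<times> 'y \<times> 'x \<times> 'a) list"
  assumes "gr_list G L"
  shows "gr_op G L (c *\<^sub>R u) = c *\<^sub>R gr_op G L u"
proof (rule ell2_eqI)
  fix z :: "'y \<times> 'a"
  obtain y g where z: "z = (y, g)" by (metis surj_pair)
  have "gr_fun G L (\<lambda>x g. ell2_fun (c *\<^sub>R u) (x, g)) y g = of_real c * gr_fun G L (\<lambda>x g. ell2_fun u (x, g)) y g"
    by (induction L) (auto simp: gr_fun_def algebra_simps)
  then show "ell2_fun (gr_op G L (c *\<^sub>R u)) z = ell2_fun (c *\<^sub>R gr_op G L u) z"
    by (simp add: z ell2_fun_gr_op[OF assms])
qed

lemma gr_fun_eq_0: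
  assumes "gr_list G L" "g \<in> carrier G" "\<And>c y x h g'. (c, y, x, h) \<in> set L \<Longrightarrow> g' \<in> carrier G \<Longrightarrow> u x g' = 0"
  shows "gr_fun G L u y g = 0"
  using assms(1,3)
proof (induction L)
  case (Cons t L)
  obtain c y' x h where t: "t = (c, y', x, h)" by (metis surj_pair)
  have h: "h \<in> carrier G" and L: "gr_list G L" using Cons.prems by (auto simp: t gr_list_def)
  have "gr_fun G L u y g = 0" by (rule Cons.IH[OF L], rule Cons.prems(2)[OF list.set_intros(2)])
  moreover have "u x (h \<otimes> g) = 0" using Cons.prems(2)[of c y' x h] h assms(2) by (simp add: t)
  ultimately show ?case by (simp add: t gr_fun_Cons)
qed (simp add: gr_fun_def)

text \<open>Coordinates outside \<open>X \<times> carrier G\<close> do not enter the operator, so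
  the unit vectors there and their multiples by \<open>i\<close> lie in the kernel. The unit vector
  at \<open>(x, \<one>)\<close> is orthogonal to them, hence so is its projection.\<close>

lemma gr_kernel_projection_support:
  fixes L :: "(int \<times> 'y \<times> 'x \<times> 'a) list"
  assumes L: "gr_list G L" and X: "\<And>c y x h. (c, y, x, h) \<in> set L \<Longrightarrow> x \<in> X" and x: "x \<in> X"
    and q: "is_proj {v. gr_op G L v = 0} (unit_vec2 (x, \<one>)) q" and z: "z \<notin> X \<times> carrier G"
  shows "ell2_fun q z = 0"
proof -
  have kernel: "gr_op G L v = 0" if v: "\<And>z'. z' \<noteq> z \<Longrightarrow> ell2_fun v z' = 0" for v
  proof (rule ell2_eqI)
    fix w :: "'y \<times> 'a"
    obtain y g where w: "w = (y, g)" by (metis surj_pair)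
    have "gr_fun G L (\<lambda>x g. ell2_fun v (x, g)) y g = 0" if "g \<in> carrier G"
      by (rule gr_fun_eq_0[OF L that]) (use X z in \<open>auto intro!: v\<close>)
    then show "ell2_fun (gr_op G L v) w = ell2_fun 0 w" by (simp add: w ell2_fun_gr_op[OF L])
  qed
  have "inner (unit_vec2 (x, \<one>) - q) (unit_vec2 z) = 0" "inner (unit_vec2 (x, \<one>) - q) (mult_i (unit_vec2 z)) = 0"
    using q kernel[of "unit_vec2 z"] kernel[of "mult_i (unit_vec2 z)"]
    by (auto simp: is_proj_def unit_vec2.rep_eq mult_i.rep_eq)
  moreover have "inner f (mult_i (unit_vec2 z)) = Im (ell2_fun f z)" for f
    using inner_finite_support[of "{z}" "mult_i (unit_vec2 z)" f]
    by (simp add: unit_vec2.rep_eq mult_i.rep_eq inner_complex_def)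
  moreover have "z \<noteq> (x, \<one>)" using x z by auto
  ultimately show ?thesis by (simp add: inner_unit_vec2 unit_vec2.rep_eq complex_eq_iff)
qed

text \<open>The group ring matrix of the map sending \<open>f\<close> to the coboundary with value
  \<open>f (inv s \<otimes> x) - f x\<close> at \<open>(s, x)\<close>. The single column is indexed
  by \<open>unit\<close>.\<close>

definition cobound :: "'a list \<Rightarrow> (int \<times> 'a \<times> unit \<times> 'a) list" where
  "cobound ss = concat (map (\<lambda>s. [(1, s, (), inv s), (- 1, s, (), \<one>)]) ss)"

context
  fixes ss :: "'a list"
  assumes ss: "set ss \<subseteq> carrier G" "distinct ss"
begin

lemma gr_list_cobound: "gr_list G (cobound ss)"
  using ss(1) by (auto simp: gr_list_def cobound_def)

lemma adj_cobound_mem: "(c, y, x, h) \<in> set (gr_adj G (cobound ss)) \<Longrightarrow> x \<in> set ss"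
  by (auto simp: cobound_def gr_adj_def)

lemma gr_adj_adj_cobound: "gr_adj G (gr_adj G (cobound ss)) = cobound ss"
  using gr_list_cobound by (intro map_idI[of "cobound ss" "\<lambda>(c, y, x, h). (c, y, x, inv (inv h))", unfolded map_map, folded gr_adj_def, THEN trans[rotated]])
    (auto simp: gr_adj_def gr_list_def)

lemma gr_bound_adj: "gr_bound (gr_adj G L) = gr_bound L"
proof -
  have "gr_weight (gr_adj G L) = gr_weight L" by (induction L) (auto simp: gr_weight_def gr_adj_def)
  then show ?thesis by (simp add: gr_bound_def)
qed

lemma cobound_apply:
  "ell2_fun (gr_op G (cobound ss) f) (s, g)
    = (if s \<in> set ss \<and> g \<in> carrier G then ell2_fun f ((), inv s \<otimes> g) - ell2_fun f ((), g) else 0)"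
proof -
  have "gr_fun G (cobound ss) u s g = (if s \<in> set ss then u () (inv s \<otimes> g) - u () g else 0)" if "g \<in> carrier G" for u :: "unit \<Rightarrow> 'a \<Rightarrow> complex"
    using ss(2) that unfolding cobound_def
    by (induction ss) (auto simp: gr_fun_def)
  then show ?thesis by (simp add: ell2_fun_gr_op[OF gr_list_cobound])
qed

lemma adj_cobound_apply:
  "ell2_fun (gr_op G (gr_adj G (cobound ss)) u) ((), g)
    = (if g \<in> carrier G then \<Sum>s\<in>set ss. ell2_fun u (s, s \<otimes> g) - ell2_fun u (s, g) else 0)"
proof -
  have "gr_fun G (gr_adj G (cobound ss)) v () g = (\<Sum>s\<in>set ss. v s (s \<otimes> g) - v s g)" if "g \<in> carrier G" for v :: "'a \<Rightarrow> 'a \<Rightarrow> complex"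
    using ss that unfolding cobound_def gr_adj_def
    by (induction ss) (auto simp: gr_fun_def)
  then show ?thesis by (simp add: ell2_fun_gr_op[OF gr_list_adj[OF gr_list_cobound]])
qed

text \<open>A function in the kernel is invariant under left translation by the generators, hence
  constant on \<open>G\<close>. On an infinite group a square-summable constant vanishes.\<close>

lemma cobound_kernel_trivial:
  assumes gen: "generate G (set ss) = carrier G" and inf: "infinite (carrier G)"
    and f: "gr_op G (cobound ss) f = 0" and g: "g \<in> carrier G"
  shows "ell2_fun f ((), g) = 0"
proof -
  have inv: "ell2_fun f ((), inv s \<otimes> g) = ell2_fun f ((), g)" if "s \<in> set ss" "g \<in> carrier G" for s g
    using cobound_apply[of f s g] that by (simp add: f)
  have const: "ell2_fun f ((), h \<otimes> g) = ell2_fun f ((), g)" if "h \<in> generate G (set ss)" "g \<in> carrier G" for h g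
    using that
  proof (induction arbitrary: g rule: generate.induct)
    case one
    then show ?case by simp
  next
    case (incl s)
    then have "s \<in> carrier G" using ss by blast
    then show ?case using inv[OF incl(1), of "s \<otimes> g"] incl(2) by (simp flip: m_assoc)
  next
    case (inv s)
    then show ?case using \<open>\<And>s g. s \<in> set ss \<Longrightarrow> g \<in> carrier G \<Longrightarrow> ell2_fun f ((), inv s \<otimes> g) = ell2_fun f ((), g)\<close> by blast
  next
    case (eng h1 h2)
    have "h1 \<in> carrier G" "h2 \<in> carrier G" using generate_in_carrier[OF ss(1)] eng by auto
    then show ?case using eng by (simp add: m_assoc)
  qed
  have c: "ell2_fun f ((), h) = ell2_fun f ((), \<one>)" if "h \<in> carrier G" for h
    using const[of h \<one>] that gen by simp
  show ?thesis
  proof (rule ccontr)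
    assume "ell2_fun f ((), g) \<noteq> 0"
    then have pos: "0 < (cmod (ell2_fun f ((), \<one>)))\<^sup>2" using c[OF g] by simp
    obtain n :: nat where n: "(norm f)\<^sup>2 < real n * (cmod (ell2_fun f ((), \<one>)))\<^sup>2"
      using reals_Archimedean3[OF pos] by blast
    obtain F where F: "F \<subseteq> carrier G" "finite F" "card F = n" using infinite_arbitrarily_large[OF inf] by blast
    have "(\<Sum>z\<in>Pair () ` F. (cmod (ell2_fun f z))\<^sup>2) \<le> (norm f)\<^sup>2"
      by (rule sum_square_le_norm_ell2) (use F in simp)
    also have "(\<Sum>z\<in>Pair () ` F. (cmod (ell2_fun f z))\<^sup>2) = (\<Sum>h\<in>F. (cmod (ell2_fun f ((), h)))\<^sup>2)"
      by (subst sum.reindex) (auto simp: inj_on_def)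
    also have "\<dots> = (\<Sum>h\<in>F. (cmod (ell2_fun f ((), \<one>)))\<^sup>2)"
      using F(1) c by (intro sum.cong refl) (metis subsetD)
    finally show False using n F(3) by simp
  qed
qed

text \<open>With \<open>D\<close> the coboundary operator, this is
  \<open>D* (1 - D D* / K)^k = (1 - D* D / K)^k D*\<close>.\<close>

lemma cobound_commute:
  "gr_op G (gr_adj G (cobound ss)) ((gr_contraction G (gr_adj G (cobound ss)) ^^ k) u)
    = (gr_contraction G (cobound ss) ^^ k) (gr_op G (gr_adj G (cobound ss)) u)"
proof (induction k)
  case (Suc k)
  let ?D = "cobound ss" and ?A = "gr_adj G (cobound ss)"
  have L: "gr_list G ?D" "gr_list G ?A" using gr_list_cobound gr_list_adj by auto
  have "gr_contraction G ?A v = v - inverse (gr_bound ?D) *\<^sub>R gr_op G ?D (gr_op G ?A v)" for v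
    by (simp add: gr_contraction_apply gr_adj_adj_cobound gr_bound_adj)
  then have "gr_op G ?A (gr_contraction G ?A v) = gr_op G ?A v - inverse (gr_bound ?D) *\<^sub>R gr_op G ?A (gr_op G ?D (gr_op G ?A v))" for v
    by (simp add: gr_op_diff[OF L(2)] gr_op_scaleR[OF L(2)])
  then have "gr_op G ?A (gr_contraction G ?A v) = gr_contraction G ?D (gr_op G ?A v)" for v
    by (simp add: gr_contraction_apply)
  then show ?case using Suc by simp
qed simp

lemma gr_contraction_diff:
  assumes "gr_list G L"
  shows "(gr_contraction G L ^^ k) (u - v) = (gr_contraction G L ^^ k) u - (gr_contraction G L ^^ k) v"
proof (induction k)
  case (Suc k)
  have "gr_contraction G L (u - v) = gr_contraction G L u - gr_contraction G L v" for u v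
    by (simp add: gr_contraction_apply gr_op_diff assms gr_list_adj algebra_simps)
  then show ?case using Suc by simp
qed simp

text \<open>The trace property for \<open>D D*\<close> and \<open>D* D\<close>, verified by hand. If
  \<open>m g\<close> denotes the value at \<open>g\<close> of the \<open>k\<close>-th iterate
  starting at the identity, then both differences are \<open>i\<close> times the sum over the
  generators of \<open>Re (2 * m \<one> - m s - m (inv s))\<close>.\<close>

lemma trace_cobound_step:
  "gr_trace G (gr_adj G (cobound ss)) (set ss) k - gr_trace G (gr_adj G (cobound ss)) (set ss) (Suc k)
    = gr_trace G (cobound ss) {()} k - gr_trace G (cobound ss) {()} (Suc k)"
proof -
  let ?D = "cobound ss" and ?A = "gr_adj G (cobound ss)"
  have L: "gr_list G ?D" "gr_list G ?A" using gr_list_cobound gr_list_adj by auto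
  define i where "i = inverse (gr_bound ?D)"
  define F where "F g = (gr_contraction G ?D ^^ k) (unit_vec2 ((), g))" for g
  define m where "m g = ell2_fun (F \<one>) ((), g)" for g
  have stepD: "Re (ell2_fun (gr_contraction G ?D u) z) = Re (ell2_fun u z) - i * Re (ell2_fun (gr_op G ?A (gr_op G ?D u)) z)" for u z
    unfolding gr_contraction_apply i_def[symmetric] by simp
  have stepA: "Re (ell2_fun (gr_contraction G ?A u) z) = Re (ell2_fun u z) - i * Re (ell2_fun (gr_op G ?D (gr_op G ?A u)) z)" for u z
    unfolding gr_contraction_apply gr_bound_adj gr_adj_adj_cobound i_def[symmetric] by simp
  have F: "ell2_fun (F g) ((), h) = m (h \<otimes> inv g)" if "g \<in> carrier G" "h \<in> carrier G" for g h
  proof -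
    have "ell2_fun (F \<one>) ((), h \<otimes> inv g) = ell2_fun (F g) ((), h \<otimes> inv g \<otimes> g)"
      unfolding F_def
      by (rule gr_contraction_translate[OF L(1) that(1)]) (use that in \<open>auto simp: unit_vec2.rep_eq\<close>)
    then show ?thesis using that by (simp add: m_def m_assoc)
  qed
  have "gr_trace G ?D {()} k - gr_trace G ?D {()} (Suc k) = i * Re (ell2_fun (gr_op G ?A (gr_op G ?D (F \<one>))) ((), \<one>))"
    by (simp add: gr_trace_def F_def[symmetric] stepD)
  also have "\<dots> = i * (\<Sum>s\<in>set ss. Re (2 * m \<one> - m s - m (inv s)))"
    using ss(1) by (auto simp: adj_cobound_apply cobound_apply m_def[symmetric] intro!: sum.cong)
  finally have D: "gr_trace G ?D {()} k - gr_trace G ?D {()} (Suc k) = i * (\<Sum>s\<in>set ss. Re (2 * m \<one> - m s - m (inv s)))" .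
  have "ell2_fun (gr_op G ?D (gr_op G ?A ((gr_contraction G ?A ^^ k) (unit_vec2 (s, \<one>))))) (s, \<one>) = 2 * m \<one> - m s - m (inv s)"
    if s: "s \<in> set ss" for s
  proof -
    have sG: "s \<in> carrier G" using s ss by blast
    have "gr_op G ?A (unit_vec2 (s, \<one>)) = unit_vec2 ((), inv s) - unit_vec2 ((), \<one>)"
    proof (rule ell2_eqI)
      fix z :: "unit \<times> 'a"
      obtain g where z: "z = ((), g)" by (cases z) auto
      have "g = inv s \<longleftrightarrow> s \<otimes> g = \<one>" if "g \<in> carrier G" using that sG inv_mult_eq_iff[of s \<one> g] by auto
      then have "(\<Sum>t\<in>set ss. ell2_fun (unit_vec2 (s, \<one>)) (t, t \<otimes> g) - ell2_fun (unit_vec2 (s, \<one>)) (t, g))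
          = (\<Sum>t\<in>set ss. if t = s then (if g = inv s then 1 else 0) - (if g = \<one> then 1 else 0) else 0)" if "g \<in> carrier G"
        using that by (intro sum.cong) (auto simp: unit_vec2.rep_eq)
      then show "ell2_fun (gr_op G ?A (unit_vec2 (s, \<one>))) z = ell2_fun (unit_vec2 ((), inv s) - unit_vec2 ((), \<one>)) z"
        using s sG by (auto simp: z adj_cobound_apply unit_vec2.rep_eq)
    qed
    then have "gr_op G ?A ((gr_contraction G ?A ^^ k) (unit_vec2 (s, \<one>))) = F (inv s) - F \<one>"
      by (simp add: cobound_commute gr_contraction_diff[OF L(1)] F_def)
    then show ?thesis using s sG by (simp add: cobound_apply F)
  qed
  then have "gr_trace G ?A (set ss) k - gr_trace G ?A (set ss) (Suc k) = (\<Sum>s\<in>set ss. i * Re (2 * m \<one> - m s - m (inv s)))"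
    unfolding gr_trace_def sum_subtractf[symmetric] by (intro sum.cong refl) (simp add: stepA)
  then show ?thesis using D by (simp only: sum_distrib_left)
qed

text \<open>The two trace sequences start at \<open>card (set ss)\<close> and at 1 and have equal
  decrements. The second one tends to the dimension of the kernel of the coboundary operator, which
  is 0; so the complement of the coboundaries has one dimension less than the whole space.\<close>

lemma trace_cobound:
  assumes gen: "generate G (set ss) = carrier G" and inf: "infinite (carrier G)"
  shows "gr_trace G (gr_adj G (cobound ss)) (set ss) \<longlonglongrightarrow> real (card (set ss)) - 1"
proof -
  let ?D = "cobound ss" and ?A = "gr_adj G (cobound ss)"
  have "gr_trace G ?A (set ss) k = real (card (set ss)) - 1 + gr_trace G ?D {()} k" for k
  proof (induction k)
    case 0
    then show ?case by (simp add: gr_trace_def unit_vec2.rep_eq)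
  next
    case (Suc k)
    then show ?case using trace_cobound_step[of k] by simp
  qed
  then have eq: "gr_trace G ?A (set ss) = (\<lambda>k. real (card (set ss)) - 1 + gr_trace G ?D {()} k)" by (rule ext)
  obtain q where q: "\<And>x. is_proj {v. gr_op G ?D v = 0} (unit_vec2 (x, \<one>)) (q x)"
    "\<And>X. gr_trace G ?D X \<longlonglongrightarrow> (\<Sum>x\<in>X. inner (q x) (unit_vec2 (x, \<one>)))"
    using gr_kernel_projection[OF gr_list_cobound] by blast
  have "ell2_fun (q ()) ((), \<one>) = 0"
    using q(1)[of "()"] by (intro cobound_kernel_trivial[OF gen inf]) (auto simp: is_proj_def)
  then have "gr_trace G ?D {()} \<longlonglongrightarrow> 0" using q(2)[of "{()}"] by (simp add: inner_unit_vec2)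
  then show ?thesis unfolding eq using tendsto_add[OF tendsto_const] by fastforce
qed

end

end

section \<open>Cocycles\<close>

context group
begin

definition cocycle_space :: "'a set \<Rightarrow> ('a \<times> 'a) ell2 set" where
  "cocycle_space S = {v. (\<forall>z. z \<notin> S \<times> carrier G \<longrightarrow> ell2_fun v z = 0) \<and>
     (\<forall>w\<in>relators G S. \<forall>x\<in>carrier G. fox G (\<lambda>s. s) (ell2_fun v) w x = 0)}"

lemma l2_ell2_fun:
  assumes "f \<in> l2 (carrier G)"
  shows "ell2_fun (Ell2 f) = f"
proof -
  have "(\<lambda>x. (cmod (f x))\<^sup>2) summable_on UNIV \<longleftrightarrow> (\<lambda>x. (cmod (f x))\<^sup>2) summable_on carrier G"
    by (rule summable_on_cong_neutral) (use assms in \<open>auto simp: l2_def\<close>)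
  then have "(\<lambda>x. (cmod (f x))\<^sup>2) summable_on UNIV" using assms by (simp add: l2_def)
  then show ?thesis by (simp add: Ell2_inverse)
qed

lemma ell2_slice_l2:
  assumes "\<And>x. x \<notin> carrier G \<Longrightarrow> ell2_fun F (y, x) = 0"
  shows "(\<lambda>x. ell2_fun F (y, x)) \<in> l2 (carrier G)"
proof -
  have "(\<lambda>z. (cmod (ell2_fun F z))\<^sup>2) summable_on Pair y ` carrier G" by (rule ell2_fun_summable)
  then have "((\<lambda>z. (cmod (ell2_fun F z))\<^sup>2) \<circ> Pair y) summable_on carrier G"
    using summable_on_reindex[of "Pair y" "carrier G"] by (auto simp: inj_on_def)
  then show ?thesis using assms by (simp add: l2_def comp_def)
qed

lemma cocycle_one:
  assumes "b \<in> l2_cocycles G" "x \<in> carrier G"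
  shows "b \<one> x = 0"
proof -
  have "b (\<one> \<otimes> \<one>) x = b \<one> x + b \<one> (inv \<one> \<otimes> x)"
    using assms unfolding l2_cocycles_def by blast
  then show ?thesis using assms(2) by simp
qed

lemma fox_cocycle:
  assumes S: "S \<subseteq> carrier G" and b: "b \<in> l2_cocycles G" and w: "fst ` set w \<subseteq> S" and x: "x \<in> carrier G"
  shows "fox G (\<lambda>s. s) (on_generators S b) w x = b (word_image G (\<lambda>s. s) w) x"
  using w x
proof (induction w arbitrary: x)
  case Nil
  then show ?case using cocycle_one[OF b] by (simp add: word_image_Nil)
next
  case (Cons a w)
  have S': "(\<lambda>s. s) ` S \<subseteq> carrier G" using S by simp
  have mult: "b (g \<otimes> h) x = b g x + b h (inv g \<otimes> x)" if "g \<in> carrier G" "h \<in> carrier G" "x \<in> carrier G" for g h x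
    using b that unfolding l2_cocycles_def by blast
  have s: "fst a \<in> S" "fst a \<in> carrier G" using Cons.prems S by auto
  have a: "letter_image G (\<lambda>s. s) a \<in> carrier G" using letter_image_closed[OF S' s(1)] .
  have w: "word_image G (\<lambda>s. s) w \<in> carrier G" using word_image_closed[OF S'] Cons.prems by auto
  have "b (letter_image G (\<lambda>s. s) a) x = (if snd a then on_generators S b (fst a, x) else - on_generators S b (fst a, fst a \<otimes> x))"
  proof (cases "snd a")
    case True
    then show ?thesis using s by (simp add: letter_image_def on_generators_def)
  next
    case False
    have "b (fst a \<otimes> inv (fst a)) (fst a \<otimes> x) = b (fst a) (fst a \<otimes> x) + b (inv (fst a)) (inv (fst a) \<otimes> (fst a \<otimes> x))"
      by (rule mult) (use s Cons.prems in auto)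
    moreover have "inv (fst a) \<otimes> (fst a \<otimes> x) = x" using s Cons.prems by (intro inv_cancel_left) auto
    ultimately have "b (inv (fst a)) x = - b (fst a) (fst a \<otimes> x)"
      using cocycle_one[OF b, of "fst a \<otimes> x"] s Cons.prems by (simp add: eq_neg_iff_add_eq_0 add.commute)
    then show ?thesis using False s by (simp add: letter_image_def on_generators_def)
  qed
  then show ?case using Cons a mult[OF a w, of x] by (simp add: word_image_Cons)
qed

lemma gr_list_fox_terms:
  assumes "\<sigma> ` S \<subseteq> carrier G" "fst ` set w \<subseteq> S"
  shows "gr_list G (fox_terms G \<sigma> y w)"
proof -
  have "h \<in> carrier G" if "(c, y', i, h) \<in> set (fox_terms G \<sigma> y w)" for c y' i h
    using fox_terms_mem[OF assms that] by blast
  then show ?thesis by (auto simp: gr_list_def)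
qed

text \<open>A cocycle is recovered from \<open>u\<close> by applying the Fox derivation to any word
  for \<open>g\<close>. The equations for all relators make this independent of the word, the
  product rule is the cocycle rule, and square-summability holds since the derivation along one word
  is a finite sum of translations.\<close>

lemma on_generators_cocycles:
  assumes S: "S \<subseteq> carrier G" "generate G S = carrier G" "finite S"
  shows "on_generators S ` l2_cocycles G = ell2_fun ` cocycle_space S"
proof (intro equalityI subsetI)
  have S': "(\<lambda>s. s) ` S \<subseteq> carrier G" using S(1) by simp
  fix u assume "u \<in> on_generators S ` l2_cocycles G"
  then obtain b where b: "b \<in> l2_cocycles G" "u = on_generators S b" by blast
  have bl: "b s \<in> l2 (carrier G)" if "s \<in> S" for s using b(1) S(1) that by (auto simp: l2_cocycles_def)
  \<comment> \<open>The function on \<open>S \<times> carrier G\<close> is assembled as a finite sum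
    of copies of the \<open>b s\<close>, so that its square-summability needs no argument.\<close>
  define v where "v = (\<Sum>s\<in>S. pull ({s} \<times> UNIV) snd (Ell2 (b s)))"
  have "ell2_fun v (t, x) = on_generators S b (t, x)" for t x
  proof -
    have inj: "inj_on snd ({s} \<times> (UNIV :: 'a set))" for s :: 'a by (auto simp: inj_on_def)
    have "ell2_fun v (t, x) = (\<Sum>s\<in>S. if s = t then b t x else 0)"
      unfolding v_def ell2_fun_sum using bl by (intro sum.cong) (auto simp: ell2_fun_pull[OF inj] l2_ell2_fun)
    then show ?thesis using S(3) by (simp add: on_generators_def)
  qed
  then have v: "ell2_fun v = u" by (auto simp: b(2))
  have "ell2_fun v z = 0" if "z \<notin> S \<times> carrier G" for z
    using that bl unfolding v b(2) on_generators_def by (cases z) (auto simp: l2_def)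
  moreover have "fox G (\<lambda>s. s) (ell2_fun v) w x = 0" if "w \<in> relators G S" "x \<in> carrier G" for w x
    unfolding v b(2) using that fox_cocycle[OF S(1) b(1)] cocycle_one[OF b(1)] by (simp add: relators_def)
  ultimately have "v \<in> cocycle_space S" by (simp add: cocycle_space_def)
  then show "u \<in> ell2_fun ` cocycle_space S" using v by blast
next
  have S': "(\<lambda>s. s) ` S \<subseteq> carrier G" using S(1) by simp
  fix u assume "u \<in> ell2_fun ` cocycle_space S"
  then obtain v where v: "v \<in> cocycle_space S" "u = ell2_fun v" by blast
  let ?ev = "word_image G (\<lambda>s. s)" and ?f = "fox G (\<lambda>s. s) (ell2_fun v)"
  define rep where "rep g = (SOME w. fst ` set w \<subseteq> S \<and> ?ev w = g)" for g
  have rep: "fst ` set (rep g) \<subseteq> S" "?ev (rep g) = g" if "g \<in> carrier G" for g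
  proof -
    have "g \<in> generate G S" using that S(2) by simp
    then have "\<exists>w. fst ` set w \<subseteq> S \<and> ?ev w = g" by (rule generate_word[OF S(1)]) blast
    then have "fst ` set (rep g) \<subseteq> S \<and> ?ev (rep g) = g" unfolding rep_def by (rule someI_ex)
    then show "fst ` set (rep g) \<subseteq> S" "?ev (rep g) = g" by auto
  qed
  \<comment> \<open>Both words are followed by the inverse of \<open>w'\<close>. This makes them
    relators, where the derivation vanishes, and by the product rule it adds the same term to both
    sides.\<close>
  have f_eq: "?f w x = ?f w' x" if w: "fst ` set w \<subseteq> S" "fst ` set w' \<subseteq> S" and eq: "?ev w = ?ev w'" and x: "x \<in> carrier G" for w w' x
  proof -
    have i: "fst ` set (inverse_word w') \<subseteq> S" using w by (simp add: fst_inverse_word)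
    have zero: "?f (z @ inverse_word w') x = 0" if "fst ` set z \<subseteq> S" "?ev z = ?ev w'" for z
    proof -
      have "?ev (z @ inverse_word w') = \<one>"
        using word_image_append[OF S' that(1) i] word_image_inverse[OF S' w(2)] word_image_closed[OF S' w(2)] that(2) by simp
      then have "z @ inverse_word w' \<in> relators G S" using that(1) i by (auto simp: relators_def)
      then show ?thesis using v(1) x unfolding cocycle_space_def by blast
    qed
    have "?f (z @ inverse_word w') x = ?f z x + ?f (inverse_word w') (inv (?ev z) \<otimes> x)" if "fst ` set z \<subseteq> S" for z
      by (rule fox_append[OF S' that i x])
    from this[OF w(1)] this[OF w(2)] have "?f w x + ?f (inverse_word w') (inv (?ev w') \<otimes> x) = ?f w' x + ?f (inverse_word w') (inv (?ev w') \<otimes> x)"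
      unfolding zero[OF w(1) eq] zero[OF w(2) refl] eq by simp
    then show ?thesis by (rule add_right_imp_eq)
  qed
  define b where "b g = (\<lambda>x. if x \<in> carrier G then ?f (rep g) x else 0)" for g
  have "b g \<in> l2 (carrier G)" if g: "g \<in> carrier G" for g
  proof -
    have L: "gr_list G (fox_terms G (\<lambda>s. s) () (rep g))"
      by (rule gr_list_fox_terms[OF S' rep(1)[OF g]])
    have "b g = (\<lambda>x. ell2_fun (gr_op G (fox_terms G (\<lambda>s. s) () (rep g)) v) ((), x))"
      by (rule ext) (simp add: b_def ell2_fun_gr_op[OF L] gr_fun_fox_terms[OF S' rep(1)[OF g]])
    then show ?thesis using ell2_slice_l2[of "gr_op G (fox_terms G (\<lambda>s. s) () (rep g)) v" "()"]
      by (simp add: ell2_fun_gr_op[OF L])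
  qed
  moreover have "b (g \<otimes> h) x = b g x + b h (inv g \<otimes> x)" if "g \<in> carrier G" "h \<in> carrier G" "x \<in> carrier G" for g h x
  proof -
    have "?f (rep (g \<otimes> h)) x = ?f (rep g @ rep h) x"
      using rep that word_image_append[OF S', of "rep g" "rep h"] by (intro f_eq) (auto simp: image_Un)
    then show ?thesis using fox_append[OF S' rep(1)[OF that(1)] rep(1)[OF that(2)] that(3), of "ell2_fun v"] that rep(2)[OF that(1)]
      by (simp add: b_def)
  qed
  ultimately have b: "b \<in> l2_cocycles G" by (simp add: l2_cocycles_def)
  have "on_generators S b z = u z" for z
  proof (cases "z \<in> S \<times> carrier G")
    case True
    then obtain s x where z: "z = (s, x)" "s \<in> S" "x \<in> carrier G" by blast
    have sG: "s \<in> carrier G" using z S by blast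
    have "?f (rep s) x = ?f [(s, True)] x"
      using rep[OF sG] z sG by (intro f_eq) (auto simp: word_image_Cons word_image_Nil letter_image_def)
    then show ?thesis using z by (simp add: on_generators_def b_def v(2))
  next
    case False
    then have "u z = 0" using v unfolding cocycle_space_def by blast
    moreover have "on_generators S b z = 0" using False by (cases z) (auto simp: on_generators_def b_def)
    ultimately show ?thesis by simp
  qed
  then have "u = on_generators S b" by auto
  then show "u \<in> on_generators S ` l2_cocycles G" using b by blast
qed

context
  fixes ss :: "'a list" and S :: "'a set"
  assumes ss: "S \<subseteq> carrier G" "distinct ss" and set_ss: "set ss = S"
begin

lemma generators_closed: "set ss \<subseteq> carrier G" using ss set_ss by simp

lemma on_generators_coboundaries:
  "on_generators S ` l2_coboundaries G = ell2_fun ` range (gr_op G (cobound ss))"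
proof (intro equalityI subsetI)
  fix u assume "u \<in> on_generators S ` l2_coboundaries G"
  then obtain b f where b: "b \<in> l2_cocycles G" "u = on_generators S b" and f: "f \<in> l2 (carrier G)"
    "\<And>g x. g \<in> carrier G \<Longrightarrow> x \<in> carrier G \<Longrightarrow> b g x = f (inv g \<otimes> x) - f x"
    unfolding l2_coboundaries_def by blast
  let ?F = "pull UNIV (snd :: unit \<times> 'a \<Rightarrow> 'a) (Ell2 f)"
  have inj: "inj_on (snd :: unit \<times> 'a \<Rightarrow> 'a) UNIV" by (auto simp: inj_on_def)
  have F: "ell2_fun ?F ((), x) = f x" for x by (simp add: ell2_fun_pull[OF inj] l2_ell2_fun[OF f(1)])
  have "u (s, x) = ell2_fun (gr_op G (cobound ss) ?F) (s, x)" for s x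
  proof (cases "s \<in> S \<and> x \<in> carrier G")
    case True
    then show ?thesis using f(2)[of s x] ss(1) by (auto simp: b(2) on_generators_def cobound_apply[OF generators_closed ss(2)] F set_ss)
  next
    case False
    then have "u (s, x) = 0" using b(1) ss(1) by (auto simp: b(2) on_generators_def l2_cocycles_def l2_def)
    then show ?thesis using False by (auto simp: cobound_apply[OF generators_closed ss(2)] set_ss)
  qed
  then have "u = ell2_fun (gr_op G (cobound ss) ?F)" by auto
  then show "u \<in> ell2_fun ` range (gr_op G (cobound ss))" by blast
next
  fix u assume "u \<in> ell2_fun ` range (gr_op G (cobound ss))"
  then obtain F where F: "u = ell2_fun (gr_op G (cobound ss) F)" by blast
  define f where "f x = (if x \<in> carrier G then ell2_fun F ((), x) else 0)" for x
  have restrict: "gr_list G [(c, (), (), h), (c', (), (), h')]" if "h \<in> carrier G" "h' \<in> carrier G" for c c' h h'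
    using that by (simp add: gr_list_def)
  have f: "f \<in> l2 (carrier G)"
  proof -
    \<comment> \<open>The identity of the group ring acts as restriction to the carrier. The second
      entry, with coefficient 0, only brings the list into the two-term shape of
      \<open>restrict\<close>.\<close>
    have "f = (\<lambda>x. ell2_fun (gr_op G [(1, (), (), \<one>), (0, (), (), \<one>)] F) ((), x))"
      by (rule ext) (simp add: f_def ell2_fun_gr_op[OF restrict] gr_fun_def)
    then show ?thesis
      using ell2_slice_l2[of "gr_op G [(1, (), (), \<one>), (0, (), (), \<one>)] F" "()"] by (simp add: ell2_fun_gr_op[OF restrict])
  qed
  define b where "b g x = (if x \<in> carrier G then f (inv g \<otimes> x) - f x else 0)" for g x
  have "b g \<in> l2 (carrier G)" if "g \<in> carrier G" for g
  proof -
    have "b g = (\<lambda>x. ell2_fun (gr_op G [(1, (), (), inv g), (- 1, (), (), \<one>)] F) ((), x))"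
      using that by (intro ext) (simp add: b_def f_def ell2_fun_gr_op[OF restrict] gr_fun_def)
    then show ?thesis
      using ell2_slice_l2[of "gr_op G [(1, (), (), inv g), (- 1, (), (), \<one>)] F" "()"] that by (simp add: ell2_fun_gr_op[OF restrict])
  qed
  then have "b \<in> l2_coboundaries G"
    using f unfolding l2_coboundaries_def l2_cocycles_def
    by (auto simp: b_def inv_mult_group m_assoc)
  moreover have "u = on_generators S b"
    using ss(1) by (auto simp: F on_generators_def cobound_apply[OF generators_closed ss(2)] set_ss b_def f_def fun_eq_iff)
  ultimately show "u \<in> on_generators S ` l2_coboundaries G" by blast
qed

text \<open>A telescoping sum: along a word only the translate by its value and the initial term
  remain. For relators they cancel, so coboundaries are cocycles.\<close>

lemma fox_cobound:
  assumes "fst ` set w \<subseteq> S" "x \<in> carrier G"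
  shows "fox G (\<lambda>s. s) (ell2_fun (gr_op G (cobound ss) f)) w x
    = ell2_fun f ((), inv (word_image G (\<lambda>s. s) w) \<otimes> x) - ell2_fun f ((), x)"
  using assms
proof (induction w arbitrary: x)
  case (Cons a w)
  have S': "(\<lambda>s. s) ` S \<subseteq> carrier G" using ss by simp
  have s: "fst a \<in> S" "fst a \<in> carrier G" using Cons.prems ss by auto
  have a: "letter_image G (\<lambda>s. s) a \<in> carrier G" using letter_image_closed[OF S' s(1)] .
  have w: "word_image G (\<lambda>s. s) w \<in> carrier G" using word_image_closed[OF S'] Cons.prems by auto
  have "inv (fst a) \<otimes> (fst a \<otimes> x) = x" using s Cons.prems by (intro inv_cancel_left) auto
  then show ?case
    using Cons a w s by (auto simp: word_image_Cons cobound_apply[OF generators_closed ss(2)] set_ss inv_mult_group m_assoc letter_image_def)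
qed (simp add: word_image_Nil)

lemma cobound_in_cocycle_space: "gr_op G (cobound ss) f \<in> cocycle_space S"
  by (auto simp: cocycle_space_def relators_def fox_cobound cobound_apply[OF generators_closed ss(2)] set_ss)

text \<open>The orthogonal complement of an image is the kernel of the adjoint. In this way the
  closure of the coboundaries never has to be formed.\<close>

lemma adj_cobound_eq_0_iff:
  "gr_op G (gr_adj G (cobound ss)) u = 0 \<longleftrightarrow> (\<forall>f. inner u (gr_op G (cobound ss) f) = 0)"
proof -
  have eq: "inner u (gr_op G (cobound ss) f) = inner f (gr_op G (gr_adj G (cobound ss)) u)" for f
    using inner_gr_op[OF gr_list_cobound[OF generators_closed ss(2)], of f u] by (simp add: inner_commute)
  show ?thesis
  proof
    assume "\<forall>f. inner u (gr_op G (cobound ss) f) = 0"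
    then have "inner (gr_op G (gr_adj G (cobound ss)) u) (gr_op G (gr_adj G (cobound ss)) u) = 0" unfolding eq by blast
    then show "gr_op G (gr_adj G (cobound ss)) u = 0" by simp
  qed (simp add: eq)
qed

lemma mult_i_cobound: "mult_i (gr_op G (cobound ss) f) = gr_op G (cobound ss) (mult_i f)"
proof (rule ell2_eqI)
  fix z :: "'a \<times> 'a"
  obtain s g where z: "z = (s, g)" by (metis surj_pair)
  show "ell2_fun (mult_i (gr_op G (cobound ss) f)) z = ell2_fun (gr_op G (cobound ss) (mult_i f)) z"
    by (simp add: z mult_i.rep_eq cobound_apply[OF generators_closed ss(2)] right_diff_distrib)
qed

lemma reduced_H1_eq:
  assumes S: "generate G S = carrier G" "finite S"
  shows "reduced_H1 G S = ell2_fun ` (cocycle_space S \<inter> {u. gr_op G (gr_adj G (cobound ss)) u = 0})"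
proof -
  let ?D = "gr_op G (cobound ss)"
  have supp: "ell2_fun (?D f) z = 0" if "z \<notin> S \<times> carrier G" for f z
    using cobound_in_cocycle_space[of f] that unfolding cocycle_space_def by blast
  have "(\<forall>f. l2_inner (S \<times> carrier G) (ell2_fun u) (ell2_fun (?D f)) = 0) \<longleftrightarrow> gr_op G (gr_adj G (cobound ss)) u = 0" for u
    unfolding adj_cobound_eq_0_iff
  proof (intro iffI allI)
    fix f assume "\<forall>f. l2_inner (S \<times> carrier G) (ell2_fun u) (ell2_fun (?D f)) = 0"
    then show "inner u (?D f) = 0" using l2_inner_Re[of "S \<times> carrier G" "?D f" u] supp by simp
  next
    fix f assume u: "\<forall>f. inner u (?D f) = 0"
    show "l2_inner (S \<times> carrier G) (ell2_fun u) (ell2_fun (?D f)) = 0"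
      by (rule l2_inner_eq_0) (use supp u in \<open>auto simp: mult_i_cobound\<close>)
  qed
  then show ?thesis
    unfolding reduced_H1_def on_generators_cocycles[OF ss(1) S] on_generators_coboundaries by auto
qed

end

end

lemma fox_mult_i: "fox G \<sigma> (\<lambda>z. \<i> * u z) w x = \<i> * fox G \<sigma> u w x"
  by (induction w arbitrary: x) (auto simp: distrib_left)

lemma closed_zero_coordinate: "closed {v. ell2_fun v z = 0}"
proof -
  have "inner v (mult_i (unit_vec2 z)) = Im (ell2_fun v z)" for v
    using inner_finite_support[of "{z}" "mult_i (unit_vec2 z)" v]
    by (simp add: unit_vec2.rep_eq mult_i.rep_eq inner_complex_def)
  then have "{v. ell2_fun v z = 0} = {v. inner v (unit_vec2 z) = 0 \<and> inner v (mult_i (unit_vec2 z)) = 0}"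
    by (auto simp: inner_unit_vec2 complex_eq_iff)
  moreover have "closed {v. inner v (unit_vec2 z) = 0 \<and> inner v (mult_i (unit_vec2 z)) = 0}"
    by (intro closed_Collect_conj closed_Collect_eq bounded_linear.continuous_on[OF bounded_linear_inner_left] continuous_on_id continuous_on_const)
  ultimately show ?thesis by simp
qed

section \<open>The dimensions of the cocycles and of the reduced cohomology\<close>

context group
begin

lemma gr_op_eq_0_iff:
  assumes "gr_list G L"
  shows "gr_op G L v = 0 \<longleftrightarrow> (\<forall>y. inner v (gr_op G (gr_adj G L) y) = 0)"
proof
  assume "\<forall>y. inner v (gr_op G (gr_adj G L) y) = 0"
  then have "inner (gr_op G L v) (gr_op G L v) = 0" unfolding inner_gr_op[OF assms] by blast
  then show "gr_op G L v = 0" by simp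
qed (simp flip: inner_gr_op[OF assms])

lemma closed_gr_kernel: "gr_list G L \<Longrightarrow> closed {v. gr_op G L v = 0}"
  unfolding gr_op_eq_0_iff by
    (intro closed_Collect_all closed_Collect_eq bounded_linear.continuous_on[OF bounded_linear_inner_left] continuous_on_id continuous_on_const)

context
  fixes S :: "'a set"
  assumes S: "S \<subseteq> carrier G" "generate G S = carrier G" "finite S"
begin

lemma generators_image: "(\<lambda>s. s) ` S \<subseteq> carrier G" using S(1) by simp

lemma relator_letters: "set ws \<subseteq> relators G S \<Longrightarrow> w \<in> set ws \<Longrightarrow> fst ` set w \<subseteq> S"
  by (auto simp: relators_def)

lemma gr_list_relators: "set ws \<subseteq> relators G S \<Longrightarrow> gr_list G (fox_matrix G (\<lambda>s. s) ws)"
  by (rule gr_list_fox_matrix[OF generators_image relator_letters])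

lemma fox_matrix_kernel:
  assumes ws: "set ws \<subseteq> relators G S" "distinct ws"
  shows "gr_op G (fox_matrix G (\<lambda>s. s) ws) v = 0
    \<longleftrightarrow> (\<forall>w\<in>set ws. \<forall>x\<in>carrier G. fox G (\<lambda>s. s) (ell2_fun v) w x = 0)"
proof -
  have "ell2_fun (gr_op G (fox_matrix G (\<lambda>s. s) ws) v) (w, x)
      = (if w \<in> set ws \<and> x \<in> carrier G then fox G (\<lambda>s. s) (ell2_fun v) w x else 0)" for w x
    using gr_fun_fox_matrix[OF generators_image relator_letters[OF ws(1)] _ ws(2), of x "\<lambda>x g. ell2_fun v (x, g)" w]
    by (simp add: ell2_fun_gr_op[OF gr_list_relators[OF ws(1)]] case_prod_unfold)
  note * = this
  show ?thesis
  proof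
    assume "gr_op G (fox_matrix G (\<lambda>s. s) ws) v = 0"
    then show "\<forall>w\<in>set ws. \<forall>x\<in>carrier G. fox G (\<lambda>s. s) (ell2_fun v) w x = 0"
      using * by (metis ell2_fun_simps(1))
  next
    assume 0: "\<forall>w\<in>set ws. \<forall>x\<in>carrier G. fox G (\<lambda>s. s) (ell2_fun v) w x = 0"
    show "gr_op G (fox_matrix G (\<lambda>s. s) ws) v = 0"
    proof (rule ell2_eqI)
      fix z :: "('a \<times> bool) list \<times> 'a"
      show "ell2_fun (gr_op G (fox_matrix G (\<lambda>s. s) ws) v) z = ell2_fun 0 z"
        using 0 by (cases z) (simp add: *)
    qed
  qed
qed

lemma cocycle_space_diff: "u \<in> cocycle_space S \<Longrightarrow> v \<in> cocycle_space S \<Longrightarrow> u - v \<in> cocycle_space S"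
  by (auto simp: cocycle_space_def minus_ell2.rep_eq fox_diff)

lemma cocycle_space_mult_i: "u \<in> cocycle_space S \<Longrightarrow> mult_i u \<in> cocycle_space S"
  by (auto simp: cocycle_space_def mult_i.rep_eq fox_mult_i)

text \<open>The cocycle space is the intersection of the decreasing kernels \<open>V m\<close> of
  the relators of length at most \<open>m\<close>. Each has dimension at least \<open>r\<close>,
  which survives in the limit. Conversely the space lies in the kernel for the special relators,
  whose dimension is at most \<open>r\<close>.\<close>

lemma parafree_cocycle_projection:
  assumes pf: "parafree G r"
  obtains p where "\<And>s. s \<in> S \<Longrightarrow> is_proj (cocycle_space S) (unit_vec2 (s, \<one>)) (p s)"
    "(\<Sum>s\<in>S. inner (p s) (unit_vec2 (s, \<one>))) = real r"
proof -
  have "\<exists>ws. set ws = {w \<in> relators G S. length w \<le> m} \<and> distinct ws" for m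
  proof -
    have "{w \<in> relators G S. length w \<le> m} \<subseteq> {w. set w \<subseteq> S \<times> UNIV \<and> length w \<le> m}"
      by (auto simp: relators_def)
    then have "finite {w \<in> relators G S. length w \<le> m}"
      using finite_lists_length_le[of "S \<times> (UNIV :: bool set)" m] S(3) by (auto intro: finite_subset)
    then show ?thesis by (rule finite_distinct_list)
  qed
  then have "\<forall>m. \<exists>ws. set ws = {w \<in> relators G S. length w \<le> m} \<and> distinct ws" ..
  from choice[OF this] obtain ws where ws: "\<And>m. set (ws m) = {w \<in> relators G S. length w \<le> m}" "\<And>m. distinct (ws m)"
    by blast
  have ws_rel: "set (ws m) \<subseteq> relators G S" for m by (auto simp: ws(1))
  let ?L = "\<lambda>m. fox_matrix G (\<lambda>s. s) (ws m)"
  have L: "gr_list G (?L m)" for m by (rule gr_list_relators[OF ws_rel])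
  have Lmem: "x \<in> S" if "(c, y, x, h) \<in> set (?L m)" for c y x h m
    using fox_matrix_mem[OF generators_image relator_letters[OF ws_rel[of m]] that] by blast
  have "\<exists>q. (\<forall>x. is_proj {v. gr_op G (?L m) v = 0} (unit_vec2 (x, \<one>)) (q x)) \<and>
      (\<forall>X. gr_trace G (?L m) X \<longlonglongrightarrow> (\<Sum>x\<in>X. inner (q x) (unit_vec2 (x, \<one>))))" for m
    by (rule gr_kernel_projection[OF L, of m]) blast
  then have "\<forall>m. \<exists>q. (\<forall>x. is_proj {v. gr_op G (?L m) v = 0} (unit_vec2 (x, \<one>)) (q x)) \<and>
      (\<forall>X. gr_trace G (?L m) X \<longlonglongrightarrow> (\<Sum>x\<in>X. inner (q x) (unit_vec2 (x, \<one>))))" ..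
  from choice[OF this] obtain q where q: "\<And>m x. is_proj {v. gr_op G (?L m) v = 0} (unit_vec2 (x, \<one>)) (q m x)"
    "\<And>m X. gr_trace G (?L m) X \<longlonglongrightarrow> (\<Sum>x\<in>X. inner (q m x) (unit_vec2 (x, \<one>)))" by blast
  \<comment> \<open>The kernels also contain all functions supported off
    \<open>S \<times> carrier G\<close>, so the support is imposed. The projections of the relevant
    unit vectors already satisfy this condition and remain the same.\<close>
  define V where "V m = {v. gr_op G (?L m) v = 0} \<inter> {v. \<forall>z. z \<notin> S \<times> carrier G \<longrightarrow> ell2_fun v z = 0}" for m
  have Vq: "is_proj (V m) (unit_vec2 (s, \<one>)) (q m s)" if "s \<in> S" for m s
  proof -
    have "ell2_fun (q m s) z = 0" if "z \<notin> S \<times> carrier G" for z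
      by (rule gr_kernel_projection_support[OF L Lmem \<open>s \<in> S\<close> q(1) that])
    then show ?thesis using q(1)[of m s] by (simp add: V_def is_proj_def)
  qed
  have "closed {v :: ('a \<times> 'a) ell2. z \<notin> S \<times> carrier G \<longrightarrow> ell2_fun v z = 0}" for z
    by (cases "z \<in> S \<times> carrier G") (auto simp: closed_zero_coordinate)
  then have closed: "closed (V m)" for m
    unfolding V_def by (intro closed_Int closed_gr_kernel[OF L] closed_Collect_all)
  have V_eq: "V m = {v. (\<forall>z. z \<notin> S \<times> carrier G \<longrightarrow> ell2_fun v z = 0) \<and>
      (\<forall>w\<in>relators G S. length w \<le> m \<longrightarrow> (\<forall>x\<in>carrier G. fox G (\<lambda>s. s) (ell2_fun v) w x = 0))}" for m
    unfolding V_def fox_matrix_kernel[OF ws_rel ws(2)] ws(1) by blast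
  have dec: "V n \<subseteq> V m" if "m \<le> n" for m n
    unfolding V_eq using that by (auto intro: order.trans)
  have Inter: "(\<Inter>m. V m) = cocycle_space S"
    unfolding V_eq cocycle_space_def by blast
  have "\<exists>p. is_proj (cocycle_space S) (unit_vec2 (s, \<one>)) p \<and> (\<lambda>m. inner (q m s) (unit_vec2 (s, \<one>))) \<longlonglongrightarrow> inner p (unit_vec2 (s, \<one>))"
    if "s \<in> S" for s
  proof (rule is_proj_decreasing_Inter[where V = V and p = "\<lambda>m. q m s" and x = "unit_vec2 (s, \<one>)", OF closed dec Vq[OF that]])
    fix p assume "is_proj (\<Inter>m. V m) (unit_vec2 (s, \<one>)) p" "(\<lambda>m. inner (q m s) (unit_vec2 (s, \<one>))) \<longlonglongrightarrow> inner p (unit_vec2 (s, \<one>))"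
    then show ?thesis unfolding Inter by blast
  qed
  then have "\<forall>s. \<exists>p. s \<in> S \<longrightarrow> is_proj (cocycle_space S) (unit_vec2 (s, \<one>)) p \<and>
      (\<lambda>m. inner (q m s) (unit_vec2 (s, \<one>))) \<longlonglongrightarrow> inner p (unit_vec2 (s, \<one>))" by blast
  from choice[OF this] obtain p where p: "\<And>s. s \<in> S \<Longrightarrow> is_proj (cocycle_space S) (unit_vec2 (s, \<one>)) (p s)"
    "\<And>s. s \<in> S \<Longrightarrow> (\<lambda>m. inner (q m s) (unit_vec2 (s, \<one>))) \<longlonglongrightarrow> inner (p s) (unit_vec2 (s, \<one>))" by blast
  let ?t = "\<Sum>s\<in>S. inner (p s) (unit_vec2 (s, \<one>))"
  have "real r \<le> ?t"
  proof (rule LIMSEQ_le_const)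
    show "(\<lambda>m. \<Sum>s\<in>S. inner (q m s) (unit_vec2 (s, \<one>))) \<longlonglongrightarrow> ?t" by (intro tendsto_sum p(2))
    have "real r \<le> (\<Sum>s\<in>S. inner (q m s) (unit_vec2 (s, \<one>)))" for m
      by (rule LIMSEQ_le_const[OF q(2)]) (use parafree_gr_trace_ge[OF pf S ws_rel ws(2)] in blast)
    then show "\<exists>N. \<forall>m\<ge>N. real r \<le> (\<Sum>s\<in>S. inner (q m s) (unit_vec2 (s, \<one>)))" by blast
  qed
  moreover have "?t \<le> real r"
  proof (rule parafree_gr_trace_le[OF pf S])
    fix vs assume vs: "set vs \<subseteq> relators G S" "distinct vs" and
      bound: "\<And>k e. 0 < e \<Longrightarrow> e < 1 \<Longrightarrow> gr_trace G (fox_matrix G (\<lambda>s. s) vs) S (Suc k)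
        \<le> real r + (1 / (- ln e) + (1 - e) ^ k) * (real (card S) * ln (gr_bound (fox_matrix G (\<lambda>s. s) vs)))"
    show ?thesis
    proof (rule gr_kernel_projection[OF gr_list_relators[OF vs(1)]])
      fix q' assume q': "\<And>x. is_proj {v. gr_op G (fox_matrix G (\<lambda>s. s) vs) v = 0} (unit_vec2 (x, \<one>)) (q' x)"
        "\<And>X. gr_trace G (fox_matrix G (\<lambda>s. s) vs) X \<longlonglongrightarrow> (\<Sum>x\<in>X. inner (q' x) (unit_vec2 (x, \<one>)))"
      have sub: "cocycle_space S \<subseteq> {v. gr_op G (fox_matrix G (\<lambda>s. s) vs) v = 0}"
        unfolding fox_matrix_kernel[OF vs] cocycle_space_def using vs(1) by blast
      have "?t \<le> (\<Sum>x\<in>S. inner (q' x) (unit_vec2 (x, \<one>)))"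
        by (intro sum_mono is_proj_mono(2)[OF p(1) q'(1) sub])
      also have "\<dots> \<le> real r" by (rule le_from_spectral_bound[OF q'(2) bound])
      finally show ?thesis .
    qed
  qed
  ultimately have "?t = real r" by simp
  with p(1) show thesis by (rule that)
qed

text \<open>The reduced cohomology is the intersection of the cocycles \<open>?Z\<close>, of
  dimension \<open>r\<close>, with the complement \<open>?D\<close> of the coboundaries, of
  dimension \<open>card S - 1\<close>. Since the complement of \<open>?D\<close> lies in
  \<open>?Z\<close>, the projection is a sum of the two minus the identity, and its trace is
  \<open>r + (card S - 1) - card S\<close>.\<close>

theorem parafree_vN_dim_reduced_H1:
  assumes pf: "parafree G r" and r: "1 \<le> r"
  shows "vN_dim G S (reduced_H1 G S) = real r - 1"
proof -
  obtain ss where ss: "set ss = S" "distinct ss" using finite_distinct_list[OF S(3)] by blast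
  note sS = S(1) ss(2,1)
  have ssG: "set ss \<subseteq> carrier G" using ss S(1) by simp
  let ?d = "gr_op G (cobound ss)" and ?A = "gr_adj G (cobound ss)"
  let ?Z = "cocycle_space S" and ?D = "{u. gr_op G ?A u = 0}"
  let ?e = "\<lambda>s. unit_vec2 (s, \<one>)"
  have LA: "gr_list G ?A" by (rule gr_list_adj[OF gr_list_cobound[OF ssG ss(2)]])
  obtain p where p: "\<And>s. s \<in> S \<Longrightarrow> is_proj ?Z (?e s) (p s)" "(\<Sum>s\<in>S. inner (p s) (?e s)) = real r"
    using parafree_cocycle_projection[OF pf] by blast
  obtain d where d: "\<And>s. is_proj ?D (?e s) (d s)" "\<And>X. gr_trace G ?A X \<longlonglongrightarrow> (\<Sum>s\<in>X. inner (d s) (?e s))"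
    using gr_kernel_projection[OF LA] by blast
  have "gr_trace G ?A (set ss) \<longlonglongrightarrow> real (card (set ss)) - 1"
    by (rule trace_cobound[OF ssG ss(2)]) (use S(2) ss parafree_infinite[OF pf r] in auto)
  then have dsum: "(\<Sum>s\<in>S. inner (d s) (?e s)) = real (card S) - 1"
    using LIMSEQ_unique[OF d(2)[of S]] by (simp add: ss)
  have D_iff: "u \<in> ?D \<longleftrightarrow> (\<forall>f. inner u (?d f) = 0)" for u
    using adj_cobound_eq_0_iff[OF sS, of u] by simp
  have Dsub: "u - v \<in> ?D" if "u \<in> ?D" "v \<in> ?D" for u v
    using that unfolding D_iff by (simp add: inner_diff_left)
  \<comment> \<open>The part of a unit vector orthogonal to \<open>?D\<close> is a cocycle: the Fox
    operator of a relator kills coboundaries, so the image of its adjoint lies in \<open>?D\<close>,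
    and orthogonality to that image means lying in the kernel of the Fox operator.\<close>
  have orthZ: "e - d' \<in> ?Z" if "s \<in> S" "is_proj ?D e d'" "e = ?e s" for s e d'
  proof -
    have "ell2_fun d' z = 0" if "z \<notin> S \<times> carrier G" for z
      by (rule gr_kernel_projection_support[OF LA _ \<open>s \<in> S\<close> \<open>is_proj ?D e d'\<close>[unfolded \<open>e = ?e s\<close>] that])
        (use adj_cobound_mem[OF ssG ss(2)] ss in blast)
    then have supp: "ell2_fun (e - d') z = 0" if "z \<notin> S \<times> carrier G" for z
      using that \<open>s \<in> S\<close> by (auto simp: \<open>e = ?e s\<close> unit_vec2.rep_eq)
    have "fox G (\<lambda>s. s) (ell2_fun (e - d')) w x = 0" if w: "w \<in> relators G S" and x: "x \<in> carrier G" for w x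
    proof -
      have ws: "set [w] \<subseteq> relators G S" "distinct [w]" using w by auto
      let ?L = "fox_matrix G (\<lambda>s. s) [w]"
      have L: "gr_list G ?L" by (rule gr_list_relators[OF ws(1)])
      have "gr_op G (gr_adj G ?L) y \<in> ?D" for y
        unfolding D_iff
      proof
        fix f
        have "gr_op G ?L (?d f) = 0"
          using cobound_in_cocycle_space[OF sS, of f] w unfolding fox_matrix_kernel[OF ws] cocycle_space_def by simp
        then have "inner (?d f) (gr_op G (gr_adj G ?L) y) = 0" using inner_gr_op[OF L, of "?d f" y] by simp
        then show "inner (gr_op G (gr_adj G ?L) y) (?d f) = 0" by (simp add: inner_commute)
      qed
      then have "inner (e - d') (gr_op G (gr_adj G ?L) y) = 0" for y
        using \<open>is_proj ?D e d'\<close> unfolding is_proj_def by blast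
      then have "gr_op G ?L (e - d') = 0" unfolding gr_op_eq_0_iff[OF L] by blast
      then show ?thesis using x unfolding fox_matrix_kernel[OF ws] by simp
    qed
    then show ?thesis using supp unfolding cocycle_space_def by blast
  qed
  have proj: "is_proj (?Z \<inter> ?D) (?e s) (p s - ?e s + d s)" if s: "s \<in> S" for s
  proof (rule is_proj_Int[OF p(1)[OF s] d(1) orthZ[OF s d(1) refl]])
    show "p s - ?e s + d s \<in> ?D"
      unfolding D_iff
    proof
      fix f
      have "inner (?e s - p s) (?d f) = 0"
        using p(1)[OF s] cobound_in_cocycle_space[OF sS, of f] unfolding is_proj_def by blast
      moreover have "inner (d s) (?d f) = 0" using d(1)[of s] D_iff unfolding is_proj_def by blast
      ultimately show "inner (p s - ?e s + d s) (?d f) = 0" by (simp add: inner_diff_left inner_add_left)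
    qed
  qed (rule cocycle_space_diff)
  have "vN_dim G S (ell2_fun ` (?Z \<inter> ?D)) = (\<Sum>s\<in>S. inner (p s - ?e s + d s) (?e s))"
  proof (rule vN_dim_eq[OF _ _ _ proj is_group])
    show "ell2_fun v z = 0" if "v \<in> ?Z \<inter> ?D" "z \<notin> S \<times> carrier G" for v z
      using that unfolding cocycle_space_def by blast
    show "u - v \<in> ?Z \<inter> ?D" if "u \<in> ?Z \<inter> ?D" "v \<in> ?Z \<inter> ?D" for u v
      using that cocycle_space_diff Dsub by blast
    show "mult_i v \<in> ?Z \<inter> ?D" if v: "v \<in> ?Z \<inter> ?D" for v
    proof
      show "mult_i v \<in> ?Z" using v cocycle_space_mult_i by blast
      show "mult_i v \<in> ?D"
      proof (rule CollectI, rule ell2_eqI)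
        fix z :: "unit \<times> 'a"
        obtain g where z: "z = ((), g)" by (cases z) auto
        have "gr_op G ?A v = 0" using v by blast
        then have "ell2_fun (gr_op G ?A v) ((), g) = 0" by simp
        then show "ell2_fun (gr_op G ?A (mult_i v)) z = ell2_fun 0 z"
          by (simp add: z adj_cobound_apply[OF ssG ss(2)] mult_i.rep_eq split: if_splits
              flip: right_diff_distrib sum_distrib_left)
      qed
    qed
  qed
  also have "\<dots> = real r - 1"
  proof -
    have "inner (?e s) (?e s) = 1" for s :: 'a by (simp add: inner_unit_vec2 unit_vec2.rep_eq)
    then have "(\<Sum>s\<in>S. inner (p s - ?e s + d s) (?e s)) = (\<Sum>s\<in>S. inner (p s) (?e s)) - real (card S) + (\<Sum>s\<in>S. inner (d s) (?e s))"
      by (simp add: inner_add_left inner_diff_left sum.distrib sum_subtractf)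
    then show ?thesis using p(2) dsum by simp
  qed
  finally show ?thesis unfolding reduced_H1_eq[OF sS S(2,3)] .
qed

end

end

section \<open>The first Betti number\<close>

definition frag_eval :: "('t \<Rightarrow> rat) \<Rightarrow> ('t \<Rightarrow>\<^sub>0 int) \<Rightarrow> rat" where
  "frag_eval g z = (\<Sum>t\<in>Poly_Mapping.keys z. of_int (Poly_Mapping.lookup z t) * g t)"

lemma frag_eval_superset:
  assumes "finite T" "Poly_Mapping.keys z \<subseteq> T"
  shows "frag_eval g z = (\<Sum>t\<in>T. of_int (Poly_Mapping.lookup z t) * g t)"
  unfolding frag_eval_def using assms by (intro sum.mono_neutral_left) (auto simp: in_keys_iff)

lemma frag_eval_diff: "frag_eval g (x - y) = frag_eval g x - frag_eval g y"
proof -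
  let ?T = "Poly_Mapping.keys x \<union> Poly_Mapping.keys y"
  have "Poly_Mapping.keys (x - y) \<subseteq> ?T" by (rule keys_diff)
  then show ?thesis
    by (simp add: frag_eval_superset[of ?T] lookup_minus sum_subtractf left_diff_distrib)
qed

lemma frag_eval_zero: "frag_eval g 0 = 0"
  by (simp add: frag_eval_def)

lemma frag_eval_add: "frag_eval g (x + y) = frag_eval g x + frag_eval g y"
  using frag_eval_diff[of g "x + y" y] by simp

lemma frag_eval_of: "frag_eval g (frag_of t) = g t"
  by (simp add: frag_eval_def)

lemma frag_eval_scale: "frag_eval (\<lambda>(a, p). \<psi> a * p) (scale_symbols q x) = q * frag_eval (\<lambda>(a, p). \<psi> a * p) x"
  using subset_UNIV[of "Poly_Mapping.keys x"]
proof (induction x rule: frag_induction)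
  case (one t)
  then show ?case by (cases t) (simp add: scale_symbols_simps frag_eval_of)
next
  case (diff x y)
  then show ?case by (simp add: scale_symbols_simps frag_eval_diff right_diff_distrib)
qed (simp_all add: scale_symbols_simps frag_eval_zero)

context
  fixes A :: "('a, 'b) monoid_scheme"
  assumes A: "comm_group A"
begin

private abbreviation (input) "F \<equiv> symbol_group A"
private abbreviation (input) "N \<equiv> bilinear_relations A"
private abbreviation (input) "K \<equiv> tensor_rat A"

text \<open>The rational linear extension of \<open>\<psi>\<close>, sending the symbol
  \<open>a \<otimes> q\<close> to \<open>q\<close> times \<open>\<psi> a\<close>. It vanishes on the
  bilinearity relations, so it may be evaluated on an arbitrarily chosen representative of a
  coset.\<close>

lemma tensor_functional:
  assumes \<psi>: "\<psi> \<in> hom A integer_group"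
  obtains \<Lambda> :: "('a \<times> rat \<Rightarrow>\<^sub>0 int) set \<Rightarrow> rat"
  where "\<And>X Y. X \<in> carrier K \<Longrightarrow> Y \<in> carrier K \<Longrightarrow> \<Lambda> (X \<oplus>\<^bsub>K\<^esub> Y) = \<Lambda> X + \<Lambda> Y"
    "\<And>q X. X \<in> carrier K \<Longrightarrow> \<Lambda> (q \<odot>\<^bsub>K\<^esub> X) = q * \<Lambda> X"
    "\<And>a. a \<in> carrier A \<Longrightarrow> \<Lambda> (N #>\<^bsub>F\<^esub> frag_of (a, 1)) = of_int (\<psi> a)"
proof -
  define ev where "ev = frag_eval (\<lambda>(a, q). of_int (\<psi> a) * q)"
  have evN: "ev x = 0" if "x \<in> N" for x
    using that unfolding bilinear_relations_def
  proof (induction rule: generate.induct)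
    case one
    then show ?case by (simp add: symbol_group_def ev_def frag_eval_zero)
  next
    case (incl h)
    then show ?case using hom_mult[OF \<psi>]
      by (auto simp: ev_def frag_eval_diff frag_eval_of distrib_left distrib_right)
  next
    case (inv h)
    have hF: "h \<in> carrier F"
      using inv by (auto intro!: diff_symbol_group[OF A] frag_of_symbol_group[OF A] comm_groupE(1)[OF A])
    have "ev h = 0" using inv hom_mult[OF \<psi>]
      by (auto simp: ev_def frag_eval_diff frag_eval_of distrib_left distrib_right)
    then show ?case using frag_eval_diff[of _ 0 h] by (simp add: inv_symbol_group[OF A hF] ev_def frag_eval_zero)
  next
    case (eng x y)
    then show ?case by (simp add: mult_symbol_group[OF A] ev_def frag_eval_add)
  qed
  define \<Lambda> where "\<Lambda> X = ev (SOME z. z \<in> X)" for X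
  have \<Lambda>: "\<Lambda> (N #>\<^bsub>F\<^esub> x) = ev x" for x
  proof -
    have "x \<in> N #>\<^bsub>F\<^esub> x" using bilinear_relations_zero[OF A] by (simp add: mem_tensor_coset_iff[OF A])
    then have "(SOME z. z \<in> N #>\<^bsub>F\<^esub> x) \<in> N #>\<^bsub>F\<^esub> x" by (rule someI)
    then have "(SOME z. z \<in> N #>\<^bsub>F\<^esub> x) - x \<in> N" unfolding mem_tensor_coset_iff[OF A] .
    from evN[OF this] show ?thesis by (simp add: \<Lambda>_def ev_def frag_eval_diff)
  qed
  show thesis
  proof (rule that[of \<Lambda>])
    fix X Y q assume "X \<in> carrier K"
    then obtain x where x: "x \<in> carrier F" "X = N #>\<^bsub>F\<^esub> x" using carrier_tensor_rat_iff[OF A] by blast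
    show "\<Lambda> (q \<odot>\<^bsub>K\<^esub> X) = q * \<Lambda> X"
      using x by (simp add: smult_tensor_coset[OF A] \<Lambda>) (simp add: ev_def frag_eval_scale)
    assume "Y \<in> carrier K"
    then obtain y where y: "y \<in> carrier F" "Y = N #>\<^bsub>F\<^esub> y" using carrier_tensor_rat_iff[OF A] by blast
    show "\<Lambda> (X \<oplus>\<^bsub>K\<^esub> Y) = \<Lambda> X + \<Lambda> Y"
      using x y by (simp add: add_tensor_coset[OF A] \<Lambda>) (simp add: ev_def frag_eval_add)
  next
    fix a show "\<Lambda> (N #>\<^bsub>F\<^esub> frag_of (a, 1)) = of_int (\<psi> a)" by (simp add: \<Lambda> ev_def frag_eval_of)
  qed
qed

text \<open>Every symbol \<open>a \<otimes> q\<close> is the multiple by \<open>q\<close> of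
  \<open>a \<otimes> 1\<close>, and the symbols generate the tensor product additively.\<close>

lemma tensor_span:
  assumes U: "U \<subseteq> carrier K"
    and gen: "\<And>a. a \<in> carrier A \<Longrightarrow> N #>\<^bsub>F\<^esub> frag_of (a, 1) \<in> module.span class_ring K U"
  shows "module.span class_ring K U = carrier K"
proof -
  interpret vectorspace class_ring K by (rule vectorspace_tensor_rat[OF A])
  have smult: "q \<odot>\<^bsub>K\<^esub> v \<in> span U" if "v \<in> span U" for q v
    using submodule.smult_closed[OF span_is_submodule[OF U], of q v] that by (simp add: class_ring_simps)
  have "x \<in> carrier F \<and> N #>\<^bsub>F\<^esub> x \<in> span U" if "x \<in> carrier F" for x
    using that[unfolded carrier_symbol_group_iff[OF A]]
  proof (induction x rule: frag_induction)
    case zero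
    have "N #>\<^bsub>F\<^esub> 0 = \<zero>\<^bsub>K\<^esub>"
      by (auto simp: mem_tensor_coset_iff[OF A] tensor_rat_def)
    then show ?case using span_zero by (simp add: carrier_symbol_group_iff[OF A])
  next
    case (one t)
    obtain a q where t: "t = (a, q)" by (metis surj_pair)
    have a: "a \<in> carrier A" using one by (simp add: t)
    have "N #>\<^bsub>F\<^esub> frag_of t = q \<odot>\<^bsub>K\<^esub> (N #>\<^bsub>F\<^esub> frag_of (a, 1))"
      by (simp add: t smult_tensor_coset[OF A frag_of_symbol_group[OF A a]] scale_symbols_simps)
    then show ?case using smult[OF gen[OF a]] frag_of_symbol_group[OF A a] by (simp add: t)
  next
    case (diff x y)
    have x: "x \<in> carrier F" "N #>\<^bsub>F\<^esub> x \<in> span U" and y: "y \<in> carrier F" "N #>\<^bsub>F\<^esub> y \<in> span U"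
      using diff by auto
    have xy: "x - y \<in> carrier F" by (rule diff_symbol_group[OF A x(1) y(1)])
    have eq: "(N #>\<^bsub>F\<^esub> y) \<oplus>\<^bsub>K\<^esub> (N #>\<^bsub>F\<^esub> (x - y)) = N #>\<^bsub>F\<^esub> x"
      unfolding add_tensor_coset[OF A y(1) xy] add_diff_eq add_diff_cancel_left' ..
    have "N #>\<^bsub>F\<^esub> (x - y) \<in> carrier K"
      unfolding carrier_tensor_rat_iff[OF A] by (rule bexI[OF _ xy]) (rule refl)
    from iffD2[OF span_add[OF U y(2) this], unfolded eq, OF x(2)] xy show ?case by simp
  qed
  note coset_span = this
  show ?thesis
  proof (intro equalityI subsetI)
    fix X assume "X \<in> carrier K"
    then obtain x where "x \<in> carrier F" "X = N #>\<^bsub>F\<^esub> x" unfolding carrier_tensor_rat_iff[OF A] by blast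
    then show "X \<in> span U" using coset_span[of x] by simp
  qed (rule span_closed[OF U])
qed

end

text \<open>The classes of the \<open>x i\<close>, tensored with 1, form a basis. The coordinate
  homomorphisms factor through the abelianisation and give dual functionals, hence independence; the
  elements of \<open>G\<close> with class in the span form a subgroup containing all
  \<open>x i\<close> and all commutators, hence everything.\<close>

lemma (in group) parafree_first_betti:
  assumes pf: "parafree G r"
  shows "first_betti G = r"
proof -
  let ?N = "derived G (carrier G)"
  define A where "A = G Mod ?N"
  have A: "comm_group A" unfolding A_def by (rule derived_quot_is_comm_group)
  interpret A: comm_group A by (rule A)
  interpret N: normal ?N G by (rule derived_is_normal[OF normal_self])
  let ?c = "\<lambda>g. ?N #> g"
  define t where "t a = bilinear_relations A #>\<^bsub>symbol_group A\<^esub> frag_of (a, 1 :: rat)" for a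
  interpret V: vectorspace class_ring "tensor_rat A" by (rule vectorspace_tensor_rat[OF A])
  have carA: "carrier A = ?c ` carrier G" by (auto simp: A_def FactGroup_def RCOSETS_def)
  have cA: "?c g \<in> carrier A" if "g \<in> carrier G" for g using that carA by blast
  have cmult: "?c (g \<otimes> h) = ?c g \<otimes>\<^bsub>A\<^esub> ?c h" if "g \<in> carrier G" "h \<in> carrier G" for g h
    using N.rcos_sum[OF that] by (simp add: A_def FactGroup_def)
  have one_A: "\<one>\<^bsub>A\<^esub> = ?c \<one>" using N.subset by (simp add: A_def FactGroup_def coset_mult_one)
  have t_in: "t a \<in> carrier (tensor_rat A)" if "a \<in> carrier A" for a
    unfolding t_def using carrier_tensor_rat_iff[OF A] frag_of_symbol_group[OF A that] by blast
  have t_mult: "t (a \<otimes>\<^bsub>A\<^esub> b) = t a \<oplus>\<^bsub>tensor_rat A\<^esub> t b" if ab: "a \<in> carrier A" "b \<in> carrier A" for a b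
    using bilinear_relations_left[OF A ab, of 1] ab
    by (simp add: t_def add_tensor_coset[OF A] frag_of_symbol_group[OF A] tensor_coset_eq_iff[OF A] diff_diff_eq)
  have t_one: "t \<one>\<^bsub>A\<^esub> = \<zero>\<^bsub>tensor_rat A\<^esub>"
    using t_mult[of "\<one>\<^bsub>A\<^esub>" "\<one>\<^bsub>A\<^esub>"] t_in[of "\<one>\<^bsub>A\<^esub>"] by simp
  have "\<exists>x \<phi>. (\<forall>i<r. x i \<in> carrier G) \<and>
      (\<forall>H. subgroup H G \<longrightarrow> (\<forall>i<r. x i \<in> H) \<longrightarrow> (\<forall>a\<in>carrier G. \<forall>b\<in>carrier G. comm a b \<in> H) \<longrightarrow> H = carrier G) \<and>
      (\<forall>i<r. \<phi> i \<in> hom G integer_group) \<and> (\<forall>i<r. \<forall>j<r. \<phi> i (x j) = (if i = j then 1 else 0))"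
  proof (rule parafree_int_homs[OF pf])
    fix x \<phi> assume "\<And>i. i < r \<Longrightarrow> x i \<in> carrier G"
      "\<And>H. subgroup H G \<Longrightarrow> (\<And>i. i < r \<Longrightarrow> x i \<in> H) \<Longrightarrow>
      (\<And>a b. a \<in> carrier G \<Longrightarrow> b \<in> carrier G \<Longrightarrow> comm a b \<in> H) \<Longrightarrow> H = carrier G"
      "\<And>i. i < r \<Longrightarrow> \<phi> i \<in> hom G integer_group"
      "\<And>i j. i < r \<Longrightarrow> j < r \<Longrightarrow> \<phi> i (x j) = (if i = j then 1 else 0)"
    then show ?thesis by (intro exI[of _ x] exI[of _ \<phi>] conjI allI impI) simp_all
  qed
  then obtain x \<phi> where x': "\<forall>i<r. x i \<in> carrier G" and
    sub: "\<forall>H. subgroup H G \<longrightarrow> (\<forall>i<r. x i \<in> H) \<longrightarrow> (\<forall>a\<in>carrier G. \<forall>b\<in>carrier G. comm a b \<in> H) \<longrightarrow> H = carrier G" and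
    \<phi>': "\<forall>i<r. \<phi> i \<in> hom G integer_group" "\<forall>i<r. \<forall>j<r. \<phi> i (x j) = (if i = j then 1 else 0)"
    by (elim exE conjE) (rule that)
  have x: "x i \<in> carrier G" and \<phi>: "\<phi> i \<in> hom G integer_group" "j < r \<Longrightarrow> \<phi> i (x j) = (if i = j then 1 else 0)"
    if "i < r" for i j using x' \<phi>' that by auto
  define e where "e i = t (?c (x i))" for i
  have e_in: "e i \<in> carrier (tensor_rat A)" if "i < r" for i using t_in cA x[OF that] by (simp add: e_def)
  have "\<exists>\<Lambda>. (\<forall>X\<in>carrier (tensor_rat A). \<forall>Y\<in>carrier (tensor_rat A). \<Lambda> (X \<oplus>\<^bsub>tensor_rat A\<^esub> Y) = \<Lambda> X + \<Lambda> Y) \<and>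
      (\<forall>q. \<forall>X\<in>carrier (tensor_rat A). \<Lambda> (q \<odot>\<^bsub>tensor_rat A\<^esub> X) = q * \<Lambda> X) \<and>
      (\<forall>j<r. \<Lambda> (e j) = (if i = j then 1 else (0 :: rat)))" if i: "i < r" for i
  proof -
    interpret \<phi>: group_hom G integer_group "\<phi> i"
      using \<phi>(1)[OF i] by (simp add: group_hom_def group_hom_axioms_def is_group group_integer_group)
    have "derived_set G (carrier G) \<subseteq> kernel G integer_group (\<phi> i)"
      by (auto simp: kernel_def)
    then have "?N \<subseteq> kernel G integer_group (\<phi> i)"
      unfolding derived_def by (rule generate_subgroup_incl[OF _ \<phi>.subgroup_kernel])
    then obtain \<psi> where \<psi>: "\<psi> \<in> hom A integer_group" "\<And>g. g \<in> carrier G \<Longrightarrow> \<psi> (?c g) = \<phi> i g"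
      unfolding A_def using \<phi>.FactGroup_universal_kernel[OF N.normal_axioms] by blast
    show ?thesis
    proof (rule tensor_functional[OF A \<psi>(1)])
      fix \<Lambda> :: "('a set \<times> rat \<Rightarrow>\<^sub>0 int) set \<Rightarrow> rat"
      assume \<Lambda>: "\<And>X Y. X \<in> carrier (tensor_rat A) \<Longrightarrow> Y \<in> carrier (tensor_rat A) \<Longrightarrow> \<Lambda> (X \<oplus>\<^bsub>tensor_rat A\<^esub> Y) = \<Lambda> X + \<Lambda> Y"
        "\<And>q X. X \<in> carrier (tensor_rat A) \<Longrightarrow> \<Lambda> (q \<odot>\<^bsub>tensor_rat A\<^esub> X) = q * \<Lambda> X"
        "\<And>a. a \<in> carrier A \<Longrightarrow> \<Lambda> (bilinear_relations A #>\<^bsub>symbol_group A\<^esub> frag_of (a, 1)) = of_int (\<psi> a)"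
      have "\<Lambda> (e j) = (if i = j then 1 else 0)" if "j < r" for j
        using \<Lambda>(3)[OF cA[OF x[OF that]]] \<psi>(2)[OF x[OF that]] \<phi>(2)[OF i that] by (simp add: e_def t_def)
      then show ?thesis using \<Lambda>(1,2) by blast
    qed
  qed
  then have "\<forall>i. \<exists>\<Lambda>. i < r \<longrightarrow> (\<forall>X\<in>carrier (tensor_rat A). \<forall>Y\<in>carrier (tensor_rat A). \<Lambda> (X \<oplus>\<^bsub>tensor_rat A\<^esub> Y) = \<Lambda> X + \<Lambda> Y) \<and>
      (\<forall>q. \<forall>X\<in>carrier (tensor_rat A). \<Lambda> (q \<odot>\<^bsub>tensor_rat A\<^esub> X) = q * \<Lambda> X) \<and>
      (\<forall>j<r. \<Lambda> (e j) = (if i = j then 1 else (0 :: rat)))" by blast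
  from choice[OF this] obtain \<Lambda> where
    \<Lambda>: "\<And>i X Y. i < r \<Longrightarrow> X \<in> carrier (tensor_rat A) \<Longrightarrow> Y \<in> carrier (tensor_rat A) \<Longrightarrow> \<Lambda> i (X \<oplus>\<^bsub>tensor_rat A\<^esub> Y) = \<Lambda> i X + \<Lambda> i Y"
      "\<And>i q X. i < r \<Longrightarrow> X \<in> carrier (tensor_rat A) \<Longrightarrow> \<Lambda> i (q \<odot>\<^bsub>tensor_rat A\<^esub> X) = q * \<Lambda> i X"
      "\<And>i j. i < r \<Longrightarrow> j < r \<Longrightarrow> \<Lambda> i (e j) = (if i = j then 1 else (0 :: rat))"
    by blast
  let ?B = "e ` {..<r}"
  have B: "?B \<subseteq> carrier (tensor_rat A)" using e_in by auto
  have inj: "inj_on e {..<r}"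
  proof (rule inj_onI)
    fix i j assume ij: "i \<in> {..<r}" "j \<in> {..<r}" "e i = e j"
    then have "\<Lambda> i (e i) = \<Lambda> i (e j)" by simp
    then show "i = j" using \<Lambda>(3) ij(1,2) by (simp split: if_splits)
  qed
  have "\<not> V.lin_dep ?B"
  proof
    assume "V.lin_dep ?B"
    then obtain a v where a: "V.lincomb a ?B = \<zero>\<^bsub>tensor_rat A\<^esub>" "v \<in> ?B" "a v \<noteq> 0"
      using V.finite_lin_dep[of ?B] B by (auto simp: class_ring_simps)
    then obtain i where i: "i < r" "v = e i" by blast
    have zero: "\<Lambda> i \<zero>\<^bsub>tensor_rat A\<^esub> = 0" using \<Lambda>(1)[OF i(1), of "\<zero>\<^bsub>tensor_rat A\<^esub>" "\<zero>\<^bsub>tensor_rat A\<^esub>"] by simp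
    have "\<Lambda> i (\<Oplus>\<^bsub>tensor_rat A\<^esub>w\<in>C. a w \<odot>\<^bsub>tensor_rat A\<^esub> w) = (\<Sum>w\<in>C. a w * \<Lambda> i w)" if "finite C" "C \<subseteq> ?B" for C
      using that
    proof (induction C rule: finite_induct)
      case (insert w C)
      have w: "w \<in> carrier (tensor_rat A)" and C: "\<And>w. w \<in> C \<Longrightarrow> w \<in> carrier (tensor_rat A)" using insert B by auto
      have "(\<Oplus>\<^bsub>tensor_rat A\<^esub>w\<in>C. a w \<odot>\<^bsub>tensor_rat A\<^esub> w) \<in> carrier (tensor_rat A)"
        using C by (intro V.finsum_closed) (auto simp: class_ring_simps)
      then show ?case
        using insert w C \<Lambda>(1,2)[OF i(1)] by (subst V.finsum_insert) (auto simp: class_ring_simps)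
    qed (simp add: zero)
    then have "\<Lambda> i (V.lincomb a ?B) = (\<Sum>w\<in>?B. a w * \<Lambda> i w)" by (simp add: V.lincomb_def)
    also have "\<dots> = (\<Sum>j<r. if i = j then a (e j) else 0)"
      unfolding sum.reindex[OF inj] comp_def using \<Lambda>(3)[OF i(1)] by (intro sum.cong) auto
    also have "\<dots> = a v" using i by simp
    finally show False using a zero by simp
  qed
  moreover have "V.span ?B = carrier (tensor_rat A)"
  proof (rule tensor_span[OF A B])
    let ?H = "{g \<in> carrier G. t (?c g) \<in> V.span ?B}"
    have "subgroup ?H G"
    proof (rule subgroupI)
      have "\<one> \<in> ?H" using t_one V.span_zero by (simp flip: one_A)
      then show "?H \<noteq> {}" by blast
      fix g assume g: "g \<in> ?H"
      have gG: "g \<in> carrier G" using g by simp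
      have "t (?c g) \<oplus>\<^bsub>tensor_rat A\<^esub> t (?c (inv g)) = \<zero>\<^bsub>tensor_rat A\<^esub>"
        using gG by (simp flip: t_mult cmult one_A add: cA t_one)
      then have "t (?c (inv g)) \<in> V.span ?B"
        using V.span_add[OF B, of "t (?c g)" "t (?c (inv g))"] g V.span_zero t_in cA by simp
      then show "inv g \<in> ?H" using gG by simp
      fix h assume h: "h \<in> ?H"
      show "g \<otimes> h \<in> ?H" using g h V.span_add1[OF B] by (simp add: cmult t_mult cA)
    qed auto
    moreover have "x i \<in> ?H" if "i < r" for i
      using x[OF that] V.span_mem[OF B, of "e i"] that by (auto simp: e_def)
    moreover have "comm a b \<in> ?H" if ab: "a \<in> carrier G" "b \<in> carrier G" for a b
    proof -
      have "comm a b \<in> ?N" unfolding derived_def comm_def using ab by (intro generate.incl) blast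
      then have "?c (comm a b) = ?c \<one>" using coset_join2[OF _ N.subgroup_axioms] N.subset ab by (simp add: comm_def coset_mult_one)
      then show ?thesis using ab t_one V.span_zero by (simp add: comm_def flip: one_A)
    qed
    ultimately have H: "?H = carrier G" using sub by blast
    show "bilinear_relations A #>\<^bsub>symbol_group A\<^esub> frag_of (a, 1) \<in> V.span ?B" if "a \<in> carrier A" for a
      using that H unfolding carA t_def by auto
  qed
  ultimately have "V.basis ?B" using B by (simp add: V.basis_def)
  then have "V.dim = card ?B" by (intro V.dim_basis) auto
  then show ?thesis unfolding first_betti_def A_def[symmetric] using card_image[OF inj] by simp
qed

section \<open>The theorem\<close>

text \<open>If the identity is one of the generators, the one-letter word consisting of it is a
  relator, and its equation states that the only coordinate is zero.\<close>

lemma (in group) cocycle_space_trivial: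
  assumes "carrier G = {\<one>}" "S \<subseteq> carrier G"
  shows "cocycle_space S \<subseteq> {0}"
proof
  fix v assume v: "v \<in> cocycle_space S"
  have "ell2_fun v z = 0" for z
  proof (cases "z \<in> S \<times> carrier G")
    case True
    then have "[(\<one>, True)] \<in> relators G S" "z = (\<one>, \<one>)"
      using assms by (auto simp: relators_def word_image_Cons word_image_Nil letter_image_def)
    moreover from this have "fox G (\<lambda>s. s) (ell2_fun v) [(\<one>, True)] \<one> = 0"
      using v one_closed unfolding cocycle_space_def by blast
    ultimately show ?thesis by simp
  qed (use v in \<open>unfold cocycle_space_def, blast\<close>)
  then have "v = 0" by (intro ell2_eqI) simp
  then show "v \<in> {0}" by simp
qed

text \<open>Supplies the case of pf-rank 0. The chosen generating set may be empty or consist of the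
  identity; in both cases there are no nonzero cocycles.\<close>

lemma (in group) vN_dim_reduced_H1_trivial:
  assumes triv: "carrier G = {\<one>}" and S: "S \<subseteq> carrier G" "generate G S = carrier G" "finite S"
  shows "vN_dim G S (reduced_H1 G S) = 0"
proof -
  obtain ss where ss: "set ss = S" "distinct ss" using finite_distinct_list[OF S(3)] by blast
  have "0 \<in> cocycle_space S"
    using cocycle_space_diff[OF S] cobound_in_cocycle_space[OF S(1) ss(2,1)] by (metis diff_self)
  moreover have "gr_op G (gr_adj G (cobound ss)) 0 = 0"
    using adj_cobound_eq_0_iff[OF S(1) ss(2,1), of 0] by simp
  ultimately have W: "cocycle_space S \<inter> {u. gr_op G (gr_adj G (cobound ss)) u = 0} = {0}"
    using cocycle_space_trivial[OF triv S(1)] by auto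
  have "vN_dim G S (ell2_fun ` {0}) = (\<Sum>s\<in>S. inner 0 (unit_vec2 (s, \<one>)))"
    by (rule vN_dim_eq[OF _ _ _ _ is_group]) (auto simp: is_proj_def intro!: ell2_eqI simp: mult_i.rep_eq)
  then show ?thesis unfolding reduced_H1_eq[OF S(1) ss(2,1) S(2,3)] W by simp
qed

theorem corollary8p1:
  fixes G :: "('a, 'b) monoid_scheme" and r :: nat
  assumes "group G"
    and "finitely_generated G"
    and "parafree G r"
  shows "first_l2_betti G \<ge> real r - 1
    \<and> real r - 1 = real (first_betti G) - 1
    \<and> (finitely_presented G \<and> r \<ge> 1 \<longrightarrow> first_l2_betti G = real r - 1)"
proof -
  interpret group G by fact
  define S where "S = (SOME S. finite S \<and> S \<subseteq> carrier G \<and> generate G S = carrier G)"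
  have S: "S \<subseteq> carrier G" "generate G S = carrier G" "finite S"
    using someI_ex[OF assms(2)[unfolded finitely_generated_def]] unfolding S_def by blast+
  have b: "first_l2_betti G = vN_dim G S (reduced_H1 G S)"
    unfolding first_l2_betti_def Let_def S_def ..
  have "first_l2_betti G = real r - 1" if "1 \<le> r"
    unfolding b by (rule parafree_vN_dim_reduced_H1[OF S assms(3) that])
  \<comment> \<open>For pf-rank 0 the group is trivial and the value is 0, strictly above
    \<open>r - 1 = - 1\<close>; only the inequality survives in this case.\<close>
  moreover have "first_l2_betti G = 0" if "r = 0"
    unfolding b using assms(3) that by (intro vN_dim_reduced_H1_trivial[OF parafree_0_trivial S]) simp
  ultimately show ?thesis using parafree_first_betti[OF assms(3)] by (cases "r = 0") auto
qed

end
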